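(* Let $\varrho\in(1,\infty)$ and let $\mu$ be a finite complex Borel measure on $\mathbb{R}^3$ which is normalized ($\mu(\mathbb{R}^3)=1$) and even ($\mu(-E)=\mu(E)$ for every Borel set $E\subseteq\mathbb{R}^3$). Suppose that $\mu$ satisfies at least one of the following three conditions: \begin{itemize} \item[(a)] $-x\cdot\nabla\widehat{\mu}(x)\ge 0$ for every $x\in\mathbb{R}^3$, and there is a constant $C=C(\mu,\varrho)<\infty$ such that for every $h\in\mathcal{S}(\mathbb{R}^3)$ \[ \Big\| \big\| (h\ast\mu_{\varepsilon})(x) \big\|_{\widetilde{\mathrm{V}}^{\varrho}_{\varepsilon}} \Big\|_{\mathrm{L}^2_x(\mathbb{R}^3)} \le C \|h\|_{\mathrm{L}^2(\mathbb{R}^3)}; \] \item[(b)] $\varrho\in(2,\infty)$, $\widehat{\mu}$ is of class $\mathrm{C}^2$, and there exist $\delta>0$ and $C<\infty$ with $|\nabla\widehat{\mu}(x)|\le C(1+|x|)^{-1-\delta}$ for all $x\in\mathbb{R}^3$; \item[(c)] there is a constant $C=C(\mu,\varrho)<\infty$ such that for every $h\in\mathcal{S}(\mathbb{R}^3)$ \[ \Big\| \big\| (h\ast\mu_{\varepsilon}\ast\overline{\mu}_{\eta})(x) \big\|_{\widetilde{\mathrm{W}}^{\varrho}_{\varepsilon,\eta}} \Big\|_{\mathrm{L}^2_x(\mathbb{R}^3)} \le C \|h\|_{\mathrm{L}^2(\mathbb{R}^3)}. \] \end{itemize} Then there is a constant $C'=C'(\mu,\varrho)<\infty$ such that for every $f\in\mathcal{S}(\mathbb{R}^3)$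 \[ \Big\| \big\| (\widehat{f}\ast\mu_{\varepsilon})(\omega) \big\|_{\mathrm{V}^{\varrho}_{\varepsilon}} \Big\|_{\mathrm{L}^2_{\omega}(\mathbb{S}^2,\sigma)} \le C' \|f\|_{\mathrm{L}^{4/3}(\mathbb{R}^3)}. \]
   Context: $\mathbb{S}^2\subset\mathbb{R}^3$ is the unit sphere with standard surface measure $\sigma$; $\mathcal{S}(\mathbb{R}^3)$ is the space of complex Schwartz functions. The Fourier transform is $\widehat{f}(y)=\int_{\mathbb{R}^3} f(x)e^{-2\pi i x\cdot y}\,dx$, and for a finite complex Borel measure $\mu$, $\widehat{\mu}(y)=\int_{\mathbb{R}^3}e^{-2\pi i x\cdot y}\,d\mu(x)$. Dilates: $\mu_\varepsilon(E)=\mu(\varepsilon^{-1}E)$ for Borel $E$ and $\varepsilon>0$; $\overline{\mu}$ is the complex-conjugate measure $\overline{\mu}(E)=\overline{\mu(E)}$ and $\overline{\mu}_\eta$ its dilate. Convolution: $(h\ast\nu)(x)=\int_{\mathbb{R}^3}h(x-y)\,d\nu(y)$. For $a:(0,\infty)\to\mathbb{C}$ and $\varrho\in[1,\infty)$: $\|a\|_{\widetilde{\mathrm{V}}^{\varrho}}=\sup\big(\sum_{j=1}^m|a(\varepsilon_j)-a(\varepsilon_{j-1})|^\varrho\big)^{1/\varrho}$ and $\|a\|_{\mathrm{V}^{\varrho}}=\sup\big(|a(\varepsilon_0)|^\varrho+\sum_{j=1}^m|a(\varepsilon_j)-a(\varepsilon_{j-1})|^\varrho\big)^{1/\varrho}$,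 suprema over $m\in\mathbb{N}$ and $0<\varepsilon_0<\dots<\varepsilon_m$. For $b:(0,\infty)^2\to\mathbb{C}$: $\|b\|_{\widetilde{\mathrm{W}}^{\varrho}}=\sup\big(\sum_{1\le j\le m,\,1\le k\le n}|b(\varepsilon_j,\eta_k)-b(\varepsilon_j,\eta_{k-1})-b(\varepsilon_{j-1},\eta_k)+b(\varepsilon_{j-1},\eta_{k-1})|^\varrho\big)^{1/\varrho}$, supremum over $m,n\in\mathbb{N}$, $0<\varepsilon_0<\dots<\varepsilon_m$, $0<\eta_0<\dots<\eta_n$. A subscript variable on a (semi)norm indicates the variable in which it is taken. *)

theory Defs
  imports "HOL-Analysis.Analysis"
begin

type_synonym R3 = "real ^ 3"

text \<open>Finite complex Borel measures on R^3 are represented by a pair (M, g) of a finite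
  positive Borel measure M and a density g in L^1(M): mu(E) = integral of g over E wrt M.
  Every finite complex Borel measure is of this form (take M = |mu| and g = d mu / d|mu|).\<close>
type_synonym cmeasure = "R3 measure \<times> (R3 \<Rightarrow> complex)"

definition is_cmeasure :: "cmeasure \<Rightarrow> bool" where
  "is_cmeasure \<mu> \<longleftrightarrow> finite_measure (fst \<mu>) \<and> sets (fst \<mu>) = sets borel
     \<and> integrable (fst \<mu>) (snd \<mu>)"

definition cm_apply :: "cmeasure \<Rightarrow> R3 set \<Rightarrow> complex" where
  "cm_apply \<mu> E = set_lebesgue_integral (fst \<mu>) E (snd \<mu>)"

definition cm_dilate :: "real \<Rightarrow> cmeasure \<Rightarrow> cmeasure" where
  "cm_dilate \<epsilon> \<mu> = (distr (fst \<mu>) borel (\<lambda>y. \<epsilon> *\<^sub>R y), \<lambda>z. snd \<mu> ((1 / \<epsilon>) *\<^sub>R z))"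

definition cm_cnj :: "cmeasure \<Rightarrow> cmeasure" where
  "cm_cnj \<mu> = (fst \<mu>, \<lambda>x. cnj (snd \<mu> x))"

definition cm_conv :: "(R3 \<Rightarrow> complex) \<Rightarrow> cmeasure \<Rightarrow> R3 \<Rightarrow> complex" where
  "cm_conv h \<nu> x = (\<integral>y. h (x - y) * snd \<nu> y \<partial>fst \<nu>)"

definition cm_fourier :: "cmeasure \<Rightarrow> R3 \<Rightarrow> complex" where
  "cm_fourier \<mu> y = (\<integral>x. exp (- 2 * complex_of_real pi * \<i> * complex_of_real (x \<bullet> y)) * snd \<mu> x \<partial>fst \<mu>)"

definition fourier :: "(R3 \<Rightarrow> complex) \<Rightarrow> R3 \<Rightarrow> complex" where
  "fourier f y = (\<integral>x. f x * exp (- 2 * complex_of_real pi * \<i> * complex_of_real (x \<bullet> y)) \<partial>lborel)"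

fun dderiv :: "R3 list \<Rightarrow> (R3 \<Rightarrow> complex) \<Rightarrow> R3 \<Rightarrow> complex" where
  "dderiv [] f = f"
| "dderiv (v # vs) f = (\<lambda>x. vector_derivative (\<lambda>t::real. dderiv vs f (x + t *\<^sub>R v)) (at 0))"

definition schwartz :: "(R3 \<Rightarrow> complex) \<Rightarrow> bool" where
  "schwartz f \<longleftrightarrow> (\<forall>vs. \<forall>x. dderiv vs f differentiable (at x))
     \<and> (\<forall>vs. \<forall>n::nat. bounded (range (\<lambda>x. (1 + norm x) ^ n * cmod (dderiv vs f x))))"

definition ennpow :: "real \<Rightarrow> ennreal \<Rightarrow> ennreal" where
  "ennpow r x = (if x = \<infinity> then \<infinity> else ennreal (enn2real x powr r))"

definition Lnorm :: "real \<Rightarrow> R3 measure \<Rightarrow> (R3 \<Rightarrow> ennreal) \<Rightarrow> ennreal" where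
  "Lnorm p M F = ennpow (1 / p) (\<integral>\<^sup>+ x. ennpow p (F x) \<partial>M)"

definition Lnorm_c :: "real \<Rightarrow> R3 measure \<Rightarrow> (R3 \<Rightarrow> complex) \<Rightarrow> ennreal" where
  "Lnorm_c p M f = Lnorm p M (\<lambda>x. ennreal (cmod (f x)))"

definition partitions :: "(nat \<times> (nat \<Rightarrow> real)) set" where
  "partitions = {(m, e). 0 < e 0 \<and> (\<forall>j<m. e j < e (Suc j))}"

definition var_tilde :: "real \<Rightarrow> (real \<Rightarrow> complex) \<Rightarrow> ennreal" where
  "var_tilde \<rho> a = (SUP (m, e) \<in> partitions.
     ennreal ((\<Sum>j\<in>{1..m}. cmod (a (e j) - a (e (j - 1))) powr \<rho>) powr (1 / \<rho>)))"

definition var :: "real \<Rightarrow> (real \<Rightarrow> complex) \<Rightarrow> ennreal" where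
  "var \<rho> a = (SUP (m, e) \<in> partitions.
     ennreal ((cmod (a (e 0)) powr \<rho> + (\<Sum>j\<in>{1..m}. cmod (a (e j) - a (e (j - 1))) powr \<rho>)) powr (1 / \<rho>)))"

definition var2_tilde :: "real \<Rightarrow> (real \<Rightarrow> real \<Rightarrow> complex) \<Rightarrow> ennreal" where
  "var2_tilde \<rho> b = (SUP ((m, e), (n, h)) \<in> partitions \<times> partitions.
     ennreal ((\<Sum>j\<in>{1..m}. \<Sum>k\<in>{1..n}.
        cmod (b (e j) (h k) - b (e j) (h (k - 1)) - b (e (j - 1)) (h k) + b (e (j - 1)) (h (k - 1))) powr \<rho>)
       powr (1 / \<rho>)))"

text \<open>Surface measure on the unit sphere S^2, as the cone measure:
  sigma(E) = 3 * Lebesgue measure of {r w : 0 < r <= 1, w in E}; it is concentrated on S^2.\<close>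
definition sphere_measure :: "R3 measure" where
  "sphere_measure = distr (density lborel (\<lambda>x. 3 * indicator (cball 0 1) x)) borel
     (\<lambda>x. (1 / norm x) *\<^sub>R x)"

definition grad_norm :: "(R3 \<Rightarrow>\<^sub>L complex) \<Rightarrow> real" where
  "grad_norm D = sqrt (\<Sum>j\<in>UNIV. (cmod (blinfun_apply D (axis j 1)))\<^sup>2)"

end

theory Submission
 imports Defs "HOL-Probability.Probability"
begin

text \<open>Linearising the variation and dualising turns the estimate into an \<open>L\<^sup>4\<close> bound for
 \<open>E(x) = \<Sum>\<^sub>u E\<^sub>u(x) (m(u x) - m(u' x))\<close>. Here \<open>u'\<close> is the predecessor of the scale \<open>u\<close>, \<open>E\<^sub>u\<close> is the Fourier extension of a
 density on the sphere, and \<open>m\<close> is the reflected Fourier transform of \<open>\<mu>\<close>. Testing \<open>|E|\<^sup>2\<close> against \<open>h \<ge> 0\<close> gives a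
 bilinear form on the sphere, whose kernel is a function of \<open>\<omega> - \<omega>'\<close> and is bounded by a variation in the scales of
 the Fourier transform of \<open>h\<close> times dilates of \<open>m\<close>. For \<open>\<omega>, \<omega>'\<close> in a cap the sum \<open>\<omega> + \<omega>'\<close> has bounded density. Exchanging
 differences for sums, a form with kernel \<open>\<Phi>(\<omega> - \<omega>')\<close> is therefore bounded by the \<open>L\<^sup>2\<close> norm of \<open>\<Phi>\<close>; this is where
 the exponent \<open>4/3\<close> comes from.

 Under (c) the kernel is a double variation. Under (a) the increments of \<open>m\<close> have one sign, and Cauchy-Schwarz with these
 weights leaves only the diagonal, hence a single variation. Under (b) the increments of \<open>m\<close> are dominated by those of a
 geometric series of Gaussians at dyadic scales, which reduces matters to the variation of the heat semigroup. That is
 bounded by Rota's dilation to a martingale and a pathwise form of Lepingle's inequality.\<close>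

section \<open>Sums of two points of a spherical cap\<close>

text \<open>The sum of two independent points of the whole sphere has a density of order 1/|x|,
  unbounded at 0 because of antipodal pairs. So the sphere is covered by six caps, on each of which
  one signed coordinate is at least 1/2; there sums stay away from 0, and the bounds for the caps
  are added. Conditions (a) and (c) speak of Schwartz functions only. Test functions are therefore
  compactly supported and convolved with a Gaussian, which makes their Fourier transforms Schwartz.
  Estimates are made for a finite set of scales, with constants independent of it: suprema become
  maxima, maximisers can be chosen measurably, and the square \<gamma> of the L^2 norm to be bounded
  is a finite number. It recurs in the L^4 bound of its dual and is cancelled: with P the integral
  of |f|^(4/3), \<gamma> \<le> P^(3/4) (C0 \<gamma>^2)^(1/4) gives \<gamma> \<le> sqrt(C0) P^(3/2).
  Dyadic scales then exhaust all scales by continuity. The initial term of the full variation norm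
  costs only the ordinary restriction estimate, because the Fourier transform of \<mu> is 1 at the
  origin.\<close>

lemmas integrable_diff = Bochner_Integration.integrable_diff
 and integrable_sum = Bochner_Integration.integrable_sum
 and integral_cong = Bochner_Integration.integral_cong
 and integral_diff = Bochner_Integration.integral_diff
 and integral_sum = Bochner_Integration.integral_sum

abbreviation nn_lebesgue :: "('a::euclidean_space \<Rightarrow> ennreal) \<Rightarrow> ennreal" (binder "LI+ " 10) where
 "nn_lebesgue f \<equiv> nn_integral lborel f"

abbreviation lebesgue_int :: "('a::euclidean_space \<Rightarrow> 'b::{banach, second_countable_topology}) \<Rightarrow> 'b" (binder "LI " 10) where
 "lebesgue_int f \<equiv> integral\<^sup>L lborel f"

section \<open>Lebesgue measure in coordinates and under affine and orthogonal maps\<close>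

definition v3 :: "real \<Rightarrow> real \<Rightarrow> real \<Rightarrow> R3" where
 "v3 a b c = a *\<^sub>R axis 1 1 + b *\<^sub>R axis 2 1 + c *\<^sub>R axis 3 1"

lemma v3_nth [simp]: "v3 a b c $ 1 = a" "v3 a b c $ 2 = b" "v3 a b c $ 3 = c"
 by (simp_all add: v3_def axis_def)

lemma v3_add: "v3 a b c + v3 a' b' c' = v3 (a + a') (b + b') (c + c')"
 by (simp add: v3_def algebra_simps)

lemma v3_scale: "r *\<^sub>R v3 a b c = v3 (r * a) (r * b) (r * c)"
 by (simp add: v3_def algebra_simps)

lemma norm_v3: "norm (v3 a b c) = sqrt (a^2 + b^2 + c^2)"
 unfolding norm_vec_def L2_set_def sum_3 by simp

lemma measurable_v3 [measurable (raw)]: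
 assumes "f \<in> borel_measurable M" "g \<in> borel_measurable M" "h \<in> borel_measurable M"
 shows "(\<lambda>x. v3 (f x) (g x) (h x)) \<in> borel_measurable M"
 using assms unfolding v3_def by measurable

lemma measurable_nth [measurable (raw)]:
 fixes f :: "'a \<Rightarrow> R3"
 assumes "f \<in> borel_measurable M"
 shows "(\<lambda>x. f x $ i) \<in> borel_measurable M"
 using measurable_compose[OF assms borel_measurable_continuous_onI[of "\<lambda>v. v $ i"]] by (simp add: continuous_on_component)

lemma borel_measurable_fst_snd [measurable]:
 "fst \<in> borel_measurable (borel :: ('a::second_countable_topology \<times> 'b::second_countable_topology) measure)"
 "snd \<in> borel_measurable (borel :: ('a::second_countable_topology \<times> 'b::second_countable_topology) measure)"
 by (intro borel_measurable_continuous_onI continuous_intros)+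

lemma nn_integral_R3:
 fixes F :: "R3 \<Rightarrow> ennreal"
 assumes [measurable]: "F \<in> borel_measurable borel"
 shows "(LI+ x. F x) = (LI+ a. LI+ b. LI+ c. F (v3 a b c))"
proof -
 let ?e = "\<lambda>i::3. axis i (1::real)"
 have B: "(Basis :: R3 set) = {?e 1, ?e 2, ?e 3}"
  by (auto simp: Basis_vec_def UNIV_3)
 have ne: "?e 1 \<noteq> ?e 2" "?e 1 \<noteq> ?e 3" "?e 2 \<noteq> ?e 3"
  by (simp_all add: axis_eq_axis)
 interpret product_sigma_finite "\<lambda>b::R3. lborel :: real measure" by standard
 let ?G = "\<lambda>f. F (\<Sum>b\<in>Basis. f b *\<^sub>R b)"
 have "(LI+ x. F x) = (\<integral>\<^sup>+f. ?G f \<partial>(Pi\<^sub>M {?e 1, ?e 2, ?e 3} (\<lambda>_. lborel)))"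
  by (subst lborel_eq, subst nn_integral_distr) (auto simp: B)
 also have "\<dots> = (LI+ a. \<integral>\<^sup>+f. ?G (f(?e 1 := a)) \<partial>(Pi\<^sub>M {?e 2, ?e 3} (\<lambda>_. lborel)))"
  by (rule product_nn_integral_insert_rev) (use ne in \<open>auto simp: B\<close>)
 also have "\<dots> = (LI+ a. LI+ b. \<integral>\<^sup>+f. ?G (f(?e 2 := b, ?e 1 := a)) \<partial>(Pi\<^sub>M {?e 3} (\<lambda>_. lborel)))"
  by (intro nn_integral_cong, rule product_nn_integral_insert_rev) (use ne in \<open>auto simp: B\<close>)
 also have "\<dots> = (LI+ a. LI+ b. \<integral>\<^sup>+f. F (v3 a b (f (?e 3))) \<partial>(Pi\<^sub>M {?e 3} (\<lambda>_. lborel)))"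
  using ne by (intro nn_integral_cong) (auto simp: B v3_def add.assoc)
 also have "\<dots> = (LI+ a. LI+ b. LI+ c. F (v3 a b c))"
  by (intro nn_integral_cong, rule product_nn_integral_singleton) auto
 finally show ?thesis .
qed

lemma nn_integral_lborel_affine:
 fixes f :: "'a::euclidean_space \<Rightarrow> ennreal"
 assumes [measurable]: "f \<in> borel_measurable borel" and c: "c \<noteq> 0"
 shows "(LI+ x. f x) = ennreal (\<bar>c\<bar> ^ DIM('a)) * (LI+ x. f (t + c *\<^sub>R x))"
 by (subst lborel_affine[OF c, of t])
   (simp add: nn_integral_density nn_integral_distr nn_integral_cmult)

lemma nn_integral_lborel_translate:
 fixes f :: "'a::euclidean_space \<Rightarrow> ennreal"
 assumes "f \<in> borel_measurable borel"
 shows "(LI+ x. f (t + x)) = (LI+ x. f x)"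
 using nn_integral_lborel_affine[OF assms, of 1 t] by simp

lemma nn_integral_lborel_reflect:
 fixes f :: "'a::euclidean_space \<Rightarrow> ennreal"
 assumes "f \<in> borel_measurable borel"
 shows "(LI+ x. f (t - x)) = (LI+ x. f x)"
 using nn_integral_lborel_affine[OF assms, of "-1" t] by simp

lemma nn_integral_lborel_pair:
 fixes f :: "real \<times> real \<Rightarrow> ennreal"
 assumes [measurable]: "f \<in> borel_measurable borel"
 shows "(LI+ p. f p) = (LI+ a. LI+ b. f (a, b))"
proof -
 have "f \<in> borel_measurable (lborel \<Otimes>\<^sub>M lborel)" by (simp add: lborel_prod)
 then show ?thesis by (subst lborel_prod[symmetric], subst lborel.nn_integral_fst[symmetric]) auto
qed

text \<open>The preimage of a box is its image under the inverse rotation, which has the same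
  volume. This invariance moves every cap to the one around the third axis, the only one that is
  computed in coordinates.\<close>

lemma lborel_distr_orthogonal:
 fixes T :: "R3 \<Rightarrow> R3"
 assumes T: "orthogonal_transformation T"
 shows "distr lborel borel T = lborel"
proof (rule sym, rule lborel_eqI)
 have [measurable]: "T \<in> borel_measurable borel"
  by (intro borel_measurable_continuous_onI linear_continuous_on linear_linear
     bounded_linear_intros orthogonal_transformation_linear T)
    (use T orthogonal_transformation_linear linear_conv_bounded_linear in blast)
 fix l u :: R3 assume lu: "\<And>b. b \<in> Basis \<Longrightarrow> l \<bullet> b \<le> u \<bullet> b"
 have iT: "orthogonal_transformation (inv T)" using T by (rule orthogonal_transformation_inv)
 have im: "T -` box l u = inv T ` box l u"
  using T by (simp add: bij_vimage_eq_inv_image orthogonal_transformation_bij)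
 have lm: "inv T ` box l u \<in> lmeasurable"
  using measure_orthogonal_image(1)[OF iT]
  by (intro measurable_linear_image orthogonal_transformation_linear iT lmeasurable_box)
 have meas: "T -` box l u \<in> sets borel" using measurable_sets[OF \<open>T \<in> borel_measurable borel\<close>, of "box l u"] by simp
 have "emeasure (distr lborel borel T) (box l u) = emeasure lborel (T -` box l u)"
  by (simp add: emeasure_distr)
 also have "\<dots> = emeasure lebesgue (inv T ` box l u)" using meas by (simp add: im)
 also have "\<dots> = ennreal (measure lebesgue (inv T ` box l u))"
  by (rule emeasure_eq_measure2[OF lm])
 also have "measure lebesgue (inv T ` box l u) = measure lebesgue (box l u)"
  by (rule measure_orthogonal_image[OF iT]) simp
 also have "\<dots> = (\<Prod>b\<in>Basis. (u - l) \<bullet> b)" using lu by (simp add: measure_lborel_box_eq)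
 finally show "emeasure (distr lborel borel T) (box l u) = (\<Prod>b\<in>Basis. (u - l) \<bullet> b)" .
qed simp

text \<open>Change of variables as an inequality: a lower bound \<open>w\<close> of the Jacobian
  suffices, \<open>g\<close> is increasing because \<open>g'\<close> dominates
  \<open>w \<ge> 0\<close>, and the image interval is enlarged to the whole line.\<close>

lemma nn_integral_subst_le:
 fixes F :: "real \<Rightarrow> ennreal" and g g' w :: "real \<Rightarrow> real"
 assumes F [measurable]: "F \<in> borel_measurable borel"
  and d: "\<And>x. x \<in> {a..b} \<Longrightarrow> (g has_real_derivative g' x) (at x)"
  and c: "continuous_on {a..b} g'"
  and w: "\<And>x. x \<in> {a..b} \<Longrightarrow> 0 \<le> w x \<and> w x \<le> g' x"
 shows "(LI+ x. F (g x) * ennreal (w x) * indicator {a..b} x) \<le> (LI+ x. F x)"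
proof (cases "a < b")
 case True
 have "(LI+ x. F (g x) * ennreal (w x) * indicator {a..b} x)
   \<le> (LI+ x. F (g x) * ennreal (g' x) * indicator {a..b} x)"
  using w by (intro nn_integral_mono) (auto split: split_indicator intro!: mult_left_mono ennreal_leI)
 also have "\<dots> = (LI+ x. F x * indicator {g a..g b} x)"
  using d c w True by (intro nn_integral_substitution_aux[symmetric]) (auto intro: order_trans)
 also have "\<dots> \<le> (LI+ x. F x)"
  by (intro nn_integral_mono) (auto split: split_indicator)
 finally show ?thesis .
next
 case False
 have "(LI+ x. F (g x) * ennreal (w x) * indicator {a..b} x) = (\<integral>\<^sup>+x. 0 \<partial>(lborel::real measure))"
  using False AE_lborel_singleton[of a]
  by (intro nn_integral_cong_AE) (auto split: split_indicator elim!: eventually_mono)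
 then show ?thesis by simp
qed

section \<open>The upper hemisphere as a graph\<close>

definition cap_height :: "real \<times> real \<Rightarrow> real" where
 "cap_height p = sqrt (1 - (norm p)^2)"

text \<open>The real \<open>sqrt\<close> is odd, so \<open>cap_height\<close> is negative outside
  the closed unit disc and the condition on the height alone selects the convex disc of radius
  sqrt(3)/2.\<close>

lemma cap_height_ge_half: "cap_height p \<ge> 1/2 \<longleftrightarrow> (norm p)\<^sup>2 \<le> 3/4"
proof -
 have "sqrt (1/4) = 1/2" by (simp add: real_sqrt_divide)
 then have "cap_height p \<ge> 1/2 \<longleftrightarrow> sqrt (1/4) \<le> sqrt (1 - (norm p)^2)" unfolding cap_height_def by (simp only:)
 also have "\<dots> \<longleftrightarrow> (norm p)\<^sup>2 \<le> 3/4" unfolding real_sqrt_le_iff by auto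
 finally show ?thesis .
qed

lemma measurable_cap_height [measurable]: "cap_height \<in> borel_measurable borel"
 unfolding cap_height_def by measurable

definition graph_pt :: "real \<times> real \<Rightarrow> real \<Rightarrow> R3" where
 "graph_pt p w = v3 (fst p) (snd p) w"

lemma graph_pt_add: "graph_pt p w + graph_pt q z = graph_pt (p + q) (w + z)"
 by (simp add: graph_pt_def v3_add)

lemma measurable_graph_pt [measurable (raw)]:
 assumes [measurable]: "f \<in> borel_measurable M" "g \<in> borel_measurable M"
 shows "(\<lambda>x. graph_pt (f x) (g x)) \<in> borel_measurable M"
proof -
 have [measurable]: "f \<in> M \<rightarrow>\<^sub>M borel \<Otimes>\<^sub>M borel" using assms(1) by (simp add: borel_prod)
 show ?thesis unfolding graph_pt_def by measurable
qed

text \<open>Here \<open>a\<close> is half the sum of two points of the disc,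
  \<open>t *\<^sub>R \<theta>\<close> is half their difference, and the argument of \<open>F\<close>
  is the sum of the heights above them. Along \<theta> the height has second derivative at most -1,
  so for t \<ge> 0 this sum has derivative at most -2t. The factor |t| therefore pays for the
  Jacobian of taking the sum of heights as the new variable.\<close>

lemma cap_height_line_integral_le:
 fixes a \<theta> :: "real \<times> real" and F :: "real \<Rightarrow> ennreal"
 assumes [measurable]: "F \<in> borel_measurable borel" and \<theta>: "norm \<theta> \<ge> 1"
 defines "P \<equiv> \<lambda>t. (norm (a + t *\<^sub>R \<theta>))^2 \<le> 3/4 \<and> (norm (a - t *\<^sub>R \<theta>))\<^sup>2 \<le> 3/4"
 shows "(LI+ t. ennreal \<bar>t\<bar> * (F (cap_height (a + t *\<^sub>R \<theta>) + cap_height (a - t *\<^sub>R \<theta>)) * indicator {t. P t} t))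
     \<le> (LI+ w. F w)"
proof -
 let ?h = "\<lambda>t. cap_height (a + t *\<^sub>R \<theta>)"
 let ?k = "\<lambda>t. - ((a + t *\<^sub>R \<theta>) \<bullet> \<theta>) / ?h t"
 let ?\<psi> = "\<lambda>t. ?h t + ?h (-t)"
 have npos: "1 - (norm (a + t *\<^sub>R \<theta>))^2 > 0" if "(norm (a + t *\<^sub>R \<theta>))^2 \<le> 3/4" for t
  using that by simp
 have eqn: "(norm (a + t *\<^sub>R \<theta>))^2 = (norm a)^2 + 2 * t * (a \<bullet> \<theta>) + t^2 * (norm \<theta>)^2" for t
  unfolding power2_norm_eq_inner by (simp add: inner_simps algebra_simps power2_eq_square inner_commute)
 define A B C where "A = (norm a)^2" and "B = a \<bullet> \<theta>" and "C = (norm \<theta>)^2"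
 have hd: "?h t = sqrt (1 - (A + 2 * t * B + t^2 * C))" for t
  unfolding cap_height_def eqn A_def B_def C_def ..
 have kd: "(a + t *\<^sub>R \<theta>) \<bullet> \<theta> = B + t * C" for t
  by (simp add: B_def C_def inner_simps power2_norm_eq_inner)
 have npos': "0 < 1 - (A + 2 * t * B + t^2 * C)" if "(norm (a + t *\<^sub>R \<theta>))^2 \<le> 3/4" for t
  using npos[OF that] unfolding eqn A_def B_def C_def .
 have dh: "(?h has_real_derivative ?k t) (at t)" if "(norm (a + t *\<^sub>R \<theta>))^2 \<le> 3/4" for t
 proof -
  have d0: "((\<lambda>t. 1 - (A + 2 * t * B + t^2 * C)) has_real_derivative (- (2 * B + 2 * t * C))) (at t)"
   by (auto intro!: derivative_eq_intros)
  have "((\<lambda>t. sqrt (1 - (A + 2 * t * B + t^2 * C))) has_real_derivative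
    (inverse (sqrt (1 - (A + 2 * t * B + t^2 * C))) / 2 * (- (2 * B + 2 * t * C)))) (at t)"
   by (rule DERIV_chain2[OF DERIV_real_sqrt d0]) (rule npos'[OF that])
  moreover have "inverse s / 2 * (- (2 * B + 2 * t * C)) = - (B + t * C) / s" for s :: real
   by (cases "s = 0") (simp_all add: field_simps)
  ultimately show ?thesis unfolding hd kd by (simp only:)
 qed
 \<comment> \<open>Both terms of the second derivative are nonpositive. The first alone is at most
   -1, since \<theta> has norm at least 1 and heights are at most 1.\<close>
 have dk: "(?k has_real_derivative (- ((norm \<theta>)^2 / ?h t) - ((a + t *\<^sub>R \<theta>) \<bullet> \<theta>)^2 / (?h t)^3)) (at t)"
  if "(norm (a + t *\<^sub>R \<theta>))^2 \<le> 3/4" for t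
 proof -
  have hp: "?h t > 0" using npos[OF that] by (simp add: cap_height_def)
  have d1: "((\<lambda>t. - (B + t * C)) has_real_derivative (- C)) (at t)"
   by (auto intro!: derivative_eq_intros)
  have e: "(- C * s - - y * (- y / s)) / (s * s) = - (C / s) - y^2 / s ^ 3" if "s > 0" for s y :: real
   using that by (simp add: field_simps power2_eq_square power3_eq_cube)
  have "((\<lambda>t. - (B + t * C) / ?h t) has_real_derivative
    ((- C * ?h t - - (B + t * C) * (- (B + t * C) / ?h t)) / (?h t * ?h t))) (at t)"
   using DERIV_divide[OF d1 dh[OF that]] hp unfolding kd by simp
  then show ?thesis unfolding e[OF hp] kd C_def[symmetric] .
 qed
 have h1: "0 < ?h t \<and> ?h t \<le> 1" if "(norm (a + t *\<^sub>R \<theta>))^2 \<le> 3/4" for t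
  using npos[OF that] by (simp add: cap_height_def)
 have sq: "(norm x)^2 \<le> 3/4 \<longleftrightarrow> norm x \<le> sqrt (3/4)" for x :: "real \<times> real"
  using real_sqrt_le_iff[of "(norm x)^2" "3/4"] by simp
 \<comment> \<open>Convexity of the disc: the segment between two of its points stays inside, where
   the height is differentiable.\<close>
 have seg: "(norm (a + s *\<^sub>R \<theta>))^2 \<le> 3/4" if "P t" "0 < t" "-t \<le> s" "s \<le> t" for s t
 proof -
  define p q where "p = (t + s) / (2*t)" and "q = (t - s) / (2*t)"
  have pq: "p + q = 1" "p * t - q * t = s" "0 \<le> p" "0 \<le> q"
   using that by (simp_all add: p_def q_def field_simps)
  have "p *\<^sub>R (a + t *\<^sub>R \<theta>) + q *\<^sub>R (a - t *\<^sub>R \<theta>) = (p + q) *\<^sub>R a + (p * t - q * t) *\<^sub>R \<theta>"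
   by (simp add: algebra_simps)
  then have "a + s *\<^sub>R \<theta> = p *\<^sub>R (a + t *\<^sub>R \<theta>) + q *\<^sub>R (a - t *\<^sub>R \<theta>)" using pq by simp
  then have "norm (a + s *\<^sub>R \<theta>) \<le> p * norm (a + t *\<^sub>R \<theta>) + q * norm (a - t *\<^sub>R \<theta>)"
   using norm_triangle_ineq[of "p *\<^sub>R (a + t *\<^sub>R \<theta>)" "q *\<^sub>R (a - t *\<^sub>R \<theta>)"] pq by simp
  also have "\<dots> \<le> p * sqrt (3/4) + q * sqrt (3/4)"
  proof -
   have "norm (a + t *\<^sub>R \<theta>) \<le> sqrt (3/4)" "norm (a - t *\<^sub>R \<theta>) \<le> sqrt (3/4)"
    using \<open>P t\<close> unfolding P_def sq by auto
   then show ?thesis using pq by (intro add_mono mult_left_mono)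
  qed
  also have "\<dots> = sqrt (3/4)" using pq by (metis distrib_right mult_1)
  finally show ?thesis by (simp only: sq)
 qed
 \<comment> \<open>Mean value theorem for the slope \<open>?k\<close> between -t and t; the interval
   has length 2t.\<close>
 have key: "?k t - ?k (-t) \<le> - 2 * t" if "P t" "0 \<le> t" for t
 proof (cases "t = 0")
  case False
  then have t: "-t < t" "0 < t" using that by simp_all
  note seg = seg[OF \<open>P t\<close> t(2)]
  obtain z where z: "-t < z" "z < t" and
   e: "?k t - ?k (-t) = (t - (-t)) * (- ((norm \<theta>)^2 / ?h z) - ((a + z *\<^sub>R \<theta>) \<bullet> \<theta>)^2 / (?h z)^3)"
   using MVT2[OF t(1), of ?k "\<lambda>t. - ((norm \<theta>)^2 / ?h t) - ((a + t *\<^sub>R \<theta>) \<bullet> \<theta>)^2 / (?h t)^3"] dk seg by auto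
  have hz: "0 < ?h z" "?h z \<le> 1" using h1 seg z by auto
  have "1 \<le> (norm \<theta>)^2" using \<theta> by (simp add: one_le_power)
  then have "1 \<le> (norm \<theta>)^2 / ?h z" using hz by (simp add: field_simps)
  moreover have "0 \<le> ((a + z *\<^sub>R \<theta>) \<bullet> \<theta>)^2 / (?h z)^3" using hz by simp
  ultimately have "- ((norm \<theta>)^2 / ?h z) - ((a + z *\<^sub>R \<theta>) \<bullet> \<theta>)^2 / (?h z)^3 \<le> -1" by linarith
  then have "(t - (-t)) * (- ((norm \<theta>)^2 / ?h z) - ((a + z *\<^sub>R \<theta>) \<bullet> \<theta>)^2 / (?h z)^3) \<le> (t - (-t)) * -1"
   using t by (intro mult_left_mono) auto
  then show ?thesis using e by simp
 qed simp
 \<comment> \<open>The admissible t \<ge> 0 form a compact interval, the domain over which the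
   substitution is made.\<close>
 let ?J = "{t. 0 \<le> t \<and> P t}"
 have closedJ: "closed ?J"
  unfolding P_def by (intro closed_Collect_conj closed_Collect_le continuous_intros)
 have boundedJ: "bounded ?J"
 proof (rule boundedI)
  fix t assume "t \<in> ?J"
  then have t: "0 \<le> t" "(norm (a + t *\<^sub>R \<theta>))^2 \<le> 3/4" "(norm (a - t *\<^sub>R \<theta>))^2 \<le> 3/4" by (auto simp: P_def)
  have e2: "(norm (a - t *\<^sub>R \<theta>))^2 = (norm a)^2 - 2 * t * (a \<bullet> \<theta>) + t^2 * (norm \<theta>)^2" using eqn[of "-t"] by simp
  have "t^2 * 1 \<le> t^2 * (norm \<theta>)^2" using \<theta> by (intro mult_left_mono) (auto simp: one_le_power)
  also have "\<dots> \<le> 3/4" using t e2 eqn[of t] by (smt (verit) zero_le_power2)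
  finally have "t^2 \<le> 1^2" by simp
  then show "norm t \<le> 1" using t(1) power2_le_imp_le[of t 1] by simp
 qed
 have convJ: "is_interval ?J"
 proof -
  have "P x" if "P b" "0 \<le> x" "x \<le> b" for x b
  proof (cases "b = 0")
   case False
   then show ?thesis using seg[of b x] seg[of b "-x"] that by (simp add: P_def)
  qed (use that in auto)
  then show ?thesis unfolding is_interval_1 by auto
 qed
 have "compact ?J" "connected ?J"
  using boundedJ closedJ convJ by (auto simp: compact_eq_bounded_closed is_interval_connected_1)
 then obtain l r where J: "?J = {l..r}"
  using connected_compact_interval_1[of ?J] by blast
 have PJ: "P t" "0 \<le> t" if "t \<in> {l..r}" for t using that unfolding J[symmetric] by simp_all
 have Pm: "P (-t) = P t" for t by (auto simp: P_def)
 have dpsi: "((\<lambda>t. - ?\<psi> t) has_real_derivative (- (?k t - ?k (-t)))) (at t)" if "t \<in> {l..r}" for t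
 proof -
  have 1: "(?h has_real_derivative ?k t) (at t)" using PJ[OF that] by (intro dh) (auto simp: P_def)
  have 2: "(?h has_real_derivative ?k (-t)) (at (-t))" using PJ[OF that] by (intro dh) (auto simp: P_def)
  have 3: "((\<lambda>t. ?h (-t)) has_real_derivative - ?k (-t)) (at t)"
   using 2 unfolding DERIV_mirror .
  show ?thesis using DERIV_minus[OF DERIV_add[OF 1 3]] by (simp only: diff_conv_add_uminus)
 qed
 have contk: "continuous_on {l..r} (\<lambda>t. - (?k t - ?k (-t)))"
 proof -
  have "isCont (\<lambda>t. - (?k t - ?k (-t))) t" if "t \<in> {l..r}" for t
  proof -
   have p: "(norm (a + t *\<^sub>R \<theta>))^2 \<le> 3/4" "(norm (a + (-t) *\<^sub>R \<theta>))^2 \<le> 3/4"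
    using PJ[OF that] by (auto simp: P_def)
   have 1: "isCont ?k t" by (rule DERIV_isCont[OF dk[OF p(1)]])
   have 2: "isCont ?k (-t)" by (rule DERIV_isCont[OF dk[OF p(2)]])
   have 3: "isCont (\<lambda>t. ?k (-t)) t"
    using continuous_at_compose[of t "\<lambda>t. - t" ?k] 2 by (simp only: o_def) (simp del: scaleR_minus_left)
   show ?thesis using isCont_minus[OF isCont_diff[OF 1 3]] .
  qed
  then show ?thesis by (intro continuous_at_imp_continuous_on ballI)
 qed
 let ?X = "\<lambda>t. F (?\<psi> t)"
 \<comment> \<open>The sum of heights decreases for t \<ge> 0, hence the substitution uses its
   negative together with the reflected \<open>F\<close>.\<close>
 have half: "(LI+ t. ?X t * ennreal (2 * t) * indicator {l..r} t) \<le> (LI+ w. F w)"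
 proof -
  have "(LI+ t. F (- (- ?\<psi> t)) * ennreal (2 * t) * indicator {l..r} t) \<le> (LI+ w. F (- w))"
  proof (rule nn_integral_subst_le[where g'="\<lambda>t. - (?k t - ?k (-t))"])
   fix t assume t: "t \<in> {l..r}"
   show "0 \<le> 2 * t \<and> 2 * t \<le> - (?k t - ?k (-t))" using key[OF PJ[OF t]] PJ(2)[OF t] by linarith
  qed (use dpsi contk in auto)
  also have "\<dots> = (LI+ w. F w)"
   using nn_integral_lborel_reflect[of F 0] by simp
  finally show ?thesis by (simp only: minus_minus)
 qed
 have [measurable]: "{t. P t} \<in> sets borel" unfolding P_def by measurable
 have [measurable]: "?h \<in> borel_measurable borel" "(\<lambda>t. ?h (-t)) \<in> borel_measurable borel" by measurable
 have sym: "(LI+ t. ennreal (- t) * (?X t * indicator {t. P t} t) * indicator {..0} t)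
      = (LI+ t. ennreal t * (?X t * indicator {t. P t} t) * indicator {0..} t)"
 proof -
  have "(LI+ t. ennreal (- t) * (?X t * indicator {t. P t} t) * indicator {..0} t)
    = (LI+ t. ennreal (- (0 - t)) * (?X (0 - t) * indicator {t. P t} (0 - t)) * indicator {..0} (0 - t))"
   by (rule nn_integral_lborel_reflect[symmetric]) measurable
  also have "\<dots> = (LI+ t. ennreal t * (?X t * indicator {t. P t} t) * indicator {0..} t)"
   by (intro nn_integral_cong) (auto simp: Pm add.commute split: split_indicator)
  finally show ?thesis .
 qed
 \<comment> \<open>By \<open>sym\<close> the negative half line contributes as much as the positive
   one, and twice the weight t is the weight 2t of \<open>half\<close>.\<close>
 have pos: "(LI+ t. ennreal t * (?X t * indicator {t. P t} t) * indicator {0..} t) +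
    (LI+ t. ennreal t * (?X t * indicator {t. P t} t) * indicator {0..} t)
   = (LI+ t. ?X t * ennreal (2 * t) * indicator {l..r} t)"
 proof -
  have "t \<in> {l..r} \<longleftrightarrow> 0 \<le> t \<and> P t" for t unfolding J[symmetric] by simp
  then have i: "indicator {l..r} t = (indicator {t. P t} t * indicator {0..} t :: ennreal)" for t
   by (auto split: split_indicator)
  show ?thesis
  proof (subst nn_integral_add[symmetric], measurable, rule nn_integral_cong)
   fix t :: real
   let ?y = "ennreal t * (?X t * indicator {t. P t} t) * indicator {0..} t"
   have "ennreal (2 * t) = 2 * ennreal t" if "0 \<le> t" using that by (simp add: ennreal_mult)
   then have "2 * ?y = ?X t * ennreal (2 * t) * indicator {l..r} t"
    unfolding i by (cases "0 \<le> t") (simp_all only: mult_ac indicator_simps atLeast_iff mult_zero_right mult_zero_left not_False_eq_True)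
   then show "?y + ?y = ?X t * ennreal (2 * t) * indicator {l..r} t" by (simp only: mult_2)
  qed
 qed
 have "(LI+ t. ennreal \<bar>t\<bar> * (?X t * indicator {t. P t} t))
   \<le> (LI+ t. ennreal (- t) * (?X t * indicator {t. P t} t) * indicator {..0} t
     + ennreal t * (?X t * indicator {t. P t} t) * indicator {0..} t)"
  by (intro nn_integral_mono) (auto split: split_indicator)
 also have "\<dots> = (LI+ t. ennreal (- t) * (?X t * indicator {t. P t} t) * indicator {..0} t)
     + (LI+ t. ennreal t * (?X t * indicator {t. P t} t) * indicator {0..} t)"
  by (rule nn_integral_add) measurable
 also have "\<dots> \<le> (LI+ w. F w)" unfolding sym pos by (rule half)
 finally show ?thesis by simp
qed


text \<open>A substitute for polar coordinates: the sectors |y| \<le> |x| and |x| \<le> |y| are each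
  swept by rays with slope in [-1, 1] and Jacobian |t|. The constant is 2 sectors times the length 2
  of the slope interval. The vectors (1, \<tau>) and (\<tau>, 1) have norm at least 1, as
  \<open>cap_height_line_integral_le\<close> demands.\<close>

lemma nn_integral_pair_rays:
 fixes Y :: "real \<times> real \<Rightarrow> ennreal"
 assumes Y [measurable]: "Y \<in> borel_measurable borel"
  and 1: "\<And>\<tau>. (LI+ t. ennreal \<bar>t\<bar> * Y (t *\<^sub>R (1, \<tau>))) \<le> B"
  and 2: "\<And>\<tau>. (LI+ t. ennreal \<bar>t\<bar> * Y (t *\<^sub>R (\<tau>, 1))) \<le> B"
 shows "(LI+ b. Y b) \<le> 4 * B"
proof -
 have [measurable]: "Y \<in> borel_measurable (borel \<Otimes>\<^sub>M borel)" by (simp add: borel_prod)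
 have aux: "(LI+ x. LI+ y. Z (x, y) * indicator {y. \<bar>y\<bar> \<le> \<bar>x\<bar>} y) \<le> 2 * B"
  if [measurable]: "Z \<in> borel_measurable (borel \<Otimes>\<^sub>M borel)"
   and Z: "\<And>\<tau>. (LI+ t. ennreal \<bar>t\<bar> * Z (t, t * \<tau>)) \<le> B" for Z :: "real \<times> real \<Rightarrow> ennreal"
 proof -
  have "(LI+ x. LI+ y. Z (x, y) * indicator {y. \<bar>y\<bar> \<le> \<bar>x\<bar>} y)
    = (LI+ x. LI+ \<tau>. ennreal \<bar>x\<bar> * Z (x, x * \<tau>) * indicator {-1..1} \<tau>)"
  proof (rule nn_integral_cong_AE)
   have "AE x in lborel. x \<noteq> (0::real)" by (rule AE_lborel_singleton)
   then show "AE x in lborel. (LI+ y. Z (x, y) * indicator {y. \<bar>y\<bar> \<le> \<bar>x\<bar>} y)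
     = (LI+ \<tau>. ennreal \<bar>x\<bar> * Z (x, x * \<tau>) * indicator {-1..1} \<tau>)"
   proof eventually_elim
    case (elim x)
    have "(LI+ y. Z (x, y) * indicator {y. \<bar>y\<bar> \<le> \<bar>x\<bar>} y)
      = \<bar>x\<bar> * (LI+ \<tau>. Z (x, 0 + x * \<tau>) * indicator {y. \<bar>y\<bar> \<le> \<bar>x\<bar>} (0 + x * \<tau>))"
     by (rule nn_integral_real_affine) (use elim in auto)
    also have "\<dots> = (LI+ \<tau>. ennreal \<bar>x\<bar> * (Z (x, 0 + x * \<tau>) * indicator {y. \<bar>y\<bar> \<le> \<bar>x\<bar>} (0 + x * \<tau>)))"
     by (rule nn_integral_cmult[symmetric]) measurable
    also have "\<dots> = (LI+ \<tau>. ennreal \<bar>x\<bar> * Z (x, x * \<tau>) * indicator {-1..1} \<tau>)"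
    proof (intro nn_integral_cong)
     fix \<tau> :: real
     have "\<bar>x * \<tau>\<bar> \<le> \<bar>x\<bar> \<longleftrightarrow> \<tau> \<in> {-1..1}"
      using elim by (auto simp: abs_mult mult_le_cancel_left1 mult_le_cancel_left2)
     then show "ennreal \<bar>x\<bar> * (Z (x, 0 + x * \<tau>) * indicator {y. \<bar>y\<bar> \<le> \<bar>x\<bar>} (0 + x * \<tau>))
       = ennreal \<bar>x\<bar> * Z (x, x * \<tau>) * indicator {-1..1} \<tau>"
      by (simp add: indicator_def)
    qed
    finally show ?case .
   qed
  qed
  also have "\<dots> = (LI+ \<tau>. LI+ x. ennreal \<bar>x\<bar> * Z (x, x * \<tau>) * indicator {-1..1} \<tau>)"
   by (rule lborel_pair.Fubini'[symmetric]) measurable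
  also have "\<dots> = (LI+ \<tau>. (LI+ x. ennreal \<bar>x\<bar> * Z (x, x * \<tau>)) * indicator {-1..1} \<tau>)"
   by (intro nn_integral_cong nn_integral_multc) measurable
  also have "\<dots> \<le> (\<integral>\<^sup>+\<tau>. B * indicator {-1..1} \<tau> \<partial>(lborel :: real measure))"
   by (intro nn_integral_mono mult_right_mono Z) auto
  also have "\<dots> = 2 * B" by (subst nn_integral_cmult_indicator) (auto simp: mult.commute)
  finally show ?thesis .
 qed
 have "(LI+ b. Y b) = (LI+ x. LI+ y. Y (x, y))"
  by (rule nn_integral_lborel_pair) simp
 also have "\<dots> \<le> (LI+ x. (LI+ y. Y (x, y) * indicator {y. \<bar>y\<bar> \<le> \<bar>x\<bar>} y)
   + (LI+ y. Y (x, y) * indicator {x. \<bar>x\<bar> \<le> \<bar>y\<bar>} x))"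
 proof (intro nn_integral_mono)
  fix x :: real
  have "(LI+ y. Y (x, y)) \<le> (LI+ y. Y (x, y) * indicator {y. \<bar>y\<bar> \<le> \<bar>x\<bar>} y + Y (x, y) * indicator {x. \<bar>x\<bar> \<le> \<bar>y\<bar>} x)"
   by (intro nn_integral_mono) (auto split: split_indicator)
  also have "\<dots> = (LI+ y. Y (x, y) * indicator {y. \<bar>y\<bar> \<le> \<bar>x\<bar>} y)
   + (LI+ y. Y (x, y) * indicator {x. \<bar>x\<bar> \<le> \<bar>y\<bar>} x)"
   by (rule nn_integral_add) measurable
  finally show "(LI+ y. Y (x, y)) \<le> (LI+ y. Y (x, y) * indicator {y. \<bar>y\<bar> \<le> \<bar>x\<bar>} y)
   + (LI+ y. Y (x, y) * indicator {x. \<bar>x\<bar> \<le> \<bar>y\<bar>} x)" .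
 qed
 also have "\<dots> = (LI+ x. (LI+ y. Y (x, y) * indicator {y. \<bar>y\<bar> \<le> \<bar>x\<bar>} y))
   + (LI+ x. (LI+ y. Y (x, y) * indicator {x. \<bar>x\<bar> \<le> \<bar>y\<bar>} x))"
  by (rule nn_integral_add) measurable
 also have "(LI+ x. (LI+ y. Y (x, y) * indicator {x. \<bar>x\<bar> \<le> \<bar>y\<bar>} x))
   = (LI+ y. (LI+ x. Y (x, y) * indicator {x. \<bar>x\<bar> \<le> \<bar>y\<bar>} x))"
  by (rule lborel_pair.Fubini') measurable
 also have "(LI+ x. (LI+ y. Y (x, y) * indicator {y. \<bar>y\<bar> \<le> \<bar>x\<bar>} y)) \<le> 2 * B"
  by (rule aux) (use 1 in auto)
 also have "(LI+ y. (LI+ x. Y (x, y) * indicator {x. \<bar>x\<bar> \<le> \<bar>y\<bar>} x)) \<le> 2 * B"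
  using aux[of "\<lambda>p. Y (snd p, fst p)"] 2 by simp
 finally show ?thesis by (simp add: distrib_right[symmetric] add_mono)
qed

text \<open>The factor 4 is the Jacobian of the four-dimensional map from (a, b) to (a + b, a - b).
  It arises from v = -u + 2a for fixed u; the remaining change u = a + b is a translation.\<close>

lemma nn_integral_diagonal_coords:
 fixes X :: "(real \<times> real) \<times> (real \<times> real) \<Rightarrow> ennreal"
 assumes [measurable]: "X \<in> borel_measurable borel"
 shows "(LI+ u. LI+ v. X (u, v)) = 4 * (LI+ a. LI+ b. X (a + b, a - b))"
proof -
 have [measurable]: "X \<in> borel_measurable (borel \<Otimes>\<^sub>M borel)" by (simp only: borel_prod) simp
 have "(LI+ u. LI+ v. X (u, v)) = (LI+ u. 4 * (LI+ a. X (u, - u + 2 *\<^sub>R a)))"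
 proof (rule nn_integral_cong)
  fix u :: "real \<times> real"
  show "(LI+ v. X (u, v)) = 4 * (LI+ a. X (u, - u + 2 *\<^sub>R a))"
   by (subst nn_integral_lborel_affine[where c=2 and t="-u"]) auto
 qed
 also have "\<dots> = 4 * (LI+ u. LI+ a. X (u, - u + 2 *\<^sub>R a))"
  by (rule nn_integral_cmult) measurable
 also have "(LI+ u. LI+ a. X (u, - u + 2 *\<^sub>R a)) = (LI+ a. LI+ u. X (u, - u + 2 *\<^sub>R a))"
  by (rule lborel_pair.Fubini') measurable
 also have "\<dots> = (LI+ a. LI+ b. X (a + b, a - b))"
 proof (rule nn_integral_cong)
  fix a :: "real \<times> real"
  have "(LI+ u. X (u, - u + 2 *\<^sub>R a)) = (LI+ b. X (a + b, - (a + b) + 2 *\<^sub>R a))"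
   by (rule nn_integral_lborel_translate[symmetric]) measurable
  also have "\<dots> = (LI+ b. X (a + b, a - b))"
   by (intro nn_integral_cong) (simp add: scaleR_2)
  finally show "(LI+ u. X (u, - u + 2 *\<^sub>R a)) = (LI+ b. X (a + b, a - b))" .
 qed
 finally show ?thesis .
qed

lemma nn_integral_graph_pt:
 fixes F :: "R3 \<Rightarrow> ennreal"
 assumes [measurable]: "F \<in> borel_measurable borel"
 shows "(LI+ p. LI+ w. F (graph_pt p w)) = (LI+ x. F x)"
 by (subst nn_integral_lborel_pair) (simp_all add: graph_pt_def nn_integral_R3)

text \<open>For u = a + b and v = a - b the horizontal part of the sum is 2a, so for fixed a only
  the sum of heights varies and the estimate along rays applies. The constant is 4 (Jacobian) times
  4 (rays), divided by 4 when 2a becomes the variable.\<close>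

lemma graph_sum_le:
 fixes F :: "R3 \<Rightarrow> ennreal"
 assumes [measurable]: "F \<in> borel_measurable borel"
 shows "(LI+ u. LI+ v. F (graph_pt u (cap_height u) + graph_pt v (cap_height v)) *
      (indicator {p. cap_height p \<ge> 1/2} u * indicator {p. cap_height p \<ge> 1/2} v))
     \<le> 4 * (LI+ x. F x)"
proof -
 let ?i = "indicator {p. cap_height p \<ge> 1/2} :: real \<times> real \<Rightarrow> ennreal"
 let ?X = "\<lambda>z. F (graph_pt (fst z) (cap_height (fst z)) + graph_pt (snd z) (cap_height (snd z))) * (?i (fst z) * ?i (snd z))"
 let ?B = "\<lambda>a. LI+ w. F (graph_pt (2 *\<^sub>R a) w)"
 have X [measurable]: "?X \<in> borel_measurable (borel \<Otimes>\<^sub>M borel)" by measurable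
 have 1: "(LI+ u. LI+ v. ?X (u, v)) = 4 * (LI+ a. LI+ b. ?X (a + b, a - b))"
  by (rule nn_integral_diagonal_coords) (use X in \<open>simp only: borel_prod\<close>)
 have 2: "(LI+ a. LI+ b. ?X (a + b, a - b)) \<le> (LI+ a. 4 * ?B a)"
 proof (rule nn_integral_mono)
  fix a :: "real \<times> real"
  have ray: "(LI+ t. ennreal \<bar>t\<bar> * ?X (a + t *\<^sub>R \<theta>, a - t *\<^sub>R \<theta>)) \<le> ?B a" if "norm \<theta> \<ge> 1" for \<theta>
  proof -
   have "(LI+ t. ennreal \<bar>t\<bar> * ?X (a + t *\<^sub>R \<theta>, a - t *\<^sub>R \<theta>))
    = (LI+ t. ennreal \<bar>t\<bar> * ((\<lambda>w. F (graph_pt (2 *\<^sub>R a) w)) (cap_height (a + t *\<^sub>R \<theta>) + cap_height (a - t *\<^sub>R \<theta>)) *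
      indicator {t. (norm (a + t *\<^sub>R \<theta>))^2 \<le> 3/4 \<and> (norm (a - t *\<^sub>R \<theta>))\<^sup>2 \<le> 3/4} t))"
   proof (rule nn_integral_cong)
    fix t :: real
    have 2: "a + t *\<^sub>R \<theta> + (a - t *\<^sub>R \<theta>) = 2 *\<^sub>R a" by (simp only: scaleR_2 add_diff_eq) simp
    have i: "?i (a + t *\<^sub>R \<theta>) * ?i (a - t *\<^sub>R \<theta>)
      = indicator {t. (norm (a + t *\<^sub>R \<theta>))^2 \<le> 3/4 \<and> (norm (a - t *\<^sub>R \<theta>))\<^sup>2 \<le> 3/4} t"
     unfolding indicator_def mem_Collect_eq cap_height_ge_half by simp
    show "ennreal \<bar>t\<bar> * ?X (a + t *\<^sub>R \<theta>, a - t *\<^sub>R \<theta>) = ennreal \<bar>t\<bar> * ((\<lambda>w. F (graph_pt (2 *\<^sub>R a) w)) (cap_height (a + t *\<^sub>R \<theta>) + cap_height (a - t *\<^sub>R \<theta>)) *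
      indicator {t. (norm (a + t *\<^sub>R \<theta>))^2 \<le> 3/4 \<and> (norm (a - t *\<^sub>R \<theta>))\<^sup>2 \<le> 3/4} t)"
     by (simp only: fst_conv snd_conv graph_pt_add 2 i)
   qed
   also have "\<dots> \<le> (LI+ w. F (graph_pt (2 *\<^sub>R a) w))"
    by (rule cap_height_line_integral_le[OF _ that]) measurable
   finally show ?thesis .
  qed
  have n: "1 \<le> norm (1::real, \<tau>::real)" "1 \<le> norm (\<tau>, 1::real)" for \<tau> by (simp_all add: norm_Pair)
  show "(LI+ b. ?X (a + b, a - b)) \<le> 4 * ?B a"
   by (rule nn_integral_pair_rays[where Y="\<lambda>b. ?X (a + b, a - b)" and B="?B a"])
     (measurable, rule ray[OF n(1)], rule ray[OF n(2)])
 qed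
 have 3: "(LI+ a. 4 * ?B a) = 4 * (LI+ a. ?B a)"
  by (rule nn_integral_cmult) measurable
 have 4: "4 * (LI+ a. ?B a) = (LI+ x. F x)"
 proof -
  have "(LI+ p. LI+ w. F (graph_pt p w))
    = ennreal (\<bar>2\<bar> ^ DIM(real \<times> real)) * (LI+ a. LI+ w. F (graph_pt (0 + 2 *\<^sub>R a) w))"
   by (rule nn_integral_lborel_affine) simp_all
  then show ?thesis using nn_integral_graph_pt[of F] by simp
 qed
 from 2 have "4 * (LI+ a. LI+ b. ?X (a + b, a - b)) \<le> 4 * (LI+ x. F x)"
  unfolding 3 4 by (rule mult_left_mono) simp
 then show ?thesis unfolding 1[symmetric] by (simp only: fst_conv snd_conv)
qed

text \<open>For fixed horizontal coordinates the radius r of the cone replaces the height c, with dr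
  = (c/r) dc and c/r \<ge> 1/2 on the cap. The constant is this 2 times the normalisation 3 in
  \<open>sphere_measure\<close>.\<close>

lemma sphere_cap_le_graph:
 fixes \<phi> :: "R3 \<Rightarrow> ennreal"
 assumes [measurable]: "\<phi> \<in> borel_measurable borel"
 shows "(\<integral>\<^sup>+\<omega>. \<phi> \<omega> * indicator {\<omega>. \<omega> $ 3 \<ge> 1/2} \<omega> \<partial>sphere_measure)
   \<le> 6 * (LI+ u. \<phi> (graph_pt u (cap_height u)) * indicator {p. cap_height p \<ge> 1/2} u)"
proof -
 let ?\<psi> = "\<lambda>\<omega>. \<phi> \<omega> * indicator {\<omega>. \<omega> $ 3 \<ge> 1/2} \<omega>"
 let ?\<chi> = "\<lambda>u. \<phi> (graph_pt u (cap_height u)) * indicator {p. cap_height p \<ge> 1/2} u"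
 let ?G = "\<lambda>x. 3 * indicator (cball 0 1) x * ?\<psi> ((1 / norm x) *\<^sub>R x)"
 let ?H = "\<lambda>a b r. 6 * indicator {0<..1} r * ?\<chi> ((1/r) *\<^sub>R (a, b))"
 have [measurable]: "{\<omega>::R3. \<omega> $ 3 \<ge> 1/2} \<in> sets borel" "cball (0::R3) 1 \<in> sets borel" by measurable
 have chi [measurable]: "?\<chi> \<in> borel_measurable borel" by measurable
 have [measurable]: "?\<chi> \<in> borel_measurable (borel \<Otimes>\<^sub>M borel)" using chi by (simp only: borel_prod)
 have "(\<integral>\<^sup>+\<omega>. ?\<psi> \<omega> \<partial>sphere_measure) = (LI+ x. ?G x)"
  unfolding sphere_measure_def by (subst nn_integral_distr, simp, simp, subst nn_integral_density) (auto simp: mult.assoc)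
 also have "\<dots> = (LI+ a. LI+ b. LI+ c. ?G (v3 a b c))"
  by (rule nn_integral_R3) measurable
 also have "\<dots> \<le> (LI+ a. LI+ b. LI+ r. ?H a b r)"
 proof (rule nn_integral_mono_AE)
  \<comment> \<open>For a nonzero first coordinate the radius is positive and smooth in the
    height.\<close>
  have "AE x in lborel. x \<noteq> (0::real)" by (rule AE_lborel_singleton)
  then show "AE a in lborel. (LI+ b. LI+ c. ?G (v3 a b c)) \<le> (LI+ b. LI+ r. ?H a b r)"
  proof eventually_elim
   case (elim a)
   show ?case
   proof (rule nn_integral_mono)
    fix b :: real
    define R where "R c = sqrt (a^2 + b^2 + c^2)" for c
    have pos: "a^2 + b^2 + c^2 > 0" for c using elim by (simp add: add_pos_nonneg)
    have Rpos: "R c > 0" for c using pos by (simp add: R_def)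
    have R2: "(R c)^2 = a^2 + b^2 + c^2" for c using pos[of c] by (simp add: R_def)
    have dR: "(R has_real_derivative c / R c) (at c)" for c
    proof -
     have "((\<lambda>c. a^2 + b^2 + c^2) has_real_derivative 2 * c) (at c)" by (auto intro!: derivative_eq_intros)
     then have "((\<lambda>c. sqrt (a^2 + b^2 + c^2)) has_real_derivative (inverse (sqrt (a^2 + b^2 + c^2)) / 2 * (2 * c))) (at c)"
      by (rule DERIV_chain2[where f=sqrt and g="\<lambda>c. a^2 + b^2 + c^2", OF DERIV_real_sqrt[OF pos[of c]]])
     then show ?thesis unfolding R_def by (simp add: field_simps)
    qed
    have "?G (v3 a b c) \<le> ?H a b (R c) * ennreal (c / R c) * indicator {0..1} c" for c
    proof (cases "R c \<le> 1 \<and> c / R c \<ge> 1/2")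
     case True
     then have c: "0 \<le> c" using Rpos[of c] by (auto simp: field_simps)
     have "c^2 \<le> (R c)^2" unfolding R2 by simp
     then have c1: "c \<le> 1" using True Rpos[of c] power2_le_imp_le[of c "R c"] by simp
     have e: "c / R c = cap_height ((1 / R c) *\<^sub>R (a, b))"
     proof -
      have "1 - (norm ((1 / R c) *\<^sub>R (a, b)))^2 = (c / R c)^2"
      proof -
       have "(a / R c)^2 + (b / R c)^2 + (c / R c)^2 = (R c)^2 / (R c)^2"
        by (simp add: power_divide R2 add_divide_distrib[symmetric])
       moreover have "(norm ((1 / R c) *\<^sub>R (a, b)))^2 = (a / R c)^2 + (b / R c)^2"
        unfolding scaleR_Pair norm_Pair by (simp add: power_divide)
       ultimately show ?thesis using Rpos[of c] by simp
      qed
      then show ?thesis using c Rpos[of c] by (simp add: cap_height_def)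
     qed
     have G: "?G (v3 a b c) = 3 * ?\<chi> ((1 / R c) *\<^sub>R (a, b))"
     proof -
      define u where "u = (1 / R c) *\<^sub>R (a, b)"
      have "(1 / norm (v3 a b c)) *\<^sub>R v3 a b c = graph_pt u (c / R c)"
       unfolding norm_v3 R_def[symmetric] v3_scale graph_pt_def u_def scaleR_Pair by simp
      then have p: "(1 / norm (v3 a b c)) *\<^sub>R v3 a b c = graph_pt u (cap_height u)" unfolding e u_def .
      have h: "cap_height u \<ge> 1/2" using True unfolding e u_def by simp
      have i: "indicator (cball 0 1) (v3 a b c) = (1::ennreal)"
       using True by (simp add: norm_v3 R_def[symmetric])
      have j: "indicator {\<omega>::R3. \<omega> $ 3 \<ge> 1/2} (graph_pt u (cap_height u)) = (1::ennreal)"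
       "indicator {p. cap_height p \<ge> 1/2} u = (1::ennreal)"
       using h by (simp_all add: graph_pt_def)
      show ?thesis unfolding p u_def[symmetric] i j by simp
     qed
     have "ennreal (1/2) \<le> ennreal (c / R c)" using True by (intro ennreal_leI) auto
     then have "6 * ?\<chi> ((1 / R c) *\<^sub>R (a, b)) * ennreal (1/2) \<le> 6 * ?\<chi> ((1 / R c) *\<^sub>R (a, b)) * ennreal (c / R c)"
      by (rule mult_left_mono) simp
     moreover have "6 * ?\<chi> ((1 / R c) *\<^sub>R (a, b)) * ennreal (1/2) = 3 * ?\<chi> ((1 / R c) *\<^sub>R (a, b))"
     proof -
      have "6 * ennreal (1/2) = ennreal (6 * (1/2))" by (subst ennreal_mult) simp_all
      then have 6: "6 * ennreal (1/2) = 3" by simp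
      have "6 * X * ennreal (1/2) = 6 * ennreal (1/2) * X" for X by (simp only: mult_ac)
      then show ?thesis unfolding 6 .
     qed
     ultimately show ?thesis using G True Rpos[of c] c c1 by simp
    next
     case False
     then have "?G (v3 a b c) = 0" by (auto simp: norm_v3 R_def[symmetric] v3_scale split: split_indicator)
     then show ?thesis by (metis zero_le)
    qed
    then have "(LI+ c. ?G (v3 a b c)) \<le> (LI+ c. ?H a b (R c) * ennreal (c / R c) * indicator {0..1} c)"
     by (intro nn_integral_mono)
    also have "\<dots> \<le> (LI+ r. ?H a b r)"
    proof (rule nn_integral_subst_le[where g'="\<lambda>c. c / R c"])
     have "continuous_on {0..1} R" unfolding R_def by (intro continuous_intros)
     then show "continuous_on {0..1} (\<lambda>c. c / R c)"
      by (intro continuous_intros) (auto simp: Rpos less_imp_neq[OF Rpos, symmetric])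
     show "0 \<le> c / R c \<and> c / R c \<le> c / R c" if "c \<in> {0..1}" for c
      using that Rpos[of c] by auto
    qed (use dR in \<open>simp_all\<close>)
    finally show "(LI+ c. ?G (v3 a b c)) \<le> (LI+ r. ?H a b r)" .
   qed
  qed
 qed
 also have "\<dots> = (LI+ p. LI+ r. ?H (fst p) (snd p) r)"
  by (subst nn_integral_lborel_pair) simp_all
 also have "\<dots> = (LI+ p. LI+ r. 6 * indicator {0<..1} r * ?\<chi> ((1/r) *\<^sub>R p))"
  by simp
 also have "\<dots> = (LI+ r. LI+ p. 6 * indicator {0<..1} r * ?\<chi> ((1/r) *\<^sub>R p))"
  by (rule lborel_pair.Fubini') measurable
 \<comment> \<open>Rescaling p = r u gives a factor r^2 \<le> 1, which is dropped; the integral over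
   r in (0, 1] is then 1.\<close>
 also have "\<dots> \<le> (LI+ r. 6 * (LI+ u. ?\<chi> u) * indicator {0<..1::real} r)"
 proof (rule nn_integral_mono)
  fix r :: real
  show "(LI+ p. 6 * indicator {0<..1} r * ?\<chi> ((1/r) *\<^sub>R p)) \<le> 6 * (LI+ u. ?\<chi> u) * indicator {0<..1} r"
  proof (cases "r \<in> {0<..1}")
   case True
   have "(LI+ p. ?\<chi> ((1/r) *\<^sub>R p)) \<le> ennreal (\<bar>1/r\<bar> ^ 2) * (LI+ p. ?\<chi> ((1/r) *\<^sub>R p))"
   proof -
    have "1 \<le> \<bar>1/r\<bar> ^ 2" using True by (intro one_le_power) (auto simp: field_simps)
    then have "1 \<le> ennreal (\<bar>1/r\<bar> ^ 2)" by (metis ennreal_1 ennreal_leI)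
    from mult_right_mono[OF this, of "LI+ p. ?\<chi> ((1/r) *\<^sub>R p)"] show ?thesis by simp
   qed
   also have "\<dots> = (LI+ u. ?\<chi> u)"
    using nn_integral_lborel_affine[of ?\<chi> "1/r" 0] True by (simp add: power2_eq_square)
   finally show ?thesis using True by (simp add: nn_integral_cmult mult_left_mono)
  qed simp
 qed
 also have "\<dots> = 6 * (LI+ u. ?\<chi> u)"
  by (subst nn_integral_cmult_indicator) auto
 finally show ?thesis .
qed

lemma sets_sphere_measure [simp, measurable_cong]: "sets sphere_measure = sets borel"
 by (simp add: sphere_measure_def)

lemma space_sphere_measure [simp]: "space sphere_measure = UNIV"
 by (simp add: sphere_measure_def)

lemma finite_sphere_measure: "finite_measure sphere_measure"
proof
 have m: "(\<lambda>x::R3. 3 * indicator (cball 0 1) x :: ennreal) \<in> borel_measurable lborel"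
  by (intro borel_measurable_times_ennreal borel_measurable_indicator borel_measurable_const) simp_all
 have "emeasure sphere_measure (space sphere_measure) = (\<integral>\<^sup>+x. 3 * indicator (cball 0 1) x \<partial>(lborel :: R3 measure))"
  unfolding sphere_measure_def by (subst emeasure_distr, simp, simp, subst emeasure_density[OF m]) auto
 also have "\<dots> = 3 * emeasure lborel (cball (0::R3) 1)" by (rule nn_integral_cmult_indicator) simp
 also have "\<dots> < \<infinity>" using emeasure_lborel_cball_finite[of "0::R3" 1] by (simp add: ennreal_mult_less_top)
 finally show "emeasure sphere_measure (space sphere_measure) \<noteq> \<infinity>" by simp
qed

interpretation sphere: finite_measure sphere_measure by (rule finite_sphere_measure)

text \<open>144 = 6 * 6 * 4: the passage to the graph in each variable, and
  \<open>graph_sum_le\<close>.\<close>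

lemma cap_sum_le:
 fixes F :: "R3 \<Rightarrow> ennreal"
 assumes [measurable]: "F \<in> borel_measurable borel"
 shows "(\<integral>\<^sup>+x. \<integral>\<^sup>+y. F (x + y) * indicator {\<omega>. \<omega> $ 3 \<ge> 1/2} y * indicator {\<omega>. \<omega> $ 3 \<ge> 1/2} x
      \<partial>sphere_measure \<partial>sphere_measure) \<le> 144 * (LI+ x. F x)"
proof -
 let ?c = "indicator {\<omega>::R3. \<omega> $ 3 \<ge> 1/2} :: R3 \<Rightarrow> ennreal"
 let ?i = "indicator {p. cap_height p \<ge> 1/2} :: real \<times> real \<Rightarrow> ennreal"
 let ?g = "\<lambda>u. graph_pt u (cap_height u)"
 have [measurable]: "{\<omega>::R3. \<omega> $ 3 \<ge> 1/2} \<in> sets borel" by measurable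
 have 1: "(\<integral>\<^sup>+x. \<integral>\<^sup>+y. F (x + y) * ?c y * ?c x \<partial>sphere_measure \<partial>sphere_measure)
   \<le> (\<integral>\<^sup>+x. (6 * (LI+ v. F (x + ?g v) * ?i v)) * ?c x \<partial>sphere_measure)"
 proof (rule nn_integral_mono)
  fix x :: R3
  have e: "(\<integral>\<^sup>+y. F (x + y) * ?c y * ?c x \<partial>sphere_measure) = (\<integral>\<^sup>+y. F (x + y) * ?c y \<partial>sphere_measure) * ?c x" by (rule nn_integral_multc) measurable
  show "(\<integral>\<^sup>+y. F (x + y) * ?c y * ?c x \<partial>sphere_measure) \<le> (6 * (LI+ v. F (x + ?g v) * ?i v)) * ?c x"
   unfolding e by (intro mult_right_mono sphere_cap_le_graph) auto
 qed
 define J where "J u = (LI+ v. F (u + ?g v) * ?i v)" for u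
 have [measurable]: "J \<in> borel_measurable borel" unfolding J_def by measurable
 have 2: "(\<integral>\<^sup>+x. 6 * J x * ?c x \<partial>sphere_measure) \<le> 6 * (LI+ u. 6 * J (?g u) * ?i u)"
  by (rule sphere_cap_le_graph) measurable
 have e: "(LI+ v. F (?g u + ?g v) * (?i u * ?i v)) = J (?g u) * ?i u" for u
 proof -
  have "F (?g u + ?g v) * (?i u * ?i v) = F (?g u + ?g v) * ?i v * ?i u" for v by (simp only: mult_ac)
  then show ?thesis unfolding J_def by (simp only: nn_integral_multc) (rule nn_integral_multc, measurable)
 qed
 have 3: "(LI+ u. 6 * J (?g u) * ?i u) = 6 * (LI+ u. J (?g u) * ?i u)"
  unfolding mult.assoc by (rule nn_integral_cmult) measurable
 have 4: "(LI+ u. J (?g u) * ?i u) \<le> 4 * (LI+ x. F x)"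
  using graph_sum_le[OF assms] unfolding e .
 have "6 * (6 * (LI+ u. J (?g u) * ?i u)) \<le> 6 * (6 * (4 * (LI+ x. F x)))"
  by (intro mult_left_mono 4) simp_all
 also have "\<dots> = 144 * (LI+ x. F x)" by (simp add: mult.assoc[symmetric])
 finally show ?thesis using order_trans[OF 1[folded J_def] 2] unfolding 3 by (rule order_trans[rotated])
qed

section \<open>Variation over finite sets of scales\<close>

lemma Hoelder_sum:
 fixes x y :: "'i \<Rightarrow> real"
 assumes p: "p > 1" "q > 1" "1/p + 1/q = 1" and nn: "\<And>i. i \<in> I \<Longrightarrow> 0 \<le> x i" "\<And>i. i \<in> I \<Longrightarrow> 0 \<le> y i"
 shows "(\<Sum>i\<in>I. x i * y i) \<le> (\<Sum>i\<in>I. x i powr p) powr (1/p) * (\<Sum>i\<in>I. y i powr q) powr (1/q)"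
proof (cases "finite I")
 case True
 define X Y where "X = (\<Sum>i\<in>I. x i powr p)" and "Y = (\<Sum>i\<in>I. y i powr q)"
 have XY0: "0 \<le> X" "0 \<le> Y" by (auto simp: X_def Y_def intro: sum_nonneg)
 show ?thesis
 proof (cases "X = 0 \<or> Y = 0")
  case True
  then have "\<forall>i\<in>I. x i = 0 \<or> y i = 0"
   using \<open>finite I\<close> by (auto simp: X_def Y_def sum_nonneg_eq_0_iff)
  then have "(\<Sum>i\<in>I. x i * y i) = 0" by (intro sum.neutral) auto
  then show ?thesis by simp
 next
  case False
  then have pos: "0 < X" "0 < Y" using XY0 by auto
  let ?a = "X powr (1/p)" let ?b = "Y powr (1/q)"
  have ab: "?a > 0" "?b > 0" using pos by auto
  have "(\<Sum>i\<in>I. (x i / ?a) * (y i / ?b)) \<le> (\<Sum>i\<in>I. (x i / ?a) powr p / p + (y i / ?b) powr q / q)"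
   using p nn ab by (intro sum_mono Youngs_inequality) auto
  also have "\<dots> = (\<Sum>i\<in>I. x i powr p / X / p + y i powr q / Y / q)"
   using p nn pos by (intro sum.cong refl) (auto simp: powr_divide powr_powr)
  also have "\<dots> = (\<Sum>i\<in>I. x i powr p) / X / p + (\<Sum>i\<in>I. y i powr q) / Y / q"
   by (simp add: sum.distrib sum_divide_distrib)
  also have "\<dots> = 1" using p pos by (simp add: X_def[symmetric] Y_def[symmetric])
  finally have "(\<Sum>i\<in>I. (x i / ?a) * (y i / ?b)) \<le> 1" .
  moreover have "(\<Sum>i\<in>I. (x i / ?a) * (y i / ?b)) = (\<Sum>i\<in>I. x i * y i) / (?a * ?b)"
   by (simp add: sum_divide_distrib)
  ultimately show ?thesis using ab by (simp add: X_def[symmetric] Y_def[symmetric] field_simps)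
 qed
qed simp

text \<open>Partitions are finite sets instead of increasing sequences, so that they can be united
  and can be values of a function of the frequency. A point \<open>s\<close> of
  \<open>steps S\<close> stands for the interval (\<open>pre S s\<close>, \<open>s\<close>], and
  \<open>nxt S u\<close> is the right end point of the interval containing \<open>u\<close>.\<close>

definition pre :: "'a::linorder set \<Rightarrow> 'a \<Rightarrow> 'a" where "pre S s = Max {u \<in> S. u < s}"
definition steps :: "'a::linorder set \<Rightarrow> 'a set" where "steps S = S - {Min S}"
definition nxt :: "'a::linorder set \<Rightarrow> 'a \<Rightarrow> 'a" where "nxt S u = Min {s \<in> S. u \<le> s}"
definition incr :: "('a \<Rightarrow> 'b::minus) \<Rightarrow> 'a::linorder set \<Rightarrow> 'a \<Rightarrow> 'b" where "incr a S s = a s - a (pre S s)"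

text \<open>Coefficients given on the intervals of a partition \<open>S\<close>, read on a finer grid.\<close>
definition refine :: "'a::linorder set \<Rightarrow> ('a \<Rightarrow> complex) \<Rightarrow> 'a \<Rightarrow> complex" where
 "refine S b u = (if Min S < u \<and> u \<le> Max S then b (nxt S u) else 0)"

definition vnorm :: "real \<Rightarrow> 'a::linorder set \<Rightarrow> ('a \<Rightarrow> complex) \<Rightarrow> real" where
 "vnorm \<rho> S a = (\<Sum>s\<in>steps S. cmod (incr a S s) powr \<rho>) powr (1/\<rho>)"

definition wnorm :: "real \<Rightarrow> 'a::linorder set \<Rightarrow> 'a set \<Rightarrow> ('a \<Rightarrow> 'a \<Rightarrow> complex) \<Rightarrow> real" where
 "wnorm \<rho> S S' b = (\<Sum>s\<in>steps S. \<Sum>t\<in>steps S'. cmod (incr (\<lambda>\<epsilon>. incr (b \<epsilon>) S' t) S s) powr \<rho>) powr (1/\<rho>)"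

lemma finite_steps [simp]: "finite S \<Longrightarrow> finite (steps S)"
 by (simp add: steps_def)

lemma steps_iff: "finite S \<Longrightarrow> s \<in> steps S \<longleftrightarrow> s \<in> S \<and> (\<exists>u\<in>S. u < s)"
 unfolding steps_def by (metis DiffD1 DiffD2 DiffI Min_in Min_le all_not_in_conv insertCI leD order_le_less singletonD)

lemma pre_props:
 assumes "finite S" "s \<in> steps S"
 shows "pre S s \<in> S" "pre S s < s" "\<And>u. u \<in> S \<Longrightarrow> u < s \<Longrightarrow> u \<le> pre S s"
proof -
 have ne: "{u \<in> S. u < s} \<noteq> {}" using assms steps_iff by fastforce
 have "pre S s \<in> {u \<in> S. u < s}" unfolding pre_def using ne assms by (intro Max_in) auto
 then show "pre S s \<in> S" "pre S s < s" by auto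
 show "u \<le> pre S s" if "u \<in> S" "u < s" for u unfolding pre_def using that assms by (intro Max_ge) auto
qed

lemma nxt_props:
 assumes "finite S" "S \<noteq> {}" "Min S < u" "u \<le> Max S"
 shows "nxt S u \<in> steps S" "pre S (nxt S u) < u" "u \<le> nxt S u" "\<And>s. s \<in> S \<Longrightarrow> u \<le> s \<Longrightarrow> nxt S u \<le> s"
proof -
 have "{s \<in> S. u \<le> s} \<noteq> {}" using assms(4) Max_in[OF assms(1,2)] by blast
 then have "nxt S u \<in> {s \<in> S. u \<le> s}" unfolding nxt_def using assms by (intro Min_in) auto
 then have n: "nxt S u \<in> S" "u \<le> nxt S u" by auto
 then show st: "nxt S u \<in> steps S" "u \<le> nxt S u" using assms Min_in[of S] steps_iff[of S] by fastforce+
 show le: "nxt S u \<le> s" if "s \<in> S" "u \<le> s" for s unfolding nxt_def using that assms by (intro Min_le) auto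
 show "pre S (nxt S u) < u"
  using pre_props(1,2)[OF assms(1) st(1)] le[of "pre S (nxt S u)"] by force
qed

lemma nxt_eqI:
 assumes "finite S" "s \<in> steps S" "pre S s < u" "u \<le> s"
 shows "nxt S u = s"
proof -
 have "s \<in> S" using assms by (simp add: steps_def)
 moreover have "s \<le> t" if "t \<in> S" "u \<le> t" for t
  using pre_props(3)[OF assms(1,2) that(1)] that assms(3) by force
 ultimately show ?thesis unfolding nxt_def using assms by (intro Min_eqI) auto
qed

lemma sum_incr_telescope:
 fixes a :: "'a::linorder \<Rightarrow> 'b::ab_group_add"
 assumes "finite T" "p \<in> T" "s \<in> T" "p \<le> s"
 shows "(\<Sum>u\<in>{u\<in>T. p < u \<and> u \<le> s}. incr a T u) = a s - a p"
 using assms(3,4)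
proof (induction "card {u\<in>T. p < u \<and> u \<le> s}" arbitrary: s rule: less_induct)
 case less
 show ?case
 proof (cases "p = s")
  case True
  then have e: "{u\<in>T. p < u \<and> u \<le> s} = {}" by auto
  show ?thesis unfolding e using True by simp
 next
  case False
  then have ps: "p < s" using less by auto
  then have st: "s \<in> steps T" using assms less by (auto simp: steps_iff)
  note pp = pre_props[OF assms(1) st]
  have e: "{u\<in>T. p < u \<and> u \<le> s} = insert s {u\<in>T. p < u \<and> u \<le> pre T s}"
   using pp ps less(2) by force
  have ni: "s \<notin> {u\<in>T. p < u \<and> u \<le> pre T s}" using pp by auto
  have fin: "finite {u\<in>T. p < u \<and> u \<le> pre T s}" using assms by auto
  have "(\<Sum>u\<in>{u\<in>T. p < u \<and> u \<le> pre T s}. incr a T u) = a (pre T s) - a p"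
   by (rule less.hyps) (use e ni fin pp ps assms in auto)
  then show ?thesis unfolding e by (subst sum.insert[OF fin ni]) (simp add: incr_def)
 qed
qed

lemma refine_outside: "\<not> (Min S < u \<and> u \<le> Max S) \<Longrightarrow> refine S b u = 0"
 unfolding refine_def by (simp only: if_False)

text \<open>The refined coefficient is constant along each interval of \<open>S\<close>, where the
  increments over the fine grid telescope, and it vanishes outside the range of
  \<open>S\<close>.\<close>

lemma sum_refine:
 fixes a :: "'a::linorder \<Rightarrow> complex"
 assumes T: "finite T" and S: "S \<subseteq> T" "S \<noteq> {}"
 shows "(\<Sum>u\<in>steps T. refine S b u * incr a T u) = (\<Sum>s\<in>steps S. b s * incr a S s)"
proof -
 have fS: "finite S" using assms finite_subset by auto
 let ?I = "\<lambda>s. {u\<in>T. pre S s < u \<and> u \<le> s}"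
 let ?U = "{u\<in>T. Min S < u \<and> u \<le> Max S}"
 have U: "?U = (\<Union>s\<in>steps S. ?I s)"
 proof (intro set_eqI iffI)
  fix u assume "u \<in> ?U"
  then show "u \<in> (\<Union>s\<in>steps S. ?I s)" using nxt_props[OF fS S(2), of u] by auto
 next
  fix u assume "u \<in> (\<Union>s\<in>steps S. ?I s)"
  then obtain s where s: "s \<in> steps S" "u \<in> T" "pre S s < u" "u \<le> s" by auto
  have "Min S \<le> pre S s" "s \<le> Max S" using pre_props(1)[OF fS s(1)] s(1) fS by (auto simp: steps_def)
  then show "u \<in> ?U" using s by auto
 qed
 have "(\<Sum>u\<in>steps T. refine S b u * incr a T u) = (\<Sum>u\<in>?U. refine S b u * incr a T u)"
 proof (rule sum.mono_neutral_right)
  show "finite (steps T)" by (rule finite_steps[OF T])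
  show "?U \<subseteq> steps T" using S Min_in[OF fS S(2)] T by (fastforce simp: steps_iff)
  show "\<forall>u\<in>steps T - ?U. refine S b u * incr a T u = 0"
  proof
   fix u assume "u \<in> steps T - ?U"
   then have "\<not> (Min S < u \<and> u \<le> Max S)" unfolding steps_def by blast
   from refine_outside[OF this] show "refine S b u * incr a T u = 0" by simp
  qed
 qed
 also have "\<dots> = (\<Sum>s\<in>steps S. \<Sum>u\<in>?I s. refine S b u * incr a T u)"
  unfolding U
 proof (rule sum.UNION_disjoint)
  show "\<forall>i\<in>steps S. \<forall>j\<in>steps S. i \<noteq> j \<longrightarrow> ?I i \<inter> ?I j = {}"
  proof (intro ballI impI equals0I)
   fix i j u assume ij: "i \<in> steps S" "j \<in> steps S" "i \<noteq> j" "u \<in> ?I i \<inter> ?I j"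
   then have "nxt S u = i" "nxt S u = j" using nxt_eqI[OF fS, of i u] nxt_eqI[OF fS, of j u] by blast+
   then show False using ij(3) by simp
  qed
  show "finite (steps S)" by (rule finite_steps[OF fS])
  show "\<forall>i\<in>steps S. finite (?I i)" by (intro ballI finite_subset[OF _ T]) blast
 qed
 also have "\<dots> = (\<Sum>s\<in>steps S. b s * incr a S s)"
 proof (rule sum.cong[OF refl])
  fix s assume s: "s \<in> steps S"
  have "(\<Sum>u\<in>?I s. refine S b u * incr a T u) = (\<Sum>u\<in>?I s. b s * incr a T u)"
  proof (rule sum.cong[OF refl])
   fix u assume u: "u \<in> ?I s"
   then have "u \<in> ?U" unfolding U using s by auto
   then show "refine S b u * incr a T u = b s * incr a T u"
    using nxt_eqI[OF fS s] u by (auto simp: refine_def)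
  qed
  also have "\<dots> = b s * (a s - a (pre S s))"
   unfolding sum_distrib_left[symmetric]
   using pre_props(1,2)[OF fS s] s S T by (subst sum_incr_telescope) (auto simp: steps_def)
  finally show "(\<Sum>u\<in>?I s. refine S b u * incr a T u) = b s * incr a S s" by (simp add: incr_def)
 qed
 finally show ?thesis .
qed

text \<open>No point of \<open>S\<close> separates \<open>u\<close> from the next point of the finer
  grid \<open>R\<close>, so both lie in the same interval of \<open>S\<close>.\<close>

lemma refine_nxt:
 assumes fR: "finite R" and S: "S \<subseteq> R" "S \<noteq> {}" and u: "Min R < u" "u \<le> Max R"
 shows "refine S b (nxt R u) = refine S b u"
proof -
 have fS: "finite S" using assms finite_subset by auto
 have R: "R \<noteq> {}" using S by auto
 note n = nxt_props[OF fR R u]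
 have nR: "nxt R u \<in> R" using n(1) by (simp add: steps_def)
 have 1: "Min S < nxt R u \<longleftrightarrow> Min S < u"
  using n(3) n(4)[of "Min S"] Min_in[OF fS S(2)] S(1) by force
 have 2: "nxt R u \<le> s \<longleftrightarrow> u \<le> s" if "s \<in> S" for s
  using n(3) n(4)[of s] that S(1) by force
 have "nxt S (nxt R u) = nxt S u" unfolding nxt_def[of S] using 2 by (metis (mono_tags, lifting))
 then show ?thesis using 1 2[OF Max_in[OF fS S(2)]] by (simp add: refine_def)
qed

text \<open>A product of two step functions is a step function for the united partition. It is
  therefore its own refinement from there, and \<open>sum_refine\<close> applies.\<close>

lemma sum_refine_product:
 fixes a :: "'a::linorder \<Rightarrow> complex"
 assumes T: "finite T" and S: "S \<subseteq> T" "S \<noteq> {}" and S': "S' \<subseteq> T" "S' \<noteq> {}"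
 shows "(\<Sum>u\<in>steps T. refine S b u * refine S' b' u * incr a T u)
    = (\<Sum>r\<in>steps (S \<union> S'). refine S b r * refine S' b' r * incr a (S \<union> S') r)"
proof -
 let ?R = "S \<union> S'"
 let ?b = "\<lambda>r. refine S b r * refine S' b' r"
 have fR: "finite ?R" using assms finite_subset by auto
 then have fS: "finite S" "finite S'" by auto
 have "refine ?R ?b u = ?b u" for u
 proof (cases "Min ?R < u \<and> u \<le> Max ?R")
  case True
  then show ?thesis using refine_nxt[OF fR _ S(2), of u b] refine_nxt[OF fR _ S'(2), of u b'] by (simp add: refine_def[of ?R])
 next
  case False
  have "Min ?R \<le> Min S" "Max S \<le> Max ?R"
   using Min_antimono[of S ?R] Max_mono[of S ?R] S fR by auto
  then have "\<not> (Min S < u \<and> u \<le> Max S)" using False by (meson le_less_trans order_trans)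
  then have "refine S b u = 0" "refine ?R ?b u = 0" using False unfolding refine_def by (simp_all only: if_False)
  then show ?thesis by simp
 qed
 then show ?thesis using sum_refine[OF T, of ?R ?b a] S S' by simp
qed

text \<open>An interval of the common refinement is determined by the two intervals of
  \<open>S\<close> and \<open>S'\<close> that contain it: its right end point is the smaller of
  theirs. The sum thus runs over distinct pairs, and the sum over all pairs factorises.\<close>

lemma sum_refine_product_powr_le:
 assumes fin: "finite S" "finite S'" and ne: "S \<noteq> {}" "S' \<noteq> {}"
 shows "(\<Sum>r\<in>steps (S \<union> S'). cmod (refine S b r * refine S' b' r) powr q)
   \<le> (\<Sum>s\<in>steps S. cmod (b s) powr q) * (\<Sum>s\<in>steps S'. cmod (b' s) powr q)"
proof -
 let ?A = "{r \<in> S \<union> S'. Min S < r \<and> r \<le> Max S \<and> Min S' < r \<and> r \<le> Max S'}"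
 let ?f = "\<lambda>r. (nxt S r, nxt S' r)"
 let ?g = "\<lambda>(s, t). cmod (b s) powr q * cmod (b' t) powr q"
 have inj: "inj_on ?f ?A"
 proof (rule inj_on_inverseI[where g="\<lambda>(x, y). min x y"])
  fix r assume r: "r \<in> ?A"
  have 1: "r \<le> nxt S r" "r \<le> nxt S' r" using nxt_props(3)[of S r] nxt_props(3)[of S' r] fin ne r by auto
  have "nxt S r = r \<or> nxt S' r = r"
   using nxt_props(4)[of S r r] nxt_props(4)[of S' r r] fin ne r 1 by (auto intro: antisym)
  then show "(case ?f r of (x, y) \<Rightarrow> min x y) = r" using 1 by (auto simp: min_def)
 qed
 have "(\<Sum>r\<in>steps (S \<union> S'). cmod (refine S b r * refine S' b' r) powr q) = (\<Sum>r\<in>?A. ?g (?f r))"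
 proof (rule sum.mono_neutral_cong_right)
  show "finite (steps (S \<union> S'))" using fin by (intro finite_steps finite_UnI)
  show "?A \<subseteq> steps (S \<union> S')" using fin ne Min_in[of S] by (fastforce simp: steps_iff)
  show "\<forall>i\<in>steps (S \<union> S') - ?A. cmod (refine S b i * refine S' b' i) powr q = 0"
  proof
   fix u assume "u \<in> steps (S \<union> S') - ?A"
   then have "\<not> (Min S < u \<and> u \<le> Max S) \<or> \<not> (Min S' < u \<and> u \<le> Max S')" unfolding steps_def by blast
   then have "refine S b u = 0 \<or> refine S' b' u = 0" using refine_outside by blast
   then show "cmod (refine S b u * refine S' b' u) powr q = 0" by auto
  qed
  show "cmod (refine S b u * refine S' b' u) powr q = ?g (?f u)" if "u \<in> ?A" for u
  proof -
   have "refine S b u = b (nxt S u)" "refine S' b' u = b' (nxt S' u)" using that by (auto simp only: refine_def mem_Collect_eq simp_thms if_True)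
   then show ?thesis by (simp add: norm_mult powr_mult)
  qed
 qed
 also have "\<dots> = sum ?g (?f ` ?A)" using sum.reindex[OF inj, of ?g] by simp
 also have "\<dots> \<le> sum ?g (steps S \<times> steps S')"
  using nxt_props(1)[of S] nxt_props(1)[of S'] fin ne by (intro sum_mono2) auto
 also have "\<dots> = (\<Sum>s\<in>steps S. cmod (b s) powr q) * (\<Sum>s\<in>steps S'. cmod (b' s) powr q)"
  by (simp add: sum_product sum.cartesian_product)
 finally show ?thesis .
qed

lemma conjugate_exponent:
 fixes \<rho> :: real assumes "1 < \<rho>"
 shows "\<rho> / (\<rho> - 1) > 1" "1/\<rho> + 1/(\<rho> / (\<rho> - 1)) = 1"
 using assms by (auto simp: field_simps)

text \<open>Hoelder on the common refinement. The coefficient norms separate without any dependence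
  on the number of points, and only the partition \<open>S \<union> S'\<close> remembers both
  factors.\<close>

lemma sum_refine_product_le:
 fixes a :: "'a::linorder \<Rightarrow> complex"
 assumes \<rho>: "1 < \<rho>" and q: "q = \<rho> / (\<rho> - 1)" and T: "finite T" and S: "S \<subseteq> T" "S \<noteq> {}" and S': "S' \<subseteq> T" "S' \<noteq> {}"
 shows "cmod (\<Sum>u\<in>steps T. refine S b u * refine S' b' u * incr a T u)
   \<le> (\<Sum>s\<in>steps S. cmod (b s) powr q) powr (1/q) * (\<Sum>s\<in>steps S'. cmod (b' s) powr q) powr (1/q) * vnorm \<rho> (S \<union> S') a"
proof -
 let ?R = "S \<union> S'"
 have fin: "finite S" "finite S'" using assms finite_subset by auto
 note ce = conjugate_exponent[OF \<rho>, folded q]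
 have "cmod (\<Sum>u\<in>steps T. refine S b u * refine S' b' u * incr a T u)
   = cmod (\<Sum>r\<in>steps ?R. refine S b r * refine S' b' r * incr a ?R r)"
  using sum_refine_product[OF T S S'] by simp
 also have "\<dots> \<le> (\<Sum>r\<in>steps ?R. cmod (refine S b r * refine S' b' r) * cmod (incr a ?R r))"
  by (rule order_trans[OF norm_sum]) (simp add: norm_mult)
 also have "\<dots> \<le> (\<Sum>r\<in>steps ?R. cmod (refine S b r * refine S' b' r) powr q) powr (1/q) * vnorm \<rho> ?R a"
  unfolding vnorm_def by (rule Hoelder_sum) (use ce \<rho> in auto)
 also have "\<dots> \<le> ((\<Sum>s\<in>steps S. cmod (b s) powr q) * (\<Sum>s\<in>steps S'. cmod (b' s) powr q)) powr (1/q) * vnorm \<rho> ?R a"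
  using ce S S' fin
  by (intro mult_right_mono powr_mono2 sum_refine_product_powr_le sum_nonneg) (auto simp: vnorm_def)
 also have "\<dots> = (\<Sum>s\<in>steps S. cmod (b s) powr q) powr (1/q) * (\<Sum>s\<in>steps S'. cmod (b' s) powr q) powr (1/q) * vnorm \<rho> ?R a"
  by (subst powr_mult) (auto intro: sum_nonneg)
 finally show ?thesis .
qed

text \<open>Each of the two summations telescopes to its own partition. Hoelder over the product set
  then separates the coefficients, because the norm of a tensor product is the product of the
  norms.\<close>

lemma sum_refine_double_le:
 fixes d :: "'a::linorder \<Rightarrow> 'a \<Rightarrow> complex"
 assumes \<rho>: "1 < \<rho>" and q: "q = \<rho> / (\<rho> - 1)" and T: "finite T" and S: "S \<subseteq> T" "S \<noteq> {}" and S': "S' \<subseteq> T" "S' \<noteq> {}"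
 shows "cmod (\<Sum>u\<in>steps T. \<Sum>v\<in>steps T. refine S b u * refine S' b' v * incr (\<lambda>\<epsilon>. incr (d \<epsilon>) T v) T u)
   \<le> (\<Sum>s\<in>steps S. cmod (b s) powr q) powr (1/q) * (\<Sum>s\<in>steps S'. cmod (b' s) powr q) powr (1/q) * wnorm \<rho> S S' d"
proof -
 have fin: "finite S" "finite S'" using assms finite_subset by auto
 note ce = conjugate_exponent[OF \<rho>, folded q]
 let ?D = "\<lambda>s t. incr (\<lambda>\<epsilon>. incr (d \<epsilon>) S' t) S s"
 have inc: "(\<Sum>v\<in>A. c v * incr (\<lambda>\<epsilon>. f \<epsilon> v) R u) = incr (\<lambda>\<epsilon>. \<Sum>v\<in>A. c v * f \<epsilon> v) R u"
  for A :: "'a set" and c :: "'a \<Rightarrow> complex" and f :: "'a \<Rightarrow> 'a \<Rightarrow> complex" and R u by (simp add: incr_def sum_subtractf right_diff_distrib)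
 have "(\<Sum>u\<in>steps T. \<Sum>v\<in>steps T. refine S b u * refine S' b' v * incr (\<lambda>\<epsilon>. incr (d \<epsilon>) T v) T u)
   = (\<Sum>u\<in>steps T. refine S b u * incr (\<lambda>\<epsilon>. \<Sum>v\<in>steps T. refine S' b' v * incr (d \<epsilon>) T v) T u)"
  unfolding inc[symmetric] by (simp add: sum_distrib_left mult.assoc)
 also have "\<dots> = (\<Sum>s\<in>steps S. b s * incr (\<lambda>\<epsilon>. \<Sum>t\<in>steps S'. b' t * incr (d \<epsilon>) S' t) S s)"
  unfolding sum_refine[OF T S'] by (rule sum_refine[OF T S])
 also have "\<dots> = (\<Sum>(s, t)\<in>steps S \<times> steps S'. b s * b' t * ?D s t)"
  unfolding inc[symmetric] by (simp add: sum_distrib_left mult.assoc sum.cartesian_product)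
 finally have "cmod (\<Sum>u\<in>steps T. \<Sum>v\<in>steps T. refine S b u * refine S' b' v * incr (\<lambda>\<epsilon>. incr (d \<epsilon>) T v) T u)
   \<le> (\<Sum>z\<in>steps S \<times> steps S'. cmod (b (fst z) * b' (snd z)) * cmod (?D (fst z) (snd z)))"
  using norm_sum[of "\<lambda>z. b (fst z) * b' (snd z) * ?D (fst z) (snd z)" "steps S \<times> steps S'"]
  by (simp add: case_prod_beta norm_mult)
 also have "\<dots> \<le> (\<Sum>z\<in>steps S \<times> steps S'. cmod (b (fst z) * b' (snd z)) powr q) powr (1/q)
   * (\<Sum>z\<in>steps S \<times> steps S'. cmod (?D (fst z) (snd z)) powr \<rho>) powr (1/\<rho>)"
  by (rule Hoelder_sum) (use ce \<rho> in auto)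
 also have "(\<Sum>z\<in>steps S \<times> steps S'. cmod (?D (fst z) (snd z)) powr \<rho>) powr (1/\<rho>) = wnorm \<rho> S S' d"
  unfolding wnorm_def by (simp add: sum.cartesian_product case_prod_beta)
 also have "(\<Sum>z\<in>steps S \<times> steps S'. cmod (b (fst z) * b' (snd z)) powr q)
   = (\<Sum>s\<in>steps S. cmod (b s) powr q) * (\<Sum>s\<in>steps S'. cmod (b' s) powr q)"
  by (simp add: sum_product sum.cartesian_product norm_mult powr_mult case_prod_beta)
 also have "\<dots> powr (1/q) = (\<Sum>s\<in>steps S. cmod (b s) powr q) powr (1/q) * (\<Sum>s\<in>steps S'. cmod (b' s) powr q) powr (1/q)"
  by (rule powr_mult)
 finally show ?thesis .
qed

text \<open>The vector that is extremal in the duality of \<open>\<ell>\<^sup>\<rho>\<close> and its dual, normalised to have the same norm as \<open>d\<close>.\<close>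
definition lp_dual :: "real \<Rightarrow> 'i set \<Rightarrow> ('i \<Rightarrow> complex) \<Rightarrow> 'i \<Rightarrow> complex" where
 "lp_dual \<rho> I d i = complex_of_real (cmod (d i) powr (\<rho> - 1) * ((\<Sum>i\<in>I. cmod (d i) powr \<rho>) powr (1/\<rho>)) powr (2 - \<rho>)) * cnj (sgn (d i))"

text \<open>The usual extremal vector pairs to N^\<rho>. The extra factor N^(2 - \<rho>) makes the
  pairing N^2 and the dual norm N, so that after integration over the sphere both are expressed by
  one L^2 norm.\<close>

lemma sum_lp_dual:
 fixes d :: "'i \<Rightarrow> complex"
 assumes \<rho>: "1 < \<rho>" and q: "q = \<rho> / (\<rho> - 1)" and I: "finite I"
 defines "N \<equiv> (\<Sum>i\<in>I. cmod (d i) powr \<rho>) powr (1/\<rho>)"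
 shows "(\<Sum>i\<in>I. lp_dual \<rho> I d i * d i) = complex_of_real (N^2)"
  and "(\<Sum>i\<in>I. cmod (lp_dual \<rho> I d i) powr q) powr (1/q) = N"
proof -
 have N0: "0 \<le> N" by (simp add: N_def)
 have Np: "(\<Sum>i\<in>I. cmod (d i) powr \<rho>) = N powr \<rho>"
  unfolding N_def using \<rho> by (simp add: powr_powr sum_nonneg)
 have cs: "cnj (sgn z) * z = complex_of_real (cmod z)" for z
 proof (cases "z = 0")
  case False
  then have r: "complex_of_real (cmod z) \<noteq> 0" by simp
  have "cnj (sgn z) = cnj z / complex_of_real (cmod z)" unfolding sgn_eq complex_cnj_divide complex_cnj_complex_of_real ..
  then have "cnj (sgn z) * z = (z * cnj z) / complex_of_real (cmod z)" by (simp only: times_divide_eq_left) (simp only: mult.commute)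
  also have "z * cnj z = complex_of_real (cmod z) * complex_of_real (cmod z)"
   unfolding complex_norm_square[symmetric] power2_eq_square of_real_mult ..
  finally show ?thesis using r by simp
 qed simp
 have pw: "x powr (\<rho> - 1) * x = x powr \<rho>" if "x \<ge> 0" for x :: real
  using that \<rho> by (cases "x = 0") (auto simp: powr_mult_base[symmetric] powr_diff)
 have "lp_dual \<rho> I d i * d i = complex_of_real (cmod (d i) powr \<rho> * N powr (2 - \<rho>))" for i
 proof -
  have "lp_dual \<rho> I d i * d i = complex_of_real (cmod (d i) powr (\<rho> - 1) * N powr (2 - \<rho>)) * complex_of_real (cmod (d i))"
   by (simp only: lp_dual_def N_def mult.assoc cs)
  also have "\<dots> = complex_of_real ((cmod (d i) powr (\<rho> - 1) * cmod (d i)) * N powr (2 - \<rho>))" by simp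
  finally show ?thesis by (simp only: pw norm_ge_zero)
 qed
 then have "(\<Sum>i\<in>I. lp_dual \<rho> I d i * d i) = complex_of_real (N powr \<rho> * N powr (2 - \<rho>))"
  by (simp add: sum_distrib_right[symmetric] Np of_real_sum[symmetric] del: of_real_mult)
 also have "N powr \<rho> * N powr (2 - \<rho>) = N^2"
 proof -
  have "N powr \<rho> * N powr (2 - \<rho>) = N powr (\<rho> + (2 - \<rho>))" by (rule powr_add[symmetric])
  also have "\<rho> + (2 - \<rho>) = 2" by simp
  finally show ?thesis using N0 by simp
 qed
 finally show "(\<Sum>i\<in>I. lp_dual \<rho> I d i * d i) = complex_of_real (N^2)" .
 have q1: "q > 1" "(\<rho> - 1) * q = \<rho>" using \<rho> conjugate_exponent[OF \<rho>] by (auto simp: q)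
 have "cmod (lp_dual \<rho> I d i) powr q = cmod (d i) powr \<rho> * N powr ((2 - \<rho>) * q)" for i
 proof (cases "d i = 0")
  case True
  then show ?thesis by (simp add: lp_dual_def)
 next
  case False
  then have "cmod (lp_dual \<rho> I d i) = cmod (d i) powr (\<rho> - 1) * N powr (2 - \<rho>)"
   by (simp add: lp_dual_def norm_mult N_def norm_sgn)
  then show ?thesis using q1 by (simp add: powr_mult powr_powr)
 qed
 then have "(\<Sum>i\<in>I. cmod (lp_dual \<rho> I d i) powr q) = N powr \<rho> * N powr ((2 - \<rho>) * q)"
  by (simp add: sum_distrib_right[symmetric] Np)
 also have "\<dots> = N powr q"
 proof -
  have "\<rho> + (2 - \<rho>) * q = q" using q1(2) by (simp add: algebra_simps)
  then show ?thesis by (simp add: powr_add[symmetric])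
 qed
 finally show "(\<Sum>i\<in>I. cmod (lp_dual \<rho> I d i) powr q) powr (1/q) = N"
  using N0 q1 by (simp add: powr_powr)
qed

section \<open>Finite sets of scales and the suprema over partitions\<close>

lemma vnorm_image:
 assumes e: "\<And>j. j < m \<Longrightarrow> e j < e (Suc j)"
 shows "vnorm \<rho> (e ` {0..m}) a = (\<Sum>j\<in>{1..m}. cmod (a (e j) - a (e (j - 1))) powr \<rho>) powr (1 / \<rho>)"
  and "steps (e ` {0..m}) = e ` {1..m}"
  and "\<And>j. j \<in> {1..m} \<Longrightarrow> pre (e ` {0..m}) (e j) = e (j - 1)"
  and "inj_on e {0..m}"
proof -
 have mono: "e i < e j" if "i < j" "j \<le> m" for i j
  using that
 proof (induction j)
  case (Suc j)
  then show ?case using e[of j] by (cases "i = j") auto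
 qed simp
 then have lt: "e i < e j \<longleftrightarrow> i < j" if "i \<le> m" "j \<le> m" for i j
  using that by (metis less_asym linorder_neqE_nat less_irrefl)
 show inj: "inj_on e {0..m}" using lt by (auto simp: inj_on_def) (metis less_irrefl linorder_neqE_nat)
 show st: "steps (e ` {0..m}) = e ` {1..m}"
 proof (intro set_eqI iffI)
  fix x assume "x \<in> steps (e ` {0..m})"
  then obtain i j where "x = e j" "j \<le> m" "i \<le> m" "e i < e j" by (auto simp: steps_iff)
  then show "x \<in> e ` {1..m}" using lt[of i j] by auto
 next
  fix x assume "x \<in> e ` {1..m}"
  then obtain j where j: "x = e j" "1 \<le> j" "j \<le> m" by auto
  then show "x \<in> steps (e ` {0..m})" using lt[of 0 j] by (auto simp: steps_iff intro!: bexI[of _ 0])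
 qed
 show pr: "pre (e ` {0..m}) (e j) = e (j - 1)" if j: "j \<in> {1..m}" for j
  unfolding pre_def
 proof (rule Max_eqI)
  show "y \<le> e (j - 1)" if "y \<in> {u \<in> e ` {0..m}. u < e j}" for y
  proof -
   from that obtain i where i: "y = e i" "i \<le> m" "e i < e j" by auto
   then have "i < j" using lt j by auto
   then show ?thesis using i j mono[of i "j - 1"] by (cases "i = j - 1") (auto simp: less_imp_le)
  qed
  show "e (j - 1) \<in> {u \<in> e ` {0..m}. u < e j}" using j lt[of "j - 1" j] by auto
 qed simp
 have inj1: "inj_on e {1..m}" using inj by (rule inj_on_subset) auto
 show "vnorm \<rho> (e ` {0..m}) a = (\<Sum>j\<in>{1..m}. cmod (a (e j) - a (e (j - 1))) powr \<rho>) powr (1 / \<rho>)"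
  unfolding vnorm_def st sum.reindex[OF inj1] o_def incr_def using pr by simp
qed

lemma partition_of_finite_set:
 fixes S :: "real set"
 assumes "finite S" "S \<noteq> {}" "S \<subseteq> {0<..}"
 obtains m e where "(m, e) \<in> partitions" "S = e ` {0..m}"
proof -
 let ?l = "sorted_list_of_set S"
 define m where "m = card S - 1"
 have c: "card S = Suc m" using assms by (simp add: m_def card_gt_0_iff)
 have len: "length ?l = Suc m" using c by simp
 have "?l ! j < ?l ! Suc j" if "j < m" for j
  using strict_sorted_list_of_set[of S] that len by (simp add: sorted_wrt_iff_nth_less)
 moreover have "S = (!) ?l ` {0..m}"
 proof -
  have "S = set ?l" using assms by simp
  also have "\<dots> = (!) ?l ` {0..m}" unfolding set_conv_nth len by (auto simp: less_Suc_eq_le)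
  finally show ?thesis .
 qed
 moreover from this have "0 < ?l ! 0" using assms by auto
 ultimately show ?thesis using that[of m "(!) ?l"] by (auto simp: partitions_def)
qed

lemma vnorm_le_var_tilde:
 assumes "finite S" "S \<noteq> {}" "S \<subseteq> {0<..}"
 shows "ennreal (vnorm \<rho> S a) \<le> var_tilde \<rho> a"
proof -
 obtain m e where me: "(m, e) \<in> partitions" "S = e ` {0..m}" using partition_of_finite_set[OF assms] .
 have "vnorm \<rho> S a = (\<Sum>j\<in>{1..m}. cmod (a (e j) - a (e (j - 1))) powr \<rho>) powr (1 / \<rho>)"
  unfolding me(2) by (rule vnorm_image(1)) (use me(1) in \<open>auto simp: partitions_def\<close>)
 then show ?thesis unfolding var_tilde_def using me(1)
  by (intro SUP_upper2[of "(m, e)"]) auto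
qed

lemma wnorm_le_var2_tilde:
 assumes "finite S" "S \<noteq> {}" "S \<subseteq> {0<..}" "finite S'" "S' \<noteq> {}" "S' \<subseteq> {0<..}"
 shows "ennreal (wnorm \<rho> S S' b) \<le> var2_tilde \<rho> b"
proof -
 obtain m e where me: "(m, e) \<in> partitions" "S = e ` {0..m}" using partition_of_finite_set[OF assms(1-3)] .
 obtain n h where nh: "(n, h) \<in> partitions" "S' = h ` {0..n}" using partition_of_finite_set[OF assms(4-6)] .
 have e: "\<And>j. j < m \<Longrightarrow> e j < e (Suc j)" and h: "\<And>j. j < n \<Longrightarrow> h j < h (Suc j)"
  using me nh by (auto simp: partitions_def)
 have i1: "inj_on e {1..m}" "inj_on h {1..n}"
  by (rule inj_on_subset[OF vnorm_image(4)[of m e, OF e]], assumption, simp)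
    (rule inj_on_subset[OF vnorm_image(4)[of n h, OF h]], assumption, simp)
 have "wnorm \<rho> S S' b = (\<Sum>j\<in>{1..m}. \<Sum>k\<in>{1..n}.
    cmod (b (e j) (h k) - b (e j) (h (k - 1)) - b (e (j - 1)) (h k) + b (e (j - 1)) (h (k - 1))) powr \<rho>)
    powr (1 / \<rho>)"
 proof -
  have st: "steps S = e ` {1..m}" "steps S' = h ` {1..n}"
   unfolding me(2) nh(2) by (rule vnorm_image(2)[of m e, OF e], assumption) (rule vnorm_image(2)[of n h, OF h], assumption)
  have pr: "\<And>j. j \<in> {1..m} \<Longrightarrow> pre S (e j) = e (j - 1)" "\<And>j. j \<in> {1..n} \<Longrightarrow> pre S' (h j) = h (j - 1)"
   unfolding me(2) nh(2) by (rule vnorm_image(3)[of m e, OF e], assumption+) (rule vnorm_image(3)[of n h, OF h], assumption+)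
  have "(\<Sum>s\<in>steps S. \<Sum>t\<in>steps S'. cmod (incr (\<lambda>\<epsilon>. incr (b \<epsilon>) S' t) S s) powr \<rho>)
   = (\<Sum>j\<in>{1..m}. \<Sum>k\<in>{1..n}. cmod (b (e j) (h k) - b (e j) (h (k - 1)) - b (e (j - 1)) (h k) + b (e (j - 1)) (h (k - 1))) powr \<rho>)"
   unfolding st sum.reindex[OF i1(1)] sum.reindex[OF i1(2)] o_def incr_def
   by (intro sum.cong refl arg_cong[where f="\<lambda>x. cmod x powr \<rho>"]) (simp add: pr)
  then show ?thesis by (simp only: wnorm_def)
 qed
 then show ?thesis unfolding var2_tilde_def using me(1) nh(1)
  by (intro SUP_upper2[of "((m, e), (n, h))"]) auto
qed

section \<open>The bilinear estimate\<close>

text \<open>This is the only property of a cap that the analysis uses: the sum of two independent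
  points has density at most \<open>A\<close>. The full surface measure fails it near the
  origin.\<close>

locale restriction_measure = finite_measure \<tau> for \<tau> :: "R3 measure" +
 fixes A :: real
 assumes sets_eq [measurable_cong]: "sets \<tau> = sets borel"
  and A_nonneg: "0 \<le> A"
  and sum_bound: "F \<in> borel_measurable borel \<Longrightarrow>
   (\<integral>\<^sup>+x. \<integral>\<^sup>+y. F (x + y) \<partial>\<tau> \<partial>\<tau>) \<le> ennreal A * (LI+ x. F x)"
begin

abbreviation nn_tau :: "(R3 \<Rightarrow> ennreal) \<Rightarrow> ennreal" (binder "TI+ " 10) where
 "nn_tau f \<equiv> nn_integral \<tau> f"

abbreviation tau_int :: "(R3 \<Rightarrow> 'b::{banach, second_countable_topology}) \<Rightarrow> 'b" (binder "TI " 10) where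
 "tau_int f \<equiv> integral\<^sup>L \<tau> f"

lemma space_eq [simp]: "space \<tau> = UNIV"
 using sets_eq_imp_space_eq[OF sets_eq] by simp

lemma Fubini_tau:
 "case_prod f \<in> borel_measurable (borel \<Otimes>\<^sub>M borel) \<Longrightarrow> (TI+ y. TI+ x. f x y) = (TI+ x. TI+ y. f x y)"
 by (rule pair_sigma_finite.Fubini')
   (auto simp: pair_sigma_finite_def sigma_finite_measure_axioms cong: measurable_cong_sets sets_pair_measure_cong)

lemma Fubini_tau_lborel:
 fixes f :: "R3 \<Rightarrow> R3 \<Rightarrow> ennreal"
 shows "case_prod f \<in> borel_measurable (borel \<Otimes>\<^sub>M borel) \<Longrightarrow> (LI+ y. TI+ x. f x y) = (TI+ x. LI+ y. f x y)"
 by (rule pair_sigma_finite.Fubini')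
   (auto simp: pair_sigma_finite_def sigma_finite_measure_axioms lborel.sigma_finite_measure_axioms cong: measurable_cong_sets sets_pair_measure_cong)

lemma nn_integral_square_expand:
 fixes f :: "R3 \<Rightarrow> R3 \<Rightarrow> ennreal"
 assumes [measurable]: "case_prod f \<in> borel_measurable (borel \<Otimes>\<^sub>M borel)"
 shows "(TI+ x. TI+ y. f x y)^2 = (TI+ x. TI+ y. TI+ x'. TI+ y'. f x y * f x' y')"
proof -
 let ?I = "TI+ x. TI+ y. f x y"
 have "(TI+ x'. TI+ y'. f x y * f x' y') = f x y * ?I" for x y
 proof -
  have "(TI+ x'. TI+ y'. f x y * f x' y') = (TI+ x'. f x y * (TI+ y'. f x' y'))"
   by (rule nn_integral_cong, rule nn_integral_cmult) measurable
  also have "\<dots> = f x y * ?I" by (rule nn_integral_cmult) measurable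
  finally show ?thesis .
 qed
 then have "(TI+ x. TI+ y. TI+ x'. TI+ y'. f x y * f x' y') = (TI+ x. TI+ y. f x y * ?I)" by simp
 also have "\<dots> = (TI+ x. (TI+ y. f x y) * ?I)"
  by (rule nn_integral_cong, rule nn_integral_multc) measurable
 also have "\<dots> = ?I * ?I" by (rule nn_integral_multc) measurable
 finally show ?thesis by (simp add: power2_eq_square)
qed

text \<open>For fixed z the weight k(x + y - z) defines a measure on pairs whose total mass is at
  most \<open>A\<close> by \<open>sum_bound\<close>. Cauchy-Schwarz in this measure gives one factor
  \<open>A\<close>, and integration over z removes the mollifier.\<close>

lemma smoothed_sum_square_le:
 fixes g k :: "R3 \<Rightarrow> ennreal"
 assumes [measurable]: "g \<in> borel_measurable borel" "k \<in> borel_measurable borel" and k: "(LI+ x. k x) = 1"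
 shows "(LI+ z. (TI+ x. TI+ y. g x * g y * k (x + y - z))^2) \<le> ennreal A * (TI+ x. (g x)^2)^2"
proof -
 let ?Q = "\<tau> \<Otimes>\<^sub>M \<tau>"
 interpret Q: pair_sigma_finite \<tau> \<tau> by (simp add: pair_sigma_finite_def sigma_finite_measure_axioms)
 have km: "(LI+ z. k (v - z)) = 1" "(LI+ w. k (w - v)) = 1" for v
  using nn_integral_lborel_reflect[of k v] nn_integral_lborel_translate[of k "-v"] k by simp_all
 have pt: "(TI+ x. TI+ y. g x * g y * k (x + y - z))^2 \<le> ennreal A * (TI+ x. TI+ y. (g x)^2 * (g y)^2 * k (x + y - z))" for z
 proof -
  let ?k = "\<lambda>p. k (fst p + snd p - z)" let ?G = "\<lambda>p. g (fst p) * g (snd p)"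
  let ?M = "density ?Q ?k"
  have e: "(TI+ x. TI+ y. f (x, y) * k (x + y - z)) = (\<integral>\<^sup>+p. f p \<partial>?M)"
   if [measurable]: "f \<in> borel_measurable (borel \<Otimes>\<^sub>M borel)" for f
   by (subst nn_integral_density, measurable, subst nn_integral_fst[symmetric], measurable) (simp add: mult.commute)
  have 1: "(\<integral>\<^sup>+p. ?G p * 1 \<partial>?M)^2 \<le> (\<integral>\<^sup>+p. (?G p)^2 \<partial>?M) * (\<integral>\<^sup>+p. 1^2 \<partial>?M)"
   by (rule Cauchy_Schwarz_nn_integral) measurable
  have "(\<integral>\<^sup>+p. 1^2 \<partial>?M) = (TI+ x. TI+ y. k (x + y - z))" using e[of "\<lambda>_. 1"] by simp
  also have "\<dots> \<le> ennreal A * (LI+ w. k (w - z))" by (rule sum_bound) measurable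
  finally have 2: "(\<integral>\<^sup>+p. 1^2 \<partial>?M) \<le> ennreal A" unfolding km by simp
  have "(\<integral>\<^sup>+p. ?G p * 1 \<partial>?M)^2 \<le> (\<integral>\<^sup>+p. (?G p)^2 \<partial>?M) * ennreal A"
   by (rule order_trans[OF 1 mult_left_mono[OF 2]]) simp
  moreover have "(TI+ x. TI+ y. g x * g y * k (x + y - z)) = (\<integral>\<^sup>+p. ?G p * 1 \<partial>?M)"
   using e[of ?G] by simp
  moreover have "(TI+ x. TI+ y. (g x)^2 * (g y)^2 * k (x + y - z)) = (\<integral>\<^sup>+p. (?G p)^2 \<partial>?M)"
   using e[of "\<lambda>p. (?G p)^2"] by (simp add: power_mult_distrib)
  ultimately show ?thesis by (simp only: mult.commute)
 qed
 have "(LI+ z. (TI+ x. TI+ y. g x * g y * k (x + y - z))^2)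
   \<le> (LI+ z. ennreal A * (TI+ x. TI+ y. (g x)^2 * (g y)^2 * k (x + y - z)))"
  by (rule nn_integral_mono) (rule pt)
 also have "\<dots> = ennreal A * (LI+ z. TI+ x. TI+ y. (g x)^2 * (g y)^2 * k (x + y - z))"
  by (rule nn_integral_cmult) measurable
 also have "(LI+ z. TI+ x. TI+ y. (g x)^2 * (g y)^2 * k (x + y - z))
   = (TI+ x. LI+ z. TI+ y. (g x)^2 * (g y)^2 * k (x + y - z))"
  by (rule Fubini_tau_lborel) measurable
 also have "\<dots> = (TI+ x. TI+ y. LI+ z. (g x)^2 * (g y)^2 * k (x + y - z))"
  by (rule nn_integral_cong, rule Fubini_tau_lborel) measurable
 also have "\<dots> = (TI+ x. TI+ y. (g x)^2 * (g y)^2)"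
  by (rule nn_integral_cong, rule nn_integral_cong) (simp add: nn_integral_cmult km)
 also have "\<dots> = (TI+ x. (g x)^2 * (TI+ y. (g y)^2))"
  by (rule nn_integral_cong, rule nn_integral_cmult) measurable
 also have "\<dots> = (TI+ x. (g x)^2)^2"
  by (subst nn_integral_multc) (auto simp: power2_eq_square)
 finally show ?thesis .
qed

text \<open>The differences and the sums of two independent points have smoothed densities of equal \<open>L\<^sup>2\<close> norm,
 because \<open>x - y = x' - y'\<close> and \<open>x + y' = x' + y\<close> are the same equation.\<close>
lemma smoothed_difference_square_eq:
 fixes g k :: "R3 \<Rightarrow> ennreal"
 assumes [measurable]: "g \<in> borel_measurable borel" "k \<in> borel_measurable borel"
 shows "(LI+ z. (TI+ x. TI+ y. g x * g y * k (x - y - z))^2)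
    = (LI+ z. (TI+ x. TI+ y. g x * g y * k (x + y - z))^2)"
proof -
 \<comment> \<open>The correlation of two mollifiers centred at w and w'. It depends on w - w' only,
   which is what allows points to be moved from one argument to the other.\<close>
 define J where "J w w' = (LI+ z. k (w - z) * k (w' - z))" for w w'
 have [measurable]: "case_prod J \<in> borel_measurable (borel \<Otimes>\<^sub>M borel)" unfolding J_def by measurable
 have Jshift: "J (w + c) (w' + c) = J w w'" for w w' c
 proof -
  have "J (w + c) (w' + c) = (LI+ z. k (w - (- c + z)) * k (w' - (- c + z)))"
   unfolding J_def by (simp add: algebra_simps)
  also have "\<dots> = J w w'" unfolding J_def by (rule nn_integral_lborel_translate) measurable
  finally show ?thesis .
 qed
 have ex: "(LI+ z. (TI+ x. TI+ y. g x * g y * k (d x y - z))^2)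
   = (TI+ x. TI+ y. TI+ x'. TI+ y'. g x * g y * (g x' * g y') * J (d x y) (d x' y'))"
  if [measurable]: "case_prod d \<in> borel_measurable (borel \<Otimes>\<^sub>M borel)" for d :: "R3 \<Rightarrow> R3 \<Rightarrow> R3"
 proof -
  let ?h = "\<lambda>z x y x' y'. (g x * g y * k (d x y - z)) * (g x' * g y' * k (d x' y' - z))"
  have "(LI+ z. (TI+ x. TI+ y. g x * g y * k (d x y - z))^2)
   = (LI+ z. TI+ x. TI+ y. TI+ x'. TI+ y'. ?h z x y x' y')"
   by (rule nn_integral_cong, rule nn_integral_square_expand) measurable
  also have "\<dots> = (TI+ x. LI+ z. TI+ y. TI+ x'. TI+ y'. ?h z x y x' y')"
   by (rule Fubini_tau_lborel) measurable
  also have "\<dots> = (TI+ x. TI+ y. LI+ z. TI+ x'. TI+ y'. ?h z x y x' y')"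
   by (rule nn_integral_cong, rule Fubini_tau_lborel) measurable
  also have "\<dots> = (TI+ x. TI+ y. TI+ x'. LI+ z. TI+ y'. ?h z x y x' y')"
   by (rule nn_integral_cong, rule nn_integral_cong, rule Fubini_tau_lborel) measurable
  also have "\<dots> = (TI+ x. TI+ y. TI+ x'. TI+ y'. LI+ z. ?h z x y x' y')"
   by (rule nn_integral_cong, rule nn_integral_cong, rule nn_integral_cong, rule Fubini_tau_lborel) measurable
  also have "\<dots> = (TI+ x. TI+ y. TI+ x'. TI+ y'. g x * g y * (g x' * g y') * J (d x y) (d x' y'))"
  proof (rule nn_integral_cong, rule nn_integral_cong, rule nn_integral_cong, rule nn_integral_cong)
   fix x y x' y'
   have "(LI+ z. ?h z x y x' y') = (LI+ z. g x * g y * (g x' * g y') * (k (d x y - z) * k (d x' y' - z)))"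
    by (rule nn_integral_cong) (simp only: mult_ac)
   also have "\<dots> = g x * g y * (g x' * g y') * J (d x y) (d x' y')"
    unfolding J_def by (rule nn_integral_cmult) measurable
   finally show "(LI+ z. ?h z x y x' y') = g x * g y * (g x' * g y') * J (d x y) (d x' y')" .
  qed
  finally show ?thesis .
 qed
 have "(LI+ z. (TI+ x. TI+ y. g x * g y * k (x - y - z))^2)
   = (TI+ x. TI+ y. TI+ x'. TI+ y'. g x * g y * (g x' * g y') * J (x - y) (x' - y'))"
  by (rule ex) measurable
 \<comment> \<open>Adding y + y' to both arguments turns x - y and x' - y' into x + y' and x' + y.
   The weight is a product over all four points, so exchanging the roles of y and y' leaves it
   unchanged.\<close>
 also have "\<dots> = (TI+ x. TI+ y'. TI+ x'. TI+ y. g x * g y' * (g x' * g y) * J (x + y') (x' + y))"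
 proof (rule nn_integral_cong)
  fix x
  have J: "J (x - y) (x' - y') = J (x + y') (x' + y)" for y x' y'
   using Jshift[of "x - y" "y + y'" "x' - y'"] by (simp add: algebra_simps)
  have "(TI+ y. TI+ x'. TI+ y'. g x * g y * (g x' * g y') * J (x - y) (x' - y'))
   = (TI+ y. TI+ x'. TI+ y'. g x * g y' * (g x' * g y) * J (x + y') (x' + y))"
   unfolding J by (simp only: mult_ac)
  also have "\<dots> = (TI+ x'. TI+ y. TI+ y'. g x * g y' * (g x' * g y) * J (x + y') (x' + y))"
   by (rule Fubini_tau) measurable
  also have "\<dots> = (TI+ x'. TI+ y'. TI+ y. g x * g y' * (g x' * g y) * J (x + y') (x' + y))"
   by (rule nn_integral_cong, rule Fubini_tau) measurable
  also have "\<dots> = (TI+ y'. TI+ x'. TI+ y. g x * g y' * (g x' * g y) * J (x + y') (x' + y))"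
   by (rule Fubini_tau) measurable
  finally show "(TI+ y. TI+ x'. TI+ y'. g x * g y * (g x' * g y') * J (x - y) (x' - y'))
   = (TI+ y'. TI+ x'. TI+ y. g x * g y' * (g x' * g y) * J (x + y') (x' + y))" .
 qed
 also have "\<dots> = (LI+ z. (TI+ x. TI+ y. g x * g y * k (x + y - z))^2)"
  by (rule ex[symmetric]) measurable
 finally show ?thesis .
qed

text \<open>The form is the integral of \<Phi> against the mollified law of the difference of two
  points. Cauchy-Schwarz in z leaves the L^2 norm of that law, which is exchanged for the law of the
  sum.\<close>

lemma smoothed_bilinear_le:
 fixes g k \<Phi> :: "R3 \<Rightarrow> ennreal"
 assumes [measurable]: "g \<in> borel_measurable borel" "k \<in> borel_measurable borel" "\<Phi> \<in> borel_measurable borel"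
  and k: "(LI+ x. k x) = 1"
 shows "(TI+ x. TI+ y. g x * g y * (LI+ z. k (x - y - z) * \<Phi> z))^2
   \<le> ennreal A * (TI+ x. (g x)^2)^2 * (LI+ z. (\<Phi> z)^2)"
proof -
 let ?R = "\<lambda>z. TI+ x. TI+ y. g x * g y * k (x - y - z)"
 have "(TI+ x. TI+ y. g x * g y * (LI+ z. k (x - y - z) * \<Phi> z))
   = (TI+ x. TI+ y. LI+ z. g x * g y * (k (x - y - z) * \<Phi> z))"
  by (rule nn_integral_cong, rule nn_integral_cong, rule nn_integral_cmult[symmetric]) measurable
 also have "\<dots> = (TI+ x. LI+ z. TI+ y. g x * g y * (k (x - y - z) * \<Phi> z))"
  by (rule nn_integral_cong, rule Fubini_tau_lborel[symmetric]) measurable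
 also have "\<dots> = (LI+ z. TI+ x. TI+ y. g x * g y * (k (x - y - z) * \<Phi> z))"
  by (rule Fubini_tau_lborel[symmetric]) measurable
 also have "\<dots> = (LI+ z. ?R z * \<Phi> z)"
 proof (rule nn_integral_cong)
  fix z
  have "(TI+ x. TI+ y. g x * g y * (k (x - y - z) * \<Phi> z)) = (TI+ x. TI+ y. g x * g y * k (x - y - z) * \<Phi> z)"
   by (simp only: mult.assoc)
  also have "\<dots> = (TI+ x. (TI+ y. g x * g y * k (x - y - z)) * \<Phi> z)"
   by (rule nn_integral_cong, rule nn_integral_multc) measurable
  also have "\<dots> = ?R z * \<Phi> z" by (rule nn_integral_multc) measurable
  finally show "(TI+ x. TI+ y. g x * g y * (k (x - y - z) * \<Phi> z)) = ?R z * \<Phi> z" .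
 qed
 finally have e: "(TI+ x. TI+ y. g x * g y * (LI+ z. k (x - y - z) * \<Phi> z)) = (LI+ z. ?R z * \<Phi> z)" .
 have 1: "(LI+ z. ?R z * \<Phi> z)^2 \<le> (LI+ z. (?R z)^2) * (LI+ z. (\<Phi> z)^2)"
  by (rule Cauchy_Schwarz_nn_integral) measurable
 have 2: "(LI+ z. (?R z)^2) \<le> ennreal A * (TI+ x. (g x)^2)^2"
  unfolding smoothed_difference_square_eq[OF assms(1,2)] by (rule smoothed_sum_square_le) (use k in auto)
 show ?thesis unfolding e by (rule order_trans[OF 1 mult_right_mono[OF 2]]) simp
qed

text \<open>Removes the mollifier with normalised indicators of shrinking balls: the kernel is
  continuous, and Fatou carries the uniform bound to the limit.\<close>

lemma bilinear_le:
 fixes g :: "R3 \<Rightarrow> ennreal" and \<Phi> :: "R3 \<Rightarrow> real"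
 assumes [measurable]: "g \<in> borel_measurable borel" and \<Phi>: "continuous_on UNIV \<Phi>" "\<And>z. 0 \<le> \<Phi> z"
 shows "(TI+ x. TI+ y. g x * g y * ennreal (\<Phi> (x - y)))^2
   \<le> ennreal A * (TI+ x. (g x)^2)^2 * (LI+ z. (ennreal (\<Phi> z))^2)"
  (is "_ \<le> ?B")
proof -
 have [measurable]: "\<Phi> \<in> borel_measurable borel" using \<Phi>(1) by (rule borel_measurable_continuous_onI)
 define r where "r n = 1 / real (Suc n)" for n
 define k :: "nat \<Rightarrow> R3 \<Rightarrow> ennreal" where "k n x = ennreal (1 / measure lborel (ball (0::R3) (r n))) * indicator (ball 0 (r n)) x" for n x
 have r0: "0 < r n" for n by (simp add: r_def)
 have [measurable]: "k n \<in> borel_measurable borel" for n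
  unfolding k_def by (intro borel_measurable_times_ennreal borel_measurable_indicator) simp_all
 have k1: "(LI+ x. k n x) = 1" for n
 proof -
  have pos: "measure lborel (ball (0::R3) (r n)) > 0" using r0 by (rule content_ball_pos)
  have "(LI+ x. k n x) = ennreal (1 / measure lborel (ball (0::R3) (r n))) * emeasure lborel (ball (0::R3) (r n))"
   unfolding k_def by (rule nn_integral_cmult_indicator) simp
  also have "emeasure lborel (ball (0::R3) (r n)) = ennreal (measure lborel (ball (0::R3) (r n)))"
   using emeasure_lborel_ball_finite[of "0::R3" "r n"] by (intro emeasure_eq_ennreal_measure) auto
  also have "ennreal (1 / measure lborel (ball (0::R3) (r n))) * \<dots> = 1"
   using pos by (subst ennreal_mult[symmetric]) auto
  finally show ?thesis .
 qed
 define \<Psi> where "\<Psi> n v = (LI+ z. k n (v - z) * ennreal (\<Phi> z))" for n v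
 have [measurable]: "\<Psi> n \<in> borel_measurable borel" for n unfolding \<Psi>_def by measurable
 \<comment> \<open>Averages over small balls eventually exceed every number below the value of
   \<Phi>; Fatou asks for no more than this lower semicontinuity.\<close>
 have lower: "ennreal (\<Phi> v) \<le> liminf (\<lambda>n. \<Psi> n v)" for v
 proof -
  have "c \<le> liminf (\<lambda>n. \<Psi> n v)" if c: "c < ennreal (\<Phi> v)" for c
  proof -
   obtain c' where c': "c = ennreal c'" "0 \<le> c'" "c' < \<Phi> v"
    using c by (cases c) (auto simp: ennreal_less_iff)
   have "\<forall>\<^sub>F x in nhds v. c' < \<Phi> x"
    using \<Phi>(1) c'(3) by (metis continuous_on_eq_continuous_at isCont_def tendsto_at_iff_tendsto_nhds open_UNIV UNIV_I order_tendstoD(1))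
   then obtain d where d: "d > 0" "\<And>x. dist x v < d \<Longrightarrow> c' < \<Phi> x" unfolding eventually_nhds_metric by auto
   have "\<forall>\<^sub>F n in sequentially. r n < d"
    using d(1) unfolding r_def by (metis (no_types, lifting) order_tendstoD(2) LIMSEQ_inverse_real_of_nat inverse_eq_divide tendsto_cong eventually_sequentially)
   then have "\<forall>\<^sub>F n in sequentially. c \<le> \<Psi> n v"
   proof eventually_elim
    case (elim n)
    have "c = c * (LI+ z. k n (v - z))"
     using nn_integral_lborel_reflect[of "k n" v] k1 by simp
    also have "\<dots> = (LI+ z. c * k n (v - z))" by (rule nn_integral_cmult[symmetric]) measurable
    also have "\<dots> \<le> \<Psi> n v" unfolding \<Psi>_def
    proof (rule nn_integral_mono)
     fix z
     show "c * k n (v - z) \<le> k n (v - z) * ennreal (\<Phi> z)"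
     proof (cases "v - z \<in> ball 0 (r n)")
      case True
      then have "c' < \<Phi> z" using elim by (intro d(2)) (auto simp: dist_norm norm_minus_commute)
      then show ?thesis unfolding c' by (subst mult.commute) (intro mult_left_mono ennreal_leI, auto)
     qed (simp add: k_def)
    qed
    finally show ?case .
   qed
   then show ?thesis by (rule Liminf_bounded)
  qed
  then show ?thesis by (rule dense_le)
 qed
 define S where "S = (TI+ x. TI+ y. g x * g y * ennreal (\<Phi> (x - y)))"
 have "S \<le> (TI+ x. liminf (\<lambda>n. TI+ y. g x * g y * \<Psi> n (x - y)))"
  unfolding S_def
 proof (rule nn_integral_mono)
  fix x
  have "(TI+ y. g x * g y * ennreal (\<Phi> (x - y))) \<le> (TI+ y. liminf (\<lambda>n. g x * g y * \<Psi> n (x - y)))"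
  proof (rule nn_integral_mono)
   fix y
   have "g x * g y * ennreal (\<Phi> (x - y)) \<le> g x * g y * liminf (\<lambda>n. \<Psi> n (x - y))"
    by (rule mult_left_mono[OF lower]) simp
   also have "\<dots> \<le> liminf (\<lambda>n. g x * g y * \<Psi> n (x - y))"
   proof (rule le_Liminf_iff[THEN iffD2], intro allI impI)
    fix c assume "c < g x * g y * liminf (\<lambda>n. \<Psi> n (x - y))"
    then have "c < (SUP m. g x * g y * (INF n\<in>{m..}. \<Psi> n (x - y)))"
     by (simp add: liminf_SUP_INF SUP_mult_left_ennreal)
    then obtain m where m: "c < g x * g y * (INF n\<in>{m..}. \<Psi> n (x - y))" by (auto simp: less_SUP_iff)
    show "\<forall>\<^sub>F n in sequentially. c < g x * g y * \<Psi> n (x - y)"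
     using eventually_ge_at_top[of m]
    proof eventually_elim
     case (elim n)
     show ?case by (rule less_le_trans[OF m]) (intro mult_left_mono INF_lower, use elim in auto)
    qed
   qed
   finally show "g x * g y * ennreal (\<Phi> (x - y)) \<le> liminf (\<lambda>n. g x * g y * \<Psi> n (x - y))" .
  qed
  also have "\<dots> \<le> liminf (\<lambda>n. TI+ y. g x * g y * \<Psi> n (x - y))" by (rule nn_integral_liminf) measurable
  finally show "(TI+ y. g x * g y * ennreal (\<Phi> (x - y))) \<le> liminf (\<lambda>n. TI+ y. g x * g y * \<Psi> n (x - y))" .
 qed
 also have "\<dots> \<le> liminf (\<lambda>n. TI+ x. TI+ y. g x * g y * \<Psi> n (x - y))" by (rule nn_integral_liminf) measurable
 finally have S: "S \<le> liminf (\<lambda>n. TI+ x. TI+ y. g x * g y * \<Psi> n (x - y))" .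
 have bd: "(TI+ x. TI+ y. g x * g y * \<Psi> n (x - y))^2 \<le> ?B" for n
  unfolding \<Psi>_def by (rule smoothed_bilinear_le) (use k1 in auto)
 show ?thesis
 proof (rule ccontr)
  assume "\<not> ?thesis"
  then have lt: "?B < S^2" by (simp add: S_def)
  \<comment> \<open>A number strictly below the liminf lies below some approximant and inherits its
    bound. Squares are compared through such numbers, which also covers infinite values.\<close>
  have "c^2 \<le> ?B" if "c < S" for c
  proof -
   have "c < liminf (\<lambda>n. TI+ x. TI+ y. g x * g y * \<Psi> n (x - y))" using that S by simp
   then have "\<forall>\<^sub>F n in sequentially. c < (TI+ x. TI+ y. g x * g y * \<Psi> n (x - y))"
    by (rule less_LiminfD)
   then obtain n where "c < (TI+ x. TI+ y. g x * g y * \<Psi> n (x - y))" by (auto dest: eventually_happens)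
   then show ?thesis using bd[of n] by (meson less_imp_le order_trans power_mono zero_le)
  qed
  then have "(SUP c\<in>{..<S}. c^2) \<le> ?B" by (intro SUP_least) auto
  moreover have "S^2 \<le> (SUP c\<in>{..<S}. c^2)"
  proof -
   have "S * S = (SUP c\<in>{..<S}. c) * (SUP c\<in>{..<S}. c)"
   proof -
    have "(SUP c\<in>{..<S}. c) = S" by (rule SUP_eqI) (auto intro: dense_le)
    then show ?thesis by simp
   qed
   also have "\<dots> \<le> (SUP c\<in>{..<S}. c^2)"
   proof (cases "S = 0")
    case False
    then have ne: "{..<S} \<noteq> {}" by (auto simp: zero_less_iff_neq_zero[symmetric])
    show ?thesis
     unfolding SUP_mult_left_ennreal SUP_mult_right_ennreal
    proof (intro SUP_least)
     fix c d assume cd: "c \<in> {..<S}" "d \<in> {..<S}"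
     then have "c * d \<le> (max c d)^2" by (simp add: power2_eq_square mult_mono)
     also have "\<dots> \<le> (SUP c\<in>{..<S}. c^2)" using cd by (intro SUP_upper) auto
     finally show "c * d \<le> (SUP c\<in>{..<S}. c^2)" .
    qed
   qed (simp add: bot_ennreal)
   finally show ?thesis by (simp add: power2_eq_square)
  qed
  ultimately show False using lt by simp
 qed
qed

end

section \<open>Fourier transform and Gaussian mollification\<close>

definition fexp :: "R3 \<Rightarrow> R3 \<Rightarrow> complex" where
 "fexp x y = exp (- 2 * complex_of_real pi * \<i> * complex_of_real (x \<bullet> y))"

lemma fexp_cis: "fexp x y = cis (- (2 * pi * (x \<bullet> y)))"
 by (simp add: fexp_def cis_conv_exp mult_ac)

lemma norm_fexp [simp]: "cmod (fexp x y) = 1"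
 by (simp add: fexp_cis)

lemma fexp_add_right: "fexp x (y + z) = fexp x y * fexp x z"
 by (simp add: fexp_cis cis_mult inner_add_right algebra_simps)

lemma fexp_add_left: "fexp (x + x') y = fexp x y * fexp x' y"
 by (simp add: fexp_cis cis_mult inner_add_left algebra_simps)

lemma fexp_minus_right: "fexp x (- y) = cnj (fexp x y)"
 by (simp add: fexp_cis cis_cnj)

lemma fexp_minus_left: "fexp (- x) y = cnj (fexp x y)"
 by (simp add: fexp_cis cis_cnj)

lemma fexp_diff_right: "fexp x (y - z) = fexp x y * cnj (fexp x z)"
 using fexp_add_right[of x y "-z"] by (simp add: fexp_minus_right)

lemma fexp_zero [simp]: "fexp x 0 = 1" "fexp 0 y = 1"
 by (simp_all add: fexp_cis)

lemma fexp_scale: "fexp (c *\<^sub>R x) y = fexp x (c *\<^sub>R y)"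
 by (simp add: fexp_cis)

lemma fexp_commute: "fexp x y = fexp y x"
 by (simp add: fexp_cis inner_commute)

lemma continuous_on_fexp [continuous_intros]:
 "continuous_on S f \<Longrightarrow> continuous_on S g \<Longrightarrow> continuous_on S (\<lambda>x. fexp (f x) (g x))"
 unfolding fexp_def by (intro continuous_intros)

lemma measurable_fexp [measurable (raw)]:
 assumes [measurable]: "f \<in> borel_measurable M" "g \<in> borel_measurable M"
 shows "(\<lambda>x. fexp (f x) (g x)) \<in> borel_measurable M"
proof -
 have "(\<lambda>z. exp (z::complex)) \<in> borel_measurable borel" by (intro borel_measurable_continuous_onI continuous_intros)
 then show ?thesis unfolding fexp_def by measurable
qed

lemma measurable_cnj [measurable (raw)]:
 "f \<in> borel_measurable M \<Longrightarrow> (\<lambda>x. cnj (f x)) \<in> borel_measurable M"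
 by (rule measurable_compose[OF _ borel_measurable_continuous_onI[of cnj]]) (auto intro!: continuous_intros)

lemma fourier_alt: "fourier f y = (LI x. f x * fexp x y)"
 by (simp add: fourier_def fexp_def)

lemma integrable_mult_bounded:
 fixes f g :: "'a \<Rightarrow> complex"
 assumes "integrable M f" "g \<in> borel_measurable M" "\<And>x. cmod (g x) \<le> B"
 shows "integrable M (\<lambda>x. f x * g x)"
proof (rule Bochner_Integration.integrable_bound[where f="\<lambda>x. complex_of_real B * f x"])
 show "AE x in M. norm (f x * g x) \<le> norm (complex_of_real B * f x)"
 proof (rule AE_I2)
  fix x
  have "cmod (f x) * cmod (g x) \<le> cmod (f x) * \<bar>B\<bar>"
   using assms(3)[of x] by (intro mult_left_mono) auto
  then show "norm (f x * g x) \<le> norm (complex_of_real B * f x)" by (simp add: norm_mult mult.commute)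
 qed
qed (use assms in auto)

lemma integrable_mult_fexp:
 "integrable lborel f \<Longrightarrow> integrable lborel (\<lambda>x. f x * fexp x y)"
 by (rule integrable_mult_bounded[where B=1]) auto

lemma integrable_pair_bounded:
 fixes f :: "'a \<Rightarrow> complex" and g :: "'b \<Rightarrow> complex" and k :: "'a \<Rightarrow> 'b \<Rightarrow> complex"
 assumes "sigma_finite_measure M" "sigma_finite_measure N"
  and f: "integrable M f" and g: "integrable N g"
  and k [measurable]: "case_prod k \<in> borel_measurable (M \<Otimes>\<^sub>M N)" and B: "\<And>x y. cmod (k x y) \<le> B"
 shows "integrable (M \<Otimes>\<^sub>M N) (\<lambda>(x, y). f x * g y * k x y)"
proof -
 interpret M: sigma_finite_measure M by fact
 interpret N: sigma_finite_measure N by fact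
 have [measurable]: "f \<in> borel_measurable M" "g \<in> borel_measurable N" using f g by auto
 have "integrable (M \<Otimes>\<^sub>M N) (\<lambda>p. f (fst p) * g (snd p))"
 proof (rule integrableI_bounded)
  have "(\<integral>\<^sup>+p. ennreal (norm (f (fst p) * g (snd p))) \<partial>(M \<Otimes>\<^sub>M N)) = (\<integral>\<^sup>+x. \<integral>\<^sup>+y. ennreal (norm (f (fst (x, y)) * g (snd (x, y)))) \<partial>N \<partial>M)"
   by (rule N.nn_integral_fst[symmetric]) measurable
  also have "\<dots> = (\<integral>\<^sup>+x. \<integral>\<^sup>+y. ennreal (norm (f x)) * ennreal (norm (g y)) \<partial>N \<partial>M)"
   by (simp only: fst_conv snd_conv norm_mult ennreal_mult norm_ge_zero)
  also have "\<dots> = (\<integral>\<^sup>+x. ennreal (norm (f x)) * (\<integral>\<^sup>+y. ennreal (norm (g y)) \<partial>N) \<partial>M)"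
   by (rule nn_integral_cong, rule nn_integral_cmult) measurable
  also have "\<dots> = (\<integral>\<^sup>+x. ennreal (norm (f x)) \<partial>M) * (\<integral>\<^sup>+y. ennreal (norm (g y)) \<partial>N)"
   by (rule nn_integral_multc) measurable
  also have "\<dots> < \<infinity>"
   using f g unfolding integrable_iff_bounded by (auto simp: ennreal_mult_less_top)
  finally show "(\<integral>\<^sup>+p. ennreal (norm (f (fst p) * g (snd p))) \<partial>(M \<Otimes>\<^sub>M N)) < \<infinity>" .
 qed measurable
 then have "integrable (M \<Otimes>\<^sub>M N) (\<lambda>p. f (fst p) * g (snd p) * case_prod k p)"
  by (rule integrable_mult_bounded[where B=B]) (auto simp: B case_prod_beta)
 then show ?thesis by (simp add: case_prod_beta')
qed

text \<open>The typical \<open>k\<close> is a character \<open>fexp\<close>, of modulus 1, depending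
  on both variables.\<close>

lemma Fubini_bounded:
 fixes f :: "'a \<Rightarrow> complex" and g :: "'b \<Rightarrow> complex" and k :: "'a \<Rightarrow> 'b \<Rightarrow> complex"
 assumes "sigma_finite_measure M" "sigma_finite_measure N" "integrable M f" "integrable N g"
  "case_prod k \<in> borel_measurable (M \<Otimes>\<^sub>M N)" "\<And>x y. cmod (k x y) \<le> B"
 shows "(\<integral>y. (\<integral>x. f x * g y * k x y \<partial>M) \<partial>N) = (\<integral>x. (\<integral>y. f x * g y * k x y \<partial>N) \<partial>M)"
 using pair_sigma_finite.Fubini_integral[of M N "\<lambda>x y. f x * g y * k x y"]
  integrable_pair_bounded[OF assms] assms(1,2) by (simp add: pair_sigma_finite_def)

section \<open>Gaussians and their Fourier transforms\<close>

lemma integral_lborel_prod_Basis: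
 fixes f :: "'a::euclidean_space \<Rightarrow> real \<Rightarrow> complex"
 assumes f: "\<And>b. b \<in> Basis \<Longrightarrow> integrable lborel (f b)"
 shows "(LI x. (\<Prod>b\<in>Basis. f b (x \<bullet> b))) = (\<Prod>b\<in>Basis. LI t. f b t)"
  and "integrable lborel (\<lambda>x. \<Prod>b\<in>Basis. f b (x \<bullet> b))"
proof -
 interpret product_sigma_finite "\<lambda>b::'a. lborel :: real measure" by standard
 have [measurable]: "f b \<in> borel_measurable borel" if "b \<in> Basis" for b using f[OF that] by auto
 have "(LI x. (\<Prod>b\<in>Basis. f b (x \<bullet> b)))
   = (\<integral>g. (\<Prod>b\<in>Basis. f b ((\<Sum>c\<in>Basis. g c *\<^sub>R c) \<bullet> b)) \<partial>(\<Pi>\<^sub>M b\<in>Basis. lborel))"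
  by (subst lborel_eq, subst integral_distr) auto
 also have "\<dots> = (\<integral>g. (\<Prod>b\<in>Basis. f b (g b)) \<partial>(\<Pi>\<^sub>M b\<in>Basis. lborel))"
  by (intro integral_cong prod.cong refl) (simp add: inner_sum_left_Basis)
 also have "\<dots> = (\<Prod>b\<in>Basis. LI t. f b t)"
  by (rule product_integral_prod) (use f in auto)
 finally show "(LI x. (\<Prod>b\<in>Basis. f b (x \<bullet> b))) = (\<Prod>b\<in>Basis. LI t. f b t)" .
 have "integrable (\<Pi>\<^sub>M b\<in>Basis. lborel) (\<lambda>g. \<Prod>b\<in>Basis. f b (g b))"
  by (rule product_integrable_prod) (use f in auto)
 then have "integrable (\<Pi>\<^sub>M b\<in>Basis. lborel) (\<lambda>g. \<Prod>b\<in>Basis. f b ((\<Sum>c\<in>Basis. g c *\<^sub>R c) \<bullet> b))"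
  by (rule Bochner_Integration.integrable_cong[THEN iffD1, rotated -1]) (auto simp: inner_sum_left_Basis)
 then show "integrable lborel (\<lambda>x. \<Prod>b\<in>Basis. f b (x \<bullet> b))"
  by (subst lborel_eq, subst integrable_distr_eq) auto
qed

text \<open>The characteristic function of the standard normal distribution after the substitution t
  = \<sigma> u.\<close>

lemma fourier_normal_density:
 assumes \<sigma>: "\<sigma> > 0"
 shows "(LI t. complex_of_real (normal_density 0 \<sigma> t) * exp (- 2 * complex_of_real pi * \<i> * complex_of_real (t * y)))
   = complex_of_real (exp (- ((2 * pi * \<sigma> * y)^2 / 2)))"
proof -
 have "complex_of_real (exp (- ((2 * pi * \<sigma> * y)^2 / 2))) = char std_normal_distribution (- (2 * pi * \<sigma> * y))"
  by (simp add: char_std_normal_distribution)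
 also have "\<dots> = (LI u. std_normal_density u *\<^sub>R iexp (- (2 * pi * \<sigma> * y) * u))"
  unfolding char_def by (subst integral_density) (auto simp: normal_density_nonneg)
 also have "\<dots> = \<bar>\<sigma>\<bar> *\<^sub>R (LI u. complex_of_real (normal_density 0 \<sigma> (0 + \<sigma> * u)) * exp (- 2 * complex_of_real pi * \<i> * complex_of_real ((0 + \<sigma> * u) * y)))"
  using \<sigma> by (subst integral_scaleR_right[symmetric])
   (auto intro!: integral_cong simp: normal_density_def real_sqrt_mult power_mult_distrib scaleR_conv_of_real mult_ac)
 also have "\<dots> = (LI t. complex_of_real (normal_density 0 \<sigma> t) * exp (- 2 * complex_of_real pi * \<i> * complex_of_real (t * y)))"
  using \<sigma> by (intro lborel_integral_real_affine[symmetric]) auto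
 finally show ?thesis by simp
qed

text \<open>The normal density with variance s/(2 pi) in each coordinate. With this scaling the
  Fourier transform is exp(-pi s |y|^2), and the parameters add under convolution.\<close>

definition gauss :: "real \<Rightarrow> R3 \<Rightarrow> real" where
 "gauss s x = (1 / sqrt s) ^ 3 * exp (- (pi * (norm x)^2 / s))"

lemma gauss_prod:
 assumes "s > 0"
 shows "gauss s x = (\<Prod>b\<in>Basis. normal_density 0 (sqrt (s / (2 * pi))) (x \<bullet> b))"
proof -
 have nd: "normal_density 0 (sqrt (s / (2 * pi))) t = (1 / sqrt s) * exp (- (pi * t^2 / s))" for t
  using assms by (simp add: normal_density_def field_simps)
 have "(\<Prod>b\<in>Basis. normal_density 0 (sqrt (s / (2 * pi))) (x \<bullet> b)) = (1 / sqrt s) ^ card (Basis::R3 set) * exp (\<Sum>b\<in>Basis. - (pi * (x \<bullet> b)^2 / s))"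
  by (simp only: nd prod.distrib prod_constant exp_sum finite_Basis)
 also have "(\<Sum>b\<in>Basis. - (pi * (x \<bullet> b)^2 / s)) = - (pi * (norm x)^2 / s)"
  by (simp add: sum_negf sum_divide_distrib[symmetric] sum_distrib_left[symmetric] norm_eq_sqrt_inner[of x] euclidean_inner[of x x] power2_eq_square sum_nonneg)
 finally show ?thesis by (simp add: gauss_def)
qed

lemma gauss_nonneg: "s > 0 \<Longrightarrow> gauss s x \<ge> 0"
 by (simp add: gauss_def)

lemma continuous_on_gauss [continuous_intros]: "continuous_on S f \<Longrightarrow> continuous_on S (\<lambda>x. gauss s (f x))"
 unfolding gauss_def divide_inverse by (intro continuous_intros)

lemma measurable_gauss [measurable]: "gauss s \<in> borel_measurable borel"
 by (intro borel_measurable_continuous_onI continuous_intros)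

lemma fourier_gauss_aux:
 assumes s: "s > 0"
 shows "integrable lborel (\<lambda>x. complex_of_real (gauss s x))"
  and "fourier (\<lambda>x. complex_of_real (gauss s x)) y = complex_of_real (exp (- (pi * s * (norm y)^2)))"
proof -
 let ?\<sigma> = "sqrt (s / (2 * pi))"
 have \<sigma>: "?\<sigma> > 0" using s by simp
 let ?n = "\<lambda>b::R3. \<lambda>t. complex_of_real (normal_density 0 ?\<sigma> t)"
 have int: "integrable lborel (?n b)" for b
  using \<sigma> by (intro integrable_of_real integrable_normal_density)
 have "integrable lborel (\<lambda>x::R3. \<Prod>b\<in>Basis. ?n b (x \<bullet> b))"
  by (rule integral_lborel_prod_Basis(2)) (rule int)
 then show "integrable lborel (\<lambda>x. complex_of_real (gauss s x))"
  by (simp add: gauss_prod[OF s])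
 let ?f = "\<lambda>b t. ?n b t * exp (- 2 * complex_of_real pi * \<i> * complex_of_real (t * (y \<bullet> b)))"
 have int2: "integrable lborel (?f b)" for b
 proof (rule integrable_mult_bounded[OF int, where B=1])
  show "(\<lambda>t. exp (- 2 * complex_of_real pi * \<i> * complex_of_real (t * (y \<bullet> b)))) \<in> borel_measurable lborel"
   unfolding measurable_lborel2 by (intro borel_measurable_continuous_onI continuous_intros)
 qed (simp add: norm_exp_eq_Re)
 have "fourier (\<lambda>x. complex_of_real (gauss s x)) y = (LI x. (\<Prod>b\<in>Basis. ?f b (x \<bullet> b)))"
  unfolding fourier_def
 proof (rule integral_cong[OF refl])
  fix x :: R3
  have "exp (- 2 * complex_of_real pi * \<i> * complex_of_real (x \<bullet> y)) = (\<Prod>b\<in>Basis. exp (- 2 * complex_of_real pi * \<i> * complex_of_real ((x \<bullet> b) * (y \<bullet> b))))"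
   by (subst euclidean_inner[of x y]) (simp add: exp_sum[symmetric] sum_distrib_left)
  then show "complex_of_real (gauss s x) * exp (- 2 * complex_of_real pi * \<i> * complex_of_real (x \<bullet> y)) = (\<Prod>b\<in>Basis. ?f b (x \<bullet> b))"
   by (simp add: gauss_prod[OF s] prod.distrib)
 qed
 also have "\<dots> = (\<Prod>b\<in>Basis. LI t. ?f b t)"
  by (rule integral_lborel_prod_Basis(1)) (rule int2)
 also have "\<dots> = (\<Prod>b\<in>Basis. complex_of_real (exp (- ((2 * pi * ?\<sigma> * (y \<bullet> b))^2 / 2))))"
  by (intro prod.cong refl fourier_normal_density \<sigma>)
 also have "\<dots> = complex_of_real (exp (\<Sum>b\<in>Basis. - ((2 * pi * ?\<sigma> * (y \<bullet> b))^2 / 2)))"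
  by (simp add: exp_sum)
 also have "(\<Sum>b\<in>Basis. - ((2 * pi * ?\<sigma> * (y \<bullet> b))^2 / 2)) = (\<Sum>b\<in>Basis. - (pi * s) * (y \<bullet> b)^2)"
  using s by (intro sum.cong refl) (simp add: power_mult_distrib field_simps power2_eq_square)
 also have "\<dots> = - (pi * s * (norm y)^2)"
  by (simp add: sum_distrib_left[symmetric] norm_eq_sqrt_inner[of y] euclidean_inner[of y y] power2_eq_square sum_nonneg sum_negf)
 finally show "fourier (\<lambda>x. complex_of_real (gauss s x)) y = complex_of_real (exp (- (pi * s * (norm y)^2)))" .
qed

lemma integrable_gauss: "s > 0 \<Longrightarrow> integrable lborel (gauss s)"
 using integrable_Re[OF fourier_gauss_aux(1)[of s]] by simp

lemmas fourier_gauss = fourier_gauss_aux(2)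

lemma integral_gauss: "s > 0 \<Longrightarrow> (LI x. gauss s x) = 1"
proof -
 assume s: "s > 0"
 have "complex_of_real (LI x. gauss s x) = fourier (\<lambda>x. complex_of_real (gauss s x)) 0"
  by (simp add: fourier_alt)
 also have "\<dots> = 1" using fourier_gauss[OF s, of 0] by simp
 finally show ?thesis using of_real_eq_1_iff by blast
qed

lemma nn_integral_gauss: "s > 0 \<Longrightarrow> (LI+ x. ennreal (gauss s x)) = 1"
 by (subst nn_integral_eq_integral) (auto simp: integrable_gauss gauss_nonneg integral_gauss)

text \<open>Up to scaling, a Gaussian is its own Fourier transform. This is the inversion formula
  that \<open>fourier_gconv_L2\<close> relies on.\<close>

lemma fourier_gauss_inverse:
 assumes s: "s > 0"
 shows "fourier (\<lambda>y. complex_of_real (exp (- (pi * s * (norm y)^2)))) x = complex_of_real (gauss s x)"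
  and "integrable lborel (\<lambda>y::R3. exp (- (pi * s * (norm y)^2)))"
proof -
 have e: "exp (- (pi * s * (norm y)^2)) = (1 / sqrt s) ^ 3 * gauss (1/s) y" for y :: R3
  using s by (simp add: gauss_def real_sqrt_divide power_divide mult_ac)
 have "fourier (\<lambda>y. complex_of_real (exp (- (pi * s * (norm y)^2)))) x
   = complex_of_real ((1 / sqrt s) ^ 3) * fourier (\<lambda>y. complex_of_real (gauss (1/s) y)) x"
  unfolding e fourier_alt by (simp only: of_real_mult mult.assoc integral_mult_right_zero)
 also have "\<dots> = complex_of_real ((1 / sqrt s) ^ 3 * exp (- (pi * (1/s) * (norm x)^2)))"
  using s by (subst fourier_gauss) simp_all
 finally show "fourier (\<lambda>y. complex_of_real (exp (- (pi * s * (norm y)^2)))) x = complex_of_real (gauss s x)"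
  by (simp add: gauss_def)
 show "integrable lborel (\<lambda>y::R3. exp (- (pi * s * (norm y)^2)))"
  unfolding e using s by (intro integrable_mult_right integrable_gauss) simp
qed

lemma gauss_scale: "s > 0 \<Longrightarrow> gauss s (sqrt s *\<^sub>R x) = (1 / sqrt s) ^ 3 * gauss 1 x"
 by (simp add: gauss_def power_mult_distrib)

section \<open>Compactly supported functions and their Gaussian mollification\<close>

definition compactly_supported :: "(R3 \<Rightarrow> 'b::real_normed_vector) \<Rightarrow> bool" where
 "compactly_supported K \<longleftrightarrow> continuous_on UNIV K \<and> (\<exists>R. \<forall>x. norm x > R \<longrightarrow> K x = 0)"

lemma compactly_supportedE:
 assumes "compactly_supported K"
 obtains R where "R > 0" "\<And>x. norm x > R \<Longrightarrow> K x = 0"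
proof -
 obtain R where R: "\<And>x. norm x > R \<Longrightarrow> K x = 0" using assms by (auto simp: compactly_supported_def)
 show ?thesis by (rule that[of "max R 1"]) (use R in auto)
qed

lemma compactly_supported_bounded:
 assumes K: "compactly_supported K"
 obtains B where "B > 0" "\<And>x. norm (K x) \<le> B"
proof -
 obtain R where R: "R > 0" "\<And>x. norm x > R \<Longrightarrow> K x = 0" by (rule compactly_supportedE[OF K]) blast
 have "compact (K ` cball 0 R)"
  using K by (intro compact_continuous_image) (auto simp: compactly_supported_def intro: continuous_on_subset)
 then obtain B where B: "\<And>x. x \<in> cball 0 R \<Longrightarrow> norm (K x) \<le> B"
  using compact_imp_bounded bounded_iff by (metis imageI)
 show ?thesis
 proof (rule that[of "max B 1"])
  show "norm (K x) \<le> max B 1" for x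
   using B[of x] R(2)[of x] by (cases "norm x > R") (auto simp: max_def)
 qed simp
qed

lemma compactly_supported_integrable:
 fixes K :: "R3 \<Rightarrow> 'b::{banach, second_countable_topology}"
 assumes K: "compactly_supported K"
 shows "integrable lborel K"
proof -
 obtain R where R: "R > 0" "\<And>x. norm x > R \<Longrightarrow> K x = 0" by (rule compactly_supportedE[OF K]) blast
 have "integrable lborel (\<lambda>x. indicator (cball 0 R) x *\<^sub>R K x)"
  using K by (intro borel_integrable_compact) (auto simp: compactly_supported_def intro: continuous_on_subset)
 moreover have "indicator (cball 0 R) x *\<^sub>R K x = K x" for x
  using R(2)[of x] by (auto split: split_indicator)
 ultimately show ?thesis by simp
qed

lemma compactly_supported_mult:
 fixes K :: "R3 \<Rightarrow> 'b::real_normed_algebra"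
 assumes "compactly_supported K" "continuous_on UNIV f"
 shows "compactly_supported (\<lambda>x. f x * K x)"
 using assms by (auto simp: compactly_supported_def intro!: continuous_intros) (metis mult_zero_right)

definition gconv :: "real \<Rightarrow> (R3 \<Rightarrow> real) \<Rightarrow> R3 \<Rightarrow> real" where
 "gconv s K x = (LI y. K (x - y) * gauss s y)"

context
 fixes K :: "R3 \<Rightarrow> real" and s :: real
 assumes K: "compactly_supported K" and Knn: "\<And>x. 0 \<le> K x" and s: "s > 0"
begin

lemma K_measurable [measurable]: "K \<in> borel_measurable borel"
 using K by (auto simp: compactly_supported_def intro: borel_measurable_continuous_onI)

lemma gconv_integrable_integrand: "integrable lborel (\<lambda>y. K (x - y) * gauss s y)"
proof -
 obtain B where B: "\<And>x. norm (K x) \<le> B" using compactly_supported_bounded[OF K] by metis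
 show ?thesis
  by (rule Bochner_Integration.integrable_bound[where f="\<lambda>y. B * gauss s y"])
    (use B gauss_nonneg[OF s] integrable_gauss[OF s] in \<open>auto simp: abs_mult intro!: mult_mono AE_I2, meson abs_ge_self order_trans\<close>)
qed

lemma gconv_nonneg: "0 \<le> gconv s K x"
 unfolding gconv_def by (intro integral_nonneg_AE AE_I2 mult_nonneg_nonneg Knn gauss_nonneg s)

lemma gconv_measurable [measurable]: "gconv s K \<in> borel_measurable borel"
 unfolding gconv_def by measurable

lemma ennreal_gconv: "ennreal (gconv s K x) = (LI+ y. ennreal (K (x - y)) * ennreal (gauss s y))"
 unfolding gconv_def
 by (subst nn_integral_eq_integral[symmetric])
   (auto simp: gconv_integrable_integrand Knn gauss_nonneg s ennreal_mult)

lemma gconv_integrable: "integrable lborel (gconv s K)"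
proof (rule integrableI_nonneg)
 have "(LI+ x. ennreal (gconv s K x)) = (LI+ y. LI+ x. ennreal (K (x - y)) * ennreal (gauss s y))"
  unfolding ennreal_gconv by (rule lborel_pair.Fubini'[symmetric]) measurable
 also have "\<dots> = (LI+ y. (LI+ x. ennreal (K x)) * ennreal (gauss s y))"
 proof (rule nn_integral_cong)
  fix y
  have "(LI+ x. ennreal (K (x - y)) * ennreal (gauss s y)) = (LI+ x. ennreal (K (x - y))) * ennreal (gauss s y)"
   by (rule nn_integral_multc) measurable
  also have "(LI+ x. ennreal (K (x - y))) = (LI+ x. ennreal (K x))"
   using nn_integral_lborel_translate[of "\<lambda>x. ennreal (K x)" "-y"] by simp
  finally show "(LI+ x. ennreal (K (x - y)) * ennreal (gauss s y)) = (LI+ x. ennreal (K x)) * ennreal (gauss s y)" .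
 qed
 also have "\<dots> = (LI+ x. ennreal (K x))"
  by (subst nn_integral_cmult) (auto simp: nn_integral_gauss s)
 also have "\<dots> < \<infinity>"
  using compactly_supported_integrable[OF K] Knn by (simp add: integrable_iff_bounded)
 finally show "(LI+ x. ennreal (gconv s K x)) < \<infinity>" .
qed (auto simp: gconv_nonneg)

end

lemma integral_lborel_translate:
 fixes f :: "R3 \<Rightarrow> 'b::{banach, second_countable_topology}"
 assumes [measurable]: "f \<in> borel_measurable borel"
 shows "(LI x. f (x - w)) = (LI x. f x)"
proof -
 have "(LI x. f x) = (\<integral>x. f x \<partial>distr lborel borel ((+) (- w)))" by (simp only: lborel_distr_plus)
 also have "\<dots> = (LI x. f (- w + x))" by (rule integral_distr) auto
 finally show ?thesis by simp
qed

lemma integral_lborel_reflect: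
 fixes f :: "R3 \<Rightarrow> 'b::{banach, second_countable_topology}"
 assumes [measurable]: "f \<in> borel_measurable borel"
 shows "(LI x. f (w - x)) = (LI x. f x)"
proof -
 have "lborel = density (distr lborel borel (\<lambda>x::R3. w + (-1) *\<^sub>R x)) (\<lambda>_. 1)"
  using lborel_affine[of "-1" w] by simp
 then have "(LI x. f x) = (\<integral>x. f x \<partial>distr lborel borel (\<lambda>x. w + (-1) *\<^sub>R x))"
  by (simp add: density_1)
 also have "\<dots> = (LI x. f (w + (-1) *\<^sub>R x))" by (rule integral_distr) auto
 finally show ?thesis by simp
qed

lemma continuous_on_integral_param:
 fixes f :: "'p::metric_space \<Rightarrow> 'a \<Rightarrow> complex"
 assumes m: "\<And>y. f y \<in> borel_measurable M" and w: "integrable M w"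
  and b: "\<And>y x. cmod (f y x) \<le> w x" and c: "\<And>x. continuous_on UNIV (\<lambda>y. f y x)"
 shows "continuous_on UNIV (\<lambda>y. \<integral>x. f y x \<partial>M)"
 unfolding continuous_on_sequentially
proof (intro allI ballI impI)
 fix u :: "nat \<Rightarrow> 'p" and a assume "(\<forall>n. u n \<in> UNIV) \<and> u \<longlonglongrightarrow> a"
 then have u: "u \<longlonglongrightarrow> a" by simp
 have "(\<lambda>n. \<integral>x. f (u n) x \<partial>M) \<longlonglongrightarrow> (\<integral>x. f a x \<partial>M)"
 proof (rule integral_dominated_convergence[OF m m w])
  show "AE x in M. (\<lambda>n. f (u n) x) \<longlonglongrightarrow> f a x"
   using c u by (intro AE_I2 continuous_on_tendsto_compose[of UNIV "\<lambda>y. f y _"]) auto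
 qed (use b in auto)
 then show "((\<lambda>y. \<integral>x. f y x \<partial>M) \<circ> u) \<longlonglongrightarrow> (\<integral>x. f a x \<partial>M)" by (simp add: o_def)
qed

lemma continuous_on_fourier:
 assumes "integrable lborel f"
 shows "continuous_on UNIV (fourier f)"
proof -
 have [measurable]: "f \<in> borel_measurable borel" using assms by auto
 show ?thesis unfolding fourier_alt
  by (rule continuous_on_integral_param[where w="\<lambda>x. cmod (f x)"])
    (use assms in \<open>auto simp: norm_mult intro!: continuous_intros\<close>)
qed

lemma norm_fourier_le:
 assumes "integrable lborel f"
 shows "cmod (fourier f y) \<le> (LI x. cmod (f x))"
 unfolding fourier_alt
 using integral_norm_bound[of lborel "\<lambda>x. f x * fexp x y"] by (simp add: norm_mult)

lemma measurable_fourier: "integrable lborel f \<Longrightarrow> fourier f \<in> borel_measurable borel"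
 by (intro borel_measurable_continuous_onI continuous_on_fourier)

context
 fixes K :: "R3 \<Rightarrow> real" and s :: real
 assumes K: "compactly_supported K" and Knn: "\<And>x. 0 \<le> K x" and s: "s > 0"
begin

lemma fourier_gconv:
 "fourier (\<lambda>x. complex_of_real (gconv s K x)) y
   = complex_of_real (exp (- (pi * s * (norm y)^2))) * fourier (\<lambda>x. complex_of_real (K x)) y"
proof -
 have [measurable]: "K \<in> borel_measurable borel" by (rule K_measurable[OF K Knn s])
 let ?K = "\<lambda>x. complex_of_real (K x)" and ?g = "\<lambda>x. complex_of_real (gauss s x)"
 let ?f = "\<lambda>x w. ?K (x - w) * ?g w * fexp x y"
 have "fourier (\<lambda>x. complex_of_real (gconv s K x)) y = (LI x. LI w. ?f x w)"
  unfolding fourier_alt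
 proof (rule integral_cong[OF refl])
  fix x
  have "complex_of_real (gconv s K x) * fexp x y = (LI w. complex_of_real (K (x - w) * gauss s w)) * fexp x y"
   unfolding gconv_def by (simp only: integral_complex_of_real)
  then show "complex_of_real (gconv s K x) * fexp x y = (LI w. ?f x w)" by simp
 qed
 also have "\<dots> = (LI w. LI x. ?f x w)"
 proof (rule lborel_pair.Fubini_integral[symmetric])
  show "integrable (lborel \<Otimes>\<^sub>M lborel) (\<lambda>(x, w). ?f x w)"
  proof (rule lborel_pair.Fubini_integrable)
   have "(LI w. norm (?f x w)) = gconv s K x" for x
    unfolding gconv_def by (simp add: norm_mult Knn gauss_nonneg s)
   then show "integrable lborel (\<lambda>x. LI w. norm (case (x, w) of (x, w) \<Rightarrow> ?f x w))"
    using gconv_integrable[OF K Knn s] by simp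
   have "integrable lborel (\<lambda>w. complex_of_real (K (x - w) * gauss s w) * fexp x y)" for x
    by (intro integrable_mult_left integrable_of_real gconv_integrable_integrand K Knn s)
   then show "AE x in lborel. integrable lborel (\<lambda>w. case (x, w) of (x, w) \<Rightarrow> ?f x w)" by simp
  qed measurable
 qed
 also have "\<dots> = (LI w. (?g w * fexp w y) * fourier ?K y)"
 proof (rule integral_cong[OF refl])
  fix w
  have "?f x w = (\<lambda>x. ?K x * fexp x y) (x - w) * (?g w * fexp w y)" for x
  proof -
   have "?f x w = ?K (x - w) * ?g w * (fexp (x - w) y * fexp w y)" by (subst fexp_add_left[symmetric]) simp
   also have "\<dots> = ?K (x - w) * fexp (x - w) y * (?g w * fexp w y)" by (simp only: mult_ac)
   finally show ?thesis .
  qed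
  then have "(LI x. ?f x w) = (LI x. (\<lambda>x. ?K x * fexp x y) (x - w) * (?g w * fexp w y))" by (simp only:)
  also have "\<dots> = (LI x. (\<lambda>x. ?K x * fexp x y) (x - w)) * (?g w * fexp w y)" by simp
  also have "(LI x. (\<lambda>x. ?K x * fexp x y) (x - w)) = fourier ?K y"
   unfolding fourier_alt by (rule integral_lborel_translate) measurable
  finally show "(LI x. ?f x w) = (?g w * fexp w y) * fourier ?K y" by (simp only: mult.commute)
 qed
 also have "\<dots> = fourier ?g y * fourier ?K y" by (simp add: fourier_alt)
 finally show ?thesis using fourier_gauss[OF s, of y] by simp
qed

text \<open>Plancherel as an inequality. The Gaussian factor squared has parameter 2s, so the
  left-hand side equals the integral of K times its mollification at 2s; averaging against a
  probability density does not increase the quadratic form.\<close>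

lemma fourier_gconv_L2:
 "(LI+ y. (ennreal (cmod (fourier (\<lambda>x. complex_of_real (gconv s K x)) y)))^2) \<le> (LI+ x. (ennreal (K x))^2)"
proof -
 have [measurable]: "K \<in> borel_measurable borel" by (rule K_measurable[OF K Knn s])
 let ?K = "\<lambda>x. complex_of_real (K x)"
 have Ki: "integrable lborel ?K" using compactly_supported_integrable[OF K] by simp
 have [measurable]: "fourier ?K \<in> borel_measurable borel" by (rule measurable_fourier[OF Ki])
 have s2: "2 * s > 0" using s by simp
 define E where "E y = complex_of_real (exp (- (pi * (2 * s) * (norm y)^2)))" for y :: R3
 have Ei: "integrable lborel E" unfolding E_def using fourier_gauss_inverse(2)[OF s2] by simp
 have [measurable]: "E \<in> borel_measurable borel" using Ei by auto
 define G where "G y = E y * cnj (fourier ?K y)" for y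
 have Gi: "integrable lborel G" unfolding G_def
  by (rule integrable_mult_bounded[OF Ei, where B="LI x. cmod (?K x)"])
    (use norm_fourier_le[OF Ki] in auto)
 have sf: "sigma_finite_measure (lborel :: R3 measure)" by (rule sigma_finite_lborel)
 have cfK: "cnj (fourier ?K y) = (LI x. ?K x * cnj (fexp x y))" for y
  unfolding fourier_alt by (simp add: Bochner_Integration.integral_cnj[symmetric])
 \<comment> \<open>The Gaussian \<open>E\<close> makes the inversion integral absolutely convergent,
   and the transform of \<open>E\<close> is known explicitly.\<close>
 have inner: "(LI y. G y * fexp x y) = complex_of_real (gconv (2 * s) K x)" for x
 proof -
  have "(LI y. G y * fexp x y) = (LI y. LI x'. ?K x' * E y * fexp (x - x') y)"
  proof (rule integral_cong[OF refl])
   fix y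
   have "fexp (x - x') y = fexp x y * cnj (fexp x' y)" for x'
    using fexp_diff_right[of y x x'] by (simp only: fexp_commute)
   then have "(LI x'. ?K x' * E y * fexp (x - x') y) = (LI x'. (E y * fexp x y) * (?K x' * cnj (fexp x' y)))"
    by (simp only: mult_ac)
   also have "\<dots> = (E y * fexp x y) * (LI x'. ?K x' * cnj (fexp x' y))" by (rule integral_mult_right_zero)
   also have "\<dots> = G y * fexp x y" unfolding G_def cfK by (simp only: mult_ac)
   finally show "G y * fexp x y = (LI x'. ?K x' * E y * fexp (x - x') y)" by simp
  qed
  also have "\<dots> = (LI x'. LI y. ?K x' * E y * fexp (x - x') y)"
   by (rule Fubini_bounded[OF sf sf Ki Ei, where B=1]) auto
  also have "\<dots> = (LI x'. complex_of_real (K x' * gauss (2 * s) (x - x')))"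
  proof (rule integral_cong[OF refl])
   fix x'
   have "(LI y. ?K x' * E y * fexp (x - x') y) = ?K x' * (LI y. E y * fexp y (x - x'))"
    by (simp add: mult.assoc fexp_commute[of "x - x'"])
   also have "(LI y. E y * fexp y (x - x')) = complex_of_real (gauss (2 * s) (x - x'))"
    using fourier_gauss_inverse(1)[OF s2, of "x - x'"] by (simp add: fourier_alt E_def)
   finally show "(LI y. ?K x' * E y * fexp (x - x') y) = complex_of_real (K x' * gauss (2 * s) (x - x'))" by simp
  qed
  also have "\<dots> = complex_of_real (LI x'. K x' * gauss (2 * s) (x - x'))" by (rule integral_complex_of_real)
  also have "(LI x'. K x' * gauss (2 * s) (x - x')) = (LI w. (\<lambda>x'. K x' * gauss (2 * s) (x - x')) (x - w))"
   by (rule integral_lborel_reflect[symmetric]) measurable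
  also have "\<dots> = gconv (2 * s) K x" by (simp add: gconv_def)
  finally show ?thesis .
 qed
 have "(LI y. complex_of_real ((cmod (fourier (\<lambda>x. complex_of_real (gconv s K x)) y))^2))
   = (LI y. LI x. ?K x * G y * fexp x y)"
 proof (rule integral_cong[OF refl])
  fix y
  have e: "complex_of_real (exp (- (pi * s * (norm y)^2))) * complex_of_real (exp (- (pi * s * (norm y)^2))) = E y"
   unfolding E_def of_real_mult[symmetric] exp_add[symmetric] by simp
  have "complex_of_real ((cmod (fourier (\<lambda>x. complex_of_real (gconv s K x)) y))^2)
    = (complex_of_real (exp (- (pi * s * (norm y)^2))) * complex_of_real (exp (- (pi * s * (norm y)^2)))) * (fourier ?K y * cnj (fourier ?K y))"
   unfolding fourier_gconv complex_norm_square by (simp add: mult_ac)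
  also have "\<dots> = (LI x. ?K x * fexp x y) * G y" unfolding e G_def fourier_alt by (simp add: mult_ac)
  also have "\<dots> = (LI x. ?K x * fexp x y * G y)" by simp
  finally show "complex_of_real ((cmod (fourier (\<lambda>x. complex_of_real (gconv s K x)) y))^2) = (LI x. ?K x * G y * fexp x y)"
   by (simp add: mult_ac)
 qed
 also have "\<dots> = (LI x. LI y. ?K x * G y * fexp x y)"
  by (rule Fubini_bounded[OF sf sf Ki Gi, where B=1]) auto
 also have "\<dots> = (LI x. complex_of_real (K x * gconv (2 * s) K x))"
  by (simp add: mult.assoc inner)
 also have "\<dots> = complex_of_real (LI x. K x * gconv (2 * s) K x)" by (rule integral_complex_of_real)
 finally have eq: "(LI y. (cmod (fourier (\<lambda>x. complex_of_real (gconv s K x)) y))^2) = (LI x. K x * gconv (2 * s) K x)"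
  unfolding integral_complex_of_real of_real_eq_iff .
 have int1: "integrable lborel (\<lambda>y. (cmod (fourier (\<lambda>x. complex_of_real (gconv s K x)) y))^2)"
 proof -
  have "integrable lborel (\<lambda>y. G y * fourier ?K y)"
   by (rule integrable_mult_bounded[OF Gi, where B="LI x. cmod (?K x)"])
     (use norm_fourier_le[OF Ki] in auto)
  moreover have "G y * fourier ?K y = complex_of_real ((cmod (fourier (\<lambda>x. complex_of_real (gconv s K x)) y))^2)" for y
  proof -
   have e: "complex_of_real (exp (- (pi * s * (norm y)^2))) * complex_of_real (exp (- (pi * s * (norm y)^2))) = E y"
    unfolding E_def of_real_mult[symmetric] exp_add[symmetric] by simp
   show ?thesis unfolding fourier_gconv complex_norm_square G_def e[symmetric] by (simp add: mult_ac)
  qed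
  ultimately have "integrable lborel (\<lambda>y. complex_of_real ((cmod (fourier (\<lambda>x. complex_of_real (gconv s K x)) y))^2))" by simp
  then show ?thesis using complex_of_real_integrable_eq by blast
 qed
 note m2 = gconv_measurable[OF K Knn s2]
 have int2: "integrable lborel (\<lambda>x. K x * gconv (2 * s) K x)"
 proof -
  obtain B where B: "\<And>x. norm (K x) \<le> B" using compactly_supported_bounded[OF K] by metis
  have "integrable lborel (\<lambda>x. complex_of_real (gconv (2 * s) K x) * ?K x)"
   by (rule integrable_mult_bounded[where B=B]) (use gconv_integrable[OF K Knn s2] B in auto)
  then have "integrable lborel (\<lambda>x. complex_of_real (K x * gconv (2 * s) K x))" by (simp add: mult.commute)
  then show ?thesis using complex_of_real_integrable_eq by blast
 qed
 have "(LI+ y. (ennreal (cmod (fourier (\<lambda>x. complex_of_real (gconv s K x)) y)))^2)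
   = ennreal (LI x. K x * gconv (2 * s) K x)"
  using nn_integral_eq_integral[OF int1] eq by (simp add: ennreal_power)
 also have "\<dots> = (LI+ x. ennreal (K x) * ennreal (gconv (2 * s) K x))"
  using nn_integral_eq_integral[OF int2] Knn gconv_nonneg[OF K Knn s2] by (simp add: ennreal_mult)
 also have "\<dots> \<le> (LI+ x. (ennreal (K x))^2)"
 proof -
  let ?L = "LI+ x. ennreal (K x) * ennreal (gconv (2 * s) K x)" and ?S = "LI+ x. (ennreal (K x))^2"
  let ?g = "\<lambda>y. ennreal (gauss (2 * s) y)"
  have g1: "(LI+ y. ?g y) = 1" by (rule nn_integral_gauss[OF s2])
  \<comment> \<open>From 2 K(x) K(x - y) \<le> K(x)^2 + K(x - y)^2: against a density of mass 1 both
    terms integrate to the same L^2 norm.\<close>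
  have "2 * ?L = (LI+ x. 2 * (ennreal (K x) * ennreal (gconv (2 * s) K x)))"
   using m2 by (intro nn_integral_cmult[symmetric]) auto
  also have "\<dots> = (LI+ x. LI+ y. 2 * ennreal (K x) * ennreal (K (x - y)) * ?g y)"
   unfolding ennreal_gconv[OF K Knn s2] by (rule nn_integral_cong) (simp add: nn_integral_cmult mult.assoc)
  also have "\<dots> \<le> (LI+ x. LI+ y. (ennreal (K x))^2 * ?g y + (ennreal (K (x - y)))^2 * ?g y)"
  proof (rule nn_integral_mono, rule nn_integral_mono)
   fix x y
   have "2 * (K x) * K (x - y) \<le> (K x)^2 + (K (x - y))^2" using sum_squares_bound[of "K x" "K (x - y)"] by simp
   then have "ennreal (2 * (K x) * K (x - y)) \<le> ennreal ((K x)^2 + (K (x - y))^2)" by (rule ennreal_leI)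
   then have "2 * ennreal (K x) * ennreal (K (x - y)) \<le> (ennreal (K x))^2 + (ennreal (K (x - y)))^2"
    using Knn by (simp add: ennreal_mult ennreal_power)
   then show "2 * ennreal (K x) * ennreal (K (x - y)) * ?g y \<le> (ennreal (K x))^2 * ?g y + (ennreal (K (x - y)))^2 * ?g y"
    unfolding distrib_right[symmetric] by (rule mult_right_mono) simp
  qed
  also have "\<dots> = (LI+ x. (LI+ y. (ennreal (K x))^2 * ?g y) + (LI+ y. (ennreal (K (x - y)))^2 * ?g y))"
   by (rule nn_integral_cong, rule nn_integral_add) measurable
  also have "\<dots> = (LI+ x. LI+ y. (ennreal (K x))^2 * ?g y) + (LI+ x. LI+ y. (ennreal (K (x - y)))^2 * ?g y)"
   by (rule nn_integral_add) measurable
  finally have le: "2 * ?L \<le> (LI+ x. LI+ y. (ennreal (K x))^2 * ?g y) + (LI+ x. LI+ y. (ennreal (K (x - y)))^2 * ?g y)" .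
  have p1: "(LI+ x. LI+ y. (ennreal (K x))^2 * ?g y) = ?S"
   by (rule nn_integral_cong) (simp add: nn_integral_cmult g1)
  have "(LI+ x. LI+ y. (ennreal (K (x - y)))^2 * ?g y) = (LI+ y. LI+ x. (ennreal (K (x - y)))^2 * ?g y)"
   by (rule lborel_pair.Fubini'[symmetric]) measurable
  also have "\<dots> = (LI+ y. ?S * ?g y)"
  proof (rule nn_integral_cong)
   fix y
   have "(LI+ x. (ennreal (K (x - y)))^2 * ?g y) = (LI+ x. (ennreal (K (x - y)))^2) * ?g y"
    by (rule nn_integral_multc) measurable
   then show "(LI+ x. (ennreal (K (x - y)))^2 * ?g y) = ?S * ?g y"
    using nn_integral_lborel_translate[of "\<lambda>x. (ennreal (K x))^2" "-y"] by simp
  qed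
  also have "\<dots> = ?S * (LI+ y. ?g y)" by (rule nn_integral_cmult) measurable
  finally have p2: "(LI+ x. LI+ y. (ennreal (K (x - y)))^2 * ?g y) = ?S" unfolding g1 by simp
  from le have "2 * ?L \<le> 2 * ?S" unfolding p1 p2 by (simp only: mult_2[of ?S])
  then show ?thesis by (subst (asm) ennreal_mult_le_mult_iff) auto
 qed
 finally show ?thesis .
qed

text \<open>Scaling the Gaussian to parameter 1 moves the small parameter into the argument of
  \<open>K\<close>, which is continuous and bounded; dominated convergence applies.\<close>

lemma gconv_tendsto: "(\<lambda>n. gconv (1 / real (Suc n)) K x) \<longlonglongrightarrow> K x"
proof -
 have [measurable]: "K \<in> borel_measurable borel" by (rule K_measurable[OF K Knn s])
 obtain B where B: "\<And>x. norm (K x) \<le> B" using compactly_supported_bounded[OF K] by metis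
 have eq: "gconv t K x = (LI y. K (x - sqrt t *\<^sub>R y) * gauss 1 y)" if t: "t > 0" for t
 proof -
  have c: "sqrt t \<noteq> 0" using t by simp
  have "gconv t K x = (\<integral>y. K (x - y) * gauss t y \<partial>density (distr lborel borel (\<lambda>y. 0 + sqrt t *\<^sub>R y)) (\<lambda>_. ennreal (\<bar>sqrt t\<bar> ^ DIM(R3))))"
   unfolding gconv_def by (subst lborel_affine[OF c, of 0]) (rule refl)
  also have "\<dots> = (\<integral>y. \<bar>sqrt t\<bar> ^ DIM(R3) *\<^sub>R (K (x - y) * gauss t y) \<partial>distr lborel borel (\<lambda>y. 0 + sqrt t *\<^sub>R y))"
   by (rule integral_density) auto
  also have "\<dots> = (LI y. \<bar>sqrt t\<bar> ^ DIM(R3) *\<^sub>R (K (x - (0 + sqrt t *\<^sub>R y)) * gauss t (0 + sqrt t *\<^sub>R y)))"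
   by (rule integral_distr) auto
  also have "\<dots> = (LI y. K (x - sqrt t *\<^sub>R y) * gauss 1 y)"
   using t by (intro integral_cong refl) (simp add: gauss_scale power_divide)
  finally show ?thesis .
 qed
 have "(\<lambda>n. LI y. K (x - sqrt (1 / real (Suc n)) *\<^sub>R y) * gauss 1 y) \<longlonglongrightarrow> (LI y. K x * gauss 1 y)"
 proof (rule integral_dominated_convergence[where w="\<lambda>y. B * gauss 1 y"])
  show "AE y in lborel. (\<lambda>n. K (x - sqrt (1 / real (Suc n)) *\<^sub>R y) * gauss 1 y) \<longlonglongrightarrow> K x * gauss 1 y"
  proof (rule AE_I2)
   fix y
   have "(\<lambda>n. x - sqrt (1 / real (Suc n)) *\<^sub>R y) \<longlonglongrightarrow> x - sqrt 0 *\<^sub>R y"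
    using LIMSEQ_inverse_real_of_nat by (intro tendsto_intros) (simp add: inverse_eq_divide)
   then have "(\<lambda>n. K (x - sqrt (1 / real (Suc n)) *\<^sub>R y)) \<longlonglongrightarrow> K x"
    using K by (intro continuous_on_tendsto_compose[of UNIV K]) (auto simp: compactly_supported_def)
   then show "(\<lambda>n. K (x - sqrt (1 / real (Suc n)) *\<^sub>R y) * gauss 1 y) \<longlonglongrightarrow> K x * gauss 1 y"
    by (intro tendsto_intros)
  qed
  show "AE y in lborel. norm (K (x - sqrt (1 / real (Suc n)) *\<^sub>R y) * gauss 1 y) \<le> B * gauss 1 y" for n
   using B gauss_nonneg[of 1] by (intro AE_I2) (simp add: abs_mult mult_right_mono)
  show "integrable lborel (\<lambda>y. B * gauss 1 y)" by (intro integrable_mult_right integrable_gauss) simp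
 qed measurable
 then show ?thesis by (simp add: eq integral_gauss)
qed

end

text \<open>A class of rapidly decreasing functions closed under directional derivatives:
  differentiating the Gaussian produces a linear factor, and differentiating
  \<open>fourier K\<close> multiplies \<open>K\<close> by a linear function, which keeps its support
  compact. Iterated derivatives are thus handled by induction.\<close>

inductive gclass :: "real \<Rightarrow> (R3 \<Rightarrow> complex) \<Rightarrow> bool" for s where
 base: "compactly_supported K \<Longrightarrow> gclass s (\<lambda>y. complex_of_real (exp (- (pi * s * (norm y)^2))) * fourier K y)"
| add: "gclass s \<phi> \<Longrightarrow> gclass s \<psi> \<Longrightarrow> gclass s (\<lambda>y. \<phi> y + \<psi> y)"
| scale: "gclass s \<phi> \<Longrightarrow> gclass s (\<lambda>y. c * \<phi> y)"
| lin: "gclass s \<phi> \<Longrightarrow> gclass s (\<lambda>y. complex_of_real (y \<bullet> v) * \<phi> y)"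

lemma fexp_remainder: "cmod (fexp x v - 1 - (- (2 * complex_of_real pi * \<i>) * complex_of_real (x \<bullet> v))) \<le> (2 * pi * (x \<bullet> v))^2 / 2"
proof -
 let ?t = "- (2 * pi * (x \<bullet> v))"
 have "cmod (iexp ?t - (\<Sum>k\<le>1. (\<i> * ?t)^k / fact k)) \<le> \<bar>?t\<bar>^(Suc 1) / fact (Suc 1)"
  by (rule iexp_approx1)
 moreover have "iexp ?t = fexp x v" by (simp add: fexp_cis cis_conv_exp)
 moreover have "(\<Sum>k\<le>1. (\<i> * ?t)^k / fact k) = 1 + (- (2 * complex_of_real pi * \<i>) * complex_of_real (x \<bullet> v))"
  by (simp add: mult_ac)
 moreover have "\<bar>?t\<bar>^(Suc 1) / fact (Suc 1) = (2 * pi * (x \<bullet> v))^2 / 2"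
  by (simp add: power2_eq_square abs_mult)
 ultimately show ?thesis by (simp only: diff_diff_eq)
qed

text \<open>Differentiation under the integral sign by the second-order remainder of the character,
  which is uniformly quadratic because the support of \<open>K\<close> is bounded.\<close>

lemma fourier_has_derivative:
 fixes K :: "R3 \<Rightarrow> complex"
 assumes K: "compactly_supported K"
 shows "(fourier K has_derivative (\<lambda>v. fourier (\<lambda>x. (- (2 * complex_of_real pi * \<i>) * complex_of_real (x \<bullet> v)) * K x) y)) (at y)"
proof -
 let ?c = "\<lambda>x v. - (2 * complex_of_real pi * \<i>) * complex_of_real (x \<bullet> v)"
 let ?L = "\<lambda>v. fourier (\<lambda>x. ?c x v * K x) y"
 have Kv: "compactly_supported (\<lambda>x. ?c x v * K x)" for v
  by (rule compactly_supported_mult[OF K]) (intro continuous_intros)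
 have iv: "integrable lborel (\<lambda>x. ?c x v * K x * fexp x y)" for v y
  by (intro integrable_mult_fexp compactly_supported_integrable Kv)
 have iK: "integrable lborel (\<lambda>x. K x * fexp x y)" for y
  by (intro integrable_mult_fexp compactly_supported_integrable K)
 have lin: "linear ?L"
 proof (rule linearI)
  fix v w
  have "?L (v + w) = (LI x. ?c x v * K x * fexp x y + ?c x w * K x * fexp x y)"
   unfolding fourier_alt by (intro integral_cong refl) (simp only: inner_add_right of_real_add distrib_left distrib_right)
  also have "\<dots> = ?L v + ?L w"
   unfolding fourier_alt by (rule Bochner_Integration.integral_add[OF iv iv])
  finally show "?L (v + w) = ?L v + ?L w" .
 next
  fix r :: real and v
  have "?L (r *\<^sub>R v) = (LI x. complex_of_real r * (?c x v * K x * fexp x y))"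
   unfolding fourier_alt by (intro integral_cong refl) (simp only: inner_scaleR_right of_real_mult mult_ac)
  also have "\<dots> = r *\<^sub>R ?L v" unfolding fourier_alt by (simp add: scaleR_conv_of_real)
  finally show "?L (r *\<^sub>R v) = r *\<^sub>R ?L v" .
 qed
 obtain R where R: "R > 0" "\<And>x. norm x > R \<Longrightarrow> K x = 0" using compactly_supportedE[OF K] by metis
 have inK: "integrable lborel (\<lambda>x. cmod (K x))" using compactly_supported_integrable[OF K] by simp
 define C where "C = 2 * pi^2 * R^2 * (LI x. cmod (K x))"
 have rem: "cmod (fourier K z - fourier K y - ?L (z - y)) \<le> C * (norm (z - y))^2" for z
 proof -
  let ?v = "z - y"
  have "fourier K z - fourier K y - ?L ?v = (LI x. K x * fexp x z - K x * fexp x y - ?c x ?v * K x * fexp x y)"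
   unfolding fourier_alt
   by (subst integral_diff[OF integrable_diff[OF iK iK] iv],
     subst integral_diff[OF iK iK]) (rule refl)
  also have "\<dots> = (LI x. K x * fexp x y * (fexp x ?v - 1 - ?c x ?v))"
  proof (intro integral_cong refl)
   fix x
   have "fexp x z = fexp x y * fexp x ?v" using fexp_add_right[of x y ?v] by simp
   then show "K x * fexp x z - K x * fexp x y - ?c x ?v * K x * fexp x y = K x * fexp x y * (fexp x ?v - 1 - ?c x ?v)"
    by (simp only:) (simp add: algebra_simps)
  qed
  finally have "cmod (fourier K z - fourier K y - ?L ?v) = cmod (LI x. K x * fexp x y * (fexp x ?v - 1 - ?c x ?v))" by simp
  also have "\<dots> \<le> (LI x. cmod (K x) * (2 * pi^2 * R^2 * (norm ?v)^2))"
  proof (rule Bochner_Integration.integral_norm_bound_integral)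
   have "(\<lambda>x. K x * fexp x y * (fexp x ?v - 1 - ?c x ?v)) = (\<lambda>x. K x * fexp x z - K x * fexp x y - ?c x ?v * K x * fexp x y)"
   proof
    fix x
    have "fexp x z = fexp x y * fexp x ?v" using fexp_add_right[of x y ?v] by simp
    then show "K x * fexp x y * (fexp x ?v - 1 - ?c x ?v) = K x * fexp x z - K x * fexp x y - ?c x ?v * K x * fexp x y"
     by (simp only:) (simp add: algebra_simps)
   qed
   then show "integrable lborel (\<lambda>x. K x * fexp x y * (fexp x ?v - 1 - ?c x ?v))"
    using iK iv by simp
   show "integrable lborel (\<lambda>x. cmod (K x) * (2 * pi^2 * R^2 * (norm ?v)^2))" using inK by simp
   fix x
   show "norm (K x * fexp x y * (fexp x ?v - 1 - ?c x ?v)) \<le> cmod (K x) * (2 * pi^2 * R^2 * (norm ?v)^2)"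
   proof (cases "norm x \<le> R")
    case True
    have "\<bar>x \<bullet> ?v\<bar> \<le> R * norm ?v"
     using Cauchy_Schwarz_ineq2[of x ?v] True by (meson mult_right_mono norm_ge_zero order_trans)
    then have "(x \<bullet> ?v)^2 \<le> (R * norm ?v)^2" by (metis abs_ge_zero power2_abs power_mono)
    then have "(2 * pi * (x \<bullet> ?v))^2 / 2 \<le> 2 * pi^2 * R^2 * (norm ?v)^2"
     by (simp add: power_mult_distrib mult_left_mono)
    then have "cmod (fexp x ?v - 1 - ?c x ?v) \<le> 2 * pi^2 * R^2 * (norm ?v)^2" using fexp_remainder[of x ?v] by linarith
    then show ?thesis by (simp only: norm_mult norm_fexp mult_1_right) (rule mult_left_mono, simp_all)
   qed (use R(2)[of x] in simp)
  qed
  also have "\<dots> = C * (norm ?v)^2" by (simp add: C_def)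
  finally show ?thesis .
 qed
 show ?thesis
 proof (rule has_derivativeI_sandwich[of 1])
  show "bounded_linear ?L" using lin linear_conv_bounded_linear by blast
  show "norm (fourier K z - fourier K y - ?L (z - y)) / norm (z - y) \<le> C * norm (z - y)" if "z \<noteq> y" for z
   using rem[of z] that by (simp add: divide_le_eq power2_eq_square mult.assoc)
  have "((\<lambda>z. C * norm (z - y)) \<longlongrightarrow> C * norm (y - y)) (at y)" by (intro tendsto_intros)
  then show "((\<lambda>z. C * norm (z - y)) \<longlongrightarrow> 0) (at y)" by simp
 qed simp
qed

text \<open>A power is absorbed by x^n \<le> n! exp x, and completing the square bounds r - c r^2 by
  1/(4c).\<close>

lemma gaussian_decay:
 fixes c :: real assumes c: "c > 0"
 shows "\<exists>B. \<forall>y::R3. (1 + norm y) ^ n * exp (- (c * (norm y)^2)) \<le> B"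
proof (intro exI allI)
 fix y :: R3
 let ?r = "norm y"
 have pow: "x ^ n \<le> fact n * exp x" if "0 \<le> x" for x :: real
 proof -
  have "x ^ n /\<^sub>R fact n = (\<Sum>k\<in>{n}. x ^ k /\<^sub>R fact k)" by simp
  also have "\<dots> \<le> (\<Sum>k. x ^ k /\<^sub>R fact k)" using that summable_exp_generic[of x] by (intro sum_le_suminf) auto
  also have "\<dots> = exp x" by (simp add: exp_def)
  finally show ?thesis by (simp add: field_simps)
 qed
 have "?r - c * ?r^2 \<le> 1 / (4 * c)"
 proof -
  have "0 \<le> (2 * c * ?r - 1)^2" by simp
  then have "4 * c * (?r - c * ?r^2) \<le> 1" by (simp add: power2_eq_square algebra_simps)
  then show ?thesis using c by (simp add: pos_le_divide_eq mult.commute)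
 qed
 then have e: "exp (1 + ?r) * exp (- (c * ?r^2)) \<le> exp (1 + 1 / (4 * c))"
  by (simp add: exp_add[symmetric])
 have "(1 + ?r) ^ n * exp (- (c * ?r^2)) \<le> fact n * exp (1 + ?r) * exp (- (c * ?r^2))"
  by (intro mult_right_mono pow) auto
 also have "\<dots> \<le> fact n * exp (1 + 1 / (4 * c))" using e by (simp add: mult.assoc mult_left_mono)
 finally show "(1 + ?r) ^ n * exp (- (c * ?r^2)) \<le> fact n * exp (1 + 1 / (4 * c))" .
qed

text \<open>The exponent is general in the induction, since a linear factor consumes one power of
  decay of the function it multiplies.\<close>

lemma gclass_decay:
 assumes "gclass s \<phi>" and s: "s > 0"
 shows "\<exists>B. \<forall>y. (1 + norm y) ^ n * cmod (\<phi> y) \<le> B"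
 using assms(1)
proof (induction arbitrary: n)
 case (base K)
 define F where "F = (LI x. cmod (K x))"
 have F0: "0 \<le> F" by (simp add: F_def)
 obtain B where B: "\<And>y::R3. (1 + norm y) ^ n * exp (- (pi * s * (norm y)^2)) \<le> B"
  using gaussian_decay[of "pi * s" n] s by auto
 show ?case
 proof (intro exI allI)
  fix y
  have "(1 + norm y) ^ n * cmod (complex_of_real (exp (- (pi * s * (norm y)^2))) * fourier K y)
    = ((1 + norm y) ^ n * exp (- (pi * s * (norm y)^2))) * cmod (fourier K y)" by (simp add: norm_mult)
  also have "\<dots> \<le> B * F"
  proof (rule mult_mono[OF B])
   show "cmod (fourier K y) \<le> F" unfolding F_def by (rule norm_fourier_le[OF compactly_supported_integrable[OF base]])
   have "0 \<le> (1 + norm y) ^ n * exp (- (pi * s * (norm y)^2))" by simp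
   then show "0 \<le> B" using B[of y] by linarith
  qed simp
  finally show "(1 + norm y) ^ n * cmod (complex_of_real (exp (- (pi * s * (norm y)^2))) * fourier K y) \<le> B * F" .
 qed
next
 case (add \<phi> \<psi>)
 obtain B1 B2 where B: "\<And>y. (1 + norm y) ^ n * cmod (\<phi> y) \<le> B1" "\<And>y. (1 + norm y) ^ n * cmod (\<psi> y) \<le> B2"
  using add.IH by metis
 show ?case
 proof (intro exI allI)
  fix y
  have "(1 + norm y) ^ n * cmod (\<phi> y + \<psi> y) \<le> (1 + norm y) ^ n * (cmod (\<phi> y) + cmod (\<psi> y))"
   by (intro mult_left_mono norm_triangle_ineq) simp
  then show "(1 + norm y) ^ n * cmod (\<phi> y + \<psi> y) \<le> B1 + B2" using B[of y] by (simp add: distrib_left)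
 qed
next
 case (scale \<phi> c)
 obtain B where B: "\<And>y. (1 + norm y) ^ n * cmod (\<phi> y) \<le> B" using scale.IH by metis
 show ?case
 proof (intro exI allI)
  fix y
  have "cmod c * ((1 + norm y) ^ n * cmod (\<phi> y)) \<le> cmod c * B" by (intro mult_left_mono B) simp
  then show "(1 + norm y) ^ n * cmod (c * \<phi> y) \<le> cmod c * B" by (simp add: norm_mult mult_ac)
 qed
next
 case (lin \<phi> v)
 obtain B where B: "\<And>y. (1 + norm y) ^ Suc n * cmod (\<phi> y) \<le> B" using lin.IH by metis
 show ?case
 proof (intro exI allI)
  fix y
  have "\<bar>y \<bullet> v\<bar> \<le> norm v * (1 + norm y)"
   using Cauchy_Schwarz_ineq2[of y v] by (simp add: algebra_simps add_increasing)
  then have "\<bar>y \<bullet> v\<bar> * ((1 + norm y) ^ n * cmod (\<phi> y)) \<le> norm v * (1 + norm y) * ((1 + norm y) ^ n * cmod (\<phi> y))"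
   by (intro mult_right_mono) auto
  also have "\<dots> = norm v * ((1 + norm y) ^ Suc n * cmod (\<phi> y))" by (simp add: mult_ac)
  also have "\<dots> \<le> norm v * B" by (intro mult_left_mono B) simp
  finally show "(1 + norm y) ^ n * cmod (complex_of_real (y \<bullet> v) * \<phi> y) \<le> norm v * B" by (simp add: norm_mult mult_ac)
 qed
qed

lemma gclass_derivative:
 assumes "gclass s \<phi>"
 shows "\<exists>D. (\<forall>y. (\<phi> has_derivative D y) (at y)) \<and> (\<forall>v. gclass s (\<lambda>y. D y v))"
 using assms
proof induction
 case (base K)
 let ?G = "\<lambda>y::R3. complex_of_real (exp (- (pi * s * (norm y)^2)))"
 let ?c = "\<lambda>x v. - (2 * complex_of_real pi * \<i>) * complex_of_real (x \<bullet> v)"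
 let ?Fv = "\<lambda>y v. fourier (\<lambda>x. ?c x v * K x) y"
 \<comment> \<open>The second summand comes from the Gaussian; the constant -2 pi s is moved into
   the direction vector so that it has the form of rule \<open>lin\<close>.\<close>
 let ?D = "\<lambda>y v. ?G y * ?Fv y v + complex_of_real (y \<bullet> ((- (2 * pi * s)) *\<^sub>R v)) * (?G y * fourier K y)"
 have "((\<lambda>y. ?G y * fourier K y) has_derivative ?D y) (at y)" for y
 proof -
  have g: "((\<lambda>y::R3. exp (- (pi * s * (y \<bullet> y)))) has_derivative (\<lambda>v. exp (- (pi * s * (y \<bullet> y))) * (- (pi * s * (2 * (y \<bullet> v)))))) (at y)"
   by (auto intro!: derivative_eq_intros simp: inner_commute algebra_simps)
  have G: "(?G has_derivative (\<lambda>v. complex_of_real (exp (- (pi * s * (norm y)^2)) * (- (pi * s * (2 * (y \<bullet> v))))))) (at y)"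
   using has_derivative_of_real[OF g] unfolding power2_norm_eq_inner by simp
  show ?thesis
   by (rule has_derivative_eq_rhs[OF has_derivative_mult[OF G fourier_has_derivative[OF base]]])
     (simp add: fun_eq_iff mult_ac)
 qed
 moreover have "gclass s (\<lambda>y. ?D y v)" for v
  by (intro gclass.add gclass.lin gclass.base base compactly_supported_mult continuous_intros)
 ultimately show ?case by (intro exI[of _ ?D]) auto
next
 case (add \<phi> \<psi>)
 obtain D1 D2 where D: "\<And>y. (\<phi> has_derivative D1 y) (at y)" "\<And>v. gclass s (\<lambda>y. D1 y v)"
  "\<And>y. (\<psi> has_derivative D2 y) (at y)" "\<And>v. gclass s (\<lambda>y. D2 y v)" using add.IH by metis
 show ?case
  by (rule exI[of _ "\<lambda>y v. D1 y v + D2 y v"]) (auto intro!: has_derivative_add D gclass.add)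
next
 case (scale \<phi> c)
 obtain D where D: "\<And>y. (\<phi> has_derivative D y) (at y)" "\<And>v. gclass s (\<lambda>y. D y v)" using scale.IH by metis
 show ?case
  by (rule exI[of _ "\<lambda>y v. c * D y v"]) (auto intro!: has_derivative_mult_right D gclass.scale)
next
 case (lin \<phi> w)
 obtain D where D: "\<And>y. (\<phi> has_derivative D y) (at y)" "\<And>v. gclass s (\<lambda>y. D y v)" using lin.IH by metis
 have "((\<lambda>y. complex_of_real (y \<bullet> w) * \<phi> y) has_derivative (\<lambda>v. complex_of_real (y \<bullet> w) * D y v + complex_of_real (v \<bullet> w) * \<phi> y)) (at y)" for y
  by (rule has_derivative_mult[OF _ D(1)]) (auto intro!: derivative_eq_intros)
 moreover have "gclass s (\<lambda>y. complex_of_real (y \<bullet> w) * D y v + complex_of_real (v \<bullet> w) * \<phi> y)" for v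
  by (intro gclass.add gclass.lin gclass.scale D lin.hyps)
 ultimately show ?case
  by (intro exI[of _ "\<lambda>y v. complex_of_real (y \<bullet> w) * D y v + complex_of_real (v \<bullet> w) * \<phi> y"]) auto
qed

lemma gclass_dderiv:
 assumes "gclass s \<phi>"
 shows "gclass s (dderiv vs \<phi>)"
proof (induction vs)
 case (Cons v vs)
 obtain D where D: "\<And>y. (dderiv vs \<phi> has_derivative D y) (at y)" "\<And>v. gclass s (\<lambda>y. D y v)"
  using gclass_derivative[OF Cons.IH] by metis
 have "dderiv (v # vs) \<phi> x = D x v" for x
 proof -
  have l: "((\<lambda>t::real. x + t *\<^sub>R v) has_derivative (\<lambda>t. t *\<^sub>R v)) (at 0)" by (auto intro!: derivative_eq_intros)
  have "(dderiv vs \<phi> has_derivative D x) (at (x + 0 *\<^sub>R v))" using D(1)[of x] by simp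
  from has_derivative_compose[OF l this]
  have "((\<lambda>t. dderiv vs \<phi> (x + t *\<^sub>R v)) has_derivative (\<lambda>t. D x (t *\<^sub>R v))) (at 0)" .
  moreover have "D x (t *\<^sub>R v) = t *\<^sub>R D x v" for t
   using has_derivative_linear[OF D(1)] by (rule linear_scale)
  ultimately have "((\<lambda>t. dderiv vs \<phi> (x + t *\<^sub>R v)) has_vector_derivative D x v) (at 0)"
   by (simp add: has_vector_derivative_def)
  then show ?thesis by (simp add: vector_derivative_at)
 qed
 then have "dderiv (v # vs) \<phi> = (\<lambda>x. D x v)" by (rule ext)
 then show ?case using D(2) by metis
qed (use assms in simp)

lemma gclass_schwartz:
 assumes g: "gclass s \<phi>" and s: "s > 0"
 shows "schwartz \<phi>"
 unfolding schwartz_def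
proof (intro conjI allI)
 fix vs x
 show "dderiv vs \<phi> differentiable at x"
  using gclass_derivative[OF gclass_dderiv[OF g, of vs]] unfolding differentiable_def by blast
next
 fix vs n
 obtain B where B: "\<And>y. (1 + norm y) ^ n * cmod (dderiv vs \<phi> y) \<le> B"
  using gclass_decay[OF gclass_dderiv[OF g] s] by metis
 show "bounded (range (\<lambda>x. (1 + norm x) ^ n * cmod (dderiv vs \<phi> x)))"
  using B by (intro boundedI[where B=B]) auto
qed

text \<open>The purpose of mollifying with Gaussians: this Fourier transform may be inserted for h
  in conditions (a) and (c).\<close>

lemma schwartz_fourier_gconv:
 assumes K: "compactly_supported K" "\<And>x. 0 \<le> K x" and s: "s > 0"
 shows "schwartz (fourier (\<lambda>x. complex_of_real (gconv s K x)))"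
proof -
 have "fourier (\<lambda>x. complex_of_real (gconv s K x)) = (\<lambda>y. complex_of_real (exp (- (pi * s * (norm y)^2))) * fourier (\<lambda>x. complex_of_real (K x)) y)"
  using fourier_gconv[OF K s] by (intro ext)
 moreover have "compactly_supported (\<lambda>x. complex_of_real (K x))"
  using K(1) by (auto simp: compactly_supported_def intro!: continuous_intros)
 ultimately have "gclass s (fourier (\<lambda>x. complex_of_real (gconv s K x)))" using gclass.base by metis
 then show ?thesis using s by (rule gclass_schwartz)
qed

section \<open>Fourier extension\<close>

lemma nn_integral_eq_cmod_integral:
 fixes q :: "R3 \<Rightarrow> real"
 assumes "integrable lborel q" "\<And>x. 0 \<le> q x"
 shows "(LI+ x. ennreal (q x)) = ennreal (cmod (LI x. complex_of_real (q x)))"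
proof -
 have "(LI+ x. ennreal (q x)) = ennreal (LI x. q x)"
  by (rule nn_integral_eq_integral[OF assms(1)]) (use assms(2) in auto)
 moreover have "0 \<le> (LI x. q x)" using assms(2) by (intro integral_nonneg_AE) auto
 ultimately show ?thesis unfolding integral_complex_of_real norm_of_real by simp
qed

context restriction_measure begin

text \<open>The Fourier transform of the measure with density \<beta>. It is the transpose, without
  conjugation, of restricting Fourier transforms to \<tau>, as
  \<open>integral_mult_extension\<close> shows.\<close>

definition extension :: "(R3 \<Rightarrow> complex) \<Rightarrow> R3 \<Rightarrow> complex" where
 "extension \<beta> x = (TI \<omega>. \<beta> \<omega> * fexp x \<omega>)"

definition bounded_borel :: "(R3 \<Rightarrow> complex) \<Rightarrow> bool" where
 "bounded_borel \<beta> \<longleftrightarrow> \<beta> \<in> borel_measurable borel \<and> (\<exists>B. \<forall>\<omega>. cmod (\<beta> \<omega>) \<le> B)"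

lemma bounded_borel_measurable: "bounded_borel \<beta> \<Longrightarrow> \<beta> \<in> borel_measurable borel"
 by (simp add: bounded_borel_def)

lemma bounded_borel_integrable:
 assumes "bounded_borel \<beta>"
 shows "integrable \<tau> \<beta>"
proof -
 obtain B where "\<And>\<omega>. cmod (\<beta> \<omega>) \<le> B" using assms by (auto simp: bounded_borel_def)
 then show ?thesis using bounded_borel_measurable[OF assms]
  by (intro integrable_const_bound[where B=B]) (auto cong: measurable_cong_sets)
qed

lemma continuous_on_extension:
 assumes "bounded_borel \<beta>"
 shows "continuous_on UNIV (extension \<beta>)"
proof -
 have [measurable]: "\<beta> \<in> borel_measurable borel" by (rule bounded_borel_measurable[OF assms])
 have i: "integrable \<tau> (\<lambda>\<omega>. cmod (\<beta> \<omega>))" using bounded_borel_integrable[OF assms] by simp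
 show ?thesis unfolding extension_def
 proof (rule continuous_on_integral_param[OF _ i])
  show "(\<lambda>\<omega>. \<beta> \<omega> * fexp y \<omega>) \<in> borel_measurable \<tau>" for y by measurable
 qed (auto simp: norm_mult intro!: continuous_intros)
qed

lemma measurable_extension: "bounded_borel \<beta> \<Longrightarrow> extension \<beta> \<in> borel_measurable borel"
 by (intro borel_measurable_continuous_onI continuous_on_extension)

lemma norm_extension_le: "cmod (extension \<beta> x) \<le> (TI \<omega>. cmod (\<beta> \<omega>))"
 unfolding extension_def using integral_norm_bound[of \<tau> "\<lambda>\<omega>. \<beta> \<omega> * fexp x \<omega>"] by (simp add: norm_mult)

lemma sf_tau: "sigma_finite_measure \<tau>" by (rule sigma_finite_measure_axioms)

lemma measurable_tau_lborel:
 "f \<in> borel_measurable (borel \<Otimes>\<^sub>M borel) \<Longrightarrow> f \<in> borel_measurable (\<tau> \<Otimes>\<^sub>M lborel)"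
 by (subst measurable_cong_sets[OF sets_pair_measure_cong[OF sets_eq sets_lborel] refl])

lemma integral_mult_extension:
 assumes p: "integrable lborel p" and \<beta>: "bounded_borel \<beta>"
 shows "(LI x. p x * extension \<beta> x) = (TI \<omega>. \<beta> \<omega> * fourier p \<omega>)"
proof -
 have "(LI x. p x * extension \<beta> x) = (LI x. TI \<omega>. \<beta> \<omega> * p x * fexp x \<omega>)"
  unfolding extension_def by (simp only: integral_mult_right_zero[symmetric] mult_ac)
 also have "\<dots> = (TI \<omega>. LI x. \<beta> \<omega> * p x * fexp x \<omega>)"
 proof (rule Fubini_bounded[OF sf_tau sigma_finite_lborel bounded_borel_integrable[OF \<beta>] p, where B=1])
  have "(\<lambda>(\<omega>, x). fexp x \<omega>) \<in> borel_measurable (borel \<Otimes>\<^sub>M borel)" by measurable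
  then show "(\<lambda>(\<omega>, x). fexp x \<omega>) \<in> borel_measurable (\<tau> \<Otimes>\<^sub>M lborel)" by (rule measurable_tau_lborel)
 qed simp
 also have "\<dots> = (TI \<omega>. \<beta> \<omega> * fourier p \<omega>)"
  unfolding fourier_alt by (simp only: integral_mult_right_zero[symmetric] mult.assoc)
 finally show ?thesis .
qed

text \<open>In the product of one extension with the conjugate of another, x enters through the
  character at \<omega> - \<omega>' only.\<close>

lemma extension_product_integral:
 assumes p: "integrable lborel p" and \<beta>: "bounded_borel \<beta>" and \<gamma>: "bounded_borel \<gamma>"
 shows "(LI x. p x * (extension \<beta> x * cnj (extension \<gamma> x)))
    = (TI \<omega>. TI \<omega>'. \<beta> \<omega> * cnj (\<gamma> \<omega>') * fourier p (\<omega> - \<omega>'))"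
proof -
 have [measurable]: "p \<in> borel_measurable borel" using p by auto
 note [measurable] = measurable_extension[OF \<gamma>] bounded_borel_measurable[OF \<gamma>]
 have c\<gamma>: "integrable \<tau> (\<lambda>\<omega>. cnj (\<gamma> \<omega>))" using bounded_borel_integrable[OF \<gamma>] by simp
 have pc: "integrable lborel (\<lambda>x. p x * cnj (extension \<gamma> x))"
  by (rule integrable_mult_bounded[OF p, where B="TI \<omega>. cmod (\<gamma> \<omega>)"]) (auto simp: norm_extension_le)
 have cE: "cnj (extension \<gamma> x) = (TI \<omega>'. cnj (\<gamma> \<omega>') * cnj (fexp x \<omega>'))" for x
  unfolding extension_def by (simp add: Bochner_Integration.integral_cnj[symmetric])
 have "(LI x. p x * (extension \<beta> x * cnj (extension \<gamma> x))) = (LI x. p x * cnj (extension \<gamma> x) * extension \<beta> x)"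
  by (simp only: mult_ac)
 also have "\<dots> = (TI \<omega>. \<beta> \<omega> * fourier (\<lambda>x. p x * cnj (extension \<gamma> x)) \<omega>)"
  by (rule integral_mult_extension[OF pc \<beta>])
 also have "\<dots> = (TI \<omega>. TI \<omega>'. \<beta> \<omega> * cnj (\<gamma> \<omega>') * fourier p (\<omega> - \<omega>'))"
 proof (rule integral_cong[OF refl])
  fix \<omega>
  have "fourier (\<lambda>x. p x * cnj (extension \<gamma> x)) \<omega> = (LI x. TI \<omega>'. cnj (\<gamma> \<omega>') * p x * fexp x (\<omega> - \<omega>'))"
  proof (unfold fourier_alt, rule integral_cong[OF refl])
   fix x
   have "p x * cnj (extension \<gamma> x) * fexp x \<omega> = (p x * fexp x \<omega>) * (TI \<omega>'. cnj (\<gamma> \<omega>') * cnj (fexp x \<omega>'))"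
    unfolding cE by (simp only: mult_ac)
   also have "\<dots> = (TI \<omega>'. (p x * fexp x \<omega>) * (cnj (\<gamma> \<omega>') * cnj (fexp x \<omega>')))"
    by (rule integral_mult_right_zero[symmetric])
   also have "\<dots> = (TI \<omega>'. cnj (\<gamma> \<omega>') * p x * fexp x (\<omega> - \<omega>'))"
    unfolding fexp_diff_right by (simp only: mult_ac)
   finally show "p x * cnj (extension \<gamma> x) * fexp x \<omega> = (TI \<omega>'. cnj (\<gamma> \<omega>') * p x * fexp x (\<omega> - \<omega>'))" .
  qed
  also have "\<dots> = (TI \<omega>'. LI x. cnj (\<gamma> \<omega>') * p x * fexp x (\<omega> - \<omega>'))"
  proof (rule Fubini_bounded[OF sf_tau sigma_finite_lborel c\<gamma> p, where B=1])
   have "(\<lambda>(\<omega>', x). fexp x (\<omega> - \<omega>')) \<in> borel_measurable (borel \<Otimes>\<^sub>M borel)" by measurable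
   then show "(\<lambda>(\<omega>', x). fexp x (\<omega> - \<omega>')) \<in> borel_measurable (\<tau> \<Otimes>\<^sub>M lborel)" by (rule measurable_tau_lborel)
  qed simp
  also have "\<dots> = (TI \<omega>'. cnj (\<gamma> \<omega>') * fourier p (\<omega> - \<omega>'))"
   unfolding fourier_alt by (simp only: integral_mult_right_zero[symmetric] mult.assoc)
  finally have e: "fourier (\<lambda>x. p x * cnj (extension \<gamma> x)) \<omega> = (TI \<omega>'. cnj (\<gamma> \<omega>') * fourier p (\<omega> - \<omega>'))" .
  show "\<beta> \<omega> * fourier (\<lambda>x. p x * cnj (extension \<gamma> x)) \<omega> = (TI \<omega>'. \<beta> \<omega> * cnj (\<gamma> \<omega>') * fourier p (\<omega> - \<omega>'))"
   unfolding e by (simp only: integral_mult_right_zero[symmetric] mult.assoc)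
 qed
 finally show ?thesis .
qed

text \<open>The common engine of all later estimates. The quadratic form \<open>q\<close> is
  nonnegative, so its integral is the modulus of a double integral over \<tau>, and a pointwise
  majorant of the total kernel by g(\<omega>) g(\<omega>') \<Phi>(\<omega> - \<omega>') brings it
  under \<open>bilinear_le\<close>. The indices are scales, or a single one for plain
  restriction.\<close>

lemma quadratic_extension_bound:
 assumes I: "finite I" and p: "\<And>i j. i \<in> I \<Longrightarrow> j \<in> I \<Longrightarrow> integrable lborel (p i j)"
  and \<beta>: "\<And>i. i \<in> I \<Longrightarrow> bounded_borel (\<beta> i)"
  and g [measurable]: "g \<in> borel_measurable borel" and g0: "\<And>\<omega>. 0 \<le> g \<omega>"
  and \<Phi>: "continuous_on UNIV \<Phi>" "\<And>z. 0 \<le> \<Phi> z"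
  and bd: "\<And>\<omega> \<omega>'. cmod (\<Sum>i\<in>I. \<Sum>j\<in>I. \<beta> i \<omega> * cnj (\<beta> j \<omega>') * fourier (p i j) (\<omega> - \<omega>')) \<le> g \<omega> * g \<omega>' * \<Phi> (\<omega> - \<omega>')"
  and q: "\<And>x. (\<Sum>i\<in>I. \<Sum>j\<in>I. p i j x * (extension (\<beta> i) x * cnj (extension (\<beta> j) x))) = complex_of_real (q x)"
  and q0: "\<And>x. 0 \<le> q x"
 shows "(LI+ x. ennreal (q x))^2
   \<le> ennreal A * (TI+ x. (ennreal (g x))^2)^2 * (LI+ z. (ennreal (\<Phi> z))^2)"
proof -
 let ?S = "\<lambda>x. (\<Sum>i\<in>I. \<Sum>j\<in>I. p i j x * (extension (\<beta> i) x * cnj (extension (\<beta> j) x)))"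
 let ?r = "\<lambda>i j \<omega> \<omega>'. \<beta> i \<omega> * cnj (\<beta> j \<omega>') * fourier (p i j) (\<omega> - \<omega>')"
 have cb: "bounded_borel (\<lambda>\<omega>. cnj (\<beta> j \<omega>))" if "j \<in> I" for j
  using \<beta>[OF that] by (auto simp: bounded_borel_def intro: measurable_cnj)
 have ipair: "integrable (\<tau> \<Otimes>\<^sub>M \<tau>) (\<lambda>(\<omega>, \<omega>'). ?r i j \<omega> \<omega>')" if ij: "i \<in> I" "j \<in> I" for i j
 proof (rule integrable_pair_bounded[OF sf_tau sf_tau bounded_borel_integrable[OF \<beta>[OF ij(1)]] bounded_borel_integrable[OF cb[OF ij(2)]]])
  have [measurable]: "fourier (p i j) \<in> borel_measurable borel" by (rule measurable_fourier[OF p[OF ij]])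
  show "(\<lambda>(\<omega>, \<omega>'). fourier (p i j) (\<omega> - \<omega>')) \<in> borel_measurable (\<tau> \<Otimes>\<^sub>M \<tau>)" by measurable
  show "cmod (fourier (p i j) (x - y)) \<le> (LI x. cmod (p i j x))" for x y by (rule norm_fourier_le[OF p[OF ij]])
 qed
 interpret pair_sigma_finite \<tau> \<tau> by (simp add: pair_sigma_finite_def sf_tau)
 have ip: "integrable lborel (\<lambda>x. p i j x * (extension (\<beta> i) x * cnj (extension (\<beta> j) x)))" if ij: "i \<in> I" "j \<in> I" for i j
 proof -
  note [measurable] = measurable_extension[OF \<beta>[OF ij(1)]] measurable_extension[OF \<beta>[OF ij(2)]]
  show ?thesis
  proof (rule integrable_mult_bounded[OF p[OF ij], where B="(TI \<omega>. cmod (\<beta> i \<omega>)) * (TI \<omega>. cmod (\<beta> j \<omega>))"])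
   show "cmod (extension (\<beta> i) x * cnj (extension (\<beta> j) x)) \<le> (TI \<omega>. cmod (\<beta> i \<omega>)) * (TI \<omega>. cmod (\<beta> j \<omega>))" for x
    unfolding norm_mult complex_mod_cnj by (intro mult_mono norm_extension_le) auto
  qed measurable
 qed
 have "integrable lborel (\<lambda>x. complex_of_real (q x))"
  unfolding q[symmetric] by (intro integrable_sum ip)
 then have "integrable lborel q" using complex_of_real_integrable_eq by blast
 from nn_integral_eq_cmod_integral[OF this q0]
 have X: "(LI+ x. ennreal (q x)) = ennreal (cmod (LI x. ?S x))" unfolding q .
 have "(LI x. ?S x)
   = (\<Sum>i\<in>I. \<Sum>j\<in>I. LI x. p i j x * (extension (\<beta> i) x * cnj (extension (\<beta> j) x)))"
  by (subst integral_sum, intro integrable_sum ip, assumption, assumption)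
    (intro sum.cong refl integral_sum ip)
 also have "\<dots> = (\<Sum>i\<in>I. \<Sum>j\<in>I. \<integral>z. case_prod (?r i j) z \<partial>(\<tau> \<Otimes>\<^sub>M \<tau>))"
 proof (intro sum.cong refl)
  fix i j assume ij: "i \<in> I" "j \<in> I"
  show "(LI x. p i j x * (extension (\<beta> i) x * cnj (extension (\<beta> j) x))) = (\<integral>z. case_prod (?r i j) z \<partial>(\<tau> \<Otimes>\<^sub>M \<tau>))"
   using extension_product_integral[OF p[OF ij] \<beta>[OF ij(1)] \<beta>[OF ij(2)]] integral_fst'[OF ipair[OF ij]] by simp
 qed
 also have "\<dots> = (\<integral>z. (\<Sum>i\<in>I. \<Sum>j\<in>I. case_prod (?r i j) z) \<partial>(\<tau> \<Otimes>\<^sub>M \<tau>))"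
  by (subst integral_sum, intro integrable_sum ipair, assumption, assumption)
    (intro sum.cong refl integral_sum[symmetric] ipair)
 finally have eq: "(LI x. ?S x)
   = (\<integral>z. (\<Sum>i\<in>I. \<Sum>j\<in>I. case_prod (?r i j) z) \<partial>(\<tau> \<Otimes>\<^sub>M \<tau>))" .
 have [measurable]: "\<Phi> \<in> borel_measurable borel" using \<Phi>(1) by (rule borel_measurable_continuous_onI)
 have "ennreal (cmod (\<integral>z. (\<Sum>i\<in>I. \<Sum>j\<in>I. case_prod (?r i j) z) \<partial>(\<tau> \<Otimes>\<^sub>M \<tau>)))
   \<le> (\<integral>\<^sup>+z. ennreal (cmod (\<Sum>i\<in>I. \<Sum>j\<in>I. case_prod (?r i j) z)) \<partial>(\<tau> \<Otimes>\<^sub>M \<tau>))"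
  by (rule integral_norm_bound_ennreal) (intro integrable_sum ipair)
 also have "\<dots> \<le> (\<integral>\<^sup>+z. ennreal (g (fst z)) * ennreal (g (snd z)) * ennreal (\<Phi> (fst z - snd z)) \<partial>(\<tau> \<Otimes>\<^sub>M \<tau>))"
 proof (rule nn_integral_mono)
  fix z :: "R3 \<times> R3"
  have "cmod (\<Sum>i\<in>I. \<Sum>j\<in>I. case_prod (?r i j) z) \<le> g (fst z) * g (snd z) * \<Phi> (fst z - snd z)"
   using bd[of "fst z" "snd z"] by (simp only: case_prod_beta)
  then have "ennreal (cmod (\<Sum>i\<in>I. \<Sum>j\<in>I. case_prod (?r i j) z)) \<le> ennreal (g (fst z) * g (snd z) * \<Phi> (fst z - snd z))"
   by (rule ennreal_leI)
  then show "ennreal (cmod (\<Sum>i\<in>I. \<Sum>j\<in>I. case_prod (?r i j) z)) \<le> ennreal (g (fst z)) * ennreal (g (snd z)) * ennreal (\<Phi> (fst z - snd z))"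
   using g0 \<Phi>(2) by (simp only: ennreal_mult mult_nonneg_nonneg)
 qed
 also have "\<dots> = (TI+ x. TI+ y. ennreal (g (fst (x, y))) * ennreal (g (snd (x, y))) * ennreal (\<Phi> (fst (x, y) - snd (x, y))))"
  by (rule sigma_finite_measure.nn_integral_fst[OF sf_tau, symmetric]) measurable
 finally have le: "ennreal (cmod (LI x. ?S x))
   \<le> (TI+ x. TI+ y. ennreal (g x) * ennreal (g y) * ennreal (\<Phi> (x - y)))"
  unfolding eq fst_conv snd_conv .
 have "(LI+ x. ennreal (q x))^2
   \<le> (TI+ x. TI+ y. ennreal (g x) * ennreal (g y) * ennreal (\<Phi> (x - y)))^2"
  unfolding X by (rule power_mono[OF le]) simp
 also have "\<dots> \<le> ennreal A * (TI+ x. (ennreal (g x))^2)^2 * (LI+ z. (ennreal (\<Phi> z))^2)"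
  by (rule bilinear_le) (use \<Phi> in auto)
 finally show ?thesis .
qed

end

text \<open>An \<open>L\<^sup>4\<close> bound from testing \<open>|E|\<^sup>2\<close> against mollified functions: let the mollification tend to zero and
 test against a truncation of \<open>|E|\<^sup>2\<close> itself.\<close>
lemma L4_by_testing:
 fixes E :: "R3 \<Rightarrow> complex"
 assumes E: "continuous_on UNIV E" and C: "C < \<infinity>"
  and test: "\<And>K s. compactly_supported K \<Longrightarrow> (\<And>x. 0 \<le> K x) \<Longrightarrow> s > 0 \<Longrightarrow>
   (LI+ x. ennreal (gconv s K x) * (ennreal (cmod (E x)))^2)\<^sup>2 \<le> C * (LI+ x. (ennreal (K x))^2)"
 shows "(LI+ x. (ennreal (cmod (E x)))^4) \<le> C"
proof -
 let ?e = "\<lambda>x. ennreal (cmod (E x))"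
 have [measurable]: "E \<in> borel_measurable borel" using E by (rule borel_measurable_continuous_onI)
 \<comment> \<open>A continuous cut-off that is 1 for |x| \<le> n - 1 and 0 for |x| \<ge> n,
   increasing in n.\<close>
 define chi where "chi n x = max 0 (min 1 (real n - norm x))" for n and x :: R3
 define K where "K n x = (cmod (E x))^2 * chi n x" for n x
 have chi: "0 \<le> chi n x" "chi n x \<le> 1" for n x by (auto simp: chi_def)
 have Kc: "compactly_supported (K n)" for n
  unfolding compactly_supported_def
 proof
  show "continuous_on UNIV (K n)" unfolding K_def chi_def by (intro continuous_intros E)
  show "\<exists>R. \<forall>x. R < norm x \<longrightarrow> K n x = 0" by (rule exI[of _ "real n"]) (auto simp: K_def chi_def)
 qed
 have K0: "0 \<le> K n x" for n x using chi by (simp add: K_def)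
 have Km [measurable]: "K n \<in> borel_measurable borel" for n by (rule K_measurable[OF Kc K0, of 1]) simp
 have bound: "(LI+ x. ennreal (K n x) * (?e x)^2) \<le> C" for n
 proof -
  let ?J = "LI+ x. ennreal (K n x) * (?e x)^2"
  let ?a = "\<lambda>m. LI+ x. ennreal (gconv (1 / real (Suc m)) (K n) x) * (?e x)^2"
  have gm [measurable]: "gconv (1 / real (Suc m)) (K n) \<in> borel_measurable borel" for m
   by (rule gconv_measurable[OF Kc K0]) simp
  have "?J = (LI+ x. liminf (\<lambda>m. ennreal (gconv (1 / real (Suc m)) (K n) x) * (?e x)^2))"
  proof (rule nn_integral_cong)
   fix x
   have "(\<lambda>m. ennreal (gconv (1 / real (Suc m)) (K n) x * (cmod (E x))^2)) \<longlonglongrightarrow> ennreal (K n x * (cmod (E x))^2)"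
    by (intro tendsto_ennrealI tendsto_intros gconv_tendsto[OF Kc K0, of 1]) simp
   then have "(\<lambda>m. ennreal (gconv (1 / real (Suc m)) (K n) x) * (?e x)^2) \<longlonglongrightarrow> ennreal (K n x) * (?e x)^2"
    using K0 gconv_nonneg[OF Kc K0] by (simp add: ennreal_mult ennreal_power)
   then show "ennreal (K n x) * (?e x)^2 = liminf (\<lambda>m. ennreal (gconv (1 / real (Suc m)) (K n) x) * (?e x)^2)"
    using lim_imp_Liminf by (metis trivial_limit_sequentially)
  qed
  also have "\<dots> \<le> liminf ?a" by (rule nn_integral_liminf) measurable
  finally have J: "?J \<le> liminf ?a" .
  \<comment> \<open>Finiteness, a gift of the truncation, is what later permits cancelling one
    factor \<open>?J\<close>.\<close>
  have Jfin: "?J < \<infinity>"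
  proof -
   have cs: "compactly_supported (\<lambda>x. (cmod (E x))^2 * K n x)"
    by (rule compactly_supported_mult[OF Kc]) (intro continuous_intros E)
   have "?J = (LI+ x. ennreal ((cmod (E x))^2 * K n x))"
    using K0 by (intro nn_integral_cong) (simp add: ennreal_mult ennreal_power mult.commute)
   also have "\<dots> = ennreal (LI x. (cmod (E x))^2 * K n x)"
    by (rule nn_integral_eq_integral[OF compactly_supported_integrable[OF cs]]) (use K0 in auto)
   finally show ?thesis by simp
  qed
  have K2: "(LI+ x. (ennreal (K n x))^2) \<le> ?J"
  proof (rule nn_integral_mono)
   fix x
   have "K n x \<le> (cmod (E x))^2" unfolding K_def using chi[of n x] by (simp add: mult_left_le)
   then have "ennreal (K n x) \<le> (?e x)^2" by (simp add: ennreal_power ennreal_leI)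
   then show "(ennreal (K n x))^2 \<le> ennreal (K n x) * (?e x)^2" unfolding power2_eq_square[of "ennreal (K n x)"] by (rule mult_left_mono) simp
  qed
  \<comment> \<open>Since K^2 \<le> K |E|^2, the right-hand side of the test inequality is
    controlled by \<open>?J\<close> itself. The mollification is removed through numbers strictly
    below \<open>?J\<close>.\<close>
  have sq: "?J^2 \<le> C * ?J"
  proof (cases "?J = 0")
   case False
   have a2: "(?a m)^2 \<le> C * ?J" for m
    by (rule order_trans[OF test[OF Kc K0] mult_left_mono[OF K2]]) simp_all
   have "c^2 \<le> C * ?J" if "c < ?J" for c
   proof -
    have "c < liminf ?a" using that J by (rule less_le_trans)
    then have "\<forall>\<^sub>F m in sequentially. c < ?a m" by (rule less_LiminfD)
    then obtain m where "c < ?a m" by (auto dest: eventually_happens)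
    then show ?thesis using a2[of m] by (meson less_imp_le order_trans power_mono zero_le)
   qed
   note lt = this
   obtain j where j: "?J = ennreal j" "0 < j" using Jfin False by (cases ?J) auto
   have lim: "(\<lambda>n. ennreal ((j * (1 - 1 / real (Suc n)))^2)) \<longlonglongrightarrow> ennreal ((j * (1 - 0))^2)"
    using LIMSEQ_inverse_real_of_nat by (intro tendsto_ennrealI tendsto_intros) (simp add: inverse_eq_divide)
   have le: "ennreal ((j * (1 - 1 / real (Suc n)))^2) \<le> C * ?J" for n
   proof -
    have "ennreal (j * (1 - 1 / real (Suc n))) < ?J"
     unfolding j using j(2) by (intro ennreal_lessI) (auto simp: field_simps)
    from lt[OF this] show ?thesis using j(2) by (simp add: ennreal_power)
   qed
   have "ennreal ((j * (1 - 0))^2) \<le> C * ?J"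
    by (rule LIMSEQ_le_const2[OF lim]) (intro exI[of _ 0] allI impI le)
   then show ?thesis unfolding j using j(2) by (simp add: ennreal_power)
  qed simp
  show ?thesis
  proof (cases "?J = 0")
   case False
   from sq have "?J * ?J \<le> ?J * C" by (simp only: power2_eq_square mult.commute)
   then show ?thesis using False Jfin by (subst (asm) ennreal_mult_le_mult_iff) auto
  qed simp
 qed
 have "(LI+ x. (?e x)^4) = (LI+ x. (SUP n. ennreal (K n x) * (?e x)^2))"
 proof (rule nn_integral_cong)
  fix x :: R3
  have le: "ennreal (K n x) * (?e x)^2 \<le> (?e x)^4" for n
  proof -
   have "K n x * (cmod (E x))^2 \<le> (cmod (E x))^2 * (cmod (E x))^2" unfolding K_def using chi[of n x] by (intro mult_right_mono) (auto simp: mult_left_le)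
   then have "ennreal (K n x * (cmod (E x))^2) \<le> ennreal ((cmod (E x))^4)" by (intro ennreal_leI) (simp add: power_add[symmetric])
   then show ?thesis using K0 by (simp add: ennreal_mult ennreal_power)
  qed
  obtain N where N: "real N > norm x + 1" using reals_Archimedean2 by blast
  have "chi N x = 1" using N by (simp add: chi_def)
  then have "ennreal (K N x * (cmod (E x))^2) = ennreal ((cmod (E x))^4)" by (simp add: K_def power_add[symmetric])
  then have eq: "ennreal (K N x) * (?e x)^2 = (?e x)^4" using K0 by (simp add: ennreal_mult ennreal_power)
  show "(?e x)^4 = (SUP n. ennreal (K n x) * (?e x)^2)"
  proof (rule antisym)
   show "(?e x)^4 \<le> (SUP n. ennreal (K n x) * (?e x)^2)"
    unfolding eq[symmetric] by (rule SUP_upper) simp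
   show "(SUP n. ennreal (K n x) * (?e x)^2) \<le> (?e x)^4" by (rule SUP_least) (rule le)
  qed
 qed
 also have "\<dots> = (SUP n. LI+ x. ennreal (K n x) * (?e x)^2)"
 proof (rule nn_integral_monotone_convergence_SUP)
  show "incseq (\<lambda>n x. ennreal (K n x) * (?e x)^2)"
  proof (intro incseq_SucI le_funI)
   fix n x
   have "chi n x \<le> chi (Suc n) x" by (auto simp: chi_def)
   then have "ennreal (K n x) \<le> ennreal (K (Suc n) x)" by (intro ennreal_leI) (simp add: K_def mult_left_mono)
   then show "ennreal (K n x) * (?e x)^2 \<le> ennreal (K (Suc n) x) * (?e x)^2" by (rule mult_right_mono) simp
  qed
 qed measurable
 also have "\<dots> \<le> C" by (intro SUP_least bound)
 finally show ?thesis .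
qed

section \<open>A pathwise Lepingle inequality\<close>

primrec rmax :: "(nat \<Rightarrow> complex) \<Rightarrow> nat \<Rightarrow> real" where
 "rmax y 0 = cmod (y 0)"
| "rmax y (Suc n) = max (rmax y n) (cmod (y (Suc n)))"

text \<open>The path sampled at stopping times: stop again once it has moved from the last sampled value by
 \<open>2\<^sup>-\<^sup>m\<close> times its running maximum.\<close>
primrec stopped :: "nat \<Rightarrow> (nat \<Rightarrow> complex) \<Rightarrow> nat \<Rightarrow> complex" where
 "stopped m y 0 = y 0"
| "stopped m y (Suc n) = (if rmax y (Suc n) / 2 ^ m \<le> cmod (y (Suc n) - stopped m y n) then y (Suc n) else stopped m y n)"

definition stopped_square :: "nat \<Rightarrow> (nat \<Rightarrow> complex) \<Rightarrow> nat \<Rightarrow> real" where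
 "stopped_square m y n = (\<Sum>i<n. (cmod (stopped m y (Suc i) - stopped m y i))^2)"

lemma rmax_ge: "i \<le> n \<Longrightarrow> cmod (y i) \<le> rmax y n"
proof (induction n)
 case (Suc n)
 then show ?case by (cases "i = Suc n") (auto simp: le_Suc_eq le_max_iff_disj)
qed simp

lemma rmax_mono: "i \<le> n \<Longrightarrow> rmax y i \<le> rmax y n"
 by (induction n) (auto simp: le_Suc_eq le_max_iff_disj)

lemma rmax_nonneg: "0 \<le> rmax y n"
 using rmax_ge[of 0 n y] by (meson le0 norm_ge_zero order_trans)

lemma rmax_le: "(\<And>i. i \<le> n \<Longrightarrow> cmod (y i) \<le> B) \<Longrightarrow> rmax y n \<le> B"
 by (induction n) auto

lemma stopped_close: "cmod (y n - stopped m y n) \<le> rmax y n / 2 ^ m"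
 using rmax_nonneg[of y n] by (cases n) auto

lemma norm_stopped_le: "cmod (stopped m y n) \<le> rmax y n"
 by (induction n) (auto simp: le_max_iff_disj)

lemma stopped_const:
 assumes "l \<le> r" "\<And>i. l \<le> i \<Longrightarrow> i < r \<Longrightarrow> cmod (y (Suc i) - stopped m y i) < rmax y (Suc i) / 2 ^ m"
 shows "stopped m y r = stopped m y l"
 using assms
proof (induction r)
 case (Suc r)
 show ?case
 proof (cases "l = Suc r")
  case False
  then have "stopped m y r = stopped m y l" using Suc by auto
  moreover have "cmod (y (Suc r) - stopped m y r) < rmax y (Suc r) / 2 ^ m"
   by (rule Suc.prems(2)) (use Suc.prems(1) False in simp_all)
  ultimately show ?thesis by simp
 qed simp
qed simp

text \<open>Discrete integration by parts. While the sample is kept, the squared deviation of the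
  path from it changes along with the inner products; at a stop that deviation is booked in
  \<open>stopped_square\<close> and reset to 0. For a martingale the inner products have expectation
  zero.\<close>

lemma stopped_square_identity:
 "stopped_square m y n + (cmod (y n - stopped m y n))^2 + (cmod (y 0))^2
   + 2 * (\<Sum>i<n. stopped m y i \<bullet> (y (Suc i) - y i)) = (cmod (y n))^2"
proof (induction n)
 case (Suc n)
 have step: "(cmod (b - v))^2 - (cmod (a - v))^2 + 2 * (v \<bullet> (b - a)) = (cmod b)^2 - (cmod a)^2" for a b v :: complex
  unfolding power2_norm_eq_inner by (simp add: inner_diff_left inner_diff_right inner_commute)
 show ?case
  using Suc step[of "y (Suc n)" "stopped m y n" "y n"] by (simp add: stopped_square_def)
qed (simp add: stopped_square_def)

lemma stopped_square_le:
 "stopped_square m y n \<le> (cmod (y n))^2 - 2 * (\<Sum>i<n. stopped m y i \<bullet> (y (Suc i) - y i))"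
 using stopped_square_identity[of m y n] zero_le_power2[of "cmod (y n - stopped m y n)"] zero_le_power2[of "cmod (y 0)"]
 by linarith

text \<open>Doob's maximal inequality in pathwise form: for a martingale the sum has expectation zero.\<close>
lemma rmax_square_le:
 "(rmax y n)^2 \<le> 4 * (cmod (y n))^2 - 4 * (\<Sum>i<n. (rmax y i *\<^sub>R sgn (y i)) \<bullet> (y (Suc i) - y i))"
proof -
 have sub: "(rmax y i *\<^sub>R sgn (y i)) \<bullet> (y (Suc i) - y i) \<le> rmax y i * (cmod (y (Suc i)) - cmod (y i))" for i
 proof -
  have "sgn (y i) \<bullet> y (Suc i) \<le> norm (sgn (y i)) * norm (y (Suc i))" by (rule norm_cauchy_schwarz)
  also have "\<dots> \<le> cmod (y (Suc i))" by (simp add: norm_sgn)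
  finally have 1: "sgn (y i) \<bullet> y (Suc i) \<le> cmod (y (Suc i))" .
  have 2: "sgn (y i) \<bullet> y i = cmod (y i)"
   unfolding sgn_div_norm inner_scaleR_left power2_norm_eq_inner[symmetric]
   by (cases "y i = 0") (simp_all add: power2_eq_square)
  have "sgn (y i) \<bullet> (y (Suc i) - y i) \<le> cmod (y (Suc i)) - cmod (y i)" using 1 2 by (simp add: inner_diff_right)
  then show ?thesis using rmax_nonneg[of y i] by (simp add: mult_left_mono)
 qed
 \<comment> \<open>Induction over time. Only a step to a new maximum b > M needs an argument, and
   there (b - M)^2 \<ge> 0 decides.\<close>
 have main: "(rmax y n)^2 / 2 \<le> rmax y n * cmod (y n) - (\<Sum>i<n. rmax y i * (cmod (y (Suc i)) - cmod (y i)))"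
 proof (induction n)
  case 0
  show ?case by (simp add: power2_eq_square)
 next
  case (Suc n)
  let ?M = "rmax y n" and ?a = "cmod (y n)" and ?b = "cmod (y (Suc n))"
  show ?case
  proof (cases "?b \<le> ?M")
   case True
   then show ?thesis using Suc by (simp add: max_absorb1 algebra_simps)
  next
   case False
   then have m: "rmax y (Suc n) = ?b" by simp
   have "?b^2 / 2 - ?b * ?b + ?M * ?b \<le> ?M^2 / 2"
    using zero_le_power2[of "?b - ?M"] by (simp add: power2_eq_square algebra_simps)
   then show ?thesis using Suc unfolding m by (simp add: algebra_simps)
  qed
 qed
 have "rmax y n * cmod (y n) \<le> (rmax y n)^2 / 4 + (cmod (y n))^2"
  using zero_le_power2[of "rmax y n / 2 - cmod (y n)"] by (simp add: power2_eq_square algebra_simps)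
 moreover have "(\<Sum>i<n. (rmax y i *\<^sub>R sgn (y i)) \<bullet> (y (Suc i) - y i)) \<le> (\<Sum>i<n. rmax y i * (cmod (y (Suc i)) - cmod (y i)))"
  by (intro sum_mono sub)
 ultimately show ?thesis using main by linarith
qed

text \<open>The sampled path stays within 2^(-m) times the running maximum of the path, so a jump
  exceeding twice this threshold forces a stop in the interval. At the last such stop the running
  maximum is still at least half of its final value. The constant 8 is this 2 times the 4 of the
  upper hypothesis.\<close>

lemma jump_captured:
 assumes lr: "l < r" and m: "m \<ge> 1"
  and lo: "2 * (rmax y r / 2 ^ m) < cmod (y r - y l)" and hi: "cmod (y r - y l) \<le> 4 * (rmax y r / 2 ^ m)"
 obtains i where "l \<le> i" "i < r" "cmod (y r - y l) \<le> 8 * cmod (stopped m y (Suc i) - stopped m y i)"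
proof -
 let ?stop = "\<lambda>i. rmax y (Suc i) / 2 ^ m \<le> cmod (y (Suc i) - stopped m y i)"
 let ?S = "{i. l \<le> i \<and> i < r \<and> ?stop i}"
 have ne: "?S \<noteq> {}"
 proof
  assume "?S = {}"
  then have "stopped m y r = stopped m y l" using lr by (intro stopped_const) (auto simp: not_le)
  then have "cmod (y r - y l) \<le> cmod (y r - stopped m y r) + cmod (y l - stopped m y l)"
   using norm_triangle_ineq4[of "y r - stopped m y r" "y l - stopped m y l"] by simp
  also have "\<dots> \<le> rmax y r / 2 ^ m + rmax y l / 2 ^ m" by (intro add_mono stopped_close)
  also have "\<dots> \<le> 2 * (rmax y r / 2 ^ m)"
  proof -
   have "rmax y l / 2 ^ m \<le> rmax y r / 2 ^ m" using rmax_mono[of l r y] lr by (intro divide_right_mono) auto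
   then show ?thesis by linarith
  qed
  finally show False using lo by simp
 qed
 \<comment> \<open>The last stop before \<open>r\<close>: afterwards the sample is frozen at y(i +
   1).\<close>
 define i where "i = Max ?S"
 have fin: "finite ?S" by (rule finite_subset[of _ "{..<r}"]) auto
 have "i \<in> ?S" unfolding i_def using fin ne by (rule Max_in)
 then have i: "l \<le> i" "i < r" "?stop i" by auto
 have no: "cmod (y (Suc j) - stopped m y j) < rmax y (Suc j) / 2 ^ m" if "i < j" "j < r" for j
 proof (rule ccontr)
  assume "\<not> ?thesis"
  then have "j \<in> ?S" using that i by auto
  then have "j \<le> i" unfolding i_def using fin by (intro Max_ge)
  then show False using that by simp
 qed
 have st: "stopped m y (Suc i) = y (Suc i)" using i(3) by simp
 have cst: "stopped m y s = y (Suc i)" if "Suc i \<le> s" "s \<le> r" for s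
  unfolding st[symmetric] by (rule stopped_const) (use that no in auto)
 \<comment> \<open>After the last stop the path remains close to a value already counted in the
   earlier running maximum.\<close>
 have "rmax y r \<le> rmax y (Suc i) + rmax y r / 2 ^ m"
 proof (rule rmax_le)
  fix s assume s: "s \<le> r"
  show "cmod (y s) \<le> rmax y (Suc i) + rmax y r / 2 ^ m"
  proof (cases "s \<le> Suc i")
   case True
   then show ?thesis using rmax_ge[of s "Suc i" y] rmax_nonneg[of y r] by (smt (verit) divide_nonneg_nonneg zero_le_power)
  next
   case False
   have "cmod (y s) \<le> cmod (y (Suc i)) + cmod (y s - stopped m y s)"
    using norm_triangle_ineq[of "y (Suc i)" "y s - y (Suc i)"] cst[of s] False s by simp
   also have "\<dots> \<le> rmax y (Suc i) + rmax y s / 2 ^ m" by (intro add_mono rmax_ge stopped_close) simp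
   also have "\<dots> \<le> rmax y (Suc i) + rmax y r / 2 ^ m" using rmax_mono[OF s, of y] by (simp add: divide_right_mono)
   finally show ?thesis .
  qed
 qed
 moreover have "rmax y r / 2 ^ m \<le> rmax y r / 2"
  using m rmax_nonneg[of y r] power_increasing[of 1 m "2::real"] by (intro divide_left_mono) auto
 ultimately have "rmax y r \<le> 2 * rmax y (Suc i)" by linarith
 then have "rmax y r / 2 ^ m \<le> 2 * (rmax y (Suc i) / 2 ^ m)" by (simp add: divide_right_mono)
 also have "\<dots> \<le> 2 * cmod (stopped m y (Suc i) - stopped m y i)" unfolding st using i(3) by simp
 finally show ?thesis using that[of i] i hi by linarith
qed

text \<open>The least m whose threshold is below the jump; it is not 0 because a jump never exceeds
  twice the running maximum.\<close>

lemma jump_scale_exists: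
 assumes "l < r" "y r \<noteq> y l"
 obtains m where "m \<ge> 1" "2 * (rmax y r / 2 ^ m) < cmod (y r - y l)" "cmod (y r - y l) \<le> 4 * (rmax y r / 2 ^ m)"
proof -
 let ?d = "cmod (y r - y l)" and ?P = "\<lambda>m. 2 * (rmax y r / 2 ^ m) < cmod (y r - y l)"
 have d: "0 < ?d" using assms by simp
 have dle: "?d \<le> 2 * rmax y r"
  using norm_triangle_ineq4[of "y r" "y l"] rmax_ge[of r r y] rmax_ge[of l r y] assms by linarith
 obtain n where "2 * rmax y r / ?d < 2 ^ n" using real_arch_pow[of 2 "2 * rmax y r / ?d"] by auto
 then have "?P n" using d by (simp add: field_simps)
 define m where "m = (LEAST m. ?P m)"
 have Pm: "?P m" unfolding m_def using \<open>?P n\<close> by (rule LeastI)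
 have m0: "m \<noteq> 0" using Pm dle by (intro notI) simp
 then obtain k where k: "m = Suc k" by (cases m) auto
 have "\<not> ?P k" using not_less_Least[of k ?P] k unfolding m_def by auto
 then have "?d \<le> 4 * (rmax y r / 2 ^ m)" unfolding k by simp
 then show ?thesis using that[of m] Pm m0 by auto
qed

text \<open>The outer 64 is the square of the 8 in \<open>jump_captured\<close>. The inner 64 is 16
  from the squared bound 4M on jumps times 4 from Doob's inequality, and the geometric series sums
  the levels m.\<close>

definition lepingle_const :: "real \<Rightarrow> real" where
 "lepingle_const \<rho> = 64 * (64 + 1 / (1 - 2 powr (2 - \<rho>)))"

definition lepingle_integrand :: "real \<Rightarrow> (nat \<Rightarrow> complex) \<Rightarrow> nat \<Rightarrow> complex" where
 "lepingle_integrand \<rho> y i = 64 *\<^sub>R (64 *\<^sub>R (rmax y i *\<^sub>R sgn (y i)) + 2 *\<^sub>R (\<Sum>m. (2 powr (2 - \<rho>)) ^ m *\<^sub>R stopped m y i))"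

text \<open>A multiple of the terminal square minus a martingale transform. The integrand at time i
  collects the Doob term and all sampled paths, and depends on the path up to time i only.\<close>

definition lepingle_bound :: "real \<Rightarrow> nat \<Rightarrow> (nat \<Rightarrow> complex) \<Rightarrow> real" where
 "lepingle_bound \<rho> N y = lepingle_const \<rho> * (cmod (y N))^2 - (\<Sum>i<N. lepingle_integrand \<rho> y i \<bullet> (y (Suc i) - y i))"

lemma summable_stopped:
 assumes "\<rho> > 2"
 shows "summable (\<lambda>m. (2 powr (2 - \<rho>)) ^ m *\<^sub>R stopped m y i)"
proof (rule summable_comparison_test'[where N=0])
 show "summable (\<lambda>m. (2 powr (2 - \<rho>)) ^ m * rmax y i)"
  using assms by (intro summable_mult2 summable_geometric) (auto simp: powr_less_one)
 show "norm ((2 powr (2 - \<rho>)) ^ m *\<^sub>R stopped m y i) \<le> (2 powr (2 - \<rho>)) ^ m * rmax y i" for m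
  using norm_stopped_le[of m y i] by (simp add: mult_left_mono)
qed

lemma lepingle_bound_eq:
 assumes \<rho>: "\<rho> > 2"
 defines "\<theta> \<equiv> 2 powr (2 - \<rho>)"
 shows "lepingle_bound \<rho> N y = 64 * (16 * (4 * (cmod (y N))^2 - 4 * (\<Sum>i<N. (rmax y i *\<^sub>R sgn (y i)) \<bullet> (y (Suc i) - y i)))
   + (\<Sum>m. \<theta> ^ m * ((cmod (y N))^2 - 2 * (\<Sum>i<N. stopped m y i \<bullet> (y (Suc i) - y i)))))"
  and "summable (\<lambda>m. \<theta> ^ m * ((cmod (y N))^2 - 2 * (\<Sum>i<N. stopped m y i \<bullet> (y (Suc i) - y i))))"
proof -
 have th: "0 < \<theta>" "\<theta> < 1" using \<rho> by (auto simp: \<theta>_def powr_less_one)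
 let ?d = "\<lambda>i. y (Suc i) - y i" and ?Y = "(cmod (y N))^2"
 let ?Z = "\<lambda>i. \<Sum>m. \<theta> ^ m *\<^sub>R stopped m y i"
 have sz: "(\<lambda>m. \<theta> ^ m *\<^sub>R stopped m y i) sums ?Z i" for i
  using summable_stopped[OF \<rho>, of y i] unfolding \<theta>_def by (rule summable_sums)
 have s1: "(\<lambda>m. (\<theta> ^ m *\<^sub>R stopped m y i) \<bullet> ?d i) sums (?Z i \<bullet> ?d i)" for i
  by (rule bounded_linear.sums[OF bounded_linear_inner_left sz])
 have "(\<lambda>m. \<Sum>i<N. (\<theta> ^ m *\<^sub>R stopped m y i) \<bullet> ?d i) sums (\<Sum>i<N. ?Z i \<bullet> ?d i)"
  by (rule sums_sum) (rule s1)
 then have s2: "(\<lambda>m. \<theta> ^ m * (\<Sum>i<N. stopped m y i \<bullet> ?d i)) sums (\<Sum>i<N. ?Z i \<bullet> ?d i)"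
  by (simp add: sum_distrib_left)
 have s3: "(\<lambda>m. \<theta> ^ m * ?Y) sums (1 / (1 - \<theta>) * ?Y)"
  using th by (intro sums_mult2 geometric_sums) simp
 have s4: "(\<lambda>m. \<theta> ^ m * (?Y - 2 * (\<Sum>i<N. stopped m y i \<bullet> ?d i))) sums (1 / (1 - \<theta>) * ?Y - 2 * (\<Sum>i<N. ?Z i \<bullet> ?d i))"
  using sums_diff[OF s3 sums_mult[OF s2, of 2]] by (simp add: right_diff_distrib mult.left_commute)
 then show "summable (\<lambda>m. \<theta> ^ m * (?Y - 2 * (\<Sum>i<N. stopped m y i \<bullet> ?d i)))" by (rule sums_summable)
 have "(\<Sum>i<N. lepingle_integrand \<rho> y i \<bullet> ?d i)
   = 64 * (64 * (\<Sum>i<N. (rmax y i *\<^sub>R sgn (y i)) \<bullet> ?d i) + 2 * (\<Sum>i<N. ?Z i \<bullet> ?d i))"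
  unfolding lepingle_integrand_def \<theta>_def[symmetric] inner_scaleR_left inner_add_left
  by (simp add: sum_distrib_left sum.distrib distrib_left)
 then show "lepingle_bound \<rho> N y = 64 * (16 * (4 * ?Y - 4 * (\<Sum>i<N. (rmax y i *\<^sub>R sgn (y i)) \<bullet> ?d i))
   + (\<Sum>m. \<theta> ^ m * (?Y - 2 * (\<Sum>i<N. stopped m y i \<bullet> ?d i))))"
  unfolding sums_unique[OF s4, symmetric] lepingle_bound_def lepingle_const_def \<theta>_def[symmetric]
  by (simp add: algebra_simps)
qed

text \<open>Each jump d gets a level m and a sampled increment on that level. With d \<le> 4M/2^m
  one has d^\<rho> \<le> (4M/2^m)^(\<rho> - 2) d^2, so level m carries the summable weight
  \<theta>^m. As the intervals are disjoint, the increments used on a level are distinct and their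
  squares are bounded by \<open>stopped_square\<close>. The inequality holds for every path, without
  probability.\<close>

theorem lepingle_pathwise:
 fixes y :: "nat \<Rightarrow> complex" and l r :: "'k \<Rightarrow> nat"
 assumes \<rho>: "\<rho> > 2" and K: "finite K" and lr: "\<And>k. k \<in> K \<Longrightarrow> l k < r k \<and> r k \<le> N"
  and disj: "\<And>k k'. k \<in> K \<Longrightarrow> k' \<in> K \<Longrightarrow> k \<noteq> k' \<Longrightarrow> {l k..<r k} \<inter> {l k'..<r k'} = {}"
 shows "((\<Sum>k\<in>K. cmod (y (r k) - y (l k)) powr \<rho>) powr (1/\<rho>))^2 \<le> lepingle_bound \<rho> N y"
proof -
 define \<theta> where "\<theta> = 2 powr (2 - \<rho>)"
 have th: "0 < \<theta>" "\<theta> < 1" using \<rho> by (auto simp: \<theta>_def powr_less_one)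
 let ?d = "\<lambda>k. cmod (y (r k) - y (l k))" and ?M = "rmax y N"
 define T where "T m = (cmod (y N))^2 - 2 * (\<Sum>i<N. stopped m y i \<bullet> (y (Suc i) - y i))" for m
 define A where "A = (\<Sum>m. \<theta> ^ m * T m)"
 have sumA: "summable (\<lambda>m. \<theta> ^ m * T m)" unfolding T_def \<theta>_def by (rule lepingle_bound_eq(2)[OF \<rho>])
 have ST: "stopped_square m y N \<le> T m" for m unfolding T_def by (rule stopped_square_le)
 have S0: "0 \<le> stopped_square m y N" for m unfolding stopped_square_def by (intro sum_nonneg) simp
 have T0: "0 \<le> T m" for m using S0 ST order_trans by blast
 have A0: "0 \<le> A" unfolding A_def using th T0 by (intro suminf_nonneg sumA) auto
 have M0: "0 \<le> ?M" by (rule rmax_nonneg)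
 let ?K = "{k\<in>K. y (r k) \<noteq> y (l k)}"
 \<comment> \<open>A level and an index of a sampled increment that together account for the jump
   over interval k.\<close>
 define P where "P k m i \<longleftrightarrow> l k \<le> i \<and> i < r k \<and> ?d k \<le> 8 * cmod (stopped m y (Suc i) - stopped m y i) \<and> ?d k \<le> 4 * (?M / 2 ^ m)" for k m i
 have "\<exists>p. P k (fst p) (snd p)" if "k \<in> ?K" for k
 proof -
  have k: "l k < r k" "r k \<le> N" "y (r k) \<noteq> y (l k)" using that lr by auto
  obtain m where m: "m \<ge> 1" "2 * (rmax y (r k) / 2 ^ m) < ?d k" "?d k \<le> 4 * (rmax y (r k) / 2 ^ m)"
   using jump_scale_exists[OF k(1,3)] by metis
  obtain i where i: "l k \<le> i" "i < r k" "?d k \<le> 8 * cmod (stopped m y (Suc i) - stopped m y i)"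
   using jump_captured[OF k(1) m] by metis
  have "4 * (rmax y (r k) / 2 ^ m) \<le> 4 * (?M / 2 ^ m)" using rmax_mono[OF k(2), of y] by (simp add: divide_right_mono)
  then have "?d k \<le> 4 * (?M / 2 ^ m)" using m(3) by linarith
  then have "P k (fst (m, i)) (snd (m, i))" unfolding P_def fst_conv snd_conv using i by blast
  then show ?thesis by blast
 qed
 then have "\<forall>k\<in>?K. \<exists>p. P k (fst p) (snd p)" by (intro ballI)
 from bchoice[OF this] obtain f where f: "\<forall>k\<in>?K. P k (fst (f k)) (snd (f k))" by (rule exE)
 define m i where "m k = fst (f k)" and "i k = snd (f k)" for k
 have mi: "l k \<le> i k \<and> i k < r k \<and> ?d k \<le> 8 * cmod (stopped (m k) y (Suc (i k)) - stopped (m k) y (i k)) \<and> ?d k \<le> 4 * (?M / 2 ^ m k)" if "k \<in> ?K" for k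
  using f[rule_format, OF that] unfolding P_def m_def i_def .
 have fK: "finite ?K" using K by simp
 have inj: "inj_on i ?K"
 proof (rule inj_onI, rule ccontr)
  fix k k' assume a: "k \<in> ?K" "k' \<in> ?K" "i k = i k'" "k \<noteq> k'"
  have "i k \<in> {l k..<r k} \<inter> {l k'..<r k'}" using mi[OF a(1)] mi[OF a(2)] a(3) by auto
  then show False using disj[of k k'] a by auto
 qed
 let ?inc = "\<lambda>m i. (cmod (stopped m y (Suc i) - stopped m y i))^2"
 \<comment> \<open>All but two powers of the jump are spent on the size bound of its level, the
   other two on the sampled increment.\<close>
 have each: "?d k powr \<rho> \<le> (4 * ?M) powr (\<rho> - 2) * 64 * (\<theta> ^ m k * ?inc (m k) (i k))" if k: "k \<in> ?K" for k
 proof -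
  have dpos: "0 < ?d k" using k by simp
  have "?d k powr \<rho> = ?d k powr (\<rho> - 2) * (?d k)^2"
  proof -
   have "?d k powr \<rho> = ?d k powr ((\<rho> - 2) + 2)" by simp
   also have "\<dots> = ?d k powr (\<rho> - 2) * ?d k powr 2" by (rule powr_add)
   finally show ?thesis using dpos by simp
  qed
  also have "\<dots> \<le> (4 * (?M / 2 ^ m k)) powr (\<rho> - 2) * (8 * cmod (stopped (m k) y (Suc (i k)) - stopped (m k) y (i k)))^2"
   using mi[OF k] \<rho> by (intro mult_mono powr_mono2 power_mono) auto
  also have "(4 * (?M / 2 ^ m k)) powr (\<rho> - 2) = (4 * ?M) powr (\<rho> - 2) * \<theta> ^ m k"
  proof -
   have "(4 * (?M / 2 ^ m k)) powr (\<rho> - 2) = (4 * ?M) powr (\<rho> - 2) / (2 ^ m k) powr (\<rho> - 2)"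
    using M0 by (simp add: powr_divide)
   also have "(2 ^ m k) powr (\<rho> - 2) = ((2::real) powr (\<rho> - 2)) ^ m k"
    by (simp add: powr_realpow[symmetric] powr_powr mult.commute)
   also have "(4 * ?M) powr (\<rho> - 2) / ((2::real) powr (\<rho> - 2)) ^ m k = (4 * ?M) powr (\<rho> - 2) * \<theta> ^ m k"
    unfolding \<theta>_def using powr_minus[of 2 "\<rho> - 2"] by (simp add: divide_inverse power_inverse)
   finally show ?thesis .
  qed
  finally show ?thesis by (simp add: power_mult_distrib mult_ac)
 qed
 have "(\<Sum>k\<in>K. ?d k powr \<rho>) = (\<Sum>k\<in>?K. ?d k powr \<rho>)"
  using K by (intro sum.mono_neutral_right) auto
 also have "\<dots> \<le> (\<Sum>k\<in>?K. (4 * ?M) powr (\<rho> - 2) * 64 * (\<theta> ^ m k * ?inc (m k) (i k)))"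
  by (intro sum_mono each)
 also have "\<dots> = (4 * ?M) powr (\<rho> - 2) * 64 * (\<Sum>k\<in>?K. \<theta> ^ m k * ?inc (m k) (i k))"
  by (simp add: sum_distrib_left)
 also have "\<dots> \<le> (4 * ?M) powr (\<rho> - 2) * 64 * A"
 proof (rule mult_left_mono)
  \<comment> \<open>Jumps are grouped by level. Within a level the indices are distinct, so the sum
    of squares is part of \<open>stopped_square\<close>.\<close>
  have "(\<Sum>k\<in>?K. \<theta> ^ m k * ?inc (m k) (i k)) = (\<Sum>n\<in>m ` ?K. \<Sum>k\<in>{k\<in>?K. m k = n}. \<theta> ^ m k * ?inc (m k) (i k))"
   by (rule sum.image_gen[OF fK])
  also have "\<dots> \<le> (\<Sum>n\<in>m ` ?K. \<theta> ^ n * T n)"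
  proof (rule sum_mono)
   fix n
   have "(\<Sum>k\<in>{k\<in>?K. m k = n}. \<theta> ^ m k * ?inc (m k) (i k)) = \<theta> ^ n * (\<Sum>k\<in>{k\<in>?K. m k = n}. ?inc n (i k))"
    by (simp add: sum_distrib_left)
   also have "(\<Sum>k\<in>{k\<in>?K. m k = n}. ?inc n (i k)) = (\<Sum>j\<in>i ` {k\<in>?K. m k = n}. ?inc n j)"
    by (rule sum.reindex_cong[symmetric, of i]) (auto intro: inj_on_subset[OF inj])
   also have "\<dots> \<le> stopped_square n y N"
    unfolding stopped_square_def
   proof (rule sum_mono2)
    show "i ` {k\<in>?K. m k = n} \<subseteq> {..<N}"
    proof
     fix j assume "j \<in> i ` {k\<in>?K. m k = n}"
     then obtain k where k: "k \<in> ?K" "j = i k" by blast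
     then have "i k < r k" "r k \<le> N" using mi[OF k(1)] lr[of k] by auto
     then show "j \<in> {..<N}" using k by simp
    qed
   qed auto
   finally have "(\<Sum>k\<in>{k\<in>?K. m k = n}. \<theta> ^ m k * ?inc (m k) (i k)) \<le> \<theta> ^ n * stopped_square n y N"
    using th by (simp add: mult_left_mono)
   also have "\<dots> \<le> \<theta> ^ n * T n" using th ST by (simp add: mult_left_mono)
   finally show "(\<Sum>k\<in>{k\<in>?K. m k = n}. \<theta> ^ m k * ?inc (m k) (i k)) \<le> \<theta> ^ n * T n" .
  qed
  also have "\<dots> \<le> A" unfolding A_def using th T0 fK by (intro sum_le_suminf sumA) auto
  finally show "(\<Sum>k\<in>?K. \<theta> ^ m k * ?inc (m k) (i k)) \<le> A" .
 qed simp
 finally have main: "(\<Sum>k\<in>K. ?d k powr \<rho>) \<le> (4 * ?M) powr (\<rho> - 2) * 64 * A" .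
 \<comment> \<open>Back from the power \<rho> to the power 2: M^2 and \<open>A\<close> appear with
   exponents (\<rho> - 2)/\<rho> and 2/\<rho>, which add up to 1, and Young's inequality makes the
   bound linear in both.\<close>
 have "((\<Sum>k\<in>K. ?d k powr \<rho>) powr (1/\<rho>))^2 = (\<Sum>k\<in>K. ?d k powr \<rho>) powr (2/\<rho>)"
  unfolding power2_eq_square powr_add[symmetric] by (simp add: add_divide_distrib[symmetric])
 also have "\<dots> \<le> ((4 * ?M) powr (\<rho> - 2) * 64 * A) powr (2/\<rho>)"
  using \<rho> main by (intro powr_mono2 sum_nonneg) auto
 also have "\<dots> = 64 powr (2/\<rho>) * (((4 * ?M)^2) powr ((\<rho> - 2)/\<rho>) * A powr (2/\<rho>))"
 proof -
  have "((4 * ?M)^2) powr ((\<rho> - 2)/\<rho>) = (4 * ?M) powr ((\<rho> - 2) * (2/\<rho>))"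
  proof (cases "?M = 0")
   case False
   then have "0 < 4 * ?M" using M0 by simp
   then have 1: "(4 * ?M)^2 = (4 * ?M) powr 2" by simp
   have 2: "2 * ((\<rho> - 2)/\<rho>) = (\<rho> - 2) * (2/\<rho>)" by simp
   show ?thesis unfolding 1 powr_powr 2 ..
  qed simp
  then show ?thesis using M0 A0 by (simp add: powr_mult powr_powr mult_ac)
 qed
 also have "\<dots> \<le> 64 * (16 * ?M^2 + A)"
 proof (rule mult_mono)
  show "(64::real) powr (2/\<rho>) \<le> 64" using powr_mono[of "2/\<rho>" 1 "64::real"] \<rho> by simp
  show "((4 * ?M)^2) powr ((\<rho> - 2)/\<rho>) * A powr (2/\<rho>) \<le> 16 * ?M^2 + A"
  proof (cases "?M = 0 \<or> A = 0")
   case True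
   then show ?thesis using A0 M0 by auto
  next
   case False
   have "((4 * ?M)^2) powr ((\<rho> - 2)/\<rho>) * A powr (2/\<rho>) \<le> ((\<rho> - 2)/\<rho>) * (4 * ?M)^2 + (2/\<rho>) * A"
    by (rule Youngs_inequality_0) (use False A0 M0 \<rho> in \<open>auto simp: field_simps\<close>)
   also have "\<dots> \<le> 1 * (4 * ?M)^2 + 1 * A"
    using \<rho> A0 by (intro add_mono mult_right_mono) (auto simp: field_simps)
   finally show ?thesis by (simp add: power_mult_distrib)
  qed
 qed auto
 also have "\<dots> \<le> 64 * (16 * (4 * (cmod (y N))^2 - 4 * (\<Sum>i<N. (rmax y i *\<^sub>R sgn (y i)) \<bullet> (y (Suc i) - y i))) + A)"
  using rmax_square_le[of y N] by simp
 also have "\<dots> = lepingle_bound \<rho> N y"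
  unfolding lepingle_bound_eq(1)[OF \<rho>] A_def T_def \<theta>_def ..
 finally show ?thesis .
qed

section \<open>Variation of the heat semigroup\<close>

text \<open>Predictability: this is what makes the transform have mean zero in
  \<open>martingale_step\<close>.\<close>

lemma lepingle_integrand_cong:
 assumes "\<And>i. i \<le> j \<Longrightarrow> y i = y' i"
 shows "lepingle_integrand \<rho> y j = lepingle_integrand \<rho> y' j"
proof -
 have r: "rmax y i = rmax y' i" if "i \<le> j" for i using that assms by (induction i) auto
 have "stopped m y i = stopped m y' i" if "i \<le> j" for i m using that
 proof (induction i)
  case (Suc i)
  then show ?case using r[of "Suc i"] assms[of "Suc i"] by (simp del: rmax.simps)
 qed (use assms in auto)
 then show ?thesis using r assms by (simp add: lepingle_integrand_def)
qed

lemma norm_lepingle_integrand_le: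
 assumes \<rho>: "\<rho> > 2" and B: "\<And>i. cmod (y i) \<le> B"
 shows "cmod (lepingle_integrand \<rho> y j) \<le> 64 * (64 * B + 2 * (B / (1 - 2 powr (2 - \<rho>))))"
proof -
 let ?\<theta> = "2 powr (2 - \<rho>)"
 have th: "0 < ?\<theta>" "?\<theta> < 1" using \<rho> by (auto simp: powr_less_one)
 have R: "rmax y i \<le> B" for i by (rule rmax_le) (rule B)
 have B0: "0 \<le> B" using B[of 0] norm_ge_zero order_trans by blast
 have sb: "cmod (stopped m y j) \<le> B" for m using norm_stopped_le[of m y j] R[of j] by linarith
 have gs: "summable (\<lambda>m. ?\<theta> ^ m * B)" using th by (intro summable_mult2 summable_geometric) simp
 have "cmod (\<Sum>m. ?\<theta> ^ m *\<^sub>R stopped m y j) \<le> (\<Sum>m. ?\<theta> ^ m * B)"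
  by (rule norm_suminf_le[OF _ gs]) (simp add: sb mult_left_mono)
 also have "\<dots> = B / (1 - ?\<theta>)" using th by (simp add: suminf_mult2[symmetric] summable_geometric suminf_geometric)
 finally have Z: "cmod (\<Sum>m. ?\<theta> ^ m *\<^sub>R stopped m y j) \<le> B / (1 - ?\<theta>)" .
 have M: "cmod (rmax y j *\<^sub>R sgn (y j)) \<le> B"
  using R[of j] rmax_nonneg[of y j] B0 by (simp add: norm_sgn)
 have "cmod (64 *\<^sub>R (rmax y j *\<^sub>R sgn (y j)) + 2 *\<^sub>R (\<Sum>m. ?\<theta> ^ m *\<^sub>R stopped m y j))
   \<le> 64 * cmod (rmax y j *\<^sub>R sgn (y j)) + 2 * cmod (\<Sum>m. ?\<theta> ^ m *\<^sub>R stopped m y j)"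
  by (rule order_trans[OF norm_triangle_ineq]) simp
 also have "\<dots> \<le> 64 * B + 2 * (B / (1 - ?\<theta>))" using M Z by linarith
 finally show ?thesis unfolding lepingle_integrand_def norm_scaleR by simp
qed

lemma measurable_lepingle:
 assumes [measurable]: "\<And>j. (\<lambda>\<omega>. Y \<omega> j) \<in> borel_measurable M"
 shows "(\<lambda>\<omega>. lepingle_integrand \<rho> (Y \<omega>) j) \<in> borel_measurable M" (is ?A)
  and "(\<lambda>\<omega>. lepingle_bound \<rho> N (Y \<omega>)) \<in> borel_measurable M" (is ?B)
proof -
 have r [measurable]: "(\<lambda>\<omega>. rmax (Y \<omega>) j) \<in> borel_measurable M" for j
 proof (induction j)
  case (Suc j)
  note [measurable] = Suc
  show ?case unfolding rmax.simps by measurable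
 qed simp
 have [measurable]: "(\<lambda>\<omega>. stopped m (Y \<omega>) j) \<in> borel_measurable M" for j m
 proof (induction j)
  case (Suc j)
  note [measurable] = Suc
  show ?case unfolding stopped.simps by measurable
 qed simp
 have [measurable]: "(\<lambda>\<omega>. sgn (Y \<omega> j)) \<in> borel_measurable M" for j
  unfolding sgn_div_norm by measurable
 show A: "(\<lambda>\<omega>. lepingle_integrand \<rho> (Y \<omega>) j) \<in> borel_measurable M" for j
  unfolding lepingle_integrand_def by measurable
 show ?B unfolding lepingle_bound_def using A by measurable
qed

definition gmeasure :: "real \<Rightarrow> R3 measure" where
 "gmeasure s = density lborel (\<lambda>x. ennreal (gauss s x))"

lemma sets_gmeasure [simp, measurable_cong]: "sets (gmeasure s) = sets borel"
 by (simp add: gmeasure_def)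

lemma space_gmeasure [simp]: "space (gmeasure s) = UNIV"
 by (simp add: gmeasure_def)

lemma prob_space_gmeasure: "s > 0 \<Longrightarrow> prob_space (gmeasure s)"
 by (rule prob_spaceI) (simp add: gmeasure_def emeasure_density nn_integral_gauss)

lemma integral_gmeasure:
 fixes f :: "R3 \<Rightarrow> complex"
 assumes [measurable]: "f \<in> borel_measurable borel" and s: "s > 0"
 shows "(\<integral>x. f x \<partial>gmeasure s) = (LI x. complex_of_real (gauss s x) * f x)"
 unfolding gmeasure_def by (subst integral_density) (auto simp: gauss_nonneg s scaleR_conv_of_real)

text \<open>On the Fourier side this is convolution with the Gaussian of parameter \<open>a\<close>,
  so the Fourier transforms of damped functions form the heat flow.\<close>

definition damp :: "real \<Rightarrow> (R3 \<Rightarrow> complex) \<Rightarrow> R3 \<Rightarrow> complex" where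
 "damp a p x = p x * complex_of_real (exp (- (pi * a * (norm x)^2)))"

lemma damp_add: "damp a (damp b p) = damp (a + b) p"
 unfolding damp_def by (intro ext) (simp add: exp_add[symmetric] of_real_mult[symmetric] algebra_simps del: of_real_mult)

lemma damp_0 [simp]: "damp 0 p = p"
 by (rule ext) (simp add: damp_def)

lemma integrable_damp:
 assumes "integrable lborel p" "a \<ge> 0"
 shows "integrable lborel (damp a p)"
 unfolding damp_def by (rule integrable_mult_bounded[OF assms(1), where B=1]) (use assms(2) in auto)

lemma integral_fexp_gmeasure:
 assumes s: "s > 0"
 shows "(\<integral>\<xi>. fexp x \<xi> \<partial>gmeasure s) = complex_of_real (exp (- (pi * s * (norm x)^2)))"
 using fourier_gauss[OF s, of x] by (subst integral_gmeasure[OF _ s]) (auto simp: fourier_alt fexp_commute)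

lemma fourier_gmeasure:
 assumes p: "integrable lborel p" and s: "s > 0"
 shows "(\<integral>\<xi>. fourier p (z - \<xi>) \<partial>gmeasure s) = fourier (damp s p) z"
proof -
 interpret prob_space "gmeasure s" by (rule prob_space_gmeasure[OF s])
 have one: "integrable (gmeasure s) (\<lambda>_. 1::complex)" by simp
 have "(\<integral>\<xi>. fourier p (z - \<xi>) \<partial>gmeasure s) = (\<integral>\<xi>. \<integral>x. p x * 1 * fexp x (z - \<xi>) \<partial>lborel \<partial>gmeasure s)"
  by (simp add: fourier_alt)
 also have "\<dots> = (LI x. \<integral>\<xi>. p x * 1 * fexp x (z - \<xi>) \<partial>gmeasure s)"
 proof (rule Fubini_bounded[OF sigma_finite_lborel sigma_finite_measure_axioms p one, where B=1])
  have "(\<lambda>(x, \<xi>). fexp x (z - \<xi>)) \<in> borel_measurable (borel \<Otimes>\<^sub>M borel)" by measurable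
  then show "(\<lambda>(x, \<xi>). fexp x (z - \<xi>)) \<in> borel_measurable (lborel \<Otimes>\<^sub>M gmeasure s)"
   by (subst measurable_cong_sets[OF sets_pair_measure_cong[OF sets_lborel sets_gmeasure] refl])
 qed simp
 also have "\<dots> = fourier (damp s p) z"
  unfolding fourier_alt
 proof (rule integral_cong[OF refl])
  fix x
  have "(\<integral>\<xi>. p x * 1 * fexp x (z - \<xi>) \<partial>gmeasure s) = (\<integral>\<xi>. (p x * fexp x z) * cnj (fexp x \<xi>) \<partial>gmeasure s)"
   by (simp add: fexp_diff_right mult.assoc)
  also have "\<dots> = (p x * fexp x z) * (\<integral>\<xi>. cnj (fexp x \<xi>) \<partial>gmeasure s)" by (rule integral_mult_right_zero)
  also have "(\<integral>\<xi>. cnj (fexp x \<xi>) \<partial>gmeasure s) = cnj (\<integral>\<xi>. fexp x \<xi> \<partial>gmeasure s)" by simp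
  finally show "(\<integral>\<xi>. p x * 1 * fexp x (z - \<xi>) \<partial>gmeasure s) = damp s p x * fexp x z"
   unfolding integral_fexp_gmeasure[OF s] damp_def complex_cnj_complex_of_real by (simp only: mult_ac)
 qed
 finally show ?thesis .
qed

text \<open>Rota's dilation: for the random walk with Gaussian steps started from Lebesgue measure, the values of the damped
 functions along the walk form a martingale in reversed time, and their expectations given the starting point are the
 functions damped twice.\<close>
locale heat_walk =
 fixes p :: "R3 \<Rightarrow> complex" and N :: nat and \<delta> :: "nat \<Rightarrow> real" and \<rho> :: real
 assumes p: "integrable lborel p" and \<delta>: "\<And>k. \<delta> k > 0" and \<rho>: "\<rho> > 2"
begin

definition c where "c i = (\<Sum>k\<le>i. \<delta> k)"
definition u where "u i = fourier (damp (c i) p)"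
definition W where "W = Pi\<^sub>M {..N} (\<lambda>k. gmeasure (\<delta> k))"
definition fwd :: "(nat \<Rightarrow> R3) \<Rightarrow> nat \<Rightarrow> R3" where "fwd \<xi> i = (\<Sum>k\<le>i. \<xi> k)"
definition bwd :: "(nat \<Rightarrow> R3) \<Rightarrow> nat \<Rightarrow> R3" where "bwd \<xi> i = (\<Sum>k\<in>{i<..N}. \<xi> k)"
text \<open>Here \<open>x\<close> is the end point of the walk, hence \<open>x - bwd \<xi> i\<close>
  its position after step i, and j = N - i counts back from the end. Moving back in time, the heat
  flow is evaluated at ever smaller parameters.\<close>

definition Y :: "R3 \<Rightarrow> (nat \<Rightarrow> R3) \<Rightarrow> nat \<Rightarrow> complex" where "Y x \<xi> j = u (N - j) (x - bwd \<xi> (N - j))"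
definition B where "B = (LI x. cmod (p x))"

sublocale product_prob_space "\<lambda>k. gmeasure (\<delta> k)"
 by (intro product_prob_spaceI prob_space_gmeasure \<delta>)

lemma prob_W: "prob_space W"
 unfolding W_def by (intro prob_space_PiM prob_space_gmeasure \<delta>)

lemma c_nonneg: "0 \<le> c i" unfolding c_def by (intro sum_nonneg less_imp_le \<delta>)

lemma integrable_damp_c: "integrable lborel (damp (c i) p)" by (rule integrable_damp[OF p c_nonneg])

lemma norm_u_le: "cmod (u i z) \<le> B"
proof -
 have pc: "integrable lborel (\<lambda>x. cmod (p x))" using p by simp
 have "cmod (u i z) \<le> (LI x. cmod (damp (c i) p x))" unfolding u_def by (rule norm_fourier_le[OF integrable_damp_c])
 also have "\<dots> \<le> B" unfolding B_def
 proof (rule integral_mono)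
  show "integrable lborel (\<lambda>x. cmod (damp (c i) p x))" using integrable_damp_c by simp
  show "cmod (damp (c i) p x) \<le> cmod (p x)" for x
   unfolding damp_def norm_mult using c_nonneg[of i] by (simp add: mult_left_le)
 qed (rule pc)
 finally show ?thesis .
qed

lemma measurable_u [measurable]: "u i \<in> borel_measurable borel"
 unfolding u_def by (rule measurable_fourier[OF integrable_damp_c])

lemma measurable_coord: "k \<le> N \<Longrightarrow> (\<lambda>\<xi>. \<xi> k) \<in> borel_measurable W"
proof -
 assume "k \<le> N"
 then have "(\<lambda>\<xi>. \<xi> k) \<in> W \<rightarrow>\<^sub>M gmeasure (\<delta> k)" unfolding W_def by (intro measurable_component_singleton) simp
 then show ?thesis by (subst (asm) measurable_cong_sets[OF refl sets_gmeasure])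
qed

lemma measurable_fwd: "i \<le> N \<Longrightarrow> (\<lambda>\<xi>. fwd \<xi> i) \<in> borel_measurable W"
 unfolding fwd_def by (intro borel_measurable_sum measurable_coord) auto

lemma measurable_bwd [measurable]: "(\<lambda>\<xi>. bwd \<xi> i) \<in> borel_measurable W"
 unfolding bwd_def by (intro borel_measurable_sum measurable_coord) auto

lemma measurable_Y: "(\<lambda>\<xi>. Y x \<xi> j) \<in> borel_measurable W"
 unfolding Y_def by measurable

lemma measurable_Y_pair: "(\<lambda>z. Y (fst z) (snd z) j) \<in> borel_measurable (borel \<Otimes>\<^sub>M W)"
 unfolding Y_def by measurable

lemma norm_Y_le: "cmod (Y x \<xi> j) \<le> B" unfolding Y_def by (rule norm_u_le)

lemma u_step: "(\<integral>\<xi>. u i (z - \<xi>) \<partial>gmeasure (\<delta> (Suc i))) = u (Suc i) z"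
proof -
 have "c (Suc i) = \<delta> (Suc i) + c i" by (simp add: c_def)
 then show ?thesis unfolding u_def using fourier_gmeasure[OF integrable_damp_c \<delta>] by (simp add: damp_add)
qed

text \<open>Passing from j to j + 1 reveals the single step with index N - j, whereas the integrand
  at j involves steps of larger index only. Integrating that step out turns the flow at level N - j
  - 1 into the one at level N - j, so the increment has conditional mean zero.\<close>

lemma martingale_step:
 assumes j: "j < N"
 shows "(\<integral>\<xi>. lepingle_integrand \<rho> (Y x \<xi>) j \<bullet> (Y x \<xi> (Suc j) - Y x \<xi> j) \<partial>W) = 0"
  and "integrable W (\<lambda>\<xi>. lepingle_integrand \<rho> (Y x \<xi>) j \<bullet> (Y x \<xi> (Suc j) - Y x \<xi> j))"
proof -
 interpret W: prob_space W by (rule prob_W)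
 let ?f = "\<lambda>\<xi>. lepingle_integrand \<rho> (Y x \<xi>) j \<bullet> (Y x \<xi> (Suc j) - Y x \<xi> j)"
 note [measurable] = measurable_Y measurable_lepingle(1)[of "Y x" W \<rho> j, OF measurable_Y]
 have [measurable]: "?f \<in> borel_measurable W" by measurable
 let ?C = "64 * (64 * B + 2 * (B / (1 - 2 powr (2 - \<rho>))))"
 show int: "integrable W ?f"
 proof (rule W.integrable_const_bound[where B="?C * (2 * B)"])
  show "AE \<xi> in W. norm (?f \<xi>) \<le> ?C * (2 * B)"
  proof (rule AE_I2)
   fix \<xi>
   have "norm (?f \<xi>) \<le> cmod (lepingle_integrand \<rho> (Y x \<xi>) j) * cmod (Y x \<xi> (Suc j) - Y x \<xi> j)"
    unfolding real_norm_def by (rule Cauchy_Schwarz_ineq2)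
   also have "\<dots> \<le> ?C * (2 * B)"
   proof (rule mult_mono)
    show 1: "cmod (lepingle_integrand \<rho> (Y x \<xi>) j) \<le> ?C" by (rule norm_lepingle_integrand_le[OF \<rho> norm_Y_le])
    show "cmod (Y x \<xi> (Suc j) - Y x \<xi> j) \<le> 2 * B"
     using norm_triangle_ineq4[of "Y x \<xi> (Suc j)" "Y x \<xi> j"] norm_Y_le[of x \<xi> j] norm_Y_le[of x \<xi> "Suc j"] by linarith
    show "0 \<le> ?C" using 1 norm_ge_zero order_trans by blast
   qed simp
   finally show "norm (?f \<xi>) \<le> ?C * (2 * B)" .
  qed
 qed measurable
 obtain k where k: "N - j = Suc k" using j by (metis Suc_diff_Suc)
 then have k': "N - Suc j = k" "Suc k \<le> N" by auto
 let ?I = "{..N} - {Suc k}"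
 have I: "insert (Suc k) ?I = {..N}" using k'(2) by auto
 have "integrable (Pi\<^sub>M (insert (Suc k) ?I) (\<lambda>k. gmeasure (\<delta> k))) ?f" using int unfolding I W_def .
 then have "(\<integral>\<xi>. ?f \<xi> \<partial>Pi\<^sub>M (insert (Suc k) ?I) (\<lambda>k. gmeasure (\<delta> k)))
   = (\<integral>\<xi>. (\<integral>\<eta>. ?f (\<xi>(Suc k := \<eta>)) \<partial>gmeasure (\<delta> (Suc k))) \<partial>Pi\<^sub>M ?I (\<lambda>k. gmeasure (\<delta> k)))"
  by (intro product_integral_insert) auto
 also have "\<dots> = (\<integral>\<xi>. 0 \<partial>Pi\<^sub>M ?I (\<lambda>k. gmeasure (\<delta> k)))"
 proof (rule integral_cong[OF refl])
  fix \<xi> :: "nat \<Rightarrow> R3"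
  have same: "bwd (\<xi>(Suc k := \<eta>)) (N - i) = bwd \<xi> (N - i)" if "i \<le> j" for i \<eta>
   unfolding bwd_def using that k by (intro sum.cong) auto
  have Yc: "Y x (\<xi>(Suc k := \<eta>)) i = Y x \<xi> i" if "i \<le> j" for i \<eta>
   unfolding Y_def same[OF that] ..
  have ins: "{k<..N} = insert (Suc k) {Suc k<..N}" using k'(2) by auto
  have nxt: "bwd (\<xi>(Suc k := \<eta>)) k = \<eta> + bwd \<xi> (Suc k)" for \<eta>
  proof -
   have "bwd (\<xi>(Suc k := \<eta>)) k = \<eta> + (\<Sum>i\<in>{Suc k<..N}. (\<xi>(Suc k := \<eta>)) i)"
    unfolding bwd_def ins by (subst sum.insert) auto
   also have "(\<Sum>i\<in>{Suc k<..N}. (\<xi>(Suc k := \<eta>)) i) = bwd \<xi> (Suc k)"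
    unfolding bwd_def by (intro sum.cong) auto
   finally show ?thesis .
  qed
  define q where "q = lepingle_integrand \<rho> (Y x \<xi>) j"
  have q: "lepingle_integrand \<rho> (Y x (\<xi>(Suc k := \<eta>))) j = q" for \<eta>
   unfolding q_def by (rule lepingle_integrand_cong) (rule Yc)
  define w where "w = x - bwd \<xi> (Suc k)"
  have Y1: "Y x (\<xi>(Suc k := \<eta>)) (Suc j) = u k (w - \<eta>)" for \<eta>
   unfolding Y_def k' nxt w_def by (simp add: algebra_simps)
  have Y0: "Y x (\<xi>(Suc k := \<eta>)) j = u (Suc k) w" for \<eta>
   using Yc[of j \<eta>] unfolding Y_def k w_def by simp
  have iu: "integrable (gmeasure (\<delta> (Suc k))) (\<lambda>\<eta>. u k (w - \<eta>))"
   by (rule M.integrable_const_bound[where B=B]) (auto simp: norm_u_le cong: measurable_cong_sets)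
  have "(\<integral>\<eta>. ?f (\<xi>(Suc k := \<eta>)) \<partial>gmeasure (\<delta> (Suc k))) = (\<integral>\<eta>. q \<bullet> (u k (w - \<eta>) - u (Suc k) w) \<partial>gmeasure (\<delta> (Suc k)))"
   unfolding q Y1 Y0 ..
  also have "\<dots> = q \<bullet> (\<integral>\<eta>. u k (w - \<eta>) - u (Suc k) w \<partial>gmeasure (\<delta> (Suc k)))"
   by (rule integral_inner_right) (use iu in auto)
  also have "(\<integral>\<eta>. u k (w - \<eta>) - u (Suc k) w \<partial>gmeasure (\<delta> (Suc k))) = 0"
   using iu by (simp add: integral_diff u_step M.prob_space[simplified])
  finally show "(\<integral>\<eta>. ?f (\<xi>(Suc k := \<eta>)) \<partial>gmeasure (\<delta> (Suc k))) = 0" by (simp only: inner_zero_right)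
 qed
 finally show "(\<integral>\<xi>. ?f \<xi> \<partial>W) = 0" unfolding I W_def by simp
qed

lemma lepingle_const_nonneg: "0 \<le> lepingle_const \<rho>"
proof -
 have "2 powr (2 - \<rho>) < 1" using \<rho> by (auto simp: powr_less_one)
 then show ?thesis by (simp add: lepingle_const_def)
qed

lemma lepingle_bound_nonneg: "0 \<le> lepingle_bound \<rho> N y"
 using lepingle_pathwise[OF \<rho>, of "{}::nat set" "\<lambda>_. 0" "\<lambda>_. 0" N y] by simp

lemma integrable_sq: "integrable W (\<lambda>\<xi>. (cmod (Y x \<xi> N))^2)"
proof -
 interpret W: prob_space W by (rule prob_W)
 note [measurable] = measurable_Y
 show ?thesis
  by (rule W.integrable_const_bound[where B="B^2"]) (auto simp: norm_Y_le power_mono)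
qed

lemma integrable_lepingle_bound: "integrable W (\<lambda>\<xi>. lepingle_bound \<rho> N (Y x \<xi>))"
 unfolding lepingle_bound_def
 by (intro integrable_diff integrable_sum martingale_step(2) integrable_mult_right integrable_sq) simp

lemma expectation_lepingle_bound:
 "(\<integral>\<^sup>+\<xi>. ennreal (lepingle_bound \<rho> N (Y x \<xi>)) \<partial>W) = ennreal (lepingle_const \<rho>) * (\<integral>\<^sup>+\<xi>. ennreal ((cmod (Y x \<xi> N))^2) \<partial>W)"
proof -
 have "(\<integral>\<xi>. lepingle_bound \<rho> N (Y x \<xi>) \<partial>W) = lepingle_const \<rho> * (\<integral>\<xi>. (cmod (Y x \<xi> N))^2 \<partial>W)
   - (\<Sum>i<N. \<integral>\<xi>. lepingle_integrand \<rho> (Y x \<xi>) i \<bullet> (Y x \<xi> (Suc i) - Y x \<xi> i) \<partial>W)"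
  unfolding lepingle_bound_def
  by (subst integral_diff, intro integrable_mult_right integrable_sq,
    intro integrable_sum martingale_step(2), simp,
    subst integral_sum, intro martingale_step(2), simp) simp
 also have "(\<Sum>i<N. \<integral>\<xi>. lepingle_integrand \<rho> (Y x \<xi>) i \<bullet> (Y x \<xi> (Suc i) - Y x \<xi> i) \<partial>W) = 0"
  by (intro sum.neutral ballI martingale_step(1)) simp
 finally have e: "(\<integral>\<xi>. lepingle_bound \<rho> N (Y x \<xi>) \<partial>W) = lepingle_const \<rho> * (\<integral>\<xi>. (cmod (Y x \<xi> N))^2 \<partial>W)" by simp
 have "(\<integral>\<^sup>+\<xi>. ennreal (lepingle_bound \<rho> N (Y x \<xi>)) \<partial>W) = ennreal (\<integral>\<xi>. lepingle_bound \<rho> N (Y x \<xi>) \<partial>W)"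
  by (rule nn_integral_eq_integral[OF integrable_lepingle_bound]) (simp add: lepingle_bound_nonneg)
 also have "\<dots> = ennreal (lepingle_const \<rho>) * ennreal (\<integral>\<xi>. (cmod (Y x \<xi> N))^2 \<partial>W)"
  unfolding e by (rule ennreal_mult[OF lepingle_const_nonneg]) simp
 also have "ennreal (\<integral>\<xi>. (cmod (Y x \<xi> N))^2 \<partial>W) = (\<integral>\<^sup>+\<xi>. ennreal ((cmod (Y x \<xi> N))^2) \<partial>W)"
  by (rule nn_integral_eq_integral[OF integrable_sq, symmetric]) simp
 finally show ?thesis .
qed

text \<open>The pathwise bound averaged over all walks that start at z; their end point is z plus
  the sum of all steps.\<close>

definition G :: "R3 \<Rightarrow> ennreal" where
 "G z = (\<integral>\<^sup>+\<xi>. ennreal (lepingle_bound \<rho> N (Y (z + fwd \<xi> N) \<xi>)) \<partial>W)"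

lemma Fubini_W:
 "case_prod f \<in> borel_measurable (borel \<Otimes>\<^sub>M W) \<Longrightarrow> (\<integral>\<^sup>+\<xi>. \<integral>\<^sup>+z. f z \<xi> \<partial>(lborel :: R3 measure) \<partial>W) = (LI+ z. \<integral>\<^sup>+\<xi>. f z \<xi> \<partial>W)"
 by (rule pair_sigma_finite.Fubini')
   (auto simp: pair_sigma_finite_def sigma_finite_lborel prob_space_imp_sigma_finite prob_W cong: measurable_cong_sets sets_pair_measure_cong)

lemma measurable_lb_pair: "(\<lambda>(z, \<xi>). ennreal (lepingle_bound \<rho> N (Y z \<xi>))) \<in> borel_measurable (borel \<Otimes>\<^sub>M W)"
 using measurable_lepingle(2)[of "\<lambda>z. Y (fst z) (snd z)" "borel \<Otimes>\<^sub>M W" \<rho> N, OF measurable_Y_pair]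
 by (simp add: case_prod_beta')

lemma measurable_lb_shift: "(\<lambda>(z, \<xi>). ennreal (lepingle_bound \<rho> N (Y (z + fwd \<xi> N) \<xi>))) \<in> borel_measurable (borel \<Otimes>\<^sub>M W)"
proof -
 have [measurable]: "(\<lambda>\<xi>. fwd \<xi> N) \<in> borel_measurable W" by (rule measurable_fwd) simp
 have "(\<lambda>z. (fst z + fwd (snd z) N, snd z)) \<in> (borel \<Otimes>\<^sub>M W) \<rightarrow>\<^sub>M (borel \<Otimes>\<^sub>M W)" by measurable
 from measurable_compose[OF this measurable_lb_pair] show ?thesis by (simp add: case_prod_beta')
qed

lemma measurable_G: "G \<in> borel_measurable borel"
proof -
 interpret W: prob_space W by (rule prob_W)
 show ?thesis unfolding G_def using measurable_lb_shift by (rule W.borel_measurable_nn_integral)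
qed

text \<open>Lebesgue measure is invariant under the walk, so integrating over the starting point is
  the same as integrating over the end point. For a fixed end point the martingale terms drop out,
  and one more translation leaves the L^2 norm of \<open>u 0\<close>.\<close>

lemma integral_G_le: "(LI+ z. G z) \<le> ennreal (lepingle_const \<rho>) * (LI+ z. (ennreal (cmod (fourier p z)))^2)"
proof -
 interpret W: prob_space W by (rule prob_W)
 let ?l = "\<lambda>z \<xi>. ennreal (lepingle_bound \<rho> N (Y z \<xi>))"
 have m1: "(\<lambda>z. ?l z \<xi>) \<in> borel_measurable borel" for \<xi>
  using measurable_lepingle(2)[of "\<lambda>z. Y z \<xi>" borel \<rho> N] unfolding Y_def by measurable
 have "(LI+ z. G z) = (\<integral>\<^sup>+\<xi>. \<integral>\<^sup>+z. ?l (z + fwd \<xi> N) \<xi> \<partial>lborel \<partial>W)"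
  unfolding G_def by (rule Fubini_W[symmetric]) (rule measurable_lb_shift)
 also have "\<dots> = (\<integral>\<^sup>+\<xi>. \<integral>\<^sup>+z. ?l z \<xi> \<partial>lborel \<partial>W)"
 proof (rule nn_integral_cong)
  fix \<xi>
  show "(LI+ z. ?l (z + fwd \<xi> N) \<xi>) = (LI+ z. ?l z \<xi>)"
   using nn_integral_lborel_translate[OF m1, of "fwd \<xi> N" \<xi>] by (simp add: add.commute)
 qed
 also have "\<dots> = (LI+ z. \<integral>\<^sup>+\<xi>. ?l z \<xi> \<partial>W)" by (rule Fubini_W) (rule measurable_lb_pair)
 also have "\<dots> = (LI+ z. ennreal (lepingle_const \<rho>) * (\<integral>\<^sup>+\<xi>. ennreal ((cmod (Y z \<xi> N))^2) \<partial>W))"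
  by (simp only: expectation_lepingle_bound)
 also have "\<dots> = ennreal (lepingle_const \<rho>) * (LI+ z. \<integral>\<^sup>+\<xi>. ennreal ((cmod (Y z \<xi> N))^2) \<partial>W)"
 proof (rule nn_integral_cmult)
  have "(\<lambda>(z, \<xi>). ennreal ((cmod (Y z \<xi> N))^2)) \<in> borel_measurable (borel \<Otimes>\<^sub>M W)"
   using measurable_Y_pair[of N] by (simp add: case_prod_beta')
  then show "(\<lambda>z. \<integral>\<^sup>+\<xi>. ennreal ((cmod (Y z \<xi> N))^2) \<partial>W) \<in> borel_measurable lborel"
   unfolding measurable_lborel2 by (rule W.borel_measurable_nn_integral)
 qed
 also have "(LI+ z. \<integral>\<^sup>+\<xi>. ennreal ((cmod (Y z \<xi> N))^2) \<partial>W) = (\<integral>\<^sup>+\<xi>. \<integral>\<^sup>+z. ennreal ((cmod (Y z \<xi> N))^2) \<partial>lborel \<partial>W)"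
  by (rule Fubini_W[symmetric]) (use measurable_Y_pair[of N] in \<open>simp add: case_prod_beta'\<close>)
 also have "\<dots> = (\<integral>\<^sup>+\<xi>. (LI+ z. ennreal ((cmod (u 0 z))^2)) \<partial>W)"
 proof (rule nn_integral_cong)
  fix \<xi>
  show "(LI+ z. ennreal ((cmod (Y z \<xi> N))^2)) = (LI+ z. ennreal ((cmod (u 0 z))^2))"
   using nn_integral_lborel_translate[of "\<lambda>z. ennreal ((cmod (u 0 z))^2)" "- bwd \<xi> 0"] by (simp add: Y_def)
 qed
 also have "\<dots> = (LI+ z. ennreal ((cmod (u 0 z))^2))" by (simp add: W.emeasure_space_1)
 finally have 1: "(LI+ z. G z) = ennreal (lepingle_const \<rho>) * (LI+ z. ennreal ((cmod (u 0 z))^2))" .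
 let ?g = "gmeasure (\<delta> 0)" and ?f = "\<lambda>z. ennreal (cmod (fourier p z))"
 have [measurable]: "fourier p \<in> borel_measurable borel" by (rule measurable_fourier[OF p])
 \<comment> \<open>The flow contracts L^2: it averages translates against a probability measure, to
   which Cauchy-Schwarz is applied pointwise.\<close>
 have "(LI+ z. ennreal ((cmod (u 0 z))^2)) \<le> (LI+ z. \<integral>\<^sup>+\<xi>. (?f (z - \<xi>))^2 \<partial>?g)"
 proof (rule nn_integral_mono)
  fix z
  have "u 0 z = (\<integral>\<xi>. fourier p (z - \<xi>) \<partial>?g)"
   unfolding u_def using fourier_gmeasure[OF p \<delta>, of 0 z] by (simp add: c_def)
  moreover have "integrable ?g (\<lambda>\<xi>. fourier p (z - \<xi>))"
   by (rule M.integrable_const_bound[where B="LI x. cmod (p x)"]) (auto simp: norm_fourier_le[OF p] cong: measurable_cong_sets)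
  ultimately have "ennreal (cmod (u 0 z)) \<le> (\<integral>\<^sup>+\<xi>. ?f (z - \<xi>) * 1 \<partial>?g)"
   using integral_norm_bound_ennreal[of ?g "\<lambda>\<xi>. fourier p (z - \<xi>)"] by simp
  then have "(ennreal (cmod (u 0 z)))^2 \<le> (\<integral>\<^sup>+\<xi>. ?f (z - \<xi>) * 1 \<partial>?g)^2" by (rule power_mono) simp
  also have "\<dots> \<le> (\<integral>\<^sup>+\<xi>. (?f (z - \<xi>))^2 \<partial>?g) * (\<integral>\<^sup>+\<xi>. 1^2 \<partial>?g)"
   by (rule Cauchy_Schwarz_nn_integral) measurable
  also have "\<dots> = (\<integral>\<^sup>+\<xi>. (?f (z - \<xi>))^2 \<partial>?g)" by (simp add: M.emeasure_space_1[simplified])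
  finally show "ennreal ((cmod (u 0 z))^2) \<le> (\<integral>\<^sup>+\<xi>. (?f (z - \<xi>))^2 \<partial>?g)" by (simp add: ennreal_power)
 qed
 also have "\<dots> = (\<integral>\<^sup>+\<xi>. \<integral>\<^sup>+z. (?f (z - \<xi>))^2 \<partial>lborel \<partial>?g)"
 proof (rule pair_sigma_finite.Fubini'[symmetric])
  show "pair_sigma_finite lborel ?g"
   by (simp add: pair_sigma_finite_def sigma_finite_lborel M.sigma_finite_measure_axioms)
  have "(\<lambda>(z, \<xi>). (?f (z - \<xi>))^2) \<in> borel_measurable (borel \<Otimes>\<^sub>M borel)" by measurable
  then show "(\<lambda>(z, \<xi>). (?f (z - \<xi>))^2) \<in> borel_measurable (lborel \<Otimes>\<^sub>M ?g)"
   by (subst measurable_cong_sets[OF sets_pair_measure_cong[OF sets_lborel sets_gmeasure] refl])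
 qed
 also have "\<dots> = (\<integral>\<^sup>+\<xi>. (LI+ z. (?f z)^2) \<partial>?g)"
 proof (rule nn_integral_cong)
  fix \<xi>
  show "(LI+ z. (?f (z - \<xi>))^2) = (LI+ z. (?f z)^2)"
   using nn_integral_lborel_translate[of "\<lambda>z. (?f z)^2" "- \<xi>"] by simp
 qed
 also have "\<dots> = (LI+ z. (?f z)^2)" by (simp add: M.emeasure_space_1[simplified])
 finally show ?thesis unfolding 1 by (rule mult_left_mono) simp
qed

text \<open>Averaging a character over the independent steps up to i gives the product of their
  Gaussian factors, that is, the damping by \<open>c i\<close> a second time.\<close>

lemma expectation_walk:
 assumes i: "i \<le> N"
 shows "(\<integral>\<xi>. u i (z + fwd \<xi> i) \<partial>W) = fourier (damp (2 * c i) p) z"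
  and "integrable W (\<lambda>\<xi>. u i (z + fwd \<xi> i))"
proof -
 interpret W: prob_space W by (rule prob_W)
 let ?q = "damp (c i) p"
 have [measurable]: "(\<lambda>\<xi>. fwd \<xi> i) \<in> borel_measurable W" by (rule measurable_fwd[OF i])
 show "integrable W (\<lambda>\<xi>. u i (z + fwd \<xi> i))"
  by (rule W.integrable_const_bound[where B=B]) (auto simp: norm_u_le)
 have one: "integrable W (\<lambda>_. 1::complex)" by simp
 have "(\<integral>\<xi>. u i (z + fwd \<xi> i) \<partial>W) = (\<integral>\<xi>. \<integral>x. ?q x * 1 * fexp x (z + fwd \<xi> i) \<partial>lborel \<partial>W)"
  by (simp add: u_def fourier_alt)
 also have "\<dots> = (LI x. \<integral>\<xi>. ?q x * 1 * fexp x (z + fwd \<xi> i) \<partial>W)"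
 proof (rule Fubini_bounded[OF sigma_finite_lborel W.sigma_finite_measure_axioms integrable_damp_c one, where B=1])
  have "(\<lambda>(x, \<xi>). fexp x (z + fwd \<xi> i)) \<in> borel_measurable (borel \<Otimes>\<^sub>M W)" by measurable
  then show "(\<lambda>(x, \<xi>). fexp x (z + fwd \<xi> i)) \<in> borel_measurable (lborel \<Otimes>\<^sub>M W)"
   by (subst measurable_cong_sets[OF sets_pair_measure_cong[OF sets_lborel refl] refl])
 qed simp
 also have "\<dots> = fourier (damp (2 * c i) p) z"
  unfolding fourier_alt
 proof (rule integral_cong[OF refl])
  fix x
  have ff: "fexp x (fwd \<xi> n) = (\<Prod>k\<le>n. fexp x (\<xi> k))" for \<xi> n
   unfolding fwd_def by (induction n) (simp_all add: fexp_add_right)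
  let ?h = "\<lambda>k. if k \<le> i then fexp x else (\<lambda>_. 1)"
  have "(\<integral>\<xi>. fexp x (fwd \<xi> i) \<partial>W) = (\<integral>\<xi>. (\<Prod>k\<in>{..N}. ?h k (\<xi> k)) \<partial>W)"
  proof (rule integral_cong[OF refl])
   fix \<xi>
   have "(\<Prod>k\<in>{..N}. ?h k (\<xi> k)) = (\<Prod>k\<le>i. fexp x (\<xi> k))"
    using i by (intro prod.mono_neutral_cong_right) auto
   then show "fexp x (fwd \<xi> i) = (\<Prod>k\<in>{..N}. ?h k (\<xi> k))" by (simp add: ff)
  qed
  also have "\<dots> = (\<Prod>k\<in>{..N}. \<integral>\<eta>. ?h k \<eta> \<partial>gmeasure (\<delta> k))"
   unfolding W_def
  proof (rule product_integral_prod)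
   fix k
   show "integrable (gmeasure (\<delta> k)) (?h k)"
    by (rule M.integrable_const_bound[where B=1]) (auto cong: measurable_cong_sets)
  qed simp
  also have "\<dots> = (\<Prod>k\<le>i. complex_of_real (exp (- (pi * \<delta> k * (norm x)^2))))"
  proof (rule prod.mono_neutral_cong_right)
   show "\<forall>k\<in>{..N} - {..i}. (\<integral>\<eta>. ?h k \<eta> \<partial>gmeasure (\<delta> k)) = 1"
    using prob_space.prob_space[OF prob_space_gmeasure[OF \<delta>]] by (auto simp del: space_gmeasure)
   show "(\<integral>\<eta>. ?h k \<eta> \<partial>gmeasure (\<delta> k)) = complex_of_real (exp (- (pi * \<delta> k * (norm x)^2)))" if "k \<in> {..i}" for k
    using that integral_fexp_gmeasure[OF \<delta>, of k x] by simp
  qed (use i in auto)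
  also have "\<dots> = complex_of_real (exp (- (pi * c i * (norm x)^2)))"
   by (simp add: exp_sum[symmetric] of_real_prod[symmetric] sum_negf sum_distrib_left[symmetric] sum_distrib_right[symmetric] c_def del: of_real_prod)
  finally have e: "(\<integral>\<xi>. fexp x (fwd \<xi> i) \<partial>W) = complex_of_real (exp (- (pi * c i * (norm x)^2)))" .
  have "(\<integral>\<xi>. ?q x * 1 * fexp x (z + fwd \<xi> i) \<partial>W) = (\<integral>\<xi>. (?q x * fexp x z) * fexp x (fwd \<xi> i) \<partial>W)"
   by (simp add: fexp_add_right mult.assoc)
  also have "\<dots> = (?q x * fexp x z) * (\<integral>\<xi>. fexp x (fwd \<xi> i) \<partial>W)" by (rule integral_mult_right_zero)
  also have "\<dots> = damp (c i) ?q x * fexp x z" unfolding e damp_def[of "c i" ?q] by (simp add: mult_ac)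
  finally show "(\<integral>\<xi>. ?q x * 1 * fexp x (z + fwd \<xi> i) \<partial>W) = damp (2 * c i) p x * fexp x z"
   by (simp add: damp_add)
 qed
 finally show "(\<integral>\<xi>. u i (z + fwd \<xi> i) \<partial>W) = fourier (damp (2 * c i) p) z" .
qed

lemma Y_forward:
 assumes "j \<le> N"
 shows "Y (z + fwd \<xi> N) \<xi> j = u (N - j) (z + fwd \<xi> (N - j))"
proof -
 have "{..N} = {..N - j} \<union> {N - j<..N}" by auto
 then have "fwd \<xi> N = fwd \<xi> (N - j) + bwd \<xi> (N - j)"
  unfolding fwd_def bwd_def by (simp only:) (rule sum.union_disjoint, auto)
 then show ?thesis unfolding Y_def by (simp add: algebra_simps)
qed

text \<open>Averaging over walks does not increase the variation. With the vector extremal for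
  \<open>F\<close> the squared norm V^2 is the mean of a pairing with the random path, and Hoelder
  with 2ab \<le> a^2 + b^2 bounds it by V^2/2 plus half the pathwise bound.\<close>

lemma variation_le_G:
 fixes e :: "nat \<Rightarrow> 'a::linorder"
 assumes e: "\<And>j. j < N \<Longrightarrow> e j < e (Suc j)" and S: "S \<subseteq> e ` {0..N}" "S \<noteq> {}"
  and F: "\<And>i. i \<le> N \<Longrightarrow> F (e i) = fourier (damp (2 * c i) p) z"
 shows "(ennreal (vnorm \<rho> S F))^2 \<le> G z"
proof -
 interpret W: prob_space W by (rule prob_W)
 have fS: "finite S" using S by (rule_tac finite_subset) auto
 define idx where "idx = inv_into {0..N} e"
 have inj: "inj_on e {0..N}" by (rule vnorm_image(4)[of N e]) (rule e)
 have mono: "e a < e b" if "a < b" "b \<le> N" for a b using that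
 proof (induction b)
  case (Suc b)
  then show ?case using e[of b] by (cases "a = b") auto
 qed simp
 have idx: "idx t \<le> N" "e (idx t) = t" if "t \<in> S" for t
  using that S(1) inv_into_into[of t e "{0..N}"] f_inv_into_f[of t e "{0..N}"] by (auto simp: idx_def)
 have idxlt: "idx s < idx t" if "s \<in> S" "t \<in> S" "s < t" for s t
  using mono[of "idx t" "idx s"] idx[OF that(1)] idx[OF that(2)] that(3) by (metis less_asym linorder_neqE_nat less_irrefl)
 have idxle: "idx s \<le> idx t" if "s \<in> S" "t \<in> S" "s \<le> t" for s t
  using idxlt[of s t] that by (metis less_imp_le order_le_less)
 define U where "U \<xi> t = u (idx t) (z + fwd \<xi> (idx t))" for \<xi> t
 have EU: "(\<integral>\<xi>. U \<xi> t \<partial>W) = F t" "integrable W (\<lambda>\<xi>. U \<xi> t)" if "t \<in> S" for t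
  using expectation_walk[OF idx(1)[OF that], of z] F[OF idx(1)[OF that]] idx(2)[OF that] unfolding U_def by auto
 have path: "(vnorm \<rho> S (U \<xi>))^2 \<le> lepingle_bound \<rho> N (Y (z + fwd \<xi> N) \<xi>)" for \<xi>
 proof -
  let ?y = "Y (z + fwd \<xi> N) \<xi>"
  have Uy: "U \<xi> t = ?y (N - idx t)" if "t \<in> S" for t
   using Y_forward[of "N - idx t" z \<xi>] idx(1)[OF that] by (simp add: U_def)
  have st: "s \<in> S" "pre S s \<in> S" "pre S s < s" if "s \<in> steps S" for s
   using that pre_props[OF fS that] by (auto simp: steps_def)
  \<comment> \<open>Time is reversed: the larger scale has the larger index and comes earlier along
    \<open>Y\<close>.\<close>
  let ?l = "\<lambda>s. N - idx s" and ?r = "\<lambda>s. N - idx (pre S s)"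
  have "vnorm \<rho> S (U \<xi>) = (\<Sum>s\<in>steps S. cmod (?y (?r s) - ?y (?l s)) powr \<rho>) powr (1/\<rho>)"
   unfolding vnorm_def incr_def using Uy st by (intro arg_cong[where f="\<lambda>x. x powr (1/\<rho>)"] sum.cong refl) (simp add: norm_minus_commute)
  moreover have "((\<Sum>s\<in>steps S. cmod (?y (?r s) - ?y (?l s)) powr \<rho>) powr (1/\<rho>))^2 \<le> lepingle_bound \<rho> N ?y"
  proof (rule lepingle_pathwise[OF \<rho>])
   show "finite (steps S)" using fS by simp
   show "?l s < ?r s \<and> ?r s \<le> N" if "s \<in> steps S" for s
    using idxlt[OF st(2)[OF that] st(1)[OF that] st(3)[OF that]] idx(1)[OF st(1)[OF that]] by auto
   have dj: "{?l s..<?r s} \<inter> {?l t..<?r t} = {}" if s: "s \<in> steps S" and t: "t \<in> steps S" and "s < t" for s t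
   proof -
    have "s \<le> pre S t" by (rule pre_props(3)[OF fS t st(1)[OF s] \<open>s < t\<close>])
    then have "idx s \<le> idx (pre S t)" by (rule idxle[OF st(1)[OF s] st(2)[OF t]])
    then show ?thesis by auto
   qed
   show "{?l s..<?r s} \<inter> {?l t..<?r t} = {}" if "s \<in> steps S" "t \<in> steps S" "s \<noteq> t" for s t
    using dj[of s t] dj[of t s] that by (metis Int_commute linorder_neqE)
  qed
  ultimately show ?thesis by simp
 qed
 define q where "q = \<rho> / (\<rho> - 1)"
 have \<rho>1: "1 < \<rho>" using \<rho> by simp
 note ce = conjugate_exponent[OF \<rho>1, folded q_def]
 define V where "V = vnorm \<rho> S F"
 have V0: "0 \<le> V" by (simp add: V_def vnorm_def)
 define b where "b = lp_dual \<rho> (steps S) (incr F S)"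
 have dual: "(\<Sum>s\<in>steps S. b s * incr F S s) = complex_of_real (V^2)"
  "(\<Sum>s\<in>steps S. cmod (b s) powr q) powr (1/q) = V"
  using sum_lp_dual[OF \<rho>1 q_def finite_steps[OF fS], of "incr F S"] unfolding b_def V_def vnorm_def by simp_all
 have stS: "s \<in> S" "pre S s \<in> S" if "s \<in> steps S" for s using that pre_props[OF fS that] by (auto simp: steps_def)
 have iUs: "integrable W (\<lambda>\<xi>. b s * incr (U \<xi>) S s)" if "s \<in> steps S" for s
  unfolding incr_def by (intro integrable_mult_right integrable_diff EU stS that)
 have "complex_of_real (V^2) = (\<Sum>s\<in>steps S. \<integral>\<xi>. b s * incr (U \<xi>) S s \<partial>W)"
  unfolding dual(1)[symmetric]
 proof (rule sum.cong[OF refl])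
  fix s assume s: "s \<in> steps S"
  show "b s * incr F S s = (\<integral>\<xi>. b s * incr (U \<xi>) S s \<partial>W)"
   unfolding incr_def using EU[OF stS(1)[OF s]] EU[OF stS(2)[OF s]] by (simp add: integral_diff)
 qed
 also have "\<dots> = (\<integral>\<xi>. (\<Sum>s\<in>steps S. b s * incr (U \<xi>) S s) \<partial>W)"
  by (rule integral_sum[symmetric]) (rule iUs)
 finally have "V^2 = Re (\<integral>\<xi>. (\<Sum>s\<in>steps S. b s * incr (U \<xi>) S s) \<partial>W)" by (metis Re_complex_of_real)
 also have "\<dots> = (\<integral>\<xi>. Re (\<Sum>s\<in>steps S. b s * incr (U \<xi>) S s) \<partial>W)"
  by (rule integral_Re[symmetric]) (intro integrable_sum iUs)
 finally have V2: "V^2 = (\<integral>\<xi>. Re (\<Sum>s\<in>steps S. b s * incr (U \<xi>) S s) \<partial>W)" .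
 let ?lb = "\<lambda>\<xi>. lepingle_bound \<rho> N (Y (z + fwd \<xi> N) \<xi>)"
 show ?thesis
 proof (cases "G z < \<infinity>")
  case True
  have mlb: "?lb \<in> borel_measurable W"
  proof (rule measurable_lepingle(2))
   have [measurable]: "(\<lambda>\<xi>. fwd \<xi> N) \<in> borel_measurable W" by (rule measurable_fwd) simp
   show "(\<lambda>\<xi>. Y (z + fwd \<xi> N) \<xi> j) \<in> borel_measurable W" for j unfolding Y_def by measurable
  qed
  have ilb: "integrable W ?lb"
   by (rule integrableI_nonneg) (use mlb True in \<open>auto simp: lepingle_bound_nonneg G_def\<close>)
  have "(\<integral>\<xi>. Re (\<Sum>s\<in>steps S. b s * incr (U \<xi>) S s) \<partial>W) \<le> (\<integral>\<xi>. V^2 / 2 + ?lb \<xi> / 2 \<partial>W)"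
  proof (rule integral_mono)
   show "integrable W (\<lambda>\<xi>. Re (\<Sum>s\<in>steps S. b s * incr (U \<xi>) S s))"
    by (intro integrable_Re integrable_sum iUs)
   show "integrable W (\<lambda>\<xi>. V^2 / 2 + ?lb \<xi> / 2)" using ilb by auto
   fix \<xi>
   have "Re (\<Sum>s\<in>steps S. b s * incr (U \<xi>) S s) \<le> (\<Sum>s\<in>steps S. cmod (b s) * cmod (incr (U \<xi>) S s))"
    by (rule order_trans[OF complex_Re_le_cmod], rule order_trans[OF norm_sum]) (simp add: norm_mult)
   also have "\<dots> \<le> V * vnorm \<rho> S (U \<xi>)"
    unfolding dual(2)[symmetric] vnorm_def by (rule Hoelder_sum) (use ce \<rho>1 in auto)
   also have "\<dots> \<le> V^2 / 2 + (vnorm \<rho> S (U \<xi>))^2 / 2"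
    using sum_squares_bound[of V "vnorm \<rho> S (U \<xi>)"] by (simp add: power2_eq_square)
   also have "\<dots> \<le> V^2 / 2 + ?lb \<xi> / 2" using path[of \<xi>] by simp
   finally show "Re (\<Sum>s\<in>steps S. b s * incr (U \<xi>) S s) \<le> V^2 / 2 + ?lb \<xi> / 2" .
  qed
  also have "\<dots> = V^2 / 2 + (\<integral>\<xi>. ?lb \<xi> \<partial>W) / 2" using ilb by (simp add: W.prob_space)
  finally have "V^2 \<le> (\<integral>\<xi>. ?lb \<xi> \<partial>W)" unfolding V2[symmetric] by simp
  then have "ennreal (V^2) \<le> ennreal (\<integral>\<xi>. ?lb \<xi> \<partial>W)" by (rule ennreal_leI)
  also have "\<dots> = G z" unfolding G_def
   by (rule nn_integral_eq_integral[OF ilb, symmetric]) (simp add: lepingle_bound_nonneg)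
  finally show ?thesis using V0 by (simp add: V_def ennreal_power)
 next
  case False
  then have "G z = \<infinity>" by (simp add: less_top[symmetric])
  then show ?thesis by simp
 qed
qed

end

lemma heat_variation:
 fixes p :: "R3 \<Rightarrow> complex" and T :: "real set"
 assumes p: "integrable lborel p" and T: "finite T" "T \<noteq> {}" "T \<subseteq> {0<..}" and \<rho>: "\<rho> > 2" and \<kappa>: "\<kappa> > 0"
 obtains G where "G \<in> borel_measurable borel"
  "\<And>S z. S \<subseteq> T \<Longrightarrow> S \<noteq> {} \<Longrightarrow> (ennreal (vnorm \<rho> S (\<lambda>t. fourier (damp (\<kappa> * t^2) p) z)))\<^sup>2 \<le> G z"
  "(LI+ z. G z) \<le> ennreal (lepingle_const \<rho>) * (LI+ z. (ennreal (cmod (fourier p z)))^2)"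
proof -
 obtain N e where Ne: "(N, e) \<in> partitions" "T = e ` {0..N}" using partition_of_finite_set[OF T] .
 have e0: "0 < e 0" and e: "\<And>j. j < N \<Longrightarrow> e j < e (Suc j)" using Ne by (auto simp: partitions_def)
 have epos: "0 < e j" if "j \<le> N" for j
 proof -
  have "e j \<in> T" using that Ne(2) by simp
  then show ?thesis using T(3) by auto
 qed
 \<comment> \<open>Half of the increments of \<kappa> t^2, because averaging given the starting
   point damps twice: 2 c(i) has to equal \<kappa> e(i)^2. The value 1 beyond N keeps every step
   nondegenerate.\<close>
 define \<delta> where "\<delta> k = (if k = 0 then \<kappa> * (e 0)^2 / 2 else if k \<le> N then \<kappa> * ((e k)^2 - (e (k - 1))^2) / 2 else 1)" for k
 have \<delta>: "\<delta> k > 0" for k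
 proof (cases "k = 0 \<or> k > N")
  case False
  then have "e (k - 1) < e k" "0 < e (k - 1)" using e[of "k - 1"] epos[of "k - 1"] by auto
  then have "(e (k - 1))^2 < (e k)^2" by (intro power_strict_mono) auto
  then show ?thesis using False \<kappa> by (simp add: \<delta>_def)
 qed (use \<kappa> e0 in \<open>auto simp: \<delta>_def\<close>)
 interpret heat_walk p N \<delta> \<rho> by unfold_locales (use p \<delta> \<rho> in auto)
 have ci: "2 * c i = \<kappa> * (e i)^2" if "i \<le> N" for i using that
 proof (induction i)
  case 0
  have "c 0 = \<delta> 0" by (simp add: c_def)
  moreover have "\<delta> 0 = \<kappa> * (e 0)^2 / 2" by (simp add: \<delta>_def)
  ultimately show ?case by simp
 next
  case (Suc i)
  have 1: "c (Suc i) = c i + \<delta> (Suc i)" by (simp add: c_def)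
  have 2: "2 * \<delta> (Suc i) = \<kappa> * (e (Suc i))^2 - \<kappa> * (e i)^2"
   using Suc.prems by (simp add: \<delta>_def right_diff_distrib)
  have 3: "2 * c i = \<kappa> * (e i)^2" using Suc.IH Suc.prems by simp
  show ?case unfolding 1 distrib_left 2 3 by simp
 qed
 show ?thesis
 proof (rule that[of G])
  show "(ennreal (vnorm \<rho> S (\<lambda>t. fourier (damp (\<kappa> * t^2) p) z)))^2 \<le> G z" if "S \<subseteq> T" "S \<noteq> {}" for S z
   by (rule variation_le_G[of e, OF e]) (use that Ne ci in auto)
 qed (rule measurable_G, rule integral_G_le)
qed

section \<open>Dilates of complex measures\<close>

text \<open>The reflected sign is the one that occurs: convolving the Fourier transform of f with a
  dilate of \<mu> multiplies f by the inverse Fourier transform of that dilate, see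
  \<open>cm_conv_fourier\<close>.\<close>

definition mhat :: "cmeasure \<Rightarrow> R3 \<Rightarrow> complex" where
 "mhat \<mu> x = cm_fourier \<mu> (- x)"

lemma mhat_alt: "mhat \<mu> x = (\<integral>y. snd \<mu> y * cnj (fexp x y) \<partial>fst \<mu>)"
proof -
 have "exp (- 2 * complex_of_real pi * \<i> * complex_of_real (y \<bullet> - x)) = cnj (fexp x y)" for y
 proof -
  have "exp (- 2 * complex_of_real pi * \<i> * complex_of_real (y \<bullet> - x)) = fexp y (- x)" by (simp only: fexp_def)
  also have "\<dots> = cnj (fexp x y)" by (simp only: fexp_minus_right fexp_commute)
  finally show ?thesis .
 qed
 then show ?thesis unfolding mhat_def cm_fourier_def by (simp only: mult.commute)
qed

context
 fixes \<mu> :: cmeasure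
 assumes \<mu>: "is_cmeasure \<mu>"
begin

lemma cm_finite: "finite_measure (fst \<mu>)" and cm_sets: "sets (fst \<mu>) = sets borel" and cm_integrable: "integrable (fst \<mu>) (snd \<mu>)"
 using \<mu> by (auto simp: is_cmeasure_def)

lemma cm_sigma_finite: "sigma_finite_measure (fst \<mu>)"
 using cm_finite by (rule finite_measure.sigma_finite_measure)



lemma cm_measurable: "f \<in> borel_measurable borel \<Longrightarrow> f \<in> borel_measurable (fst \<mu>)"
 by (subst measurable_cong_sets[OF cm_sets refl])

lemma cm_density_measurable: "snd \<mu> \<in> borel_measurable borel"
 using borel_measurable_integrable[OF cm_integrable] by (subst (asm) measurable_cong_sets[OF cm_sets refl])

lemma norm_mhat_le: "cmod (mhat \<mu> x) \<le> (\<integral>y. cmod (snd \<mu> y) \<partial>fst \<mu>)"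
 unfolding mhat_alt using integral_norm_bound[of "fst \<mu>" "\<lambda>y. snd \<mu> y * cnj (fexp x y)"] by (simp add: norm_mult)

lemma continuous_on_mhat: "continuous_on UNIV (mhat \<mu>)"
 unfolding mhat_alt
proof (rule continuous_on_integral_param)
 show "integrable (fst \<mu>) (\<lambda>y. cmod (snd \<mu> y))" using cm_integrable by simp
 note [measurable] = cm_density_measurable
 show "(\<lambda>y. snd \<mu> y * cnj (fexp x y)) \<in> borel_measurable (fst \<mu>)" for x
  by (rule cm_measurable) measurable
qed (auto simp: norm_mult intro!: continuous_intros)

lemma mhat_0: "mhat \<mu> 0 = cm_apply \<mu> UNIV"
 unfolding mhat_alt cm_apply_def set_lebesgue_integral_def by simp

lemma cm_conv_fourier:
 assumes f: "integrable lborel f" and \<epsilon>: "\<epsilon> > 0"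
 shows "cm_conv (fourier f) (cm_dilate \<epsilon> \<mu>) = fourier (\<lambda>x. f x * mhat \<mu> (\<epsilon> *\<^sub>R x))"
proof
 fix x
 note [measurable] = cm_density_measurable measurable_fourier[OF f]
 have m: "(\<lambda>y. \<epsilon> *\<^sub>R y) \<in> fst \<mu> \<rightarrow>\<^sub>M borel" by (rule cm_measurable) measurable
 have "cm_conv (fourier f) (cm_dilate \<epsilon> \<mu>) x = (\<integral>z. fourier f (x - z) * snd \<mu> ((1 / \<epsilon>) *\<^sub>R z) \<partial>distr (fst \<mu>) borel (\<lambda>y. \<epsilon> *\<^sub>R y))"
  by (simp only: cm_conv_def cm_dilate_def fst_conv snd_conv)
 also have "\<dots> = (\<integral>y. fourier f (x - \<epsilon> *\<^sub>R y) * snd \<mu> ((1 / \<epsilon>) *\<^sub>R (\<epsilon> *\<^sub>R y)) \<partial>fst \<mu>)"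
  by (rule integral_distr[OF m]) measurable
 also have "\<dots> = (\<integral>y. \<integral>\<xi>. f \<xi> * snd \<mu> y * fexp \<xi> (x - \<epsilon> *\<^sub>R y) \<partial>lborel \<partial>fst \<mu>)"
 proof (rule integral_cong[OF refl])
  fix y
  have "fourier f (x - \<epsilon> *\<^sub>R y) * snd \<mu> ((1 / \<epsilon>) *\<^sub>R (\<epsilon> *\<^sub>R y)) = (LI \<xi>. f \<xi> * fexp \<xi> (x - \<epsilon> *\<^sub>R y)) * snd \<mu> y"
   using \<epsilon> by (simp add: fourier_alt)
  also have "\<dots> = (LI \<xi>. f \<xi> * fexp \<xi> (x - \<epsilon> *\<^sub>R y) * snd \<mu> y)" by (rule integral_mult_left_zero[symmetric])
  finally show "fourier f (x - \<epsilon> *\<^sub>R y) * snd \<mu> ((1 / \<epsilon>) *\<^sub>R (\<epsilon> *\<^sub>R y)) = (LI \<xi>. f \<xi> * snd \<mu> y * fexp \<xi> (x - \<epsilon> *\<^sub>R y))"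
   by (simp only: mult_ac)
 qed
 also have "\<dots> = (LI \<xi>. \<integral>y. f \<xi> * snd \<mu> y * fexp \<xi> (x - \<epsilon> *\<^sub>R y) \<partial>fst \<mu>)"
 proof (rule Fubini_bounded[OF sigma_finite_lborel cm_sigma_finite f cm_integrable, where B=1])
  have "(\<lambda>(\<xi>, y). fexp \<xi> (x - \<epsilon> *\<^sub>R y)) \<in> borel_measurable (borel \<Otimes>\<^sub>M borel)" by measurable
  then show "(\<lambda>(\<xi>, y). fexp \<xi> (x - \<epsilon> *\<^sub>R y)) \<in> borel_measurable (lborel \<Otimes>\<^sub>M fst \<mu>)"
   by (subst measurable_cong_sets[OF sets_pair_measure_cong[OF sets_lborel cm_sets] refl])
 qed simp
 also have "\<dots> = fourier (\<lambda>x. f x * mhat \<mu> (\<epsilon> *\<^sub>R x)) x"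
  unfolding fourier_alt
 proof (rule integral_cong[OF refl])
  fix \<xi>
  have "(\<integral>y. f \<xi> * snd \<mu> y * fexp \<xi> (x - \<epsilon> *\<^sub>R y) \<partial>fst \<mu>) = (\<integral>y. (f \<xi> * fexp \<xi> x) * (snd \<mu> y * cnj (fexp (\<epsilon> *\<^sub>R \<xi>) y)) \<partial>fst \<mu>)"
   unfolding fexp_diff_right fexp_scale by (simp only: mult_ac)
  also have "\<dots> = (f \<xi> * fexp \<xi> x) * mhat \<mu> (\<epsilon> *\<^sub>R \<xi>)" unfolding mhat_alt by (rule integral_mult_right_zero)
  finally show "(\<integral>y. f \<xi> * snd \<mu> y * fexp \<xi> (x - \<epsilon> *\<^sub>R y) \<partial>fst \<mu>) = f \<xi> * mhat \<mu> (\<epsilon> *\<^sub>R \<xi>) * fexp \<xi> x"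
   by (simp only: mult_ac)
 qed
 finally show "cm_conv (fourier f) (cm_dilate \<epsilon> \<mu>) x = fourier (\<lambda>x. f x * mhat \<mu> (\<epsilon> *\<^sub>R x)) x" .
qed

lemma integrable_mult_mhat:
 assumes "integrable lborel f"
 shows "integrable lborel (\<lambda>x. f x * mhat \<mu> (\<epsilon> *\<^sub>R x))"
proof (rule integrable_mult_bounded[OF assms])
 show "cmod (mhat \<mu> (\<epsilon> *\<^sub>R x)) \<le> (\<integral>y. cmod (snd \<mu> y) \<partial>fst \<mu>)" for x by (rule norm_mhat_le)
 show "(\<lambda>x. mhat \<mu> (\<epsilon> *\<^sub>R x)) \<in> borel_measurable lborel"
  unfolding measurable_lborel2
  by (intro borel_measurable_continuous_onI continuous_on_compose2[OF continuous_on_mhat] continuous_intros) auto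
qed

lemma is_cmeasure_cnj: "is_cmeasure (cm_cnj \<mu>)"
 using \<mu> by (simp add: is_cmeasure_def cm_cnj_def)

lemma mhat_cnj: "mhat (cm_cnj \<mu>) x = cnj (mhat \<mu> (- x))"
 unfolding mhat_alt by (simp add: cm_cnj_def fexp_minus_left Bochner_Integration.integral_cnj[symmetric])

text \<open>Evenness of the set function passes to integrals by approximation with simple functions.\<close>
lemma mhat_even:
 assumes even: "\<forall>E\<in>sets borel. cm_apply \<mu> (uminus ` E) = cm_apply \<mu> E"
 shows "mhat \<mu> (- x) = mhat \<mu> x"
proof -
 let ?M = "fst \<mu>" and ?g = "snd \<mu>"
 have um: "y \<in> uminus ` A \<longleftrightarrow> - y \<in> A" for y :: R3 and A
  by (auto simp: image_iff intro!: bexI[of _ "- y"])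
 let ?\<phi> = "\<lambda>y. cnj (fexp x y)"
 have \<phi>: "?\<phi> \<in> borel_measurable borel" by measurable
 \<comment> \<open>Simple functions converging to the character, of modulus at most 2 and hence
   dominated by an integrable function.\<close>
 obtain F where F: "\<And>i. simple_function borel (F i)" "\<And>y. (\<lambda>i. F i y) \<longlonglongrightarrow> ?\<phi> y"
  "\<And>i y. dist (F i y) 0 \<le> 2 * dist (?\<phi> y) 0"
  using borel_measurable_implies_sequence_metric[OF \<phi>, of 0] by auto
 have Fm: "F i \<in> borel_measurable borel" for i using F(1) by (rule borel_measurable_simple_function)
 have bd: "cmod (F i y) \<le> 2" for i y using F(3)[of i y] by simp
 \<comment> \<open>A simple function is a finite combination of level sets. Reflecting its argument
   reflects these sets, and there evenness of the set function applies.\<close>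
 have simple: "(\<integral>y. F i y * ?g y \<partial>?M) = (\<integral>y. F i (- y) * ?g y \<partial>?M)" for i
 proof -
  have fin: "finite (range (F i))" using simple_functionD(1)[OF F(1)[of i]] by simp
  let ?S = "\<lambda>c. F i -` {c}"
  have Sm: "?S c \<in> sets borel" for c using measurable_sets[OF Fm[of i], of "{c}"] by simp
  have Sm': "uminus ` ?S c \<in> sets borel" for c
  proof -
   have e: "uminus ` ?S c = (\<lambda>y. F i (- y)) -` {c}" using um[of _ "?S c"] by auto
   have "(\<lambda>y. F i (- y)) \<in> borel_measurable borel" using Fm[of i] by (rule measurable_compose[rotated]) measurable
   from measurable_sets[OF this, of "{c}"] show ?thesis unfolding e by simp
  qed
  have ind: "integrable ?M (\<lambda>y. indicator E y *\<^sub>R ?g y)" if "E \<in> sets borel" for E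
   using that cm_sets cm_integrable by (intro integrable_mult_indicator) auto
  have rep: "F i y = (\<Sum>c\<in>range (F i). indicator (?S c) y *\<^sub>R c)" for y
  proof -
   have "(\<Sum>c\<in>range (F i). indicator (?S c) y *\<^sub>R c) = (\<Sum>c\<in>range (F i). if c = F i y then c else 0)"
    by (intro sum.cong refl) (auto split: split_indicator)
   also have "\<dots> = F i y" using fin by simp
   finally show ?thesis by simp
  qed
  have L: "(\<integral>y. F i y * ?g y \<partial>?M) = (\<Sum>c\<in>range (F i). c * cm_apply \<mu> (?S c))"
  proof -
   have "(\<integral>y. F i y * ?g y \<partial>?M) = (\<integral>y. (\<Sum>c\<in>range (F i). c * (indicator (?S c) y *\<^sub>R ?g y)) \<partial>?M)"
   proof (rule integral_cong[OF refl])
    fix y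
    have "F i y * ?g y = (\<Sum>c\<in>range (F i). indicator (?S c) y *\<^sub>R c) * ?g y" by (simp only: rep[symmetric])
    also have "\<dots> = (\<Sum>c\<in>range (F i). (indicator (?S c) y *\<^sub>R c) * ?g y)" by (rule sum_distrib_right)
    finally show "F i y * ?g y = (\<Sum>c\<in>range (F i). c * (indicator (?S c) y *\<^sub>R ?g y))"
     by (simp only: mult_scaleR_left mult_scaleR_right)
   qed
   also have "\<dots> = (\<Sum>c\<in>range (F i). \<integral>y. c * (indicator (?S c) y *\<^sub>R ?g y) \<partial>?M)"
    by (intro integral_sum integrable_mult_right ind Sm)
   finally show ?thesis unfolding cm_apply_def set_lebesgue_integral_def by (simp only: integral_mult_right_zero)
  qed
  have R: "(\<integral>y. F i (- y) * ?g y \<partial>?M) = (\<Sum>c\<in>range (F i). c * cm_apply \<mu> (uminus ` ?S c))"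
  proof -
   have ie: "indicator (?S c) (- y) = (indicator (uminus ` ?S c) y :: real)" for c y
    using um[of y "?S c"] by (simp only: indicator_def)
   have "(\<integral>y. F i (- y) * ?g y \<partial>?M) = (\<integral>y. (\<Sum>c\<in>range (F i). c * (indicator (uminus ` ?S c) y *\<^sub>R ?g y)) \<partial>?M)"
   proof (rule integral_cong[OF refl])
    fix y
    have "F i (- y) * ?g y = (\<Sum>c\<in>range (F i). indicator (?S c) (- y) *\<^sub>R c) * ?g y" by (simp only: rep[symmetric])
    also have "\<dots> = (\<Sum>c\<in>range (F i). (indicator (?S c) (- y) *\<^sub>R c) * ?g y)" by (rule sum_distrib_right)
    finally show "F i (- y) * ?g y = (\<Sum>c\<in>range (F i). c * (indicator (uminus ` ?S c) y *\<^sub>R ?g y))"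
     by (simp only: ie mult_scaleR_left mult_scaleR_right)
   qed
   also have "\<dots> = (\<Sum>c\<in>range (F i). \<integral>y. c * (indicator (uminus ` ?S c) y *\<^sub>R ?g y) \<partial>?M)"
    by (intro integral_sum integrable_mult_right ind Sm')
   finally show ?thesis unfolding cm_apply_def set_lebesgue_integral_def by (simp only: integral_mult_right_zero)
  qed
  show ?thesis unfolding L R using even Sm by simp
 qed
 have w: "integrable ?M (\<lambda>y. 2 * cmod (?g y))" using cm_integrable by simp
 note [measurable] = cm_density_measurable Fm
 have l1: "(\<lambda>i. \<integral>y. F i y * ?g y \<partial>?M) \<longlonglongrightarrow> (\<integral>y. ?\<phi> y * ?g y \<partial>?M)"
  by (rule integral_dominated_convergence[OF _ _ w])
    (auto intro!: cm_measurable AE_I2 tendsto_intros F(2) simp: norm_mult bd mult_right_mono)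
 have l2: "(\<lambda>i. \<integral>y. F i (- y) * ?g y \<partial>?M) \<longlonglongrightarrow> (\<integral>y. ?\<phi> (- y) * ?g y \<partial>?M)"
  by (rule integral_dominated_convergence[OF _ _ w])
    (auto intro!: cm_measurable AE_I2 tendsto_intros F(2) simp: norm_mult bd mult_right_mono)
 have "(\<integral>y. ?\<phi> y * ?g y \<partial>?M) = (\<integral>y. ?\<phi> (- y) * ?g y \<partial>?M)"
  using LIMSEQ_unique[OF l1] l2 unfolding simple by blast
 then show ?thesis unfolding mhat_alt by (simp add: fexp_minus_left fexp_minus_right mult.commute)
qed

end

section \<open>Integrability of Schwartz functions and the duality of L^(4/3) and L^4\<close>

lemma integrable_inverse_power6: "(\<integral>\<^sup>+x. ennreal (1 / (1 + norm x) ^ 6) \<partial>(lborel :: R3 measure)) < \<infinity>"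
proof -
 have i1: "(\<integral>\<^sup>+t. ennreal (1 / (1 + t^2)) \<partial>(lborel::real measure)) < \<infinity>"
 proof -
  have "einterval (-\<infinity>) \<infinity> = (UNIV::real set)" by (auto simp: einterval_def)
  then have "integrable lborel (\<lambda>t::real. inverse (1 + t^2))"
   using integrable_inverse_1_plus_square by (simp add: set_integrable_def)
  then show ?thesis by (simp add: integrable_iff_bounded inverse_eq_divide)
 qed
 have "(\<integral>\<^sup>+x. ennreal (1 / (1 + norm x) ^ 6) \<partial>(lborel :: R3 measure)) \<le> (\<integral>\<^sup>+x. (\<Prod>b\<in>Basis. ennreal (1 / (1 + (x \<bullet> b)^2))) \<partial>(lborel :: R3 measure))"
 proof (rule nn_integral_mono)
  fix x :: R3
  \<comment> \<open>The exponent 6 is 2 for each of three coordinates, which makes the majorant a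
    product of integrable functions of one variable.\<close>
  have "(\<Prod>b\<in>(Basis::R3 set). 1 / (1 + norm x)^2) \<le> (\<Prod>b\<in>Basis. 1 / (1 + (x \<bullet> b)^2))"
  proof (rule prod_mono)
   fix b :: R3 assume b: "b \<in> Basis"
   have "(x \<bullet> b)^2 \<le> (norm x)^2" using Basis_le_norm[OF b, of x] by (metis abs_ge_zero power2_abs power_mono)
   moreover have "(1 + norm x)^2 = 1 + 2 * norm x + (norm x)^2" by (simp add: power2_sum)
   moreover have "0 \<le> norm x" by (rule norm_ge_zero)
   ultimately have "1 + (x \<bullet> b)^2 \<le> (1 + norm x)^2" by linarith
   moreover have "0 < 1 + (x \<bullet> b)^2" by (simp add: add_pos_nonneg)
   ultimately show "0 \<le> 1 / (1 + norm x)^2 \<and> 1 / (1 + norm x)^2 \<le> 1 / (1 + (x \<bullet> b)^2)"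
    by (auto intro!: divide_left_mono mult_pos_pos)
  qed
  moreover have "(\<Prod>b\<in>(Basis::R3 set). 1 / (1 + norm x)^2) = 1 / (1 + norm x) ^ 6"
   by (simp add: power_divide power_mult[symmetric])
  ultimately have "ennreal (1 / (1 + norm x) ^ 6) \<le> ennreal (\<Prod>b\<in>Basis. 1 / (1 + (x \<bullet> b)^2))"
   by (intro ennreal_leI) simp
  also have "\<dots> = (\<Prod>b\<in>Basis. ennreal (1 / (1 + (x \<bullet> b)^2)))" by (rule prod_ennreal[symmetric]) simp
  finally show "ennreal (1 / (1 + norm x) ^ 6) \<le> (\<Prod>b\<in>Basis. ennreal (1 / (1 + (x \<bullet> b)^2)))" .
 qed
 also have "\<dots> = (\<Prod>b\<in>(Basis::R3 set). LI+ t. ennreal (1 / (1 + t^2)))"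
  by (rule nn_integral_lborel_prod) auto
 also have "\<dots> < \<infinity>" using i1 by (simp add: power_less_top_ennreal)
 finally show ?thesis .
qed

lemma schwartz_continuous: "schwartz f \<Longrightarrow> continuous_on UNIV f"
 unfolding schwartz_def
 by (metis continuous_at_imp_continuous_on dderiv.simps(1) differentiable_imp_continuous_within)

lemma schwartz_decay:
 assumes "schwartz f"
 obtains B where "B > 0" "\<And>x. cmod (f x) \<le> B / (1 + norm x) ^ 6"
proof -
 have "bounded (range (\<lambda>x. (1 + norm x) ^ 6 * cmod (dderiv [] f x)))" using assms unfolding schwartz_def by blast
 then obtain B where B: "B > 0" "\<And>x. norm ((1 + norm x) ^ 6 * cmod (f x)) \<le> B" unfolding bounded_pos by auto
 have "cmod (f x) \<le> B / (1 + norm x) ^ 6" for x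
 proof -
  have p: "0 < (1 + norm x) ^ 6" by (intro zero_less_power add_pos_nonneg) auto
  have "(1 + norm x) ^ 6 * cmod (f x) \<le> B" using B(2)[of x] by simp
  then show ?thesis using p by (simp add: pos_le_divide_eq mult.commute)
 qed
 then show ?thesis using that B by blast
qed

lemma schwartz_integrable:
 assumes f: "schwartz f"
 shows "integrable lborel f"
proof (rule integrableI_bounded)
 show "f \<in> borel_measurable lborel" using borel_measurable_continuous_onI[OF schwartz_continuous[OF f]] by simp
 obtain B where B: "B > 0" "\<And>x. cmod (f x) \<le> B / (1 + norm x) ^ 6" by (rule schwartz_decay[OF f]) blast
 have "(LI+ x. ennreal (norm (f x))) \<le> (\<integral>\<^sup>+x. ennreal B * ennreal (1 / (1 + norm x) ^ 6) \<partial>(lborel :: R3 measure))"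
 proof (rule nn_integral_mono)
  fix x
  have "ennreal (norm (f x)) \<le> ennreal (B * (1 / (1 + norm x) ^ 6))" using B(2)[of x] by (intro ennreal_leI) simp
  then show "ennreal (norm (f x)) \<le> ennreal B * ennreal (1 / (1 + norm x) ^ 6)"
   by (subst (asm) ennreal_mult) (use B(1) in auto)
 qed
 also have "\<dots> = ennreal B * (\<integral>\<^sup>+x. ennreal (1 / (1 + norm x) ^ 6) \<partial>(lborel::R3 measure))" by (rule nn_integral_cmult) measurable
 also have "\<dots> < \<infinity>" using integrable_inverse_power6 by (simp add: ennreal_mult_less_top)
 finally show "(LI+ x. ennreal (norm (f x))) < \<infinity>" .
qed

text \<open>Raising a decay factor that is at most 1 to the power 4/3 only makes it smaller, so the
  same majorant serves.\<close>

lemma schwartz_L43_finite: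
 assumes f: "schwartz f"
 shows "(LI+ x. ennreal (cmod (f x) powr (4/3))) < \<infinity>"
proof -
 obtain B where B: "B > 0" "\<And>x. cmod (f x) \<le> B / (1 + norm x) ^ 6" by (rule schwartz_decay[OF f]) blast
 have "(\<integral>\<^sup>+x. ennreal (cmod (f x) powr (4/3)) \<partial>(lborel :: R3 measure)) \<le> (\<integral>\<^sup>+x. ennreal (B powr (4/3)) * ennreal (1 / (1 + norm x) ^ 6) \<partial>(lborel :: R3 measure))"
 proof (rule nn_integral_mono)
  fix x :: R3
  let ?r = "1 / (1 + norm x) ^ 6"
  have n1: "1 \<le> 1 + norm x" using norm_ge_zero[of x] by linarith
  then have "1 \<le> (1 + norm x) ^ 6" by (rule one_le_power)
  moreover have "0 < 1 / y \<and> 1 / y \<le> 1" if "1 \<le> y" for y :: real using that by (simp add: divide_le_eq_1)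
  ultimately have r: "0 < ?r" "?r \<le> 1" by blast+
  have "cmod (f x) powr (4/3) \<le> (B * ?r) powr (4/3)" using B(2)[of x] by (intro powr_mono2) auto
  also have "\<dots> = B powr (4/3) * ?r powr (4/3)" by (rule powr_mult)
  also have "\<dots> \<le> B powr (4/3) * ?r"
  proof (rule mult_left_mono)
   have "?r powr (4/3) \<le> ?r powr 1" using r by (intro powr_mono') auto
   then show "?r powr (4/3) \<le> ?r" using r by simp
  qed simp
  finally have "cmod (f x) powr (4/3) \<le> B powr (4/3) * ?r" .
  then have "ennreal (cmod (f x) powr (4/3)) \<le> ennreal (B powr (4/3) * ?r)" by (rule ennreal_leI)
  then show "ennreal (cmod (f x) powr (4/3)) \<le> ennreal (B powr (4/3)) * ennreal ?r"
   by (subst (asm) ennreal_mult) auto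
 qed
 also have "\<dots> = ennreal (B powr (4/3)) * (\<integral>\<^sup>+x. ennreal (1 / (1 + norm x) ^ 6) \<partial>(lborel::R3 measure))" by (rule nn_integral_cmult) measurable
 also have "\<dots> < \<infinity>" using integrable_inverse_power6 by (simp add: ennreal_mult_less_top)
 finally show ?thesis .
qed

text \<open>Pointwise Young inequality for the normalised functions. If the product is not
  integrable, its Bochner integral is 0 by convention and the bound is trivial.\<close>

lemma Hoelder_L43_L4:
 fixes f E :: "R3 \<Rightarrow> complex"
 assumes f: "f \<in> borel_measurable borel" and E: "E \<in> borel_measurable borel"
  and P: "(LI+ x. ennreal (cmod (f x) powr (4/3))) = ennreal P" "0 \<le> P"
  and C: "(LI+ x. (ennreal (cmod (E x)))^4) \<le> ennreal C" "0 < C"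
 shows "cmod (LI x. f x * E x) \<le> P powr (3/4) * C powr (1/4)"
proof (cases "P = 0")
 case True
 note [measurable] = f E
 have "AE x in lborel. ennreal (cmod (f x) powr (4/3)) = 0"
  using P True by (subst nn_integral_0_iff_AE[symmetric]) auto
 then have "AE x in lborel. f x * E x = 0" by eventually_elim (auto simp: ennreal_eq_0_iff)
 then have "(LI x. f x * E x) = (\<integral>x. 0 \<partial>(lborel::R3 measure))" by (intro integral_cong_AE) auto
 then show ?thesis by simp
next
 case False
 note [measurable] = f E
 have P0: "0 < P" using P(2) False by simp
 let ?a = "P powr (3/4)" and ?b = "C powr (1/4)"
 have ab: "0 < ?a" "0 < ?b" using P0 C by auto
 have pt: "cmod (f x * E x) \<le> ?a * ?b * (3/4 * (cmod (f x) powr (4/3) / P) + 1/4 * ((cmod (E x))^4 / C))" for x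
 proof -
  have Y: "(cmod (f x) / ?a) * (cmod (E x) / ?b) \<le> (cmod (f x) / ?a) powr (4/3) / (4/3) + (cmod (E x) / ?b) powr 4 / 4"
   using ab by (intro Youngs_inequality) auto
  have Y1: "(cmod (f x) / ?a) powr (4/3) = cmod (f x) powr (4/3) / P"
   using P0 by (simp add: powr_divide powr_powr)
  have Y2: "(cmod (E x) / ?b) powr 4 = (cmod (E x))^4 / C"
  proof -
   have b4: "?b powr 4 = C" using C by (simp add: powr_powr)
   have E4: "cmod (E x) powr 4 = (cmod (E x))^4" by (cases "cmod (E x) = 0") (auto simp: powr_numeral)
   have "(cmod (E x) / ?b) powr 4 = cmod (E x) powr 4 / ?b powr 4" by (rule powr_divide)
   then show ?thesis unfolding b4 E4 .
  qed
  have "u / (4/3) + v / 4 = 3/4 * u + 1/4 * v" for u v :: real by simp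
  then have "(cmod (f x) / ?a) * (cmod (E x) / ?b) \<le> 3/4 * (cmod (f x) powr (4/3) / P) + 1/4 * ((cmod (E x))^4 / C)"
   using Y unfolding Y1 Y2 by (simp only:)
  then have "?a * ?b * ((cmod (f x) / ?a) * (cmod (E x) / ?b)) \<le> ?a * ?b * (3/4 * (cmod (f x) powr (4/3) / P) + 1/4 * ((cmod (E x))^4 / C))"
   using ab by (intro mult_left_mono) auto
  moreover have "?a * ?b * ((cmod (f x) / ?a) * (cmod (E x) / ?b)) = cmod (f x * E x)" using ab by (simp add: norm_mult)
  ultimately show ?thesis by simp
 qed
 show ?thesis
 proof (cases "integrable lborel (\<lambda>x. f x * E x)")
  case True
  have "ennreal (cmod (LI x. f x * E x)) \<le> (LI+ x. ennreal (cmod (f x * E x)))"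
   by (rule integral_norm_bound_ennreal[OF True])
  also have "\<dots> \<le> (LI+ x. ennreal (?a * ?b * (3/4) / P) * ennreal (cmod (f x) powr (4/3)) + ennreal (?a * ?b * (1/4) / C) * (ennreal (cmod (E x)))^4)"
  proof (rule nn_integral_mono)
   fix x
   have "c * d * (3/4 * (u / P) + 1/4 * (v / C)) = c * d * (3/4) / P * u + c * d * (1/4) / C * v" for c d u v :: real
    by (simp add: algebra_simps)
   then have "ennreal (cmod (f x * E x)) \<le> ennreal (?a * ?b * (3/4) / P * cmod (f x) powr (4/3) + ?a * ?b * (1/4) / C * (cmod (E x))^4)"
    using pt[of x] by (intro ennreal_leI) (simp only:)
   also have "\<dots> = ennreal (?a * ?b * (3/4) / P * cmod (f x) powr (4/3)) + ennreal (?a * ?b * (1/4) / C * (cmod (E x))^4)"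
    using ab P0 C by (intro ennreal_plus) auto
   also have "\<dots> = ennreal (?a * ?b * (3/4) / P) * ennreal (cmod (f x) powr (4/3)) + ennreal (?a * ?b * (1/4) / C) * (ennreal (cmod (E x)))^4"
   proof (rule arg_cong2[where f="(+)"])
    show "ennreal (?a * ?b * (3/4) / P * cmod (f x) powr (4/3)) = ennreal (?a * ?b * (3/4) / P) * ennreal (cmod (f x) powr (4/3))"
    using ab P0 by (intro ennreal_mult) auto
    show "ennreal (?a * ?b * (1/4) / C * (cmod (E x))^4) = ennreal (?a * ?b * (1/4) / C) * (ennreal (cmod (E x)))^4"
    using ab C by (subst ennreal_mult) (auto simp: ennreal_power)
   qed
   finally show "ennreal (cmod (f x * E x)) \<le> ennreal (?a * ?b * (3/4) / P) * ennreal (cmod (f x) powr (4/3)) + ennreal (?a * ?b * (1/4) / C) * (ennreal (cmod (E x)))^4" .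
  qed
  also have "\<dots> = ennreal (?a * ?b * (3/4) / P) * (LI+ x. ennreal (cmod (f x) powr (4/3))) + ennreal (?a * ?b * (1/4) / C) * (LI+ x. (ennreal (cmod (E x)))^4)"
   by (subst nn_integral_add, measurable, subst nn_integral_cmult, measurable, subst nn_integral_cmult, measurable)
  also have "\<dots> \<le> ennreal (?a * ?b * (3/4) / P) * ennreal P + ennreal (?a * ?b * (1/4) / C) * ennreal C"
   unfolding P(1) by (intro add_left_mono mult_left_mono C(1)) simp
  also have "\<dots> = ennreal (?a * ?b * (3/4) / P * P) + ennreal (?a * ?b * (1/4) / C * C)"
   using ab P0 C(2) by (intro arg_cong2[where f="(+)"] ennreal_mult[symmetric]) auto
  also have "\<dots> = ennreal (?a * ?b * (3/4)) + ennreal (?a * ?b * (1/4))" using P0 C(2) by simp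
  also have "\<dots> = ennreal (?a * ?b * (3/4) + ?a * ?b * (1/4))" using ab by (intro ennreal_plus[symmetric]) auto
  also have "\<dots> = ennreal (?a * ?b)" by simp
  finally show ?thesis using ab by (simp add: ennreal_le_iff)
 next
  case False
  then show ?thesis using ab by (simp add: not_integrable_integral_eq)
 qed
qed

text \<open>Testing gives the L^4 bound C0 \<gamma>^2, and Hoelder yields \<gamma>^4 \<le> P^3 C0
  \<gamma>^2. Dividing by \<gamma>^2 is legitimate because \<gamma> is a real number.\<close>

lemma (in restriction_measure) dual_close:
 fixes f E :: "R3 \<Rightarrow> complex"
 assumes f: "f \<in> borel_measurable borel"
  and P: "(LI+ x. ennreal (cmod (f x) powr (4/3))) = ennreal P" "0 \<le> P"
  and E: "continuous_on UNIV E" and \<gamma>: "0 \<le> \<gamma>" and C0: "0 < C0"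
  and eq: "(LI x. f x * E x) = complex_of_real \<gamma>"
  and test: "\<And>K s. compactly_supported K \<Longrightarrow> (\<And>x. 0 \<le> K x) \<Longrightarrow> s > 0 \<Longrightarrow>
   (LI+ x. ennreal (gconv s K x) * (ennreal (cmod (E x)))^2)\<^sup>2 \<le> ennreal (C0 * \<gamma>^2) * (LI+ x. (ennreal (K x))^2)"
 shows "\<gamma> \<le> sqrt C0 * P powr (3/2)"
proof (cases "\<gamma> = 0")
 case False
 then have g: "0 < \<gamma>" using \<gamma> by simp
 have "(LI+ x. (ennreal (cmod (E x)))^4) \<le> ennreal (C0 * \<gamma>^2)"
  by (rule L4_by_testing[OF E _ test]) auto
 then have "cmod (LI x. f x * E x) \<le> P powr (3/4) * (C0 * \<gamma>^2) powr (1/4)"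
  using g C0 by (intro Hoelder_L43_L4 f P borel_measurable_continuous_onI E) auto
 then have "\<gamma> \<le> P powr (3/4) * (C0 * \<gamma>^2) powr (1/4)" unfolding eq using \<gamma> by simp
 then have "\<gamma> ^ 4 \<le> (P powr (3/4) * (C0 * \<gamma>^2) powr (1/4)) ^ 4" using \<gamma> by (rule power_mono)
 also have "\<dots> = P ^ 3 * (C0 * \<gamma>^2)"
 proof -
  have "(P powr (3/4)) ^ 4 = P ^ 3"
  proof (cases "P = 0")
   case False
   then have "0 < P" using P by simp
   then have "(P powr (3/4)) ^ 4 = P powr (real 4 * (3/4))" by (simp add: powr_power)
   then show ?thesis using \<open>0 < P\<close> by simp
  qed simp
  moreover have "((C0 * \<gamma>^2) powr (1/4)) ^ 4 = C0 * \<gamma>^2" using g C0 by (simp add: powr_power)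
  ultimately show ?thesis by (simp add: power_mult_distrib)
 qed
 finally have "\<gamma>^2 * \<gamma>^2 \<le> (P ^ 3 * C0) * \<gamma>^2" by (simp add: power4_eq_xxxx power2_eq_square mult_ac)
 then have "\<gamma>^2 \<le> P ^ 3 * C0" by (rule mult_right_le_imp_le) (use g in simp)
 also have "\<dots> = (sqrt C0 * P powr (3/2))^2"
 proof (cases "P = 0")
  case False
  then have "0 < P" using P by simp
  then have "(P powr (3/2))^2 = P powr 3" by (simp add: powr_power)
  then have "(P powr (3/2))^2 = P ^ 3" using \<open>0 < P\<close> by simp
  then show ?thesis using C0 by (simp add: power_mult_distrib mult.commute)
 qed simp
 finally show ?thesis by (rule power2_le_imp_le) (use C0 in simp)
qed (use C0 in simp)

section \<open>Linearisation and duality\<close>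

lemma continuous_on_powr_nonneg:
 fixes f :: "'a::topological_space \<Rightarrow> real"
 assumes "continuous_on S f" "\<And>x. 0 \<le> f x" "0 < r"
 shows "continuous_on S (\<lambda>x. f x powr r)"
 using assms by (intro continuous_on_powr') (auto intro: continuous_on_const)

lemma continuous_on_vnorm:
 fixes a :: "'z::topological_space \<Rightarrow> 'a::linorder \<Rightarrow> complex"
 assumes "0 < \<rho>" "\<And>t. continuous_on UNIV (\<lambda>z. a z t)"
 shows "continuous_on UNIV (\<lambda>z. vnorm \<rho> S (a z))"
 unfolding vnorm_def incr_def using assms
 by (intro continuous_on_powr_nonneg continuous_intros sum_nonneg) auto

lemma continuous_on_wnorm:
 fixes b :: "'z::topological_space \<Rightarrow> 'a::linorder \<Rightarrow> 'a \<Rightarrow> complex"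
 assumes "0 < \<rho>" "\<And>s t. continuous_on UNIV (\<lambda>z. b z s t)"
 shows "continuous_on UNIV (\<lambda>z. wnorm \<rho> S S' (b z))"
 unfolding wnorm_def incr_def using assms
 by (intro continuous_on_powr_nonneg continuous_intros sum_nonneg) auto

lemma continuous_on_Max_finite:
 fixes f :: "'i \<Rightarrow> 'z::topological_space \<Rightarrow> real"
 assumes "finite I" "I \<noteq> {}" "\<And>i. i \<in> I \<Longrightarrow> continuous_on UNIV (f i)"
 shows "continuous_on UNIV (\<lambda>z. Max ((\<lambda>i. f i z) ` I))"
 using assms
proof (induction rule: finite_ne_induct)
 case (insert i I)
 have "(\<lambda>z. Max ((\<lambda>i. f i z) ` insert i I)) = (\<lambda>z. max (f i z) (Max ((\<lambda>i. f i z) ` I)))"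
  using insert.hyps by (intro ext) simp
 moreover have "continuous_on UNIV (\<lambda>z. max (f i z) (Max ((\<lambda>i. f i z) ` I)))"
  using insert by (intro continuous_on_max) auto
 ultimately show ?case by (simp only:)
qed simp

text \<open>Measurable selection from a finite family, one member at a time. It makes the maximising
  partition a measurable function of the frequency.\<close>

lemma measurable_argmax:
 fixes N :: "'i \<Rightarrow> 'a::topological_space \<Rightarrow> real"
 assumes "finite I" "I \<noteq> {}" "\<And>i. i \<in> I \<Longrightarrow> N i \<in> borel_measurable borel"
 shows "\<exists>sel. (\<forall>\<omega>. sel \<omega> \<in> I) \<and> (\<forall>i. {\<omega>. sel \<omega> = i} \<in> sets borel) \<and> (\<forall>\<omega>. \<forall>i\<in>I. N i \<omega> \<le> N (sel \<omega>) \<omega>)"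
 using assms
proof (induction rule: finite_ne_induct)
 case (singleton i)
 show ?case by (rule exI[of _ "\<lambda>_. i"]) auto
next
 case (insert i I)
 then obtain sel where sel: "\<And>\<omega>. sel \<omega> \<in> I" "\<And>i. {\<omega>. sel \<omega> = i} \<in> sets borel" "\<And>\<omega> i. i \<in> I \<Longrightarrow> N i \<omega> \<le> N (sel \<omega>) \<omega>"
  by auto metis
 have [measurable]: "N j \<in> borel_measurable borel" if "j \<in> insert i I" for j using insert.prems that by auto
 let ?A = "{\<omega>. N (sel \<omega>) \<omega> \<le> N i \<omega>}"
 have "?A = (\<Union>j\<in>I. {\<omega>. sel \<omega> = j} \<inter> {\<omega>. N j \<omega> \<le> N i \<omega>})" using sel(1) by auto
 moreover have "(\<Union>j\<in>I. {\<omega>. sel \<omega> = j} \<inter> {\<omega>. N j \<omega> \<le> N i \<omega>}) \<in> sets borel"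
 proof (intro sets.finite_UN insert.hyps sets.Int sel(2))
  fix j assume "j \<in> I"
  then have [measurable]: "N j \<in> borel_measurable borel" "N i \<in> borel_measurable borel" using insert.prems by auto
  show "{\<omega>. N j \<omega> \<le> N i \<omega>} \<in> sets borel" by measurable
 qed
 ultimately have A: "?A \<in> sets borel" by simp
 let ?s = "\<lambda>\<omega>. if \<omega> \<in> ?A then i else sel \<omega>"
 show ?case
 proof (intro exI[of _ ?s] conjI allI ballI)
  show "?s \<omega> \<in> insert i I" for \<omega> using sel(1) by simp
  fix j
  have "{\<omega>. ?s \<omega> = j} = (if j = i then ?A \<union> {\<omega>. sel \<omega> = j} else {\<omega>. sel \<omega> = j} - ?A)" by auto
  then show "{\<omega>. ?s \<omega> = j} \<in> sets borel" using A sel(2)[of j] by auto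
 next
  fix \<omega> j assume "j \<in> insert i I"
  then show "N j \<omega> \<le> N (?s \<omega>) \<omega>" using sel(3)[of j \<omega>] by auto
 qed
qed

lemma fourier_diff:
 assumes "integrable lborel f" "integrable lborel g"
 shows "fourier (\<lambda>x. f x - g x) z = fourier f z - fourier g z"
 unfolding fourier_alt left_diff_distrib
 by (rule integral_diff) (intro integrable_mult_fexp assms)+

lemma ennreal_le_sqrt:
 assumes "x^2 \<le> ennreal y" "0 \<le> y"
 shows "x \<le> ennreal (sqrt y)"
proof (cases x)
 case (real r)
 then have "r^2 \<le> y" using assms by (simp add: ennreal_power)
 then have "r \<le> sqrt y" by (rule real_le_rsqrt)
 then show ?thesis using real by (simp add: ennreal_leI)
qed (use assms in \<open>simp add: power2_eq_square ennreal_top_mult top_unique\<close>)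

context restriction_measure begin

text \<open>The adjoint of the variation once it is linearised: at \<open>\<omega>\<close> the supremum is attained at the partition \<open>sel \<omega>\<close>,
 with dual coefficients \<open>b \<omega>\<close>.\<close>
definition lin_ext :: "real set \<Rightarrow> (R3 \<Rightarrow> real set) \<Rightarrow> (R3 \<Rightarrow> real \<Rightarrow> complex) \<Rightarrow> (R3 \<Rightarrow> complex) \<Rightarrow> R3 \<Rightarrow> complex" where
 "lin_ext T sel b m x = (\<Sum>u\<in>steps T. extension (\<lambda>\<omega>. refine (sel \<omega>) (b \<omega>) u) x * incr (\<lambda>t. m (t *\<^sub>R x)) T u)"

text \<open>The function \<open>g\<close> dominates the dual norm of the coefficients pointwise. In
  \<open>variation_bound\<close> it is the variation itself, in L^2 because there are finitely many
  scales.\<close>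

definition admissible :: "real \<Rightarrow> real set \<Rightarrow> (R3 \<Rightarrow> real set) \<Rightarrow> (R3 \<Rightarrow> real \<Rightarrow> complex) \<Rightarrow> (R3 \<Rightarrow> real) \<Rightarrow> bool" where
 "admissible \<rho> T sel b g \<longleftrightarrow> finite T \<and> T \<noteq> {} \<and> T \<subseteq> {0<..} \<and> (\<forall>\<omega>. sel \<omega> \<subseteq> T \<and> sel \<omega> \<noteq> {})
  \<and> (\<forall>u\<in>steps T. bounded_borel (\<lambda>\<omega>. refine (sel \<omega>) (b \<omega>) u))
  \<and> g \<in> borel_measurable borel \<and> (\<forall>\<omega>. 0 \<le> g \<omega>) \<and> (TI+ \<omega>. (ennreal (g \<omega>))^2) < \<infinity>
  \<and> (\<forall>\<omega>. (\<Sum>s\<in>steps (sel \<omega>). cmod (b \<omega> s) powr (\<rho> / (\<rho> - 1))) powr (1 / (\<rho> / (\<rho> - 1))) \<le> g \<omega>)"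

text \<open>The form in which the three conditions are used. The constant is uniform in the scales,
  the selected partitions and the coefficients; the factor in \<open>g\<close> is the fourth power
  of its L^2 norm.\<close>

definition testable :: "real \<Rightarrow> (R3 \<Rightarrow> complex) \<Rightarrow> real \<Rightarrow> bool" where
 "testable \<rho> m C0 \<longleftrightarrow> (\<forall>T sel b g K s. admissible \<rho> T sel b g \<longrightarrow> compactly_supported K \<longrightarrow> (\<forall>x. 0 \<le> K x) \<longrightarrow> s > 0 \<longrightarrow>
   (LI+ x. ennreal (gconv s K x) * (ennreal (cmod (lin_ext T sel b m x)))^2)\<^sup>2
    \<le> ennreal C0 * (TI+ \<omega>. (ennreal (g \<omega>))^2)^2 * (LI+ x. (ennreal (K x))^2))"

lemma continuous_on_incr_scale:
 fixes m :: "R3 \<Rightarrow> 'b::real_normed_vector"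
 assumes "continuous_on UNIV m"
 shows "continuous_on UNIV (\<lambda>x. incr (\<lambda>t. m (t *\<^sub>R x)) T u)"
 unfolding incr_def
 by (intro continuous_on_diff continuous_on_compose2[OF assms] continuous_intros) auto

text \<open>Linearisation and duality: with the maximising partition and its extremal coefficients,
  the integral \<gamma> of the squared variation equals the pairing of f with
  \<open>lin_ext\<close>, and \<open>dual_close\<close> turns the test bound for the latter into a
  bound for \<gamma>.\<close>

lemma variation_bound:
 fixes f m :: "R3 \<Rightarrow> complex" and T :: "real set"
 assumes \<rho>: "1 < \<rho>" and m: "continuous_on UNIV m" "\<And>x. cmod (m x) \<le> Bm" and test: "testable \<rho> m C0" and C0: "0 < C0"
  and f: "integrable lborel f" and P: "(LI+ x. ennreal (cmod (f x) powr (4/3))) = ennreal P" "0 \<le> P"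
  and T: "finite T" "T \<noteq> {}" "T \<subseteq> {0<..}"
 defines "a \<equiv> \<lambda>\<omega> t. fourier (\<lambda>x. f x * m (t *\<^sub>R x)) \<omega>"
 shows "(TI+ \<omega>. (ennreal (Max ((\<lambda>S. vnorm \<rho> S (a \<omega>)) ` (Pow T - {{}}))))^2) \<le> ennreal (sqrt C0 * P powr (3/2))"
proof -
 let ?I = "Pow T - {{}}"
 have I: "finite ?I" "?I \<noteq> {}" using T by auto
 have fin: "finite S" if "S \<in> ?I" for S using that T(1) finite_subset by auto
 have mt: "continuous_on UNIV (\<lambda>x. m (t *\<^sub>R x))" for t
  by (intro continuous_on_compose2[OF m(1)] continuous_intros) auto
 have int: "integrable lborel (\<lambda>x. f x * m (t *\<^sub>R x))" for t
  by (rule integrable_mult_bounded[OF f, where B=Bm]) (use m(2) borel_measurable_continuous_onI[OF mt] in auto)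
 have ac: "continuous_on UNIV (\<lambda>\<omega>. a \<omega> t)" for t unfolding a_def by (rule continuous_on_fourier[OF int])
 define Ba where "Ba = (LI x. cmod (f x)) * \<bar>Bm\<bar>"
 have Ba0: "0 \<le> Ba" by (simp add: Ba_def)
 have ab: "cmod (a \<omega> t) \<le> Ba" for \<omega> t
 proof -
  have "cmod (a \<omega> t) \<le> (LI x. cmod (f x * m (t *\<^sub>R x)))" unfolding a_def by (rule norm_fourier_le[OF int])
  also have "\<dots> \<le> (LI x. cmod (f x) * \<bar>Bm\<bar>)"
  proof (rule integral_mono)
   show "integrable lborel (\<lambda>x. cmod (f x * m (t *\<^sub>R x)))" using int[of t] by simp
   show "integrable lborel (\<lambda>x. cmod (f x) * \<bar>Bm\<bar>)" using f by simp
   show "cmod (f x * m (t *\<^sub>R x)) \<le> cmod (f x) * \<bar>Bm\<bar>" for x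
    unfolding norm_mult using m(2)[of "t *\<^sub>R x"] by (intro mult_left_mono) auto
  qed
  finally show ?thesis by (simp add: Ba_def)
 qed
 let ?N = "\<lambda>S \<omega>. vnorm \<rho> S (a \<omega>)"
 have Nc: "continuous_on UNIV (?N S)" for S using \<rho> ac by (intro continuous_on_vnorm) auto
 have Nm: "?N S \<in> borel_measurable borel" for S using Nc by (rule borel_measurable_continuous_onI)
 obtain sel where sel0: "\<forall>\<omega>. sel \<omega> \<in> ?I" "\<forall>S. {\<omega>. sel \<omega> = S} \<in> sets borel" "\<forall>\<omega>. \<forall>S\<in>?I. ?N S \<omega> \<le> ?N (sel \<omega>) \<omega>"
  using measurable_argmax[OF I, of ?N, OF Nm] by (elim exE conjE)
 have sel: "\<And>\<omega>. sel \<omega> \<in> ?I" "\<And>S. {\<omega>. sel \<omega> = S} \<in> sets borel" "\<And>\<omega> S. S \<in> ?I \<Longrightarrow> ?N S \<omega> \<le> ?N (sel \<omega>) \<omega>"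
  using sel0 by (blast, blast, blast)
 define V where "V \<omega> = Max ((\<lambda>S. ?N S \<omega>) ` ?I)" for \<omega>
 have Vsel: "V \<omega> = ?N (sel \<omega>) \<omega>" for \<omega>
  unfolding V_def
 proof (rule Max_eqI)
  show "finite ((\<lambda>S. ?N S \<omega>) ` ?I)" using I(1) by (rule finite_imageI)
  show "y \<le> ?N (sel \<omega>) \<omega>" if "y \<in> (\<lambda>S. ?N S \<omega>) ` ?I" for y using that sel(3) by blast
  show "?N (sel \<omega>) \<omega> \<in> (\<lambda>S. ?N S \<omega>) ` ?I" using sel(1) by (rule imageI)
 qed
 have V0: "0 \<le> V \<omega>" for \<omega> unfolding Vsel vnorm_def by simp
 have Vc: "continuous_on UNIV V" unfolding V_def by (rule continuous_on_Max_finite[OF I]) (rule Nc)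
 have Vm [measurable]: "V \<in> borel_measurable borel" using Vc by (rule borel_measurable_continuous_onI)
 \<comment> \<open>A crude bound depending on the number of scales. It serves boundedness and
   integrability and does not enter the final constant.\<close>
 define BV where "BV = (real (card T) * (2 * Ba) powr \<rho>) powr (1/\<rho>)"
 have VB: "V \<omega> \<le> BV" for \<omega>
 proof -
  let ?S = "sel \<omega>"
  have S: "?S \<subseteq> T" "finite ?S" using sel(1)[of \<omega>] fin by auto
  have "(\<Sum>s\<in>steps ?S. cmod (incr (a \<omega>) ?S s) powr \<rho>) \<le> (\<Sum>s\<in>steps ?S. (2 * Ba) powr \<rho>)"
  proof (intro sum_mono powr_mono2)
   fix s
   show "cmod (incr (a \<omega>) ?S s) \<le> 2 * Ba"
    unfolding incr_def using norm_triangle_ineq4[of "a \<omega> s" "a \<omega> (pre ?S s)"] ab[of \<omega> s] ab[of \<omega> "pre ?S s"] by linarith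
  qed (use \<rho> in auto)
  also have "\<dots> = real (card (steps ?S)) * (2 * Ba) powr \<rho>" by simp
  also have "\<dots> \<le> real (card T) * (2 * Ba) powr \<rho>"
   using S T(1) by (intro mult_right_mono) (auto simp: steps_def intro!: card_mono)
  finally show ?thesis unfolding Vsel vnorm_def BV_def using \<rho> by (intro powr_mono2 sum_nonneg) auto
 qed
 define q where "q = \<rho> / (\<rho> - 1)"
 note ce = conjugate_exponent[OF \<rho>, folded q_def]
 define b where "b \<omega> = lp_dual \<rho> (steps (sel \<omega>)) (incr (a \<omega>) (sel \<omega>))" for \<omega>
 have dual: "(\<Sum>s\<in>steps (sel \<omega>). b \<omega> s * incr (a \<omega>) (sel \<omega>) s) = complex_of_real ((V \<omega>)^2)"
  "(\<Sum>s\<in>steps (sel \<omega>). cmod (b \<omega> s) powr q) powr (1/q) = V \<omega>" for \<omega>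
  using sum_lp_dual[OF \<rho> q_def finite_steps[OF fin[OF sel(1)[of \<omega>]]], of "incr (a \<omega>) (sel \<omega>)"]
  unfolding b_def Vsel vnorm_def by simp_all
 let ?\<beta> = "\<lambda>u \<omega>. refine (sel \<omega>) (b \<omega>) u"
 have bB: "cmod (b \<omega> s) \<le> BV" if "s \<in> steps (sel \<omega>)" for \<omega> s
 proof -
  have "cmod (b \<omega> s) powr q \<le> (\<Sum>s\<in>steps (sel \<omega>). cmod (b \<omega> s) powr q)"
   using that finite_steps[OF fin[OF sel(1)[of \<omega>]]] by (intro member_le_sum) auto
  then have "(cmod (b \<omega> s) powr q) powr (1/q) \<le> V \<omega>" unfolding dual(2)[symmetric] using ce by (intro powr_mono2) auto
  then show ?thesis using VB[of \<omega>] ce by (simp add: powr_powr)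
 qed
 have BV0: "0 \<le> BV" by (simp add: BV_def)
 have \<beta>: "bounded_borel (?\<beta> u)" for u
  unfolding bounded_borel_def
 proof (intro conjI exI allI)
  show "cmod (?\<beta> u \<omega>) \<le> BV" for \<omega>
   unfolding refine_def using bB[OF nxt_props(1)[OF fin[OF sel(1)[of \<omega>]]]] sel(1)[of \<omega>] BV0 by auto
  let ?b = "\<lambda>S \<omega>. refine S (lp_dual \<rho> (steps S) (incr (a \<omega>) S)) u"
  \<comment> \<open>Measurability is checked on the finitely many pieces on which the selected
    partition is constant.\<close>
  have "?\<beta> u = (\<lambda>\<omega>. \<Sum>S\<in>?I. indicator {\<omega>. sel \<omega> = S} \<omega> *\<^sub>R ?b S \<omega>)"
  proof
   fix \<omega>
   have "(\<Sum>S\<in>?I. indicator {\<omega>. sel \<omega> = S} \<omega> *\<^sub>R ?b S \<omega>) = (\<Sum>S\<in>?I. if S = sel \<omega> then ?b S \<omega> else 0)"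
    by (intro sum.cong refl) (auto split: split_indicator)
   also have "\<dots> = ?b (sel \<omega>) \<omega>" using I(1) sel(1)[of \<omega>] by simp
   finally show "?\<beta> u \<omega> = (\<Sum>S\<in>?I. indicator {\<omega>. sel \<omega> = S} \<omega> *\<^sub>R ?b S \<omega>)" by (simp add: b_def)
  qed
  moreover have "?b S \<in> borel_measurable borel" for S
  proof -
   have [measurable]: "(\<lambda>\<omega>. a \<omega> t) \<in> borel_measurable borel" for t using ac by (rule borel_measurable_continuous_onI)
   have [measurable]: "(\<lambda>\<omega>. sgn (incr (a \<omega>) S s)) \<in> borel_measurable borel" for s
    unfolding sgn_div_norm incr_def by measurable
   have [measurable]: "(\<lambda>\<omega>. incr (a \<omega>) S s) \<in> borel_measurable borel" for s
    unfolding incr_def by measurable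
   have "(\<lambda>\<omega>. lp_dual \<rho> (steps S) (incr (a \<omega>) S) s) \<in> borel_measurable borel" for s
    unfolding lp_dual_def by measurable
   then show ?thesis unfolding refine_def by simp
  qed
  ultimately show "?\<beta> u \<in> borel_measurable borel" using sel(2) by simp
 qed
 have iV: "integrable \<tau> (\<lambda>\<omega>. (V \<omega>)^2)"
  by (rule integrable_const_bound[where B="BV^2"]) (use V0 VB in \<open>auto simp: power_mono cong: measurable_cong_sets\<close>)
 define \<gamma> where "\<gamma> = (TI \<omega>. (V \<omega>)^2)"
 have \<gamma>0: "0 \<le> \<gamma>" unfolding \<gamma>_def by simp
 have V2: "(TI+ \<omega>. (ennreal (V \<omega>))^2) = ennreal \<gamma>"
  unfolding \<gamma>_def using nn_integral_eq_integral[OF iV] V0 by (simp add: ennreal_power)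
 have adm: "admissible \<rho> T sel b V"
  unfolding admissible_def using T sel(1) \<beta> V0 Vm dual(2)[unfolded q_def] V2 by auto
 let ?E = "lin_ext T sel b m"
 have Ec: "continuous_on UNIV ?E" unfolding lin_ext_def
  by (intro continuous_on_sum continuous_on_mult continuous_on_extension \<beta> continuous_on_incr_scale m)
 have Dint: "integrable lborel (\<lambda>x. f x * incr (\<lambda>t. m (t *\<^sub>R x)) T u)" for u
  unfolding incr_def right_diff_distrib by (intro integrable_diff int)
 have Dfou: "fourier (\<lambda>x. f x * incr (\<lambda>t. m (t *\<^sub>R x)) T u) \<omega> = incr (a \<omega>) T u" for u \<omega>
  unfolding incr_def right_diff_distrib a_def by (rule fourier_diff[OF int int])
 have iE: "integrable lborel (\<lambda>x. f x * incr (\<lambda>t. m (t *\<^sub>R x)) T u * extension (?\<beta> u) x)" for u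
  by (rule integrable_mult_bounded[OF Dint, where B="TI \<omega>. cmod (?\<beta> u \<omega>)"])
    (use norm_extension_le measurable_extension[OF \<beta>] in auto)
 have i\<beta>: "integrable \<tau> (\<lambda>\<omega>. ?\<beta> u \<omega> * incr (a \<omega>) T u)" for u
 proof (rule integrable_mult_bounded[OF bounded_borel_integrable[OF \<beta>], where B="2 * Ba"])
  have "(\<lambda>\<omega>. incr (a \<omega>) T u) \<in> borel_measurable borel"
   unfolding incr_def using borel_measurable_continuous_onI[OF ac] by measurable
  then show "(\<lambda>\<omega>. incr (a \<omega>) T u) \<in> borel_measurable \<tau>" by (simp cong: measurable_cong_sets)
  show "cmod (incr (a \<omega>) T u) \<le> 2 * Ba" for \<omega>
   unfolding incr_def using norm_triangle_ineq4[of "a \<omega> u" "a \<omega> (pre T u)"] ab[of \<omega> u] ab[of \<omega> "pre T u"] by linarith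
 qed
 have "(LI x. f x * ?E x) = (LI x. (\<Sum>u\<in>steps T. f x * incr (\<lambda>t. m (t *\<^sub>R x)) T u * extension (?\<beta> u) x))"
  unfolding lin_ext_def by (simp only: sum_distrib_left mult_ac)
 also have "\<dots> = (\<Sum>u\<in>steps T. LI x. f x * incr (\<lambda>t. m (t *\<^sub>R x)) T u * extension (?\<beta> u) x)"
  by (rule integral_sum) (rule iE)
 also have "\<dots> = (\<Sum>u\<in>steps T. TI \<omega>. ?\<beta> u \<omega> * incr (a \<omega>) T u)"
  by (intro sum.cong refl) (simp only: integral_mult_extension[OF Dint \<beta>] Dfou)
 also have "\<dots> = (TI \<omega>. (\<Sum>u\<in>steps T. ?\<beta> u \<omega> * incr (a \<omega>) T u))"
  by (rule integral_sum[symmetric]) (rule i\<beta>)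
 \<comment> \<open>On the selected partition the increments telescope, and the extremal coefficients
   pair with them to the squared variation.\<close>
 also have "\<dots> = (TI \<omega>. complex_of_real ((V \<omega>)^2))"
 proof (rule integral_cong[OF refl])
  fix \<omega>
  have "sel \<omega> \<subseteq> T" "sel \<omega> \<noteq> {}" using sel(1)[of \<omega>] by auto
  from sum_refine[OF T(1) this, of "b \<omega>" "a \<omega>"] show "(\<Sum>u\<in>steps T. ?\<beta> u \<omega> * incr (a \<omega>) T u) = complex_of_real ((V \<omega>)^2)"
   unfolding dual(1) .
 qed
 also have "\<dots> = complex_of_real \<gamma>" unfolding \<gamma>_def by (rule integral_complex_of_real)
 finally have eq: "(LI x. f x * ?E x) = complex_of_real \<gamma>" .
 have "\<gamma> \<le> sqrt C0 * P powr (3/2)"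
 proof (rule dual_close[OF _ P Ec \<gamma>0 C0 eq])
  show "f \<in> borel_measurable borel" using f by auto
  fix K :: "R3 \<Rightarrow> real" and s :: real assume K: "compactly_supported K" "\<And>x. 0 \<le> K x" "s > 0"
  have e: "ennreal C0 * (ennreal \<gamma>)^2 = ennreal (C0 * \<gamma>^2)" using C0 \<gamma>0 by (simp add: ennreal_mult ennreal_power)
  show "(LI+ x. ennreal (gconv s K x) * (ennreal (cmod (?E x)))^2)^2 \<le> ennreal (C0 * \<gamma>^2) * (LI+ x. (ennreal (K x))^2)"
   using test[unfolded testable_def, rule_format, OF adm K] unfolding V2 e .
 qed
 then show ?thesis using V2 unfolding V_def by (simp add: ennreal_leI)
qed

text \<open>Restriction from L^(4/3) to L^2 by the same duality with a single index. It will control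
  the variation norm at scale 0, and \<open>A + 1\<close> ensures a positive constant.\<close>

lemma restriction_bound:
 assumes f: "integrable lborel f" and P: "(LI+ x. ennreal (cmod (f x) powr (4/3))) = ennreal P" "0 \<le> P"
 shows "(TI+ \<omega>. (ennreal (cmod (fourier f \<omega>)))^2) \<le> ennreal (sqrt (A + 1) * P powr (3/2))"
proof -
 let ?\<beta> = "\<lambda>\<omega>. cnj (fourier f \<omega>)"
 have [measurable]: "fourier f \<in> borel_measurable borel" by (rule measurable_fourier[OF f])
 have \<beta>: "bounded_borel ?\<beta>"
  unfolding bounded_borel_def using norm_fourier_le[OF f] by (auto intro!: exI[of _ "LI x. cmod (f x)"])
 have iV: "integrable \<tau> (\<lambda>\<omega>. (cmod (fourier f \<omega>))^2)"
  by (rule integrable_const_bound[where B="(LI x. cmod (f x))^2"])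
    (use norm_fourier_le[OF f] in \<open>auto simp: power_mono cong: measurable_cong_sets\<close>)
 define \<gamma> where "\<gamma> = (TI \<omega>. (cmod (fourier f \<omega>))^2)"
 have \<gamma>0: "0 \<le> \<gamma>" unfolding \<gamma>_def by simp
 have V2: "(TI+ \<omega>. (ennreal (cmod (fourier f \<omega>)))^2) = ennreal \<gamma>"
  unfolding \<gamma>_def using nn_integral_eq_integral[OF iV] by (simp add: ennreal_power)
 have "(LI x. f x * extension ?\<beta> x) = (TI \<omega>. complex_of_real ((cmod (fourier f \<omega>))^2))"
  unfolding integral_mult_extension[OF f \<beta>] complex_norm_square by (simp only: mult.commute)
 also have "\<dots> = complex_of_real \<gamma>" unfolding \<gamma>_def by (rule integral_complex_of_real)
 finally have eq: "(LI x. f x * extension ?\<beta> x) = complex_of_real \<gamma>" .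
 have "\<gamma> \<le> sqrt (A + 1) * P powr (3/2)"
 proof (rule dual_close[OF _ P continuous_on_extension[OF \<beta>] \<gamma>0 _ eq])
  show "f \<in> borel_measurable borel" using f by auto
  show "0 < A + 1" using A_nonneg by simp
  fix K :: "R3 \<Rightarrow> real" and s :: real assume K: "compactly_supported K" "\<And>x. 0 \<le> K x" "s > 0"
  let ?h = "\<lambda>x. complex_of_real (gconv s K x)"
  have hi: "integrable lborel ?h" using gconv_integrable[OF K] by simp
  have "(LI+ x. ennreal (gconv s K x * (cmod (extension ?\<beta> x))^2))^2
    \<le> ennreal A * (TI+ x. (ennreal (cmod (fourier f x)))^2)^2 * (LI+ z. (ennreal (cmod (fourier ?h z)))^2)"
  proof (rule quadratic_extension_bound[where p="\<lambda>_ _. ?h" and \<beta>="\<lambda>_. ?\<beta>" and I="{()}"])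
   show "continuous_on UNIV (\<lambda>z. cmod (fourier ?h z))" by (intro continuous_on_norm continuous_on_fourier hi)
   show "(\<Sum>i\<in>{()}. \<Sum>j\<in>{()}. ?h x * (extension ?\<beta> x * cnj (extension ?\<beta> x))) = complex_of_real (gconv s K x * (cmod (extension ?\<beta> x))^2)" for x
    using complex_norm_square[of "extension ?\<beta> x"] by simp
   show "0 \<le> gconv s K x * (cmod (extension ?\<beta> x))^2" for x using gconv_nonneg[OF K] by simp
  qed (use hi \<beta> in \<open>auto simp: norm_mult\<close>)
  also have "\<dots> \<le> ennreal ((A + 1) * \<gamma>^2) * (LI+ x. (ennreal (K x))^2)"
  proof (rule mult_mono)
   have "ennreal A * (ennreal \<gamma>)^2 = ennreal (A * \<gamma>^2)" using A_nonneg \<gamma>0 by (simp add: ennreal_mult ennreal_power)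
   also have "\<dots> \<le> ennreal ((A + 1) * \<gamma>^2)" by (intro ennreal_leI mult_right_mono) auto
   finally show "ennreal A * (TI+ x. (ennreal (cmod (fourier f x)))^2)^2 \<le> ennreal ((A + 1) * \<gamma>^2)" unfolding V2 .
   show "(LI+ z. (ennreal (cmod (fourier ?h z)))^2) \<le> (LI+ x. (ennreal (K x))^2)" by (rule fourier_gconv_L2[OF K])
  qed simp_all
  finally show "(LI+ x. ennreal (gconv s K x) * (ennreal (cmod (extension ?\<beta> x)))^2)^2 \<le> ennreal ((A + 1) * \<gamma>^2) * (LI+ x. (ennreal (K x))^2)"
   using gconv_nonneg[OF K] by (simp add: ennreal_mult ennreal_power)
 qed
 then show ?thesis unfolding V2 by (rule ennreal_leI)
qed

end

section \<open>Testing\<close>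

lemma ennreal_power2_le_imp_le:
 fixes x y :: ennreal
 assumes "x^2 \<le> y^2"
 shows "x \<le> y"
proof (cases y)
 case (real r)
 then have "x^2 \<le> ennreal (r^2)" using assms by (simp add: ennreal_power)
 from ennreal_le_sqrt[OF this] show ?thesis using real by simp
qed simp

lemma ennreal_sqrt_exists: "\<exists>q::ennreal. q^2 = y"
proof (cases y)
 case (real r)
 then show ?thesis by (intro exI[of _ "ennreal (sqrt r)"]) (simp add: ennreal_power)
next
 case top
 then show ?thesis by (intro exI[of _ "\<infinity>"]) (simp add: power2_eq_square)
qed

lemma ennpow_2: "ennpow 2 x = x^2"
proof (cases x)
 case (real r)
 then show ?thesis by (simp add: ennpow_def ennreal_power)
qed (simp add: ennpow_def power2_eq_square)

lemma Lnorm_2_le_iff: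
 assumes "0 \<le> c"
 shows "Lnorm 2 M F \<le> ennreal c \<longleftrightarrow> (\<integral>\<^sup>+x. (F x)^2 \<partial>M) \<le> ennreal (c^2)"
proof -
 let ?I = "\<integral>\<^sup>+x. (F x)^2 \<partial>M"
 have L: "Lnorm 2 M F = ennpow (1/2) ?I" unfolding Lnorm_def by (simp only: ennpow_2)
 show ?thesis
 proof (cases ?I)
  case (real r)
  then have "Lnorm 2 M F = ennreal (sqrt r)" unfolding L by (simp add: ennpow_def powr_half_sqrt)
  then show ?thesis using real assms by (simp add: real_sqrt_le_iff' real_le_lsqrt sqrt_le_D)
 next
  case top
  then show ?thesis unfolding L by (simp add: ennpow_def top_unique)
 qed
qed

text \<open>Only an inequality, since \<open>enn2real\<close> sends an infinite norm to 0.\<close>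

lemma Lnorm_c_2_square_le: "ennreal ((enn2real (Lnorm_c 2 M f))^2) \<le> (\<integral>\<^sup>+x. (ennreal (cmod (f x)))^2 \<partial>M)"
proof -
 let ?I = "\<integral>\<^sup>+x. (ennreal (cmod (f x)))^2 \<partial>M"
 have L: "Lnorm_c 2 M f = ennpow (1/2) ?I" unfolding Lnorm_def Lnorm_c_def by (simp only: ennpow_2)
 show ?thesis
 proof (cases ?I)
  case (real r)
  then have "Lnorm_c 2 M f = ennreal (sqrt r)" unfolding L by (simp add: ennpow_def powr_half_sqrt)
  then show ?thesis using real by simp
 qed (simp add: L ennpow_def)
qed

lemma L2_bound_of_Lnorm:
 assumes "Lnorm 2 M F \<le> ennreal (C * enn2real (Lnorm_c 2 N f))"
 shows "(\<integral>\<^sup>+x. (F x)^2 \<partial>M) \<le> ennreal (C^2) * (\<integral>\<^sup>+x. (ennreal (cmod (f x)))^2 \<partial>N)"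
proof -
 let ?n = "enn2real (Lnorm_c 2 N f)"
 \<comment> \<open>The hypothesis allows a negative constant, in which case \<open>ennreal\<close>
   truncates at 0; its absolute value covers both signs.\<close>
 have "C * ?n \<le> \<bar>C\<bar> * ?n" by (intro mult_right_mono) auto
 then have "Lnorm 2 M F \<le> ennreal (\<bar>C\<bar> * ?n)" using assms ennreal_leI order_trans by blast
 then have "(\<integral>\<^sup>+x. (F x)^2 \<partial>M) \<le> ennreal ((\<bar>C\<bar> * ?n)^2)" by (subst (asm) Lnorm_2_le_iff) auto
 also have "\<dots> = ennreal (C^2) * ennreal (?n^2)" by (simp add: power_mult_distrib ennreal_mult)
 also have "\<dots> \<le> ennreal (C^2) * (\<integral>\<^sup>+x. (ennreal (cmod (f x)))^2 \<partial>N)" by (intro mult_left_mono Lnorm_c_2_square_le) simp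
 finally show ?thesis .
qed

lemma refine_cnj: "cnj (refine S b u) = refine S (\<lambda>s. cnj (b s)) u"
 by (simp add: refine_def)

lemma wnorm_cong:
 assumes "finite S" "finite S'" "\<And>s t. s \<in> S \<Longrightarrow> t \<in> S' \<Longrightarrow> b s t = b' s t"
 shows "wnorm \<rho> S S' b = wnorm \<rho> S S' b'"
proof -
 have "incr (\<lambda>\<epsilon>. incr (b \<epsilon>) S' t) S s = incr (\<lambda>\<epsilon>. incr (b' \<epsilon>) S' t) S s" if "s \<in> steps S" "t \<in> steps S'" for s t
 proof -
  have "s \<in> S" "t \<in> S'" "pre S s \<in> S" "pre S' t \<in> S'"
   using that pre_props(1) assms(1,2) by (auto simp: steps_def)
  then show ?thesis unfolding incr_def using assms(3) by simp
 qed
 then show ?thesis unfolding wnorm_def by (intro arg_cong[where f="\<lambda>x. x powr (1/\<rho>)"] sum.cong refl) simp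
qed

lemma vnorm_cong:
 assumes "finite S" "\<And>s. s \<in> S \<Longrightarrow> a s = a' s"
 shows "vnorm \<rho> S a = vnorm \<rho> S a'"
proof -
 have "incr a S s = incr a' S s" if "s \<in> steps S" for s
 proof -
  have "s \<in> S" "pre S s \<in> S" using that pre_props(1) assms(1) by (auto simp: steps_def)
  then show ?thesis unfolding incr_def using assms(2) by simp
 qed
 then show ?thesis unfolding vnorm_def by (intro arg_cong[where f="\<lambda>x. x powr (1/\<rho>)"] sum.cong refl) simp
qed

lemma fourier_zero: "fourier (\<lambda>x. 0) z = 0"
 unfolding fourier_alt by simp

context restriction_measure begin

lemma admissibleD:
 assumes "admissible \<rho> T sel b g"
 shows "finite T" "T \<noteq> {}" "T \<subseteq> {0<..}" "\<And>\<omega>. sel \<omega> \<subseteq> T" "\<And>\<omega>. sel \<omega> \<noteq> {}"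
  "\<And>u. u \<in> steps T \<Longrightarrow> bounded_borel (\<lambda>\<omega>. refine (sel \<omega>) (b \<omega>) u)"
  "g \<in> borel_measurable borel" "\<And>\<omega>. 0 \<le> g \<omega>" "(TI+ \<omega>. (ennreal (g \<omega>))^2) < \<infinity>"
  "\<And>\<omega>. (\<Sum>s\<in>steps (sel \<omega>). cmod (b \<omega> s) powr (\<rho> / (\<rho> - 1))) powr (1 / (\<rho> / (\<rho> - 1))) \<le> g \<omega>"
 using assms unfolding admissible_def by blast+

lemma integrable_mult_scaled:
 fixes m :: "R3 \<Rightarrow> complex"
 assumes "integrable lborel f" "continuous_on UNIV m" "\<And>x. cmod (m x) \<le> Bm"
 shows "integrable lborel (\<lambda>x. f x * m (t *\<^sub>R x))"
proof (rule integrable_mult_bounded[OF assms(1), where B=Bm])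
 have "continuous_on UNIV (\<lambda>x. m (t *\<^sub>R x))" by (intro continuous_on_compose2[OF assms(2)] continuous_intros) auto
 then show "(\<lambda>x. m (t *\<^sub>R x)) \<in> borel_measurable lborel" using borel_measurable_continuous_onI by auto
qed (rule assms(3))

text \<open>Expanding |E|^2 gives a double sum over scales whose kernels are double increments of
  the Fourier transform of the test function times m(\<epsilon> x) and the conjugate of m(\<eta> x).
  The pair of partitions selected at \<omega> and \<omega>' is then handled by
  \<open>sum_refine_double_le\<close>. The added 1 makes the constant positive.\<close>

lemma testable_double_variation:
 fixes m :: "R3 \<Rightarrow> complex"
 assumes \<rho>: "1 < \<rho>" and m: "continuous_on UNIV m" "\<And>x. cmod (m x) \<le> Bm" and H: "0 \<le> H"
  and var2: "\<And>T (K :: R3 \<Rightarrow> real) s. finite T \<Longrightarrow> T \<noteq> {} \<Longrightarrow> T \<subseteq> {0<..} \<Longrightarrow> compactly_supported K \<Longrightarrow> (\<And>x. 0 \<le> K x) \<Longrightarrow> s > 0 \<Longrightarrow>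
   \<exists>G. (\<forall>S S' z. S \<subseteq> T \<longrightarrow> S \<noteq> {} \<longrightarrow> S' \<subseteq> T \<longrightarrow> S' \<noteq> {} \<longrightarrow>
    ennreal (wnorm \<rho> S S' (\<lambda>\<epsilon> \<eta>. fourier (\<lambda>x. complex_of_real (gconv s K x) * m (\<epsilon> *\<^sub>R x) * cnj (m (\<eta> *\<^sub>R x))) z)) \<le> G z)
    \<and> (LI+ z. (G z)^2) \<le> ennreal H * (LI+ x. (ennreal (K x))^2)"
 shows "testable \<rho> m (A * H + 1)"
 unfolding testable_def
proof (intro allI impI)
 fix T sel b g s and K :: "R3 \<Rightarrow> real" assume adm: "admissible \<rho> T sel b g" and K: "compactly_supported K" "\<forall>x. 0 \<le> K x" and s: "(0::real) < s"
 note T = admissibleD[OF adm]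
 have K0: "\<And>x. 0 \<le> K x" using K(2) by simp
 let ?h = "\<lambda>x. complex_of_real (gconv s K x)"
 let ?D = "\<lambda>u x. incr (\<lambda>t. m (t *\<^sub>R x)) T u"
 let ?\<beta> = "\<lambda>u \<omega>. refine (sel \<omega>) (b \<omega>) u"
 let ?E = "\<lambda>u. extension (?\<beta> u)"
 let ?bb = "\<lambda>z \<epsilon> \<eta>. fourier (\<lambda>x. ?h x * m (\<epsilon> *\<^sub>R x) * cnj (m (\<eta> *\<^sub>R x))) z"
 obtain G where G: "\<And>S S' z. S \<subseteq> T \<Longrightarrow> S \<noteq> {} \<Longrightarrow> S' \<subseteq> T \<Longrightarrow> S' \<noteq> {} \<Longrightarrow> ennreal (wnorm \<rho> S S' (?bb z)) \<le> G z"
  "(LI+ z. (G z)^2) \<le> ennreal H * (LI+ x. (ennreal (K x))^2)"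
  using var2[OF T(1-3) K(1) K0 s] by blast
 have hi: "integrable lborel ?h" using gconv_integrable[OF K(1) K0 s] by simp
 have mc: "continuous_on UNIV (\<lambda>x. cnj (m x))" using m(1) by (intro continuous_intros)
 have ib: "integrable lborel (\<lambda>x. ?h x * m (\<epsilon> *\<^sub>R x) * cnj (m (\<eta> *\<^sub>R x)))" for \<epsilon> \<eta>
  using integrable_mult_scaled[OF integrable_mult_scaled[OF hi m, of \<epsilon>] mc, of Bm \<eta>] m(2) by simp
 have bbc: "continuous_on UNIV (\<lambda>z. ?bb z \<epsilon> \<eta>)" for \<epsilon> \<eta> by (rule continuous_on_fourier[OF ib])
 let ?I = "(Pow T - {{}}) \<times> (Pow T - {{}})"
 \<comment> \<open>The maximum over all pairs of partitions depends on \<omega> - \<omega>' only and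
   is continuous, as \<open>quadratic_extension_bound\<close> demands.\<close>
 let ?\<Phi> = "\<lambda>z. Max ((\<lambda>i. wnorm \<rho> (fst i) (snd i) (?bb z)) ` ?I)"
 have I: "finite ?I" "?I \<noteq> {}" using T(1,2) by auto
 have fI: "finite ((\<lambda>i. wnorm \<rho> (fst i) (snd i) (?bb z)) ` ?I)" for z using I(1) by (rule finite_imageI)
 have \<Phi>c: "continuous_on UNIV ?\<Phi>"
  by (rule continuous_on_Max_finite[OF I]) (use \<rho> bbc in \<open>intro continuous_on_wnorm, auto\<close>)
 have \<Phi>mem: "\<exists>i\<in>?I. ?\<Phi> z = wnorm \<rho> (fst i) (snd i) (?bb z)" for z
  using Max_in[OF fI] I(2) by blast
 have \<Phi>0: "0 \<le> ?\<Phi> z" for z using \<Phi>mem[of z] by (auto simp: wnorm_def)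
 have \<Phi>G: "ennreal (?\<Phi> z) \<le> G z" for z
 proof -
  obtain i where i: "i \<in> ?I" "?\<Phi> z = wnorm \<rho> (fst i) (snd i) (?bb z)" using \<Phi>mem[of z] by blast
  show ?thesis unfolding i(2) using i(1) by (intro G(1)) auto
 qed
 let ?p = "\<lambda>u v x. ?h x * ?D u x * cnj (?D v x)"
 \<comment> \<open>A product of two increments is a double increment with four terms.\<close>
 have pe: "?p u v = (\<lambda>x. (?h x * m (u *\<^sub>R x) * cnj (m (v *\<^sub>R x)) - ?h x * m (u *\<^sub>R x) * cnj (m (pre T v *\<^sub>R x)))
   - (?h x * m (pre T u *\<^sub>R x) * cnj (m (v *\<^sub>R x)) - ?h x * m (pre T u *\<^sub>R x) * cnj (m (pre T v *\<^sub>R x))))" for u v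
  unfolding incr_def by (intro ext) (simp add: algebra_simps)
 have pint: "integrable lborel (?p u v)" for u v
  unfolding pe by (intro integrable_diff ib)
 have pf: "fourier (?p u v) z = incr (\<lambda>\<epsilon>. incr (?bb z \<epsilon>) T v) T u" for u v z
  unfolding pe unfolding incr_def
  by (subst fourier_diff, intro integrable_diff ib, intro integrable_diff ib)
    (simp only: fourier_diff[OF ib ib])
 let ?L = "lin_ext T sel b m"
 have e: "(\<Sum>u\<in>steps T. \<Sum>v\<in>steps T. ?p u v x * (?E u x * cnj (?E v x))) = complex_of_real (gconv s K x * (cmod (?L x))^2)" for x
 proof -
  have "complex_of_real (gconv s K x * (cmod (?L x))^2) = ?h x * (?L x * cnj (?L x))"
   unfolding of_real_mult complex_norm_square ..
  also have "\<dots> = ?h x * ((\<Sum>u\<in>steps T. ?E u x * ?D u x) * (\<Sum>v\<in>steps T. cnj (?E v x) * cnj (?D v x)))"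
   unfolding lin_ext_def cnj_sum complex_cnj_mult ..
  also have "\<dots> = (\<Sum>u\<in>steps T. \<Sum>v\<in>steps T. ?h x * ((?E u x * ?D u x) * (cnj (?E v x) * cnj (?D v x))))"
   unfolding sum_product unfolding sum_distrib_left ..
  finally show ?thesis by (simp only: mult_ac)
 qed
 have bdE: "(LI+ x. ennreal (gconv s K x * (cmod (?L x))^2))^2 \<le> ennreal A * (TI+ x. (ennreal (g x))^2)^2 * (LI+ z. (ennreal (?\<Phi> z))^2)"
 proof (rule quadratic_extension_bound[OF _ _ _ T(7) T(8) \<Phi>c \<Phi>0 _ e])
  show "0 \<le> gconv s K x * (cmod (?L x))^2" for x using gconv_nonneg[OF K(1) K0 s] by simp
  show "finite (steps T)" using T(1) by simp
  show "integrable lborel (?p u v)" for u v by (rule pint)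
  show "bounded_borel (?\<beta> u)" if "u \<in> steps T" for u using that by (rule T(6))
  fix \<omega> \<omega>' :: R3
  let ?z = "\<omega> - \<omega>'"
  let ?q = "\<rho> / (\<rho> - 1)"
  have "cmod (\<Sum>u\<in>steps T. \<Sum>v\<in>steps T. ?\<beta> u \<omega> * cnj (?\<beta> v \<omega>') * fourier (?p u v) ?z)
    = cmod (\<Sum>u\<in>steps T. \<Sum>v\<in>steps T. refine (sel \<omega>) (b \<omega>) u * refine (sel \<omega>') (\<lambda>s. cnj (b \<omega>' s)) v * incr (\<lambda>\<epsilon>. incr (?bb ?z \<epsilon>) T v) T u)"
   unfolding pf refine_cnj ..
  also have "\<dots> \<le> (\<Sum>s\<in>steps (sel \<omega>). cmod (b \<omega> s) powr ?q) powr (1/?q) * (\<Sum>s\<in>steps (sel \<omega>'). cmod (cnj (b \<omega>' s)) powr ?q) powr (1/?q) * wnorm \<rho> (sel \<omega>) (sel \<omega>') (?bb ?z)"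
   by (rule sum_refine_double_le[OF \<rho> refl T(1) T(4) T(5) T(4) T(5)])
  also have "\<dots> \<le> g \<omega> * g \<omega>' * ?\<Phi> ?z"
  proof (intro mult_mono)
   show "(\<Sum>s\<in>steps (sel \<omega>). cmod (b \<omega> s) powr ?q) powr (1/?q) \<le> g \<omega>" by (rule T(10))
   show "(\<Sum>s\<in>steps (sel \<omega>'). cmod (cnj (b \<omega>' s)) powr ?q) powr (1/?q) \<le> g \<omega>'" using T(10)[of \<omega>'] by (simp only: complex_mod_cnj)
   have "(sel \<omega>, sel \<omega>') \<in> ?I" using T(4,5) by auto
   from imageI[OF this, of "\<lambda>i. wnorm \<rho> (fst i) (snd i) (?bb ?z)"]
   show "wnorm \<rho> (sel \<omega>) (sel \<omega>') (?bb ?z) \<le> ?\<Phi> ?z" unfolding fst_conv snd_conv by (rule Max_ge[OF fI])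
  qed (auto simp: T(8) wnorm_def)
  finally show "cmod (\<Sum>u\<in>steps T. \<Sum>v\<in>steps T. ?\<beta> u \<omega> * cnj (?\<beta> v \<omega>') * fourier (?p u v) ?z) \<le> g \<omega> * g \<omega>' * ?\<Phi> ?z" .
 qed
 let ?g2 = "(TI+ x. (ennreal (g x))^2)^2" and ?K2 = "LI+ x. (ennreal (K x))^2"
 have "(LI+ z. (ennreal (?\<Phi> z))^2) \<le> (LI+ z. (G z)^2)"
  by (intro nn_integral_mono power_mono \<Phi>G) simp
 then have "(LI+ z. (ennreal (?\<Phi> z))^2) \<le> ennreal H * ?K2" using G(2) by (rule order_trans)
 then have "ennreal A * ?g2 * (LI+ z. (ennreal (?\<Phi> z))^2) \<le> ennreal A * ?g2 * (ennreal H * ?K2)"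
  by (rule mult_left_mono) simp
 also have "\<dots> = ennreal (A * H) * ?g2 * ?K2" using A_nonneg H by (simp only: ennreal_mult mult_ac)
 also have "\<dots> \<le> ennreal (A * H + 1) * ?g2 * ?K2" by (intro mult_right_mono ennreal_leI) auto
 finally show "(LI+ x. ennreal (gconv s K x) * (ennreal (cmod (?L x)))^2)^2 \<le> ennreal (A * H + 1) * ?g2 * ?K2"
  using order_trans[OF bdE] gconv_nonneg[OF K(1) K0 s] by (simp add: ennreal_mult ennreal_power)
qed

text \<open>Equal indices only: the product of the coefficients for \<open>sel \<omega>\<close> and \<open>sel \<omega>'\<close> lives on the common refinement,
 so that the single variation suffices.\<close>
lemma diagonal_bound:
 fixes M :: "R3 \<Rightarrow> real"
 assumes \<rho>: "1 < \<rho>" and adm: "admissible \<rho> T sel b g"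
  and M: "continuous_on UNIV M" "\<And>x. \<bar>M x\<bar> \<le> Bm"
  and dec: "\<And>s t x. 0 < s \<Longrightarrow> s < t \<Longrightarrow> M (t *\<^sub>R x) \<le> M (s *\<^sub>R x)"
  and K: "compactly_supported K" "\<And>x. 0 \<le> K x" "s > 0"
  and G: "\<And>S z. S \<subseteq> T \<Longrightarrow> S \<noteq> {} \<Longrightarrow> (ennreal (vnorm \<rho> S (\<lambda>t. fourier (\<lambda>x. complex_of_real (gconv s K x) * complex_of_real (M (t *\<^sub>R x))) z)))\<^sup>2 \<le> G z"
 shows "(LI+ x. ennreal (gconv s K x) * (\<Sum>u\<in>steps T. (ennreal (cmod (extension (\<lambda>\<omega>. refine (sel \<omega>) (b \<omega>) u) x)))^2
   * ennreal (M (pre T u *\<^sub>R x) - M (u *\<^sub>R x))))^2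
  \<le> ennreal A * (TI+ \<omega>. (ennreal (g \<omega>))^2)^2 * (LI+ z. G z)"
proof -
 note T = admissibleD[OF adm]
 let ?h = "\<lambda>x. complex_of_real (gconv s K x)"
 let ?M = "\<lambda>x. complex_of_real (M x)"
 let ?\<beta> = "\<lambda>u \<omega>. refine (sel \<omega>) (b \<omega>) u"
 let ?E = "\<lambda>u. extension (?\<beta> u)"
 let ?F = "\<lambda>z t. fourier (\<lambda>x. ?h x * ?M (t *\<^sub>R x)) z"
 let ?w = "\<lambda>u x. M (pre T u *\<^sub>R x) - M (u *\<^sub>R x)"
 have hi: "integrable lborel ?h" using gconv_integrable[OF K] by simp
 have Mc: "continuous_on UNIV ?M" using M(1) by (intro continuous_intros)
 have iM: "integrable lborel (\<lambda>x. ?h x * ?M (t *\<^sub>R x))" for t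
  by (rule integrable_mult_scaled[OF hi Mc, where Bm=Bm]) (use M(2) in simp)
 have Fc: "continuous_on UNIV (\<lambda>z. ?F z t)" for t by (rule continuous_on_fourier[OF iM])
 have w0: "0 \<le> ?w u x" if "u \<in> steps T" for u x
 proof -
  have "0 < pre T u" "pre T u < u" using pre_props(1,2)[OF T(1) that] T(3) by auto
  then show ?thesis using dec[of "pre T u" u x] by simp
 qed
 let ?I = "Pow T - {{}}"
 let ?\<Phi> = "\<lambda>z. Max ((\<lambda>S. vnorm \<rho> S (?F z)) ` ?I)"
 have I: "finite ?I" "?I \<noteq> {}" using T(1,2) by auto
 have fI: "finite ((\<lambda>S. vnorm \<rho> S (?F z)) ` ?I)" for z using I(1) by (rule finite_imageI)
 have \<Phi>c: "continuous_on UNIV ?\<Phi>"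
  by (rule continuous_on_Max_finite[OF I]) (use \<rho> Fc in \<open>intro continuous_on_vnorm, auto\<close>)
 have \<Phi>mem: "\<exists>S\<in>?I. ?\<Phi> z = vnorm \<rho> S (?F z)" for z
  using Max_in[OF fI] I(2) by blast
 have \<Phi>0: "0 \<le> ?\<Phi> z" for z using \<Phi>mem[of z] by (auto simp: vnorm_def)
 have \<Phi>G: "(ennreal (?\<Phi> z))^2 \<le> G z" for z
 proof -
  obtain S where S: "S \<in> ?I" "?\<Phi> z = vnorm \<rho> S (?F z)" using \<Phi>mem[of z] by blast
  show ?thesis unfolding S(2) using S(1) by (intro G) auto
 qed
 \<comment> \<open>Off-diagonal entries are zero, which embeds the weighted sum of squares into the
   general quadratic form.\<close>
 let ?p = "\<lambda>u v x. if u = v then ?h x * complex_of_real (?w u x) else 0"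
 have we: "(\<lambda>x. ?h x * complex_of_real (?w u x)) = (\<lambda>x. ?h x * ?M (pre T u *\<^sub>R x) - ?h x * ?M (u *\<^sub>R x))" for u
  by (simp only: of_real_diff right_diff_distrib)
 have wint: "integrable lborel (\<lambda>x. ?h x * complex_of_real (?w u x))" for u
  unfolding we by (intro integrable_diff iM)
 have pint: "integrable lborel (?p u v)" for u v
  using wint[of u] by (cases "u = v") simp_all
 \<comment> \<open>The minus sign reflects that the weights are decrements of \<open>M\<close>,
   which decreases along rays.\<close>
 have pf: "fourier (?p u v) z = (if u = v then - incr (?F z) T u else 0)" for u v z
 proof (cases "u = v")
  case True
  have "fourier (\<lambda>x. ?h x * complex_of_real (?w u x)) z = - incr (?F z) T u"
   unfolding we incr_def fourier_diff[OF iM iM] by (rule minus_diff_eq[symmetric])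
  then show ?thesis using True by simp
 next
  case False
  then show ?thesis using fourier_zero by simp
 qed
 have fs: "finite (steps T)" using T(1) by simp
 let ?Q = "\<lambda>x. gconv s K x * (\<Sum>u\<in>steps T. (cmod (?E u x))^2 * ?w u x)"
 have e: "(\<Sum>u\<in>steps T. \<Sum>v\<in>steps T. ?p u v x * (?E u x * cnj (?E v x))) = complex_of_real (?Q x)" for x
 proof -
  have "(\<Sum>v\<in>steps T. ?p u v x * (?E u x * cnj (?E v x))) = ?h x * complex_of_real ((cmod (?E u x))^2 * ?w u x)" if u: "u \<in> steps T" for u
  proof -
   have "(\<Sum>v\<in>steps T. ?p u v x * (?E u x * cnj (?E v x))) = (\<Sum>v\<in>steps T. if u = v then ?h x * complex_of_real (?w u x) * (?E u x * cnj (?E u x)) else 0)"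
    by (rule sum.cong[OF refl]) simp
   also have "\<dots> = ?h x * complex_of_real (?w u x) * (?E u x * cnj (?E u x))" using u fs by (simp only: sum.delta' if_True)
   finally show ?thesis unfolding complex_norm_square[symmetric] of_real_mult by (simp only: mult_ac)
  qed
  then have "(\<Sum>u\<in>steps T. \<Sum>v\<in>steps T. ?p u v x * (?E u x * cnj (?E v x))) = (\<Sum>u\<in>steps T. ?h x * complex_of_real ((cmod (?E u x))^2 * ?w u x))"
   by (rule sum.cong[OF refl])
  then show ?thesis unfolding of_real_mult of_real_sum sum_distrib_left .
 qed
 have q0: "0 \<le> ?Q x" for x using gconv_nonneg[OF K] w0 by (intro mult_nonneg_nonneg sum_nonneg) auto
 have eq: "ennreal (gconv s K x) * (\<Sum>u\<in>steps T. (ennreal (cmod (?E u x)))^2 * ennreal (?w u x)) = ennreal (?Q x)" for x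
 proof -
  have "(\<Sum>u\<in>steps T. (ennreal (cmod (?E u x)))^2 * ennreal (?w u x)) = (\<Sum>u\<in>steps T. ennreal ((cmod (?E u x))^2 * ?w u x))"
   using w0 by (intro sum.cong refl) (simp add: ennreal_mult ennreal_power)
  also have "\<dots> = ennreal (\<Sum>u\<in>steps T. (cmod (?E u x))^2 * ?w u x)" using w0 by (intro sum_ennreal) auto
  finally have e1: "(\<Sum>u\<in>steps T. (ennreal (cmod (?E u x)))^2 * ennreal (?w u x)) = ennreal (\<Sum>u\<in>steps T. (cmod (?E u x))^2 * ?w u x)" .
  have "0 \<le> (\<Sum>u\<in>steps T. (cmod (?E u x))^2 * ?w u x)" using w0 by (intro sum_nonneg mult_nonneg_nonneg) auto
  then show ?thesis unfolding e1 using gconv_nonneg[OF K] by (intro ennreal_mult[symmetric])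
 qed
 have bdE: "(LI+ x. ennreal (?Q x))^2 \<le> ennreal A * (TI+ x. (ennreal (g x))^2)^2 * (LI+ z. (ennreal (?\<Phi> z))^2)"
 proof (rule quadratic_extension_bound[OF fs _ _ T(7) T(8) \<Phi>c \<Phi>0 _ e q0])
  show "integrable lborel (?p u v)" for u v by (rule pint)
  show "bounded_borel (?\<beta> u)" if "u \<in> steps T" for u using that by (rule T(6))
  fix \<omega> \<omega>' :: R3
  let ?z = "\<omega> - \<omega>'"
  let ?q = "\<rho> / (\<rho> - 1)"
  let ?S = "sel \<omega>" and ?S' = "sel \<omega>'"
  have "(\<Sum>u\<in>steps T. \<Sum>v\<in>steps T. ?\<beta> u \<omega> * cnj (?\<beta> v \<omega>') * fourier (?p u v) ?z)
    = (\<Sum>u\<in>steps T. - (?\<beta> u \<omega> * cnj (?\<beta> u \<omega>') * incr (?F ?z) T u))"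
  proof (rule sum.cong[OF refl])
   fix u assume u: "u \<in> steps T"
   have "(\<Sum>v\<in>steps T. ?\<beta> u \<omega> * cnj (?\<beta> v \<omega>') * fourier (?p u v) ?z) = (\<Sum>v\<in>steps T. if u = v then - (?\<beta> u \<omega> * cnj (?\<beta> u \<omega>') * incr (?F ?z) T u) else 0)"
    unfolding pf by (rule sum.cong[OF refl]) (simp del: complex_cnj_mult)
   also have "\<dots> = - (?\<beta> u \<omega> * cnj (?\<beta> u \<omega>') * incr (?F ?z) T u)" using u fs by (simp only: sum.delta' if_True)
   finally show "(\<Sum>v\<in>steps T. ?\<beta> u \<omega> * cnj (?\<beta> v \<omega>') * fourier (?p u v) ?z) = - (?\<beta> u \<omega> * cnj (?\<beta> u \<omega>') * incr (?F ?z) T u)" .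
  qed
  then have "cmod (\<Sum>u\<in>steps T. \<Sum>v\<in>steps T. ?\<beta> u \<omega> * cnj (?\<beta> v \<omega>') * fourier (?p u v) ?z)
    = cmod (\<Sum>u\<in>steps T. refine ?S (b \<omega>) u * refine ?S' (\<lambda>s. cnj (b \<omega>' s)) u * incr (?F ?z) T u)"
   unfolding refine_cnj by (simp only: sum_negf norm_minus_cancel)
  also have "\<dots> \<le> (\<Sum>s\<in>steps ?S. cmod (b \<omega> s) powr ?q) powr (1/?q) * (\<Sum>s\<in>steps ?S'. cmod (cnj (b \<omega>' s)) powr ?q) powr (1/?q) * vnorm \<rho> (?S \<union> ?S') (?F ?z)"
   by (rule sum_refine_product_le[OF \<rho> refl T(1) T(4) T(5) T(4) T(5)])
  also have "\<dots> \<le> g \<omega> * g \<omega>' * ?\<Phi> ?z"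
  proof (intro mult_mono)
   show "(\<Sum>s\<in>steps ?S. cmod (b \<omega> s) powr ?q) powr (1/?q) \<le> g \<omega>" by (rule T(10))
   show "(\<Sum>s\<in>steps ?S'. cmod (cnj (b \<omega>' s)) powr ?q) powr (1/?q) \<le> g \<omega>'" using T(10)[of \<omega>'] by (simp only: complex_mod_cnj)
   have "?S \<union> ?S' \<in> ?I" using T(4,5) by auto
   from imageI[OF this, of "\<lambda>S. vnorm \<rho> S (?F ?z)"]
   show "vnorm \<rho> (?S \<union> ?S') (?F ?z) \<le> ?\<Phi> ?z" by (rule Max_ge[OF fI])
  qed (auto simp: T(8) vnorm_def)
  finally show "cmod (\<Sum>u\<in>steps T. \<Sum>v\<in>steps T. ?\<beta> u \<omega> * cnj (?\<beta> v \<omega>') * fourier (?p u v) ?z) \<le> g \<omega> * g \<omega>' * ?\<Phi> ?z" .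
 qed
 have "(LI+ z. (ennreal (?\<Phi> z))^2) \<le> (LI+ z. G z)"
  by (intro nn_integral_mono \<Phi>G)
 then have "ennreal A * (TI+ x. (ennreal (g x))^2)^2 * (LI+ z. (ennreal (?\<Phi> z))^2) \<le> ennreal A * (TI+ x. (ennreal (g x))^2)^2 * (LI+ z. G z)"
  by (rule mult_left_mono) simp
 then show ?thesis unfolding eq using bdE by (rule order_trans[rotated])
qed

end

text \<open>Increments of m are dominated by sums of decrements of radially decreasing profiles.
  Cauchy-Schwarz with these weights costs their total mass 2 B c0, and each profile is then treated
  by \<open>diagonal_bound\<close>. Summing over profiles gives another c0; the constant is squared
  because testing is quadratic.\<close>

lemma (in restriction_measure) testable_of_family:
 fixes m :: "R3 \<Rightarrow> complex" and M :: "nat \<Rightarrow> R3 \<Rightarrow> real"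
 assumes \<rho>: "1 < \<rho>" and B: "0 \<le> B" and H: "0 \<le> H" and c0: "0 \<le> c0"
  and M: "\<And>k. continuous_on UNIV (M k)" "\<And>k x. \<bar>M k x\<bar> \<le> B"
  and dec: "\<And>k s t x. 0 < s \<Longrightarrow> s < t \<Longrightarrow> M k (t *\<^sub>R x) \<le> M k (s *\<^sub>R x)"
  and c: "(\<Sum>k. c k) \<le> ennreal c0"
  and dom: "\<And>s t x. 0 < s \<Longrightarrow> s < t \<Longrightarrow> ennreal (cmod (m (t *\<^sub>R x) - m (s *\<^sub>R x))) \<le> (\<Sum>k. c k * ennreal (M k (s *\<^sub>R x) - M k (t *\<^sub>R x)))"
  and var: "\<And>k T (K :: R3 \<Rightarrow> real) s. finite T \<Longrightarrow> T \<noteq> {} \<Longrightarrow> T \<subseteq> {0<..} \<Longrightarrow> compactly_supported K \<Longrightarrow> (\<And>x. 0 \<le> K x) \<Longrightarrow> s > 0 \<Longrightarrow>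
   \<exists>G. (\<forall>S z. S \<subseteq> T \<longrightarrow> S \<noteq> {} \<longrightarrow>
    (ennreal (vnorm \<rho> S (\<lambda>t. fourier (\<lambda>x. complex_of_real (gconv s K x) * complex_of_real (M k (t *\<^sub>R x))) z)))\<^sup>2 \<le> G z)
    \<and> (LI+ z. G z) \<le> ennreal H * (LI+ x. (ennreal (K x))^2)"
 shows "testable \<rho> m ((2 * B * c0^2)^2 * (A * H) + 1)"
 unfolding testable_def
proof (intro allI impI)
 fix T sel b g s and K :: "R3 \<Rightarrow> real" assume adm: "admissible \<rho> T sel b g" and K: "compactly_supported K" "\<forall>x. 0 \<le> K x" and s: "(0::real) < s"
 note T = admissibleD[OF adm]
 have K0: "\<And>x. 0 \<le> K x" using K(2) by simp
 let ?\<beta> = "\<lambda>u \<omega>. refine (sel \<omega>) (b \<omega>) u"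
 define E where "E u x = ennreal (cmod (extension (?\<beta> u) x))" for u x
 define w where "w k u x = ennreal (M k (pre T u *\<^sub>R x) - M k (u *\<^sub>R x))" for k u x
 define W where "W u x = (\<Sum>k. c k * w k u x)" for u x
 let ?L = "lin_ext T sel b m"
 let ?h = "\<lambda>x. ennreal (gconv s K x)"
 let ?g2 = "(TI+ x. (ennreal (g x))^2)^2" and ?K2 = "LI+ x. (ennreal (K x))^2"
 have fs: "finite (steps T)" using T(1) by simp
 have pp: "0 < pre T u" "pre T u < u" if "u \<in> steps T" for u
  using pre_props(1,2)[OF T(1) that] T(3) by auto
 \<comment> \<open>The weights of one profile telescope, so their total does not depend on the
   number of scales.\<close>
 have wsum: "(\<Sum>u\<in>steps T. w k u x) \<le> ennreal (2 * B)" for k x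
 proof -
  have Mm: "Min T \<in> T" "Max T \<in> T" using T(1,2) by auto
  have le: "Min T \<le> Max T" using Mm(1) T(1) by simp
  have st: "{u \<in> T. Min T < u \<and> u \<le> Max T} = steps T"
  proof (intro equalityI subsetI)
   fix u assume "u \<in> {u \<in> T. Min T < u \<and> u \<le> Max T}" then show "u \<in> steps T" by (simp add: steps_def)
  next
   fix u assume "u \<in> steps T"
   then have u: "u \<in> T" "u \<noteq> Min T" by (simp_all add: steps_def)
   then have "Min T \<le> u" "u \<le> Max T" using T(1) by simp_all
   then show "u \<in> {u \<in> T. Min T < u \<and> u \<le> Max T}" using u by simp
  qed
  have "(\<Sum>u\<in>steps T. incr (\<lambda>t. M k (t *\<^sub>R x)) T u) = M k (Max T *\<^sub>R x) - M k (Min T *\<^sub>R x)"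
   using sum_incr_telescope[OF T(1) Mm le, of "\<lambda>t. M k (t *\<^sub>R x)"] unfolding st .
  then have tel: "(\<Sum>u\<in>steps T. M k (pre T u *\<^sub>R x) - M k (u *\<^sub>R x)) = M k (Min T *\<^sub>R x) - M k (Max T *\<^sub>R x)"
   unfolding incr_def sum_subtractf by linarith
  have "(\<Sum>u\<in>steps T. w k u x) = ennreal (\<Sum>u\<in>steps T. M k (pre T u *\<^sub>R x) - M k (u *\<^sub>R x))"
   unfolding w_def by (rule sum_ennreal) (use dec[OF pp] in simp)
  also have "\<dots> \<le> ennreal (2 * B)"
   unfolding tel using M(2)[of k "Min T *\<^sub>R x"] M(2)[of k "Max T *\<^sub>R x"] by (intro ennreal_leI) linarith
  finally show ?thesis .
 qed
 have Wsum: "(\<Sum>u\<in>steps T. W u x) \<le> ennreal (2 * B * c0)" for x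
 proof -
  have "(\<Sum>u\<in>steps T. W u x) = (\<Sum>k. \<Sum>u\<in>steps T. c k * w k u x)"
   unfolding W_def by (rule suminf_sum[symmetric]) (rule summableI)
  also have "\<dots> \<le> (\<Sum>k. ennreal (2 * B) * c k)"
  proof (rule suminf_le[OF _ summableI summableI])
   fix k
   have "(\<Sum>u\<in>steps T. c k * w k u x) = c k * (\<Sum>u\<in>steps T. w k u x)" by (rule sum_distrib_left[symmetric])
   also have "\<dots> \<le> c k * ennreal (2 * B)" by (rule mult_left_mono[OF wsum]) simp
   finally show "(\<Sum>u\<in>steps T. c k * w k u x) \<le> ennreal (2 * B) * c k" by (simp only: mult.commute)
  qed
  also have "\<dots> = ennreal (2 * B) * (\<Sum>k. c k)" by (rule ennreal_suminf_cmult)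
  also have "\<dots> \<le> ennreal (2 * B) * ennreal c0" by (rule mult_left_mono[OF c]) simp
  also have "\<dots> = ennreal (2 * B * c0)" using B c0 by (intro ennreal_mult[symmetric]) auto
  finally show ?thesis .
 qed
 have Wfin: "W u x < \<infinity>" if "u \<in> steps T" for u x
 proof -
  have "W u x \<le> (\<Sum>u\<in>steps T. W u x)" using that fs by (intro member_le_sum) auto
  also have "\<dots> < \<infinity>" using Wsum[of x] by (rule le_less_trans) simp
  finally show ?thesis .
 qed
 \<comment> \<open>Each weight is split into two square roots, one of which accompanies the
   extension.\<close>
 have CS: "(ennreal (cmod (?L x)))^2 \<le> ennreal (2 * B * c0) * (\<Sum>u\<in>steps T. (E u x)^2 * W u x)" for x
 proof -
  define r where "r u = enn2real (W u x)" for u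
  define e where "e u = cmod (extension (?\<beta> u) x)" for u
  have r: "W u x = ennreal (r u)" "0 \<le> r u" if "u \<in> steps T" for u using Wfin[OF that, of x] by (auto simp: r_def)
  have "cmod (?L x) \<le> (\<Sum>u\<in>steps T. e u * cmod (incr (\<lambda>t. m (t *\<^sub>R x)) T u))"
   unfolding lin_ext_def e_def by (rule order_trans[OF norm_sum]) (simp add: norm_mult)
  also have "\<dots> \<le> (\<Sum>u\<in>steps T. e u * r u)"
  proof (intro sum_mono mult_left_mono)
   fix u assume u: "u \<in> steps T"
   have "ennreal (cmod (incr (\<lambda>t. m (t *\<^sub>R x)) T u)) \<le> W u x" unfolding W_def w_def incr_def by (rule dom[OF pp[OF u]])
   then show "cmod (incr (\<lambda>t. m (t *\<^sub>R x)) T u) \<le> r u" using r[OF u] by simp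
  qed (simp add: e_def)
  finally have "(cmod (?L x))^2 \<le> (\<Sum>u\<in>steps T. e u * r u)^2" by (intro power_mono) auto
  also have "(\<Sum>u\<in>steps T. e u * r u) = (\<Sum>u\<in>steps T. sqrt (r u) * (e u * sqrt (r u)))"
  proof (rule sum.cong[OF refl])
   fix u assume "u \<in> steps T"
   then have "sqrt (r u) * sqrt (r u) = r u" using r(2) by simp
   then show "e u * r u = sqrt (r u) * (e u * sqrt (r u))" by (metis mult.left_commute mult.commute)
  qed
  finally have "(cmod (?L x))^2 \<le> (\<Sum>u\<in>steps T. sqrt (r u) * (e u * sqrt (r u)))^2" .
  also have "\<dots> \<le> (\<Sum>u\<in>steps T. (sqrt (r u))^2) * (\<Sum>u\<in>steps T. (e u * sqrt (r u))^2)" by (rule Cauchy_Schwarz_ineq_sum)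
  also have "\<dots> = (\<Sum>u\<in>steps T. r u) * (\<Sum>u\<in>steps T. (e u)^2 * r u)"
   using r(2) by (simp add: power_mult_distrib)
  finally have "ennreal ((cmod (?L x))^2) \<le> ennreal ((\<Sum>u\<in>steps T. r u) * (\<Sum>u\<in>steps T. (e u)^2 * r u))" by (rule ennreal_leI)
  also have "\<dots> = ennreal (\<Sum>u\<in>steps T. r u) * ennreal (\<Sum>u\<in>steps T. (e u)^2 * r u)"
   using r(2) by (intro ennreal_mult sum_nonneg mult_nonneg_nonneg) auto
  also have "ennreal (\<Sum>u\<in>steps T. r u) = (\<Sum>u\<in>steps T. W u x)"
  proof -
   have "(\<Sum>u\<in>steps T. W u x) = (\<Sum>u\<in>steps T. ennreal (r u))" by (rule sum.cong[OF refl]) (rule r(1))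
   also have "\<dots> = ennreal (\<Sum>u\<in>steps T. r u)" by (rule sum_ennreal) (rule r(2))
   finally show ?thesis by (rule sym)
  qed
  also have "ennreal (\<Sum>u\<in>steps T. (e u)^2 * r u) = (\<Sum>u\<in>steps T. (E u x)^2 * W u x)"
  proof -
   have "ennreal (\<Sum>u\<in>steps T. (e u)^2 * r u) = (\<Sum>u\<in>steps T. ennreal ((e u)^2 * r u))"
    using r(2) by (intro sum_ennreal[symmetric]) auto
   also have "\<dots> = (\<Sum>u\<in>steps T. (E u x)^2 * W u x)"
   proof (rule sum.cong[OF refl])
    fix u assume u: "u \<in> steps T"
    have "ennreal ((e u)^2 * r u) = ennreal ((e u)^2) * ennreal (r u)" using r(2)[OF u] by (intro ennreal_mult) auto
    then show "ennreal ((e u)^2 * r u) = (E u x)^2 * W u x" unfolding E_def r(1)[OF u] e_def by (simp add: ennreal_power)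
   qed
   finally show ?thesis .
  qed
  finally have "ennreal ((cmod (?L x))^2) \<le> (\<Sum>u\<in>steps T. W u x) * (\<Sum>u\<in>steps T. (E u x)^2 * W u x)" .
  then have "(ennreal (cmod (?L x)))^2 \<le> (\<Sum>u\<in>steps T. W u x) * (\<Sum>u\<in>steps T. (E u x)^2 * W u x)" by (simp add: ennreal_power)
  then show ?thesis using mult_right_mono[OF Wsum[of x], of "\<Sum>u\<in>steps T. (E u x)^2 * W u x"] by (rule order_trans) simp
 qed
 let ?J = "\<lambda>k x. ?h x * (\<Sum>u\<in>steps T. (E u x)^2 * w k u x)"
 have Em [measurable]: "E u \<in> borel_measurable borel" if "u \<in> steps T" for u
  unfolding E_def using measurable_extension[OF T(6)[OF that]] by measurable
 have wm [measurable]: "w k u \<in> borel_measurable borel" for k u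
 proof -
  have "continuous_on UNIV (\<lambda>x. M k (t *\<^sub>R x))" for t by (intro continuous_on_compose2[OF M(1)] continuous_intros) auto
  note [measurable] = borel_measurable_continuous_onI[OF this]
  show ?thesis unfolding w_def by measurable
 qed
 have hm [measurable]: "gconv s K \<in> borel_measurable borel" by (rule gconv_measurable[OF K(1) K0 s])
 have Jm: "?J k \<in> borel_measurable borel" for k
  by (intro borel_measurable_times_ennreal borel_measurable_sum borel_measurable_power_ennreal Em wm) measurable
 \<comment> \<open>The bound for a single profile is quadratic while the series over profiles is
   summed before squaring, hence the square root.\<close>
 obtain q where q: "q^2 = ennreal A * ?g2 * (ennreal H * ?K2)" using ennreal_sqrt_exists by blast
 have Jq: "(LI+ x. ?J k x) \<le> q" for k
 proof (rule ennreal_power2_le_imp_le)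
  obtain G where G: "\<And>S z. S \<subseteq> T \<Longrightarrow> S \<noteq> {} \<Longrightarrow> (ennreal (vnorm \<rho> S (\<lambda>t. fourier (\<lambda>x. complex_of_real (gconv s K x) * complex_of_real (M k (t *\<^sub>R x))) z)))\<^sup>2 \<le> G z"
   "(LI+ z. G z) \<le> ennreal H * ?K2" using var[OF T(1-3) K(1) K0 s, of k] by blast
  have "(LI+ x. ?J k x)^2 \<le> ennreal A * ?g2 * (LI+ z. G z)"
   unfolding E_def w_def by (rule diagonal_bound[OF \<rho> adm M dec K(1) K0 s G(1)])
  also have "\<dots> \<le> ennreal A * ?g2 * (ennreal H * ?K2)" by (rule mult_left_mono[OF G(2)]) simp
  finally show "(LI+ x. ?J k x)^2 \<le> q^2" unfolding q .
 qed
 have pt: "?h x * (ennreal (cmod (?L x)))^2 \<le> ennreal (2 * B * c0) * (\<Sum>k. c k * ?J k x)" for x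
 proof -
  have "?h x * (\<Sum>u\<in>steps T. (E u x)^2 * W u x) = (\<Sum>k. c k * ?J k x)"
  proof -
   have "(\<Sum>u\<in>steps T. (E u x)^2 * W u x) = (\<Sum>u\<in>steps T. \<Sum>k. (E u x)^2 * (c k * w k u x))"
    unfolding W_def ennreal_suminf_cmult ..
   also have "\<dots> = (\<Sum>k. \<Sum>u\<in>steps T. (E u x)^2 * (c k * w k u x))" by (rule suminf_sum[symmetric]) (rule summableI)
   finally have "?h x * (\<Sum>u\<in>steps T. (E u x)^2 * W u x) = (\<Sum>k. ?h x * (\<Sum>u\<in>steps T. (E u x)^2 * (c k * w k u x)))"
    unfolding ennreal_suminf_cmult by simp
   also have "\<dots> = (\<Sum>k. c k * ?J k x)"
   proof (rule suminf_cong)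
    fix k
    have "(\<Sum>u\<in>steps T. (E u x)^2 * (c k * w k u x)) = c k * (\<Sum>u\<in>steps T. (E u x)^2 * w k u x)"
     unfolding sum_distrib_left by (simp only: mult_ac)
    then show "?h x * (\<Sum>u\<in>steps T. (E u x)^2 * (c k * w k u x)) = c k * ?J k x" by (simp only: mult_ac)
   qed
   finally show ?thesis .
  qed
  moreover have "?h x * (ennreal (cmod (?L x)))^2 \<le> ?h x * (ennreal (2 * B * c0) * (\<Sum>u\<in>steps T. (E u x)^2 * W u x))"
   by (rule mult_left_mono[OF CS]) simp
  ultimately show ?thesis by (simp only: mult.left_commute[of "?h x" "ennreal (2 * B * c0)"])
 qed
 let ?Z = "LI+ x. ?h x * (ennreal (cmod (?L x)))^2"
 have "?Z \<le> (LI+ x. ennreal (2 * B * c0) * (\<Sum>k. c k * ?J k x))" by (rule nn_integral_mono) (rule pt)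
 also have "\<dots> = ennreal (2 * B * c0) * (\<Sum>k. c k * (LI+ x. ?J k x))"
 proof -
  have "(LI+ x. ennreal (2 * B * c0) * (\<Sum>k. c k * ?J k x)) = ennreal (2 * B * c0) * (LI+ x. (\<Sum>k. c k * ?J k x))"
  proof (rule nn_integral_cmult)
   have "(\<lambda>x. \<Sum>k. c k * ?J k x) \<in> borel_measurable borel"
    by (rule borel_measurable_suminf_order) (rule borel_measurable_times_ennreal[OF borel_measurable_const Jm])
   then show "(\<lambda>x. \<Sum>k. c k * ?J k x) \<in> borel_measurable lborel" by simp
  qed
  moreover have "(LI+ x. (\<Sum>k. c k * ?J k x)) = (\<Sum>k. LI+ x. c k * ?J k x)"
   by (rule nn_integral_suminf) (use borel_measurable_times_ennreal[OF borel_measurable_const Jm] in simp)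
  moreover have "(LI+ x. c k * ?J k x) = c k * (LI+ x. ?J k x)" for k
   by (rule nn_integral_cmult) (use Jm in auto)
  ultimately show ?thesis by (simp only:)
 qed
 also have "\<dots> \<le> ennreal (2 * B * c0) * (ennreal c0 * q)"
 proof (rule mult_left_mono)
  have "(\<Sum>k. c k * (LI+ x. ?J k x)) \<le> (\<Sum>k. q * c k)"
  proof (rule suminf_le[OF _ summableI summableI])
   show "c k * (LI+ x. ?J k x) \<le> q * c k" for k
    using mult_left_mono[OF Jq[of k], of "c k"] by (simp only: mult.commute zero_le)
  qed
  also have "\<dots> = q * (\<Sum>k. c k)" by (rule ennreal_suminf_cmult)
  also have "\<dots> \<le> q * ennreal c0" by (rule mult_left_mono[OF c]) simp
  finally show "(\<Sum>k. c k * (LI+ x. ?J k x)) \<le> ennreal c0 * q" by (simp only: mult.commute)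
 qed simp
 also have "\<dots> = ennreal (2 * B * c0^2) * q"
 proof -
  have "ennreal (2 * B * c0) * ennreal c0 = ennreal (2 * B * c0 * c0)" using B c0 by (intro ennreal_mult[symmetric]) auto
  then show ?thesis by (simp only: mult.assoc[symmetric] power2_eq_square)
 qed
 finally have "?Z^2 \<le> (ennreal (2 * B * c0^2) * q)^2" by (rule power_mono) simp
 also have "\<dots> = ennreal ((2 * B * c0^2)^2) * (ennreal A * ?g2 * (ennreal H * ?K2))"
 proof -
  have "(ennreal (2 * B * c0^2))^2 = ennreal ((2 * B * c0^2)^2)" using B by (intro ennreal_power) auto
  then show ?thesis unfolding q[symmetric] by (simp only: power_mult_distrib[of _ q])
 qed
 also have "\<dots> = ennreal ((2 * B * c0^2)^2 * (A * H)) * ?g2 * ?K2" using A_nonneg H by (simp only: ennreal_mult mult_ac zero_le_power2 mult_nonneg_nonneg)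
 also have "\<dots> \<le> ennreal ((2 * B * c0^2)^2 * (A * H) + 1) * ?g2 * ?K2" by (intro mult_right_mono ennreal_leI) auto
 finally show "?Z^2 \<le> ennreal ((2 * B * c0^2)^2 * (A * H) + 1) * ?g2 * ?K2" .
qed

text \<open>At radius \<open>\<tau> r \<approx> 2\<^sup>k\<close> the derivative of the Gaussian of width \<open>2\<^sup>k\<close> alone dominates that of \<open>\<phi>\<close>.\<close>
lemma heat_profile_domination:
 fixes \<phi> \<phi>' :: "real \<Rightarrow> complex"
 assumes K0: "0 \<le> K0" and \<delta>: "0 < \<delta>" and r: "0 \<le> r" and st: "0 < s" "s < t"
  and deriv: "\<And>\<tau>. (\<phi> has_vector_derivative \<phi>' \<tau>) (at \<tau>)"
  and small: "\<And>\<tau>. 0 < \<tau> \<Longrightarrow> \<tau> * r \<le> 1 \<Longrightarrow> cmod (\<phi>' \<tau>) \<le> K0 * (\<tau> * r) * r"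
  and large: "\<And>\<tau>. 0 < \<tau> \<Longrightarrow> 1 \<le> \<tau> * r \<Longrightarrow> cmod (\<phi>' \<tau>) \<le> K0 * (\<tau> * r) powr (-1 - \<delta>) * r"
 defines "c \<equiv> \<lambda>k::nat. K0 * exp (4 * pi) / (2 * pi) * (2 powr (- \<delta>)) ^ k"
 shows "\<exists>N. cmod (\<phi> t - \<phi> s) \<le> (\<Sum>k<N. c k * (exp (- (pi * (1/4)^k * (s * r)^2)) - exp (- (pi * (1/4)^k * (t * r)^2))))"
proof -
 \<comment> \<open>Up to radius t r only finitely many widths are needed.\<close>
 obtain N0 where N0: "t * r < 2 ^ N0" using real_arch_pow[of 2 "t * r"] by auto
 define N where "N = Suc N0"
 define \<psi> where "\<psi> \<tau> = - (\<Sum>k<N. c k * exp (- (pi * (1/4)^k * (\<tau> * r)^2)))" for \<tau>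
 define \<psi>' where "\<psi>' \<tau> = (\<Sum>k<N. c k * (2 * pi * (1/4)^k * (\<tau> * r) * r * exp (- (pi * (1/4)^k * (\<tau> * r)^2))))" for \<tau>
 have c0: "0 \<le> c k" for k using K0 by (simp add: c_def)
 have d\<psi>: "(\<psi> has_vector_derivative \<psi>' \<tau>) (at \<tau>)" for \<tau>
 proof -
  have "((\<lambda>\<tau>. exp (- (pi * (1/4)^k * (\<tau> * r)^2))) has_real_derivative - (2 * pi * (1/4)^k * (\<tau> * r) * r * exp (- (pi * (1/4)^k * (\<tau> * r)^2)))) (at \<tau>)" for k
   by (auto intro!: derivative_eq_intros simp: power2_eq_square)
  from DERIV_minus[OF DERIV_sum[of "{..<N}", OF DERIV_cmult[OF this]]]
  have "(\<psi> has_real_derivative - (\<Sum>k<N. c k * - (2 * pi * (1/4)^k * (\<tau> * r) * r * exp (- (pi * (1/4)^k * (\<tau> * r)^2))))) (at \<tau>)"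
   unfolding \<psi>_def .
  then show ?thesis unfolding has_real_derivative_iff_has_vector_derivative \<psi>'_def
   by (simp only: mult_minus_right sum_negf minus_minus)
 qed
 have bound: "cmod (\<phi>' \<tau>) \<le> \<psi>' \<tau>" if \<tau>: "\<tau> \<in> {s<..<t}" for \<tau>
 proof -
  define x where "x = \<tau> * r"
  have \<tau>0: "0 < \<tau>" using \<tau> st by auto
  have x0: "0 \<le> x" using \<tau>0 r by (simp add: x_def)
  let ?f = "\<lambda>k. c k * (2 * pi * (1/4)^k * x * r * exp (- (pi * (1/4)^k * x^2)))"
  have f0: "0 \<le> ?f k" for k using c0 x0 r by (intro mult_nonneg_nonneg) auto
  have f1: "?f k \<le> \<psi>' \<tau>" if "k < N" for k
   unfolding \<psi>'_def x_def[symmetric] using that f0 by (intro member_le_sum) auto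
  show ?thesis
  proof (cases "x \<le> 1")
   case True
   \<comment> \<open>Near the origin the profile with k = 0 suffices: the factor exp(4 pi) in
     \<open>c\<close> outweighs the smallness of the Gaussian, and 2 pi cancels against its
     derivative.\<close>
   have "x^2 \<le> 1" using True x0 by (simp add: power_le_one)
   then have "pi * x^2 \<le> pi * 4" by (intro mult_left_mono) auto
   then have e: "1 \<le> exp (4 * pi) * exp (- (pi * x^2))" unfolding exp_add[symmetric] by simp
   have "cmod (\<phi>' \<tau>) \<le> K0 * x * r * 1" using small[OF \<tau>0] True by (simp add: x_def)
   also have "\<dots> \<le> K0 * x * r * (exp (4 * pi) * exp (- (pi * x^2)))" using e K0 x0 r by (intro mult_left_mono) auto
   also have "\<dots> = ?f 0" by (simp add: c_def)
   finally show ?thesis using f1[of 0] by (simp add: N_def)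
  next
   case False
   then have x1: "1 < x" by simp
   \<comment> \<open>The dyadic position of x: with n = k + 1 it satisfies 2^k \<le> x < 2^(k + 1),
     so the exponent of the k-th Gaussian is at least -4 pi.\<close>
   define n where "n = (LEAST n. x < 2 ^ n)"
   have "x \<le> t * r" unfolding x_def using \<tau> r by (intro mult_right_mono) auto
   then have ex: "x < 2 ^ N0" using N0 by (rule le_less_trans)
   then have n: "x < 2 ^ n" "n \<le> N0" unfolding n_def by (rule LeastI, rule Least_le)
   have "n \<noteq> 0" using n(1) x1 by (cases n) auto
   then obtain k where k: "n = Suc k" by (cases n) auto
   have "\<not> x < 2 ^ k" using not_less_Least[of k "\<lambda>n. x < 2 ^ n"] k unfolding n_def[symmetric] by simp
   then have k1: "2 ^ k \<le> x" by simp
   have k2: "x \<le> 2 * 2 ^ k" using n(1) unfolding k by simp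
   have q4: "(1/4::real) ^ k = (1 / 2 ^ k)^2" by (simp add: power_mult[symmetric] power_divide power2_eq_square power_mult_distrib[symmetric])
   have y: "x / 2 ^ k \<le> 2" "1 \<le> x / 2 ^ k" using k1 k2 by (simp_all add: divide_le_eq)
   have "(x / 2 ^ k)^2 \<le> 2^2" using y x1 by (intro power_mono) auto
   then have "pi * ((1/4) ^ k * x^2) \<le> pi * 4" unfolding q4 by (intro mult_left_mono) (auto simp: power_divide)
   then have e: "1 \<le> exp (4 * pi) * exp (- (pi * (1/4) ^ k * x^2))" unfolding exp_add[symmetric] by (simp add: mult.assoc)
   have p: "x powr (-1 - \<delta>) \<le> (2 powr (- \<delta>)) ^ k * ((1/4) ^ k * x)"
   proof -
    have "x powr (-1 - \<delta>) = x powr (- \<delta> + - 1)" by (simp add: algebra_simps)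
    also have "\<dots> = x powr (- \<delta>) * x powr (- 1)" by (rule powr_add)
    finally have "x powr (-1 - \<delta>) = x powr (- \<delta>) * x powr (- 1)" .
    also have "\<dots> \<le> (2 ^ k) powr (- \<delta>) * ((1/4) ^ k * x)"
    proof (intro mult_mono)
     show "x powr (- \<delta>) \<le> (2 ^ k) powr (- \<delta>)" using k1 \<delta> by (intro powr_mono2') auto
     have "1 \<le> (x / 2 ^ k)^2" using y(2) by (simp add: one_le_power)
     then have "1 \<le> (1/4) ^ k * x^2" unfolding q4 by (simp add: power_divide)
     then have "1 / x \<le> (1/4) ^ k * x" using x1 by (simp add: divide_le_eq power2_eq_square mult.assoc)
     then show "x powr (- 1) \<le> (1/4) ^ k * x" using x1 by (simp add: powr_minus_divide)
    qed auto
    also have "(2 ^ k) powr (- \<delta>) = (2 powr (- \<delta>)) ^ k"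
     by (simp add: powr_realpow[symmetric] powr_powr mult.commute)
    finally show ?thesis .
   qed
   have "cmod (\<phi>' \<tau>) \<le> K0 * x powr (-1 - \<delta>) * r * 1" using large[OF \<tau>0] x1 by (simp add: x_def)
   also have "\<dots> \<le> K0 * ((2 powr (- \<delta>)) ^ k * ((1/4) ^ k * x)) * r * (exp (4 * pi) * exp (- (pi * (1/4) ^ k * x^2)))"
    using p e K0 r x0 by (intro mult_mono mult_nonneg_nonneg) auto
   also have "\<dots> = ?f k" by (simp add: c_def)
   finally show ?thesis using f1[of k] n(2) k by (simp add: N_def)
  qed
 qed
 have "norm (\<phi> t - \<phi> s) \<le> \<psi> t - \<psi> s"
 proof (rule differentiable_bound_general[OF st(2)])
  show "continuous_on {s..t} \<phi>" using deriv by (meson continuous_on_vector_derivative has_vector_derivative_at_within)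
  show "continuous_on {s..t} \<psi>" using d\<psi> by (meson continuous_on_vector_derivative has_vector_derivative_at_within)
  fix \<tau> assume \<tau>: "s < \<tau>" "\<tau> < t"
  show "(\<phi> has_vector_derivative \<phi>' \<tau>) (at \<tau>)" by (rule deriv)
  show "(\<psi> has_vector_derivative \<psi>' \<tau>) (at \<tau>)" by (rule d\<psi>)
  show "norm (\<phi>' \<tau>) \<le> \<psi>' \<tau>" by (rule bound) (use \<tau> in simp)
 qed
 also have "\<dots> = (\<Sum>k<N. c k * (exp (- (pi * (1/4)^k * (s * r)^2)) - exp (- (pi * (1/4)^k * (t * r)^2))))"
  unfolding \<psi>_def right_diff_distrib sum_subtractf by simp
 finally show ?thesis by blast
qed

section \<open>The three conditions\<close>

lemma has_vector_derivative_radial: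
 fixes F :: "R3 \<Rightarrow> complex" and D :: "R3 \<Rightarrow> R3 \<Rightarrow>\<^sub>L complex"
 assumes "\<And>x. (F has_derivative blinfun_apply (D x)) (at x)"
 shows "((\<lambda>t. F (t *\<^sub>R y)) has_vector_derivative blinfun_apply (D (t *\<^sub>R y)) y) (at t)"
proof -
 have "((\<lambda>t. t *\<^sub>R y) has_derivative (\<lambda>h. h *\<^sub>R y)) (at t)" by (auto intro!: derivative_eq_intros)
 from has_derivative_compose[OF this assms[of "t *\<^sub>R y"]]
 show ?thesis unfolding has_vector_derivative_def by (simp add: blinfun.scaleR_right)
qed

context
 fixes F :: "R3 \<Rightarrow> complex" and D :: "R3 \<Rightarrow> R3 \<Rightarrow>\<^sub>L complex"
 assumes der: "\<And>x. (F has_derivative blinfun_apply (D x)) (at x)"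
  and cond: "\<And>x. Im (- blinfun_apply (D x) x) = 0 \<and> Re (- blinfun_apply (D x) x) \<ge> 0"
begin

lemma radial_derivative_sign:
 assumes "0 < t"
 shows "Im (blinfun_apply (D (t *\<^sub>R y)) y) = 0" "Re (blinfun_apply (D (t *\<^sub>R y)) y) \<le> 0"
proof -
 have "blinfun_apply (D (t *\<^sub>R y)) (t *\<^sub>R y) = t *\<^sub>R blinfun_apply (D (t *\<^sub>R y)) y" by (rule blinfun.scaleR_right)
 then have "t * Im (blinfun_apply (D (t *\<^sub>R y)) y) = 0" "t * Re (blinfun_apply (D (t *\<^sub>R y)) y) \<le> 0"
  using cond[of "t *\<^sub>R y"] by simp_all
 then show "Im (blinfun_apply (D (t *\<^sub>R y)) y) = 0" "Re (blinfun_apply (D (t *\<^sub>R y)) y) \<le> 0"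
  using assms by (simp_all add: mult_le_0_iff)
qed

lemma radial_derivative_Re: "((\<lambda>t. Re (F (t *\<^sub>R y))) has_real_derivative Re (blinfun_apply (D (t *\<^sub>R y)) y)) (at t)"
 unfolding has_real_derivative_iff_has_vector_derivative
 by (rule bounded_linear.has_vector_derivative[OF bounded_linear_Re has_vector_derivative_radial[OF der]])

lemma radial_derivative_Im: "((\<lambda>t. Im (F (t *\<^sub>R y))) has_real_derivative Im (blinfun_apply (D (t *\<^sub>R y)) y)) (at t)"
 unfolding has_real_derivative_iff_has_vector_derivative
 by (rule bounded_linear.has_vector_derivative[OF bounded_linear_Im has_vector_derivative_radial[OF der]])

lemma radially_decreasing_Re:
 assumes "0 < s" "s < t"
 shows "Re (F (t *\<^sub>R y)) \<le> Re (F (s *\<^sub>R y))"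
proof (rule DERIV_nonpos_imp_nonincreasing[of s t "\<lambda>t. Re (F (t *\<^sub>R y))"])
 fix x assume "s \<le> x" "x \<le> t"
 then have "0 < x" using assms by simp
 then show "\<exists>z. ((\<lambda>t. Re (F (t *\<^sub>R y))) has_real_derivative z) (at x) \<and> z \<le> 0"
  using radial_derivative_Re radial_derivative_sign(2) by blast
qed (use assms in simp)

text \<open>The radial derivative is real, so the imaginary part is constant along rays. For
  normalised \<mu> it vanishes at the origin, and the Fourier transform is real.\<close>

lemma radially_constant_Im: "Im (F y) = Im (F 0)"
proof -
 have "Im (F (1 *\<^sub>R y)) = Im (F (0 *\<^sub>R y))"
 proof (rule DERIV_isconst_end[where f="\<lambda>t. Im (F (t *\<^sub>R y))"])
  show "continuous_on {0..1} (\<lambda>t. Im (F (t *\<^sub>R y)))"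
   by (rule DERIV_continuous_on[OF has_field_derivative_at_within[OF radial_derivative_Im]])
  show "((\<lambda>t. Im (F (t *\<^sub>R y))) has_real_derivative 0) (at x)" if "0 < x" "x < 1" for x
   using radial_derivative_Im[of y x] radial_derivative_sign(1)[OF that(1), of y] by simp
 qed simp
 then show ?thesis by simp
qed

end

lemma norm_le_grad_norm: "cmod (blinfun_apply D v) \<le> grad_norm D * norm v"
proof -
 have "v = (\<Sum>j\<in>UNIV. v $ j *\<^sub>R axis j 1)" by (metis (no_types, lifting) basis_expansion scalar_mult_eq_scaleR sum.cong)
 then have "blinfun_apply D v = blinfun_apply D (\<Sum>j\<in>UNIV. v $ j *\<^sub>R axis j 1)" by simp
 also have "\<dots> = (\<Sum>j\<in>UNIV. v $ j *\<^sub>R blinfun_apply D (axis j 1))" by (simp add: blinfun.sum_right blinfun.scaleR_right)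
 finally have "cmod (blinfun_apply D v) \<le> (\<Sum>j\<in>UNIV. \<bar>v $ j\<bar> * cmod (blinfun_apply D (axis j 1)))"
  using norm_sum[of "\<lambda>j. v $ j *\<^sub>R blinfun_apply D (axis j 1)" UNIV] by simp
 also have "\<dots> \<le> L2_set (\<lambda>j. v $ j) UNIV * L2_set (\<lambda>j. cmod (blinfun_apply D (axis j 1))) UNIV"
  using L2_set_mult_ineq[of "\<lambda>j. v $ j" "\<lambda>j. cmod (blinfun_apply D (axis j 1))" UNIV] by simp
 also have "\<dots> = grad_norm D * norm v"
  unfolding grad_norm_def norm_vec_def L2_set_def by simp
 finally show ?thesis .
qed

text \<open>Evenness makes the derivative at 0 both even and odd, hence zero. A bound for the second
  derivative on the unit ball then gives linear growth near 0, and the assumed decay governs the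
  rest. Both are needed to compare with Gaussians, whose radial derivative also vanishes at
  0.\<close>

lemma even_derivative_bounds:
 fixes F :: "R3 \<Rightarrow> complex" and D :: "R3 \<Rightarrow> R3 \<Rightarrow>\<^sub>L complex" and D2 :: "R3 \<Rightarrow> R3 \<Rightarrow>\<^sub>L (R3 \<Rightarrow>\<^sub>L complex)"
 assumes even: "\<And>x. F (- x) = F x"
  and der: "\<And>x. (F has_derivative blinfun_apply (D x)) (at x)"
  and der2: "\<And>x. (D has_derivative blinfun_apply (D2 x)) (at x)"
  and cont: "continuous_on UNIV D2" and \<delta>: "\<delta> > 0"
  and decay: "\<And>x. grad_norm (D x) \<le> C * (1 + norm x) powr (- 1 - \<delta>)"
 shows "\<exists>K\<ge>0. (\<forall>y v. norm y \<le> 1 \<longrightarrow> cmod (blinfun_apply (D y) v) \<le> K * norm y * norm v)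
  \<and> (\<forall>y v. 1 \<le> norm y \<longrightarrow> cmod (blinfun_apply (D y) v) \<le> K * norm y powr (- 1 - \<delta>) * norm v)"
proof -
 have "(F has_derivative (\<lambda>v. blinfun_apply (D 0) (- v))) (at 0)"
 proof -
  have "((\<lambda>x::R3. - x) has_derivative (\<lambda>h. - h)) (at 0)" by (auto intro!: derivative_eq_intros)
  moreover have "(F has_derivative blinfun_apply (D 0)) (at (- 0))" using der[of 0] by simp
  ultimately have "((\<lambda>x. F (- x)) has_derivative (\<lambda>v. blinfun_apply (D 0) (- v))) (at 0)" by (rule has_derivative_compose)
  then show ?thesis unfolding even .
 qed
 from fun_cong[OF has_derivative_unique[OF this der[of 0]]]
 have "- blinfun_apply (D 0) v = blinfun_apply (D 0) v" for v unfolding blinfun.minus_right .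
 then have "blinfun_apply (D 0) v = 0" for v by (simp add: complex_eq_iff)
 then have D0: "D 0 = 0" by (intro blinfun_eqI) simp
 have "compact (D2 ` cball 0 1)" using cont by (intro compact_continuous_image) (auto intro: continuous_on_subset)
 then have "bounded (D2 ` cball 0 1)" by (rule compact_imp_bounded)
 then obtain B where B: "0 < B" "\<And>y. y \<in> D2 ` cball 0 1 \<Longrightarrow> norm y \<le> B" unfolding bounded_pos by blast
 have nD: "norm (D y) \<le> B * norm y" if "norm y \<le> 1" for y
 proof -
  have "norm (D y - D 0) \<le> B * norm (y - 0)"
  proof (rule differentiable_bound[where S="cball 0 1" and f'="\<lambda>x. blinfun_apply (D2 x)"])
   show "(D has_derivative blinfun_apply (D2 x)) (at x within cball 0 1)" for x by (rule has_derivative_at_withinI[OF der2])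
   show "onorm (blinfun_apply (D2 x)) \<le> B" if "x \<in> cball 0 1" for x
    using B(2)[of "D2 x"] that unfolding norm_blinfun.rep_eq by blast
  qed (use that in auto)
  then show ?thesis using D0 by simp
 qed
 show ?thesis
 proof (intro exI[of _ "max B \<bar>C\<bar>"] conjI allI impI)
  fix y v :: R3 assume y: "norm y \<le> 1"
  have "cmod (blinfun_apply (D y) v) \<le> norm (D y) * norm v" by (rule norm_blinfun)
  also have "\<dots> \<le> (B * norm y) * norm v" by (rule mult_right_mono[OF nD[OF y]]) simp
  also have "\<dots> \<le> max B \<bar>C\<bar> * norm y * norm v" by (intro mult_right_mono) auto
  finally show "cmod (blinfun_apply (D y) v) \<le> max B \<bar>C\<bar> * norm y * norm v" .
 next
  fix y v :: R3 assume y: "1 \<le> norm y"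
  have "cmod (blinfun_apply (D y) v) \<le> grad_norm (D y) * norm v" by (rule norm_le_grad_norm)
  also have "\<dots> \<le> (max B \<bar>C\<bar> * norm y powr (- 1 - \<delta>)) * norm v"
  proof (rule mult_right_mono)
   have "C * (1 + norm y) powr (- 1 - \<delta>) \<le> max B \<bar>C\<bar> * (1 + norm y) powr (- 1 - \<delta>)" by (intro mult_right_mono) auto
   also have "\<dots> \<le> max B \<bar>C\<bar> * norm y powr (- 1 - \<delta>)"
    using y \<delta> B(1) by (intro mult_left_mono powr_mono2') auto
   finally show "grad_norm (D y) \<le> max B \<bar>C\<bar> * norm y powr (- 1 - \<delta>)" using decay[of y] by linarith
  qed simp
  finally show "cmod (blinfun_apply (D y) v) \<le> max B \<bar>C\<bar> * norm y powr (- 1 - \<delta>) * norm v" .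
 qed (use B(1) in auto)
qed

context restriction_measure begin

text \<open>Condition (a): the transform is real and decreases along rays, so it is its own
  dominating profile, and the single variation hypothesis bounds the diagonal.\<close>

lemma testable_monotone:
 assumes \<rho>: "1 < \<rho>" and \<mu>: "is_cmeasure \<mu>" and norm1: "cm_apply \<mu> UNIV = 1"
  and der: "\<And>x. (cm_fourier \<mu> has_derivative blinfun_apply (D x)) (at x)"
  and cond: "\<And>x. Im (- blinfun_apply (D x) x) = 0 \<and> Re (- blinfun_apply (D x) x) \<ge> 0"
  and hyp: "\<And>h. schwartz h \<Longrightarrow> Lnorm 2 lborel (\<lambda>x. var_tilde \<rho> (\<lambda>\<epsilon>. cm_conv h (cm_dilate \<epsilon> \<mu>) x)) \<le> ennreal (C * enn2real (Lnorm_c 2 lborel h))"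
 shows "\<exists>C0>0. testable \<rho> (mhat \<mu>) C0"
proof -
 define B where "B = (\<integral>y. cmod (snd \<mu> y) \<partial>fst \<mu>)"
 define M where "M x = Re (mhat \<mu> x)" for x
 have "Im (cm_fourier \<mu> 0) = 0" using mhat_0[OF \<mu>] norm1 by (simp add: mhat_def)
 then have "Im (mhat \<mu> x) = 0" for x unfolding mhat_def using radially_constant_Im[OF der cond, of "- x"] by simp
 then have real: "mhat \<mu> x = complex_of_real (M x)" for x by (simp add: complex_eq_iff M_def)
 have dec: "M (t *\<^sub>R x) \<le> M (s *\<^sub>R x)" if "0 < s" "s < t" for s t x
  using radially_decreasing_Re[OF der cond that, of "- x"] by (simp add: M_def mhat_def)
 \<comment> \<open>One profile, repeated with weights of total mass 1 to fit the general
   lemma.\<close>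
 let ?c = "\<lambda>k::nat. ennreal ((1/2) ^ Suc k)"
 have c1: "(\<Sum>k. ?c k) = ennreal 1"
  by (rule suminf_ennreal_eq[OF _ power_half_series]) simp
 have "testable \<rho> (mhat \<mu>) ((2 * B * 1^2)^2 * (A * C^2) + 1)"
 proof (rule testable_of_family[where M="\<lambda>_. M" and c="?c"])
  show "0 \<le> B" by (simp add: B_def)
  show "continuous_on UNIV M" unfolding M_def by (intro continuous_on_Re continuous_on_mhat[OF \<mu>])
  show "\<bar>M x\<bar> \<le> B" for x
   using order_trans[OF abs_Re_le_cmod norm_mhat_le[OF \<mu>]] unfolding M_def B_def .
  show "(\<Sum>k. ?c k) \<le> ennreal 1" unfolding c1 by (rule order_refl)
  show "ennreal (cmod (mhat \<mu> (t *\<^sub>R x) - mhat \<mu> (s *\<^sub>R x))) \<le> (\<Sum>k. ?c k * ennreal (M (s *\<^sub>R x) - M (t *\<^sub>R x)))"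
   if "0 < s" "s < t" for s t x
  proof -
   have "cmod (mhat \<mu> (t *\<^sub>R x) - mhat \<mu> (s *\<^sub>R x)) = M (s *\<^sub>R x) - M (t *\<^sub>R x)"
   proof -
    have "mhat \<mu> (t *\<^sub>R x) - mhat \<mu> (s *\<^sub>R x) = complex_of_real (M (t *\<^sub>R x) - M (s *\<^sub>R x))" by (simp only: real of_real_diff)
    then have "cmod (mhat \<mu> (t *\<^sub>R x) - mhat \<mu> (s *\<^sub>R x)) = \<bar>M (t *\<^sub>R x) - M (s *\<^sub>R x)\<bar>" by (simp only: norm_of_real)
    then show ?thesis using dec[OF that, of x] by linarith
   qed
   then show ?thesis unfolding ennreal_suminf_multc c1 by (simp only: ennreal_1 mult_1 order_refl)
  qed
  fix T :: "real set" and K :: "R3 \<Rightarrow> real" and s :: real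
  assume T: "finite T" "T \<noteq> {}" "T \<subseteq> {0<..}" and K: "compactly_supported K" "\<And>x. 0 \<le> K x" "0 < s"
  let ?h = "\<lambda>x. complex_of_real (gconv s K x)"
  let ?a = "\<lambda>z \<epsilon>. cm_conv (fourier ?h) (cm_dilate \<epsilon> \<mu>) z"
  have hi: "integrable lborel ?h" using gconv_integrable[OF K] by simp
  let ?G = "\<lambda>z. (var_tilde \<rho> (?a z))^2"
  have G1: "(ennreal (vnorm \<rho> S (\<lambda>t. fourier (\<lambda>x. ?h x * complex_of_real (M (t *\<^sub>R x))) z)))^2 \<le> ?G z" if S: "S \<subseteq> T" "S \<noteq> {}" for S z
  proof -
   have S': "finite S" "S \<subseteq> {0<..}" using finite_subset[OF S(1) T(1)] subset_trans[OF S(1) T(3)] by blast+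
   have "vnorm \<rho> S (\<lambda>t. fourier (\<lambda>x. ?h x * complex_of_real (M (t *\<^sub>R x))) z) = vnorm \<rho> S (?a z)"
   proof (rule vnorm_cong[OF S'(1)])
    fix t assume "t \<in> S"
    then have "0 < t" using S'(2) by auto
    then show "fourier (\<lambda>x. ?h x * complex_of_real (M (t *\<^sub>R x))) z = ?a z t"
     by (simp only: cm_conv_fourier[OF \<mu> hi] real)
   qed
   then have "ennreal (vnorm \<rho> S (\<lambda>t. fourier (\<lambda>x. ?h x * complex_of_real (M (t *\<^sub>R x))) z)) \<le> var_tilde \<rho> (?a z)"
    using vnorm_le_var_tilde[OF S'(1) S(2) S'(2), of \<rho> "?a z"] by (simp only:)
   then show ?thesis by (rule power_mono) simp
  qed
  have G2: "(LI+ z. ?G z) \<le> ennreal (C^2) * (LI+ x. (ennreal (K x))^2)"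
   using L2_bound_of_Lnorm[OF hyp[OF schwartz_fourier_gconv[OF K]]]
   by (rule order_trans) (intro mult_left_mono fourier_gconv_L2[OF K], simp)
  show "\<exists>G. (\<forall>S z. S \<subseteq> T \<longrightarrow> S \<noteq> {} \<longrightarrow> (ennreal (vnorm \<rho> S (\<lambda>t. fourier (\<lambda>x. ?h x * complex_of_real (M (t *\<^sub>R x))) z)))\<^sup>2 \<le> G z)
    \<and> (LI+ z. G z) \<le> ennreal (C^2) * (LI+ x. (ennreal (K x))^2)"
   by (rule exI[of _ ?G]) (intro conjI allI impI G1 G2)
 qed (use \<rho> dec in auto)
 moreover have "0 < (2 * B * 1^2)^2 * (A * C^2) + 1" using A_nonneg by (intro add_nonneg_pos mult_nonneg_nonneg) auto
 ultimately show ?thesis by blast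
qed

text \<open>Condition (c): convolution with the conjugate measure multiplies by the conjugate of m
  at the reflected point, and evenness removes the reflection. Only then is the kernel the one
  produced by |E|^2.\<close>

lemma testable_double:
 assumes \<rho>: "1 < \<rho>" and \<mu>: "is_cmeasure \<mu>" and even: "\<forall>E\<in>sets borel. cm_apply \<mu> (uminus ` E) = cm_apply \<mu> E"
  and hyp: "\<And>h. schwartz h \<Longrightarrow> Lnorm 2 lborel (\<lambda>x. var2_tilde \<rho> (\<lambda>\<epsilon> \<eta>. cm_conv (cm_conv h (cm_dilate \<epsilon> \<mu>)) (cm_dilate \<eta> (cm_cnj \<mu>)) x))
   \<le> ennreal (C * enn2real (Lnorm_c 2 lborel h))"
 shows "\<exists>C0>0. testable \<rho> (mhat \<mu>) C0"
proof -
 have "testable \<rho> (mhat \<mu>) (A * C^2 + 1)"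
 proof (rule testable_double_variation[OF \<rho> continuous_on_mhat[OF \<mu>] norm_mhat_le[OF \<mu>]])
  fix T :: "real set" and K :: "R3 \<Rightarrow> real" and s :: real
  assume T: "finite T" "T \<noteq> {}" "T \<subseteq> {0<..}" and K: "compactly_supported K" "\<And>x. 0 \<le> K x" "0 < s"
  let ?h = "\<lambda>x. complex_of_real (gconv s K x)"
  let ?a = "\<lambda>z \<epsilon> \<eta>. cm_conv (cm_conv (fourier ?h) (cm_dilate \<epsilon> \<mu>)) (cm_dilate \<eta> (cm_cnj \<mu>)) z"
  let ?b = "\<lambda>z \<epsilon> \<eta>. fourier (\<lambda>x. ?h x * mhat \<mu> (\<epsilon> *\<^sub>R x) * cnj (mhat \<mu> (\<eta> *\<^sub>R x))) z"
  have hi: "integrable lborel ?h" using gconv_integrable[OF K] by simp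
  have ab: "?a z \<epsilon> \<eta> = ?b z \<epsilon> \<eta>" if "0 < \<epsilon>" "0 < \<eta>" for z \<epsilon> \<eta>
   unfolding cm_conv_fourier[OF \<mu> hi that(1)] cm_conv_fourier[OF is_cmeasure_cnj[OF \<mu>] integrable_mult_mhat[OF \<mu> hi] that(2)]
    mhat_cnj[OF \<mu>] mhat_even[OF \<mu> even] ..
  let ?G = "\<lambda>z. var2_tilde \<rho> (?a z)"
  have G1: "ennreal (wnorm \<rho> S S' (?b z)) \<le> ?G z" if S: "S \<subseteq> T" "S \<noteq> {}" "S' \<subseteq> T" "S' \<noteq> {}" for S S' z
  proof -
   have S': "finite S" "S \<subseteq> {0<..}" "finite S'" "S' \<subseteq> {0<..}"
    using finite_subset[OF S(1) T(1)] subset_trans[OF S(1) T(3)] finite_subset[OF S(3) T(1)] subset_trans[OF S(3) T(3)] by blast+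
   have "wnorm \<rho> S S' (?b z) = wnorm \<rho> S S' (?a z)"
   proof (rule wnorm_cong[OF S'(1,3)])
    fix t t' assume "t \<in> S" "t' \<in> S'"
    then have "0 < t" "0 < t'" using S'(2,4) by auto
    then show "?b z t t' = ?a z t t'" by (rule ab[symmetric])
   qed
   then show ?thesis using wnorm_le_var2_tilde[OF S'(1) S(2) S'(2) S'(3) S(4) S'(4), of \<rho> "?a z"] by (simp only:)
  qed
  have G2: "(LI+ z. (?G z)^2) \<le> ennreal (C^2) * (LI+ x. (ennreal (K x))^2)"
   using L2_bound_of_Lnorm[OF hyp[OF schwartz_fourier_gconv[OF K]]]
   by (rule order_trans) (intro mult_left_mono fourier_gconv_L2[OF K], simp)
  show "\<exists>G. (\<forall>S S' z. S \<subseteq> T \<longrightarrow> S \<noteq> {} \<longrightarrow> S' \<subseteq> T \<longrightarrow> S' \<noteq> {} \<longrightarrow> ennreal (wnorm \<rho> S S' (?b z)) \<le> G z)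
    \<and> (LI+ z. (G z)^2) \<le> ennreal (C^2) * (LI+ x. (ennreal (K x))^2)"
   by (rule exI[of _ ?G]) (intro conjI allI impI G1 G2)
 qed simp
 moreover have "0 < A * C^2 + 1" using A_nonneg by (intro add_nonneg_pos mult_nonneg_nonneg) auto
 ultimately show ?thesis by blast
qed

text \<open>Condition (b): the profiles are Gaussians whose variation in the scale is that of the
  heat semigroup, with a constant independent of the width. The decay exponent \<delta> > 0 makes
  the weights a convergent geometric series.\<close>

lemma testable_smooth:
 assumes \<rho>: "2 < \<rho>" and \<mu>: "is_cmeasure \<mu>" and even: "\<forall>E\<in>sets borel. cm_apply \<mu> (uminus ` E) = cm_apply \<mu> E"
  and der: "\<And>x. (cm_fourier \<mu> has_derivative blinfun_apply (D x)) (at x)"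
  and der2: "\<And>x. (D has_derivative blinfun_apply (D2 x)) (at x)"
  and cont: "continuous_on UNIV D2" and \<delta>: "\<delta> > 0"
  and decay: "\<And>x. grad_norm (D x) \<le> C * (1 + norm x) powr (- 1 - \<delta>)"
 shows "\<exists>C0>0. testable \<rho> (mhat \<mu>) C0"
proof -
 have ev: "cm_fourier \<mu> (- x) = cm_fourier \<mu> x" for x
  using mhat_even[OF \<mu> even, of x] unfolding mhat_def minus_minus by (rule sym)
 obtain K0 where K0: "0 \<le> K0" "\<And>y v. norm y \<le> 1 \<Longrightarrow> cmod (blinfun_apply (D y) v) \<le> K0 * norm y * norm v"
  "\<And>y v. 1 \<le> norm y \<Longrightarrow> cmod (blinfun_apply (D y) v) \<le> K0 * norm y powr (- 1 - \<delta>) * norm v"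
  using even_derivative_bounds[OF ev der der2 cont \<delta> decay] by blast
 define c where "c k = K0 * exp (4 * pi) / (2 * pi) * (2 powr (- \<delta>)) ^ k" for k :: nat
 define c0 where "c0 = K0 * exp (4 * pi) / (2 * pi) * (1 / (1 - 2 powr (- \<delta>)))"
 define M where "M k x = exp (- (pi * (1/4) ^ k * (norm x)^2))" for k :: nat and x :: R3
 define H where "H = max 0 (lepingle_const \<rho>)"
 have d1: "2 powr (- \<delta>) < 1" using powr_less_mono[of "- \<delta>" 0 2] \<delta> by simp
 have cnn: "0 \<le> c k" for k using K0(1) by (simp add: c_def)
 have csum: "(\<Sum>k. ennreal (c k)) = ennreal c0"
 proof (rule suminf_ennreal_eq[OF cnn])
  show "c sums c0" unfolding c_def c0_def by (rule sums_mult, rule geometric_sums) (use d1 in simp)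
 qed
 have c0: "0 \<le> c0" unfolding c0_def using K0(1) d1 by (intro mult_nonneg_nonneg) auto
 have dec: "M k (t *\<^sub>R x) \<le> M k (s *\<^sub>R x)" if "0 < s" "s < t" for k s t x
 proof -
  have "norm (s *\<^sub>R x) \<le> norm (t *\<^sub>R x)" using that by (simp add: mult_right_mono)
  then have "(norm (s *\<^sub>R x))^2 \<le> (norm (t *\<^sub>R x))^2" by (rule power_mono) simp
  then have "pi * (1/4) ^ k * (norm (s *\<^sub>R x))^2 \<le> pi * (1/4) ^ k * (norm (t *\<^sub>R x))^2" by (rule mult_left_mono) simp
  then show ?thesis unfolding M_def by simp
 qed
 have "testable \<rho> (mhat \<mu>) ((2 * 1 * c0^2)^2 * (A * H) + 1)"
 proof (rule testable_of_family[where M=M and c="\<lambda>k. ennreal (c k)"])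
  show "continuous_on UNIV (M k)" for k unfolding M_def by (intro continuous_intros)
  show "\<bar>M k x\<bar> \<le> 1" for k x unfolding M_def by simp
  show "(\<Sum>k. ennreal (c k)) \<le> ennreal c0" unfolding csum by simp
  show "ennreal (cmod (mhat \<mu> (t *\<^sub>R x) - mhat \<mu> (s *\<^sub>R x))) \<le> (\<Sum>k. ennreal (c k) * ennreal (M k (s *\<^sub>R x) - M k (t *\<^sub>R x)))"
   if st: "0 < s" "s < t" for s t x
  proof -
   let ?\<phi> = "\<lambda>\<tau>. cm_fourier \<mu> (\<tau> *\<^sub>R (- x))" and ?\<phi>' = "\<lambda>\<tau>. blinfun_apply (D (\<tau> *\<^sub>R (- x))) (- x)"
   have "\<exists>N. cmod (?\<phi> t - ?\<phi> s) \<le> (\<Sum>k<N. c k * (exp (- (pi * (1/4)^k * (s * norm x)^2)) - exp (- (pi * (1/4)^k * (t * norm x)^2))))"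
    unfolding c_def
   proof (rule heat_profile_domination[OF K0(1) \<delta> norm_ge_zero st, where \<phi>'="?\<phi>'"])
    show "(?\<phi> has_vector_derivative ?\<phi>' \<tau>) (at \<tau>)" for \<tau> by (rule has_vector_derivative_radial[OF der])
    show "cmod (?\<phi>' \<tau>) \<le> K0 * (\<tau> * norm x) * norm x" if "0 < \<tau>" "\<tau> * norm x \<le> 1" for \<tau>
     using K0(2)[of "\<tau> *\<^sub>R (- x)" "- x"] that by simp
    show "cmod (?\<phi>' \<tau>) \<le> K0 * (\<tau> * norm x) powr (- 1 - \<delta>) * norm x" if "0 < \<tau>" "1 \<le> \<tau> * norm x" for \<tau>
     using K0(3)[of "\<tau> *\<^sub>R (- x)" "- x"] that by simp
   qed
   then obtain N where N: "cmod (?\<phi> t - ?\<phi> s) \<le> (\<Sum>k<N. c k * (exp (- (pi * (1/4)^k * (s * norm x)^2)) - exp (- (pi * (1/4)^k * (t * norm x)^2))))" by blast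
   have "cmod (mhat \<mu> (t *\<^sub>R x) - mhat \<mu> (s *\<^sub>R x)) \<le> (\<Sum>k<N. c k * (M k (s *\<^sub>R x) - M k (t *\<^sub>R x)))"
    using N st by (simp add: mhat_def M_def)
   then have "ennreal (cmod (mhat \<mu> (t *\<^sub>R x) - mhat \<mu> (s *\<^sub>R x))) \<le> ennreal (\<Sum>k<N. c k * (M k (s *\<^sub>R x) - M k (t *\<^sub>R x)))" by (rule ennreal_leI)
   also have "\<dots> = (\<Sum>k<N. ennreal (c k * (M k (s *\<^sub>R x) - M k (t *\<^sub>R x))))"
    using cnn dec[OF st] by (intro sum_ennreal[symmetric]) simp
   also have "\<dots> = (\<Sum>k<N. ennreal (c k) * ennreal (M k (s *\<^sub>R x) - M k (t *\<^sub>R x)))"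
    using cnn dec[OF st] by (intro sum.cong refl ennreal_mult) simp_all
   also have "\<dots> \<le> (\<Sum>k. ennreal (c k) * ennreal (M k (s *\<^sub>R x) - M k (t *\<^sub>R x)))"
    by (rule sum_le_suminf[OF summableI]) auto
   finally show ?thesis .
  qed
  fix k and T :: "real set" and K :: "R3 \<Rightarrow> real" and s :: real
  assume T: "finite T" "T \<noteq> {}" "T \<subseteq> {0<..}" and K: "compactly_supported K" "\<And>x. 0 \<le> K x" "0 < s"
  let ?h = "\<lambda>x. complex_of_real (gconv s K x)"
  have hi: "integrable lborel ?h" using gconv_integrable[OF K] by simp
  \<comment> \<open>At scale t the k-th profile is the damping by \<kappa> t^2 with \<kappa> =
    4^(-k).\<close>
  have dm: "(\<lambda>x. ?h x * complex_of_real (M k (t *\<^sub>R x))) = damp ((1/4) ^ k * t^2) ?h" for t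
   unfolding M_def damp_def by (intro ext) (simp add: power_mult_distrib mult_ac)
  obtain G where G: "\<And>S z. S \<subseteq> T \<Longrightarrow> S \<noteq> {} \<Longrightarrow> (ennreal (vnorm \<rho> S (\<lambda>t. fourier (damp ((1/4) ^ k * t^2) ?h) z)))\<^sup>2 \<le> G z"
   "(LI+ z. G z) \<le> ennreal (lepingle_const \<rho>) * (LI+ z. (ennreal (cmod (fourier ?h z)))^2)"
   by (rule heat_variation[OF hi T \<rho>, of "(1/4) ^ k"]) auto
  have "ennreal (lepingle_const \<rho>) * (LI+ z. (ennreal (cmod (fourier ?h z)))^2) \<le> ennreal H * (LI+ x. (ennreal (K x))^2)"
   by (intro mult_mono fourier_gconv_L2[OF K] ennreal_leI) (auto simp: H_def)
  then have "(LI+ z. G z) \<le> ennreal H * (LI+ x. (ennreal (K x))^2)" using G(2) by (rule order_trans[rotated])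
  then show "\<exists>G. (\<forall>S z. S \<subseteq> T \<longrightarrow> S \<noteq> {} \<longrightarrow> (ennreal (vnorm \<rho> S (\<lambda>t. fourier (\<lambda>x. ?h x * complex_of_real (M k (t *\<^sub>R x))) z)))\<^sup>2 \<le> G z)
    \<and> (LI+ z. G z) \<le> ennreal H * (LI+ x. (ennreal (K x))^2)"
   unfolding dm using G(1) by (intro exI[of _ G] conjI allI impI)
 qed (use \<rho> dec c0 in \<open>auto simp: H_def\<close>)
 moreover have "0 < (2 * 1 * c0^2)^2 * (A * H) + 1" using A_nonneg by (intro add_nonneg_pos mult_nonneg_nonneg) (auto simp: H_def)
 ultimately show ?thesis by blast
qed

end

section \<open>Caps and dyadic scales\<close>

lemma nn_integral_sphere:
 assumes [measurable]: "F \<in> borel_measurable borel"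
 shows "(\<integral>\<^sup>+\<omega>. F \<omega> \<partial>sphere_measure) = (LI+ x. 3 * indicator (cball 0 1) x * F ((1 / norm x) *\<^sub>R x))"
proof -
 have m: "(\<lambda>x::R3. 3 * indicator (cball 0 1) x :: ennreal) \<in> borel_measurable lborel"
  by (intro borel_measurable_times_ennreal borel_measurable_indicator borel_measurable_const) simp_all
 have p: "(\<lambda>x::R3. (1 / norm x) *\<^sub>R x) \<in> borel_measurable borel" by measurable
 have "(\<integral>\<^sup>+\<omega>. F \<omega> \<partial>sphere_measure) = (\<integral>\<^sup>+x. F ((1 / norm x) *\<^sub>R x) \<partial>density lborel (\<lambda>x. 3 * indicator (cball 0 1) x))"
  unfolding sphere_measure_def by (rule nn_integral_distr) (use p in simp_all)
 also have "\<dots> = (LI+ x. 3 * indicator (cball 0 1) x * F ((1 / norm x) *\<^sub>R x))"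
  by (rule nn_integral_density[OF m]) (use measurable_compose[OF p assms] in simp)
 finally show ?thesis .
qed

lemma measurable_orthogonal:
 fixes T :: "R3 \<Rightarrow> R3"
 assumes "orthogonal_transformation T"
 shows "T \<in> borel_measurable borel"
 using assms by (intro borel_measurable_continuous_onI linear_continuous_on linear_conv_bounded_linear[THEN iffD1] orthogonal_transformation_linear)

text \<open>The cone over a rotated set is the rotated cone, so invariance is inherited from
  Lebesgue measure.\<close>

lemma nn_integral_sphere_orthogonal:
 fixes T :: "R3 \<Rightarrow> R3"
 assumes T: "orthogonal_transformation T" and [measurable]: "F \<in> borel_measurable borel"
 shows "(\<integral>\<^sup>+\<omega>. F (T \<omega>) \<partial>sphere_measure) = (\<integral>\<^sup>+\<omega>. F \<omega> \<partial>sphere_measure)"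
proof -
 note Tm [measurable] = measurable_orthogonal[OF T]
 let ?H = "\<lambda>x. 3 * indicator (cball 0 1) x * F ((1 / norm x) *\<^sub>R x)"
 have Hm: "?H \<in> borel_measurable borel"
  by (intro borel_measurable_times_ennreal borel_measurable_indicator borel_measurable_const) (simp, measurable)
 have "(\<integral>\<^sup>+\<omega>. F (T \<omega>) \<partial>sphere_measure) = (LI+ x. 3 * indicator (cball 0 1) x * F (T ((1 / norm x) *\<^sub>R x)))"
  by (rule nn_integral_sphere) measurable
 also have "\<dots> = (LI+ x. ?H (T x))"
 proof (rule nn_integral_cong)
  fix x
  have n: "norm (T x) = norm x" using T by (rule orthogonal_transformation_norm)
  have "T ((1 / norm x) *\<^sub>R x) = (1 / norm x) *\<^sub>R T x" using orthogonal_transformation_linear[OF T] by (rule linear_cmul)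
  then show "3 * indicator (cball 0 1) x * F (T ((1 / norm x) *\<^sub>R x)) = ?H (T x)"
   unfolding n by (simp add: indicator_def n)
 qed
 also have "\<dots> = (\<integral>\<^sup>+x. ?H x \<partial>distr lborel borel T)"
  by (rule nn_integral_distr[symmetric]) (use Hm in simp_all)
 also have "\<dots> = (\<integral>\<^sup>+\<omega>. F \<omega> \<partial>sphere_measure)"
  unfolding lborel_distr_orthogonal[OF T] by (rule nn_integral_sphere[symmetric]) measurable
 finally show ?thesis .
qed

definition cap :: "R3 \<Rightarrow> R3 set" where "cap e = {\<omega>. \<omega> \<bullet> e \<ge> 1/2}"

lemma cap_borel [measurable]: "cap e \<in> sets borel"
 unfolding cap_def by measurable

text \<open>A rotation taking the third axis to \<open>e\<close> carries the polar cap to this one.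
  It is applied in both variables and, by linearity, to the sum.\<close>

lemma restriction_measure_cap:
 assumes e: "norm e = 1"
 shows "restriction_measure (density sphere_measure (indicator (cap e))) 144"
proof -
 let ?\<tau> = "density sphere_measure (indicator (cap e))"
 have dens: "(\<integral>\<^sup>+\<omega>. h \<omega> \<partial>?\<tau>) = (\<integral>\<^sup>+\<omega>. h \<omega> * indicator (cap e) \<omega> \<partial>sphere_measure)" if "h \<in> borel_measurable borel" for h
  using nn_integral_density[of "indicator (cap e)" sphere_measure h] that by (simp add: mult.commute)
 have "norm (axis 3 1 :: R3) = norm e" using e by simp
 then obtain T :: "R3 \<Rightarrow> R3" where T: "orthogonal_transformation T" "T (axis 3 1) = e" by (rule orthogonal_transformation_exists)
 note Tm [measurable] = measurable_orthogonal[OF T(1)]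
 have Tcap: "indicator (cap e) (T \<omega>) = (indicator {\<omega>. \<omega> $ 3 \<ge> 1/2} \<omega> :: ennreal)" for \<omega>
 proof -
  have "T \<omega> \<bullet> e = \<omega> \<bullet> axis 3 1" using T unfolding orthogonal_transformation_def by metis
  then show ?thesis by (simp add: cap_def indicator_def inner_axis)
 qed
 interpret fm: finite_measure ?\<tau>
 proof
  have "emeasure ?\<tau> (space ?\<tau>) = (\<integral>\<^sup>+\<omega>. indicator (cap e) \<omega> \<partial>sphere_measure)" by (subst emeasure_density) auto
  also have "\<dots> \<le> (\<integral>\<^sup>+\<omega>. 1 \<partial>sphere_measure)" by (intro nn_integral_mono) (simp add: indicator_def)
  also have "\<dots> = emeasure sphere_measure UNIV" by simp
  also have "\<dots> < \<infinity>" using sphere.emeasure_finite[of UNIV] unfolding infinity_ennreal_def less_top .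
  finally show "emeasure ?\<tau> (space ?\<tau>) \<noteq> \<infinity>" by simp
 qed
 show ?thesis
 proof
  show "sets ?\<tau> = sets borel" by simp
  fix F :: "R3 \<Rightarrow> ennreal" assume Fm [measurable]: "F \<in> borel_measurable borel"
  let ?i = "indicator (cap e) :: R3 \<Rightarrow> ennreal"
  let ?c = "indicator {\<omega>::R3. \<omega> $ 3 \<ge> 1/2} :: R3 \<Rightarrow> ennreal"
  have im: "?i \<in> borel_measurable borel" by (rule borel_measurable_indicator) (rule cap_borel)
  have m1: "(\<lambda>y. F (x + y)) \<in> borel_measurable borel" for x by measurable
  have m1i: "(\<lambda>y. F (x + y) * ?i y) \<in> borel_measurable borel" for x by (intro borel_measurable_times_ennreal m1 im)
  have m2: "(\<lambda>x. \<integral>\<^sup>+y. F (x + y) * ?i y \<partial>sphere_measure) \<in> borel_measurable borel"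
  proof (rule sphere.borel_measurable_nn_integral)
   have "(\<lambda>(x, y). F (x + y) * ?i y) \<in> borel_measurable (borel \<Otimes>\<^sub>M borel)"
    unfolding case_prod_beta
    by (intro borel_measurable_times_ennreal measurable_compose[OF measurable_snd im]) measurable
   then show "(\<lambda>(x, y). F (x + y) * ?i y) \<in> borel_measurable (borel \<Otimes>\<^sub>M sphere_measure)"
    by (subst measurable_cong_sets[OF sets_pair_measure_cong[OF refl sets_sphere_measure] refl])
  qed
  have "(\<integral>\<^sup>+x. \<integral>\<^sup>+y. F (x + y) \<partial>?\<tau> \<partial>?\<tau>) = (\<integral>\<^sup>+x. \<integral>\<^sup>+y. F (x + y) * ?i y \<partial>sphere_measure \<partial>?\<tau>)"
   unfolding dens[OF m1] ..
  also have "\<dots> = (\<integral>\<^sup>+x. (\<integral>\<^sup>+y. F (x + y) * ?i y \<partial>sphere_measure) * ?i x \<partial>sphere_measure)" by (rule dens[OF m2])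
  also have "\<dots> = (\<integral>\<^sup>+x. (\<integral>\<^sup>+y. F (T x + y) * ?i y \<partial>sphere_measure) * ?i (T x) \<partial>sphere_measure)"
   by (rule nn_integral_sphere_orthogonal[OF T(1), symmetric]) (intro borel_measurable_times_ennreal m2 im)
  also have "\<dots> = (\<integral>\<^sup>+x. (\<integral>\<^sup>+y. F (T x + T y) * ?i (T y) \<partial>sphere_measure) * ?i (T x) \<partial>sphere_measure)"
   unfolding nn_integral_sphere_orthogonal[OF T(1) m1i, symmetric] ..
  also have "\<dots> = (\<integral>\<^sup>+x. (\<integral>\<^sup>+y. (F \<circ> T) (x + y) * ?c y \<partial>sphere_measure) * ?c x \<partial>sphere_measure)"
   unfolding Tcap o_def linear_add[OF orthogonal_transformation_linear[OF T(1)]] ..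
  also have "\<dots> = (\<integral>\<^sup>+x. \<integral>\<^sup>+y. (F \<circ> T) (x + y) * ?c y * ?c x \<partial>sphere_measure \<partial>sphere_measure)"
  proof (rule nn_integral_cong)
   fix x
   have cm: "?c \<in> borel_measurable borel" by (rule borel_measurable_indicator) measurable
   have "(\<lambda>y. (F \<circ> T) (x + y) * ?c y) \<in> borel_measurable borel"
    unfolding o_def by (intro borel_measurable_times_ennreal cm) measurable
   then show "(\<integral>\<^sup>+y. (F \<circ> T) (x + y) * ?c y \<partial>sphere_measure) * ?c x = (\<integral>\<^sup>+y. (F \<circ> T) (x + y) * ?c y * ?c x \<partial>sphere_measure)"
    by (intro nn_integral_multc[symmetric]) simp
  qed
  also have "\<dots> \<le> 144 * (LI+ x. (F \<circ> T) x)"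
   by (rule cap_sum_le) (unfold o_def, measurable)
  also have "(LI+ x. (F \<circ> T) x) = (\<integral>\<^sup>+x. F x \<partial>distr lborel borel T)"
   unfolding o_def by (rule nn_integral_distr[symmetric]) auto
  finally show "(\<integral>\<^sup>+x. \<integral>\<^sup>+y. F (x + y) \<partial>?\<tau> \<partial>?\<tau>) \<le> ennreal 144 * (LI+ x. F x)"
   unfolding lborel_distr_orthogonal[OF T(1)] by simp
 qed simp
qed

definition cap_centres :: "R3 set" where "cap_centres = range (\<lambda>j. axis j 1) \<union> range (\<lambda>j. - axis j 1)"

lemma finite_cap_centres: "finite cap_centres" by (simp add: cap_centres_def)

lemma norm_cap_centres: "e \<in> cap_centres \<Longrightarrow> norm e = 1" by (auto simp: cap_centres_def)

text \<open>If all three coordinates were at most 1/2 in absolute value, the squared norm would be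
  at most 3/4.\<close>

lemma unit_vector_in_cap:
 fixes \<omega> :: R3
 assumes "norm \<omega> = 1"
 shows "\<exists>e\<in>cap_centres. \<omega> \<in> cap e"
proof (rule ccontr)
 assume n: "\<not> (\<exists>e\<in>cap_centres. \<omega> \<in> cap e)"
 have "(\<omega> $ j)^2 \<le> 1/4" for j
 proof -
  have "\<not> \<omega> \<bullet> axis j 1 \<ge> 1/2" "\<not> \<omega> \<bullet> (- axis j 1) \<ge> 1/2" using n unfolding cap_centres_def cap_def by blast+
  then have "\<bar>\<omega> $ j\<bar> \<le> 1/2" by (simp add: inner_axis)
  then have "\<bar>\<omega> $ j\<bar>\<^sup>2 \<le> (1/2)^2" by (rule power_mono) simp
  then show ?thesis by (simp add: power_divide)
 qed
 then have "(\<Sum>j\<in>UNIV. (\<omega> $ j)^2) \<le> (\<Sum>j\<in>(UNIV::3 set). 1/4)" by (intro sum_mono)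
 moreover have "(norm \<omega>)^2 = (\<Sum>j\<in>UNIV. (\<omega> $ j)^2)" unfolding norm_vec_def L2_set_def by (simp add: sum_nonneg)
 ultimately show False using assms by simp
qed

text \<open>The cone formula shows that almost all of the measure sits on unit vectors, each of
  which lies in some cap; overlaps only enlarge the right-hand side.\<close>

lemma nn_integral_sphere_le_caps:
 assumes F: "F \<in> borel_measurable borel"
 shows "(\<integral>\<^sup>+\<omega>. F \<omega> \<partial>sphere_measure) \<le> (\<Sum>e\<in>cap_centres. \<integral>\<^sup>+\<omega>. F \<omega> \<partial>density sphere_measure (indicator (cap e)))"
proof -
 let ?i = "\<lambda>e. indicator (cap e) :: R3 \<Rightarrow> ennreal"
 have m: "(\<lambda>\<omega>. ?i e \<omega> * F \<omega>) \<in> borel_measurable borel" for e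
  by (intro borel_measurable_times_ennreal borel_measurable_indicator cap_borel F)
 have ms: "(\<lambda>\<omega>. \<Sum>e\<in>cap_centres. ?i e \<omega> * F \<omega>) \<in> borel_measurable borel" by (intro borel_measurable_sum m)
 have pt: "F \<omega> \<le> (\<Sum>e\<in>cap_centres. ?i e \<omega> * F \<omega>)" if \<omega>: "norm \<omega> = 1" for \<omega>
 proof -
  obtain e where e: "e \<in> cap_centres" "\<omega> \<in> cap e" using unit_vector_in_cap[OF \<omega>] by blast
  have "?i e \<omega> * F \<omega> \<le> (\<Sum>e\<in>cap_centres. ?i e \<omega> * F \<omega>)" using e(1) finite_cap_centres by (intro member_le_sum) auto
  then show ?thesis using e(2) by simp
 qed
 have "(\<integral>\<^sup>+\<omega>. F \<omega> \<partial>sphere_measure) = (LI+ x. 3 * indicator (cball 0 1) x * F ((1 / norm x) *\<^sub>R x))"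
  by (rule nn_integral_sphere[OF F])
 also have "\<dots> \<le> (LI+ x. 3 * indicator (cball 0 1) x * (\<Sum>e\<in>cap_centres. ?i e ((1 / norm x) *\<^sub>R x) * F ((1 / norm x) *\<^sub>R x)))"
 proof (rule nn_integral_mono_AE)
  have "AE x in lborel. x \<noteq> (0::R3)" by (rule AE_lborel_singleton)
  then show "AE x in lborel. 3 * indicator (cball 0 1) x * F ((1 / norm x) *\<^sub>R x) \<le> 3 * indicator (cball 0 1) x * (\<Sum>e\<in>cap_centres. ?i e ((1 / norm x) *\<^sub>R x) * F ((1 / norm x) *\<^sub>R x))"
  proof eventually_elim
   case (elim x)
   then show ?case by (intro mult_left_mono pt) auto
  qed
 qed
 also have "\<dots> = (\<integral>\<^sup>+\<omega>. (\<Sum>e\<in>cap_centres. ?i e \<omega> * F \<omega>) \<partial>sphere_measure)"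
  by (rule nn_integral_sphere[OF ms, symmetric])
 also have "\<dots> = (\<Sum>e\<in>cap_centres. \<integral>\<^sup>+\<omega>. ?i e \<omega> * F \<omega> \<partial>sphere_measure)"
  by (rule nn_integral_sum) (use m in simp)
 also have "\<dots> = (\<Sum>e\<in>cap_centres. \<integral>\<^sup>+\<omega>. F \<omega> \<partial>density sphere_measure (?i e))"
  by (intro sum.cong refl nn_integral_density[symmetric]) (use F in simp_all)
 finally show ?thesis .
qed

section \<open>Dyadic scales and the full variation norm\<close>

definition dyadic :: "nat \<Rightarrow> real set" where "dyadic n = (\<lambda>k. real k / 2 ^ n) ` {1..4 ^ n}"

text \<open>The bound 4^n on the numerator makes the grid of mesh 2^(-n) reach up to 2^n, so these
  nested finite sets become dense in the positive half line.\<close>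

lemma dyadic_props: "finite (dyadic n)" "dyadic n \<noteq> {}" "dyadic n \<subseteq> {0<..}" "dyadic n \<subseteq> dyadic (Suc n)"
proof -
 show "finite (dyadic n)" "dyadic n \<subseteq> {0<..}" by (auto simp: dyadic_def)
 show "dyadic n \<noteq> {}" by (simp add: dyadic_def)
 show "dyadic n \<subseteq> dyadic (Suc n)"
 proof
  fix x assume "x \<in> dyadic n"
  then obtain k where k: "1 \<le> k" "k \<le> 4 ^ n" "x = real k / 2 ^ n" by (auto simp: dyadic_def)
  have "x = real (2 * k) / 2 ^ Suc n" "2 * k \<in> {1..4 ^ Suc n}" using k by auto
  then show "x \<in> dyadic (Suc n)" unfolding dyadic_def by blast
 qed
qed

lemma dyadic_mono: "n \<le> n' \<Longrightarrow> dyadic n \<subseteq> dyadic n'"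
 by (rule lift_Suc_mono_le[of dyadic]) (rule dyadic_props(4))

definition dyadic_variation :: "real \<Rightarrow> (real \<Rightarrow> complex) \<Rightarrow> nat \<Rightarrow> real" where
 "dyadic_variation \<rho> a n = Max ((\<lambda>S. vnorm \<rho> S a) ` (Pow (dyadic n) - {{}}))"

lemma dyadic_variation_ge:
 assumes "S \<subseteq> dyadic n" "S \<noteq> {}"
 shows "vnorm \<rho> S a \<le> dyadic_variation \<rho> a n"
proof -
 have "finite ((\<lambda>S. vnorm \<rho> S a) ` (Pow (dyadic n) - {{}}))" using dyadic_props(1) by simp
 moreover have "vnorm \<rho> S a \<in> (\<lambda>S. vnorm \<rho> S a) ` (Pow (dyadic n) - {{}})" using assms by blast
 ultimately show ?thesis unfolding dyadic_variation_def by (rule Max_ge)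
qed

lemma dyadic_variation_mono:
 assumes "n \<le> n'"
 shows "dyadic_variation \<rho> a n \<le> dyadic_variation \<rho> a n'"
 unfolding dyadic_variation_def
proof (rule Max_mono)
 show "(\<lambda>S. vnorm \<rho> S a) ` (Pow (dyadic n) - {{}}) \<subseteq> (\<lambda>S. vnorm \<rho> S a) ` (Pow (dyadic n') - {{}})"
  using dyadic_mono[OF assms] by blast
 show "(\<lambda>S. vnorm \<rho> S a) ` (Pow (dyadic n) - {{}}) \<noteq> {}" using dyadic_props(2)[of n] by blast
 show "finite ((\<lambda>S. vnorm \<rho> S a) ` (Pow (dyadic n') - {{}}))" using dyadic_props(1) by simp
qed

text \<open>Rounding up keeps the approximation positive, so its numerator is at least 1; the upper
  limit of the grid is met once 2^n exceeds x + 1.\<close>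

lemma dyadic_approximation:
 fixes x :: real
 assumes "0 < x"
 defines "y \<equiv> \<lambda>n. real_of_int \<lceil>2 ^ n * x\<rceil> / 2 ^ n"
 shows "y \<longlonglongrightarrow> x" "eventually (\<lambda>n. y n \<in> dyadic n) sequentially"
proof -
 have b: "x \<le> y n" "y n \<le> x + (1/2) ^ n" for n
 proof -
  have "2 ^ n * x \<le> real_of_int \<lceil>2 ^ n * x\<rceil>" "real_of_int \<lceil>2 ^ n * x\<rceil> \<le> 2 ^ n * x + 1" by linarith+
  then have "2 ^ n * x / 2 ^ n \<le> y n" "y n \<le> (2 ^ n * x + 1) / 2 ^ n" unfolding y_def by (intro divide_right_mono; simp)+
  moreover have "2 ^ n * x / 2 ^ n = x" "(2 ^ n * x + 1) / 2 ^ n = x + (1/2) ^ n" by (simp_all add: add_divide_distrib power_divide)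
  ultimately show "x \<le> y n" "y n \<le> x + (1/2) ^ n" by (simp_all only:)
 qed
 have "(\<lambda>n. x + (1/2) ^ n) \<longlonglongrightarrow> x + 0" by (intro tendsto_intros LIMSEQ_power_zero) simp
 then have l: "(\<lambda>n. x + (1/2) ^ n) \<longlonglongrightarrow> x" by simp
 show "y \<longlonglongrightarrow> x"
  by (rule real_tendsto_sandwich[OF _ _ tendsto_const l]) (use b in auto)
 obtain N where N: "x + 1 < 2 ^ N" using real_arch_pow[of 2 "x + 1"] by auto
 have "y n \<in> dyadic n" if n: "N \<le> n" for n
 proof -
  let ?k = "nat \<lceil>2 ^ n * x\<rceil>"
  have p: "0 < \<lceil>2 ^ n * x\<rceil>" using assms(1) by simp
  have "2 ^ N \<le> (2::real) ^ n" using n by (rule power_increasing) simp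
  then have "x + 1 \<le> 2 ^ n" using N by linarith
  then have "2 ^ n * (x + 1) \<le> 2 ^ n * (2 ^ n :: real)" by (rule mult_left_mono) simp
  moreover have "(2::real) ^ n * 2 ^ n = 4 ^ n" by (simp add: power_mult_distrib[symmetric])
  moreover have "real_of_int \<lceil>2 ^ n * x\<rceil> \<le> 2 ^ n * x + 1" by linarith
  moreover have "(1::real) \<le> 2 ^ n" by simp
  ultimately have "real_of_int \<lceil>2 ^ n * x\<rceil> \<le> 4 ^ n" unfolding distrib_left mult_1_right by linarith
  then have "real_of_int \<lceil>2 ^ n * x\<rceil> \<le> real_of_int (4 ^ n)" by simp
  then have "\<lceil>2 ^ n * x\<rceil> \<le> 4 ^ n" by (simp only: of_int_le_iff)
  then have "?k \<in> {1..4 ^ n}" using p by (simp add: nat_le_iff) linarith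
  moreover have "y n = real ?k / 2 ^ n" using p by (simp add: y_def)
  ultimately show ?thesis unfolding dyadic_def by blast
 qed
 then show "eventually (\<lambda>n. y n \<in> dyadic n) sequentially" by (auto simp: eventually_sequentially)
qed

text \<open>The points of a partition are moved to dyadic ones. For large n they remain strictly
  increasing, and continuity in the scale transfers the bound to the limit.\<close>

lemma partition_variation_le:
 assumes \<rho>: "0 < \<rho>" and a: "continuous_on UNIV a" and e: "(m, e) \<in> partitions"
 shows "ennreal ((\<Sum>j\<in>{1..m}. cmod (a (e j) - a (e (j - 1))) powr \<rho>) powr (1 / \<rho>)) \<le> (SUP n. ennreal (dyadic_variation \<rho> a n))"
proof -
 have e0: "0 < e 0" and inc: "\<And>j. j < m \<Longrightarrow> e j < e (Suc j)" using e by (auto simp: partitions_def)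
 have pos: "0 < e j" if "j \<le> m" for j
  using that
 proof (induction j)
  case (Suc j)
  then show ?case using inc[of j] by simp
 qed (simp add: e0)
 define y where "y n j = real_of_int \<lceil>2 ^ n * e j\<rceil> / 2 ^ n" for n j
 note ya = dyadic_approximation[OF pos, folded y_def]
 have ac: "(\<lambda>n. a (y n j)) \<longlonglongrightarrow> a (e j)" if "j \<le> m" for j
  using continuous_on_tendsto_compose[OF a ya(1)[OF that]] by simp
 let ?g = "\<lambda>e. (\<Sum>j\<in>{1..m}. cmod (a (e j) - a (e (j - 1))) powr \<rho>) powr (1 / \<rho>)"
 have powr_lim: "(\<lambda>n. f n powr r) \<longlonglongrightarrow> l powr r" if "f \<longlonglongrightarrow> l" "\<And>n. 0 \<le> f n" "0 < r" for f :: "nat \<Rightarrow> real" and l r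
  by (rule tendsto_powr'[OF that(1) tendsto_const]) (use that in auto)
 have "(\<lambda>n. ?g (y n)) \<longlonglongrightarrow> ?g e"
  using \<rho> by (intro powr_lim tendsto_sum tendsto_norm tendsto_diff ac sum_nonneg) auto
 then have lim: "(\<lambda>n. ennreal (?g (y n))) \<longlonglongrightarrow> ennreal (?g e)" by (rule tendsto_ennrealI)
 have ev1: "eventually (\<lambda>n. \<forall>j\<in>{..<m}. y n j < y n (Suc j)) sequentially"
 proof (rule eventually_ball_finite)
  show "\<forall>j\<in>{..<m}. eventually (\<lambda>n. y n j < y n (Suc j)) sequentially"
  proof
   fix j assume j: "j \<in> {..<m}"
   have "(\<lambda>n. y n (Suc j) - y n j) \<longlonglongrightarrow> e (Suc j) - e j" using j by (intro tendsto_diff ya(1)) auto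
   then have "eventually (\<lambda>n. 0 < y n (Suc j) - y n j) sequentially" by (rule order_tendstoD) (use inc[of j] j in simp)
   then show "eventually (\<lambda>n. y n j < y n (Suc j)) sequentially" by eventually_elim simp
  qed
 qed simp
 have ev2: "eventually (\<lambda>n. \<forall>j\<in>{0..m}. y n j \<in> dyadic n) sequentially"
  by (rule eventually_ball_finite) (use ya(2) in auto)
 have "eventually (\<lambda>n. ennreal (?g (y n)) \<le> (SUP n. ennreal (dyadic_variation \<rho> a n))) sequentially"
  using ev1 ev2
 proof eventually_elim
  case (elim n)
  have "?g (y n) = vnorm \<rho> (y n ` {0..m}) a" by (rule vnorm_image(1)[symmetric]) (use elim(1) in simp)
  also have "\<dots> \<le> dyadic_variation \<rho> a n" by (rule dyadic_variation_ge) (use elim(2) in auto)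
  finally have "ennreal (?g (y n)) \<le> ennreal (dyadic_variation \<rho> a n)" by (rule ennreal_leI)
  then show ?case by (rule SUP_upper2[OF UNIV_I])
 qed
 then show ?thesis by (rule tendsto_upperbound[OF lim]) simp
qed

text \<open>The initial value differs from the value at scale 0 by at most one variation, and the
  l^\<rho> combination of the initial value with the variation is at most their sum.\<close>

lemma var_le_dyadic:
 assumes \<rho>: "1 < \<rho>" and a: "continuous_on UNIV a"
 shows "var \<rho> a \<le> ennreal (cmod (a 0)) + 2 * (SUP n. ennreal (dyadic_variation \<rho> a n))"
proof -
 let ?U = "SUP n. ennreal (dyadic_variation \<rho> a n)"
 have two: "ennreal (cmod (a t - a s)) \<le> ?U" if "0 < s" "s < t" for s t
 proof -
  have "(1, \<lambda>j. if j = 0 then s else t) \<in> partitions" using that by (auto simp: partitions_def)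
  from partition_variation_le[OF _ a this, of \<rho>] show ?thesis using \<rho> by (simp add: powr_powr)
 qed
 \<comment> \<open>The lower scale tends to 0 in the two-point variation, by continuity at 0. The
   shift n + 2 keeps it strictly below t.\<close>
 have zero: "ennreal (cmod (a t)) \<le> ennreal (cmod (a 0)) + ?U" if t: "0 < t" for t
 proof -
  have s: "(\<lambda>n. t / real (n + 2)) \<longlonglongrightarrow> 0" by (rule LIMSEQ_ignore_initial_segment[OF lim_const_over_n])
  have "(\<lambda>n. a (t / real (n + 2))) \<longlonglongrightarrow> a 0" using continuous_on_tendsto_compose[OF a s] by simp
  then have "(\<lambda>n. ennreal (cmod (a t - a (t / real (n + 2))))) \<longlonglongrightarrow> ennreal (cmod (a t - a 0))"
   by (intro tendsto_ennrealI tendsto_norm tendsto_diff tendsto_const)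
  then have "ennreal (cmod (a t - a 0)) \<le> ?U"
  proof (rule tendsto_upperbound)
   show "eventually (\<lambda>n. ennreal (cmod (a t - a (t / real (n + 2)))) \<le> ?U) sequentially"
    by (intro always_eventually allI two) (use t in \<open>auto simp: divide_less_eq\<close>)
  qed simp
  moreover have "ennreal (cmod (a t)) \<le> ennreal (cmod (a 0)) + ennreal (cmod (a t - a 0))"
   using ennreal_leI[OF norm_triangle_sub[of "a t" "a 0"]] by (subst (asm) ennreal_plus) auto
  ultimately show ?thesis by (meson add_left_mono order_trans)
 qed
 show ?thesis unfolding var_def
 proof (rule SUP_least, clarify)
  fix m e assume me: "(m, e) \<in> partitions"
  let ?x = "cmod (a (e 0))" and ?S = "\<Sum>j\<in>{1..m}. cmod (a (e j) - a (e (j - 1))) powr \<rho>"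
  have S0: "0 \<le> ?S" by (intro sum_nonneg) simp
  define y where "y = ?S powr (1/\<rho>)"
  have y: "0 \<le> y" "y powr \<rho> = ?S" using \<rho> S0 by (auto simp: y_def powr_powr)
  \<comment> \<open>Superadditivity of the power \<rho> > 1: fractions of the total are at most 1,
    so their powers are at most the fractions themselves.\<close>
  have "?x powr \<rho> + ?S \<le> (?x + y) powr \<rho>"
  proof -
   have c: "(?x / (?x + y)) powr \<rho> + (y / (?x + y)) powr \<rho> \<le> 1" if p: "0 < ?x + y"
   proof -
    have "(?x / (?x + y)) powr \<rho> \<le> (?x / (?x + y)) powr 1" using p y(1) \<rho> by (intro powr_mono') (auto simp: divide_le_eq)
    moreover have "(y / (?x + y)) powr \<rho> \<le> (y / (?x + y)) powr 1" using p y(1) \<rho> by (intro powr_mono') (auto simp: divide_le_eq)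
    moreover have "(?x / (?x + y)) powr 1 + (y / (?x + y)) powr 1 = 1" using p y(1) by (simp add: add_divide_distrib[symmetric])
    ultimately show ?thesis by linarith
   qed
   show ?thesis
   proof (cases "?x + y = 0")
    case True
    then have "?x = 0" "y = 0" using y(1) norm_ge_zero[of "a (e 0)"] by linarith+
    then show ?thesis using y(2) \<rho> by simp
   next
    case False
    then have p: "0 < ?x + y" using y(1) norm_ge_zero[of "a (e 0)"] by linarith
    have "((?x / (?x + y)) powr \<rho> + (y / (?x + y)) powr \<rho>) * (?x + y) powr \<rho> \<le> 1 * (?x + y) powr \<rho>"
     by (rule mult_right_mono[OF c[OF p]]) simp
    moreover have "(?x / (?x + y)) powr \<rho> * (?x + y) powr \<rho> = ?x powr \<rho>" "(y / (?x + y)) powr \<rho> * (?x + y) powr \<rho> = y powr \<rho>"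
     using p y(1) by (simp_all add: powr_mult[symmetric])
    ultimately show ?thesis unfolding y(2) distrib_right by simp
   qed
  qed
  then have "(?x powr \<rho> + ?S) powr (1/\<rho>) \<le> ((?x + y) powr \<rho>) powr (1/\<rho>)" using \<rho> S0 by (intro powr_mono2) auto
  also have "\<dots> = ?x + y" using \<rho> y(1) by (simp add: powr_powr)
  finally have "ennreal ((?x powr \<rho> + ?S) powr (1/\<rho>)) \<le> ennreal (?x + y)" by (rule ennreal_leI)
  also have "\<dots> = ennreal ?x + ennreal y" using y(1) by (simp add: ennreal_plus)
  also have "\<dots> \<le> (ennreal (cmod (a 0)) + ?U) + ?U"
  proof (rule add_mono)
   show "ennreal ?x \<le> ennreal (cmod (a 0)) + ?U" by (rule zero) (use me in \<open>simp add: partitions_def\<close>)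
   show "ennreal y \<le> ?U" unfolding y_def by (rule partition_variation_le[OF _ a me]) (use \<rho> in simp)
  qed
  also have "\<dots> = ennreal (cmod (a 0)) + 2 * ?U" by (simp add: mult_2 add.assoc)
  finally show "ennreal ((?x powr \<rho> + ?S) powr (1/\<rho>)) \<le> ennreal (cmod (a 0)) + 2 * ?U" .
 qed
qed

lemma ennreal_SUP_power2_le:
 fixes f :: "nat \<Rightarrow> ennreal"
 shows "(SUP n. f n)^2 \<le> (SUP n. (f n)^2)"
proof -
 obtain q :: ennreal where q: "q^2 = (SUP n. (f n)^2)" using ennreal_sqrt_exists by blast
 have "f n \<le> q" for n
  by (rule ennreal_power2_le_imp_le) (unfold q, rule SUP_upper, simp)
 then have "(SUP n. f n) \<le> q" by (intro SUP_least)
 then show ?thesis unfolding q[symmetric] by (rule power_mono) simp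
qed

lemma ennreal_power2_add_le:
 fixes x y :: ennreal
 shows "(x + 2 * y)^2 \<le> 2 * x^2 + 8 * y^2"
proof (cases "x = \<infinity> \<or> y = \<infinity>")
 case True
 then show ?thesis by (auto simp: power2_eq_square ennreal_mult_top ennreal_top_mult)
next
 case False
 then obtain r t where r: "x = ennreal r" "0 \<le> r" and t: "y = ennreal t" "0 \<le> t" by (cases x; cases y) auto
 have "0 \<le> (r - 2 * t)^2" by simp
 then have "(r + 2 * t)^2 \<le> 2 * r^2 + 8 * t^2" by (simp add: power2_eq_square algebra_simps)
 then have "ennreal ((r + 2 * t)^2) \<le> ennreal (2 * r^2 + 8 * t^2)" by (rule ennreal_leI)
 moreover have "x + 2 * y = ennreal (r + 2 * t)" using r t by (simp add: ennreal_plus ennreal_mult)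
 moreover have "2 * x^2 + 8 * y^2 = ennreal (2 * r^2 + 8 * t^2)" using r t by (simp add: ennreal_plus ennreal_mult ennreal_power)
 ultimately show ?thesis using r(2) t(2) ennreal_power[of "r + 2 * t" 2] by (simp only: add_nonneg_nonneg mult_nonneg_nonneg zero_le_numeral)
qed

text \<open>The variation norm is a supremum over uncountably many partitions. This pointwise bound
  of its square is a countable increasing supremum, hence measurable; it can be split over caps and
  integrated by monotone convergence. The factors 2 and 8 come from (x + 2y)^2 \<le> 2x^2 +
  8y^2.\<close>

definition majorant :: "real \<Rightarrow> (R3 \<Rightarrow> complex) \<Rightarrow> (R3 \<Rightarrow> complex) \<Rightarrow> R3 \<Rightarrow> ennreal" where
 "majorant \<rho> m f \<omega> = 2 * (ennreal (cmod (fourier f \<omega>)))^2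
   + 8 * (SUP n. (ennreal (dyadic_variation \<rho> (\<lambda>t. fourier (\<lambda>x. f x * m (t *\<^sub>R x)) \<omega>) n))^2)"

context
 fixes f m :: "R3 \<Rightarrow> complex" and \<rho> Bm :: real
 assumes \<rho>: "1 < \<rho>" and f: "integrable lborel f" and m: "continuous_on UNIV m" "\<And>x. cmod (m x) \<le> Bm"
begin

lemma integrable_mult_dilate: "integrable lborel (\<lambda>x. f x * m (t *\<^sub>R x))"
proof (rule integrable_mult_bounded[OF f, where B=Bm])
 have "continuous_on UNIV (\<lambda>x. m (t *\<^sub>R x))" by (intro continuous_on_compose2[OF m(1)] continuous_intros) auto
 then show "(\<lambda>x. m (t *\<^sub>R x)) \<in> borel_measurable lborel" using borel_measurable_continuous_onI by auto
qed (rule m(2))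

lemma continuous_on_fourier_dilate: "continuous_on UNIV (\<lambda>t. fourier (\<lambda>x. f x * m (t *\<^sub>R x)) \<omega>)"
 unfolding fourier_alt
proof (rule continuous_on_integral_param[where w="\<lambda>x. cmod (f x) * Bm"])
 show "(\<lambda>x. f x * m (t *\<^sub>R x) * fexp x \<omega>) \<in> borel_measurable lborel" for t
  using integrable_mult_fexp[OF integrable_mult_dilate] by (rule borel_measurable_integrable)
 show "integrable lborel (\<lambda>x. cmod (f x) * Bm)" using f by simp
 show "cmod (f x * m (t *\<^sub>R x) * fexp x \<omega>) \<le> cmod (f x) * Bm" for t x
  using m(2)[of "t *\<^sub>R x"] by (simp add: norm_mult mult_left_mono)
 show "continuous_on UNIV (\<lambda>t. f x * m (t *\<^sub>R x) * fexp x \<omega>)" for x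
  by (intro continuous_on_mult continuous_on_const continuous_on_compose2[OF m(1)] continuous_intros) auto
qed

lemma measurable_dyadic_variation:
 "(\<lambda>\<omega>. dyadic_variation \<rho> (\<lambda>t. fourier (\<lambda>x. f x * m (t *\<^sub>R x)) \<omega>) n) \<in> borel_measurable borel"
 unfolding dyadic_variation_def
proof (intro borel_measurable_continuous_onI continuous_on_Max_finite continuous_on_vnorm)
 show "finite (Pow (dyadic n) - {{}})" using dyadic_props(1) by simp
 show "Pow (dyadic n) - {{}} \<noteq> {}" using dyadic_props(2)[of n] by blast
 show "0 < \<rho>" using \<rho> by simp
 show "continuous_on UNIV (\<lambda>\<omega>. fourier (\<lambda>x. f x * m (t *\<^sub>R x)) \<omega>)" for t
  by (rule continuous_on_fourier[OF integrable_mult_dilate])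
qed

lemma measurable_majorant: "majorant \<rho> m f \<in> borel_measurable borel"
proof -
 note [measurable] = measurable_dyadic_variation measurable_fourier[OF f]
 show ?thesis unfolding majorant_def by measurable
qed

lemma var_power2_le_majorant:
 assumes "m 0 = 1"
 shows "(var \<rho> (\<lambda>t. fourier (\<lambda>x. f x * m (t *\<^sub>R x)) \<omega>))^2 \<le> majorant \<rho> m f \<omega>"
proof -
 let ?a = "\<lambda>t. fourier (\<lambda>x. f x * m (t *\<^sub>R x)) \<omega>"
 let ?U = "SUP n. ennreal (dyadic_variation \<rho> ?a n)"
 have a0: "?a 0 = fourier f \<omega>" using assms by simp
 have "var \<rho> ?a \<le> ennreal (cmod (?a 0)) + 2 * ?U"
  by (rule var_le_dyadic[OF \<rho> continuous_on_fourier_dilate])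
 then have "(var \<rho> ?a)^2 \<le> (ennreal (cmod (?a 0)) + 2 * ?U)^2" by (rule power_mono) simp
 also have "\<dots> \<le> 2 * (ennreal (cmod (?a 0)))^2 + 8 * ?U^2" by (rule ennreal_power2_add_le)
 also have "\<dots> \<le> 2 * (ennreal (cmod (?a 0)))^2 + 8 * (SUP n. (ennreal (dyadic_variation \<rho> ?a n))^2)"
  by (intro add_left_mono mult_left_mono ennreal_SUP_power2_le) simp
 finally show ?thesis unfolding majorant_def a0 .
qed

end

text \<open>The constant in \<open>variation_bound\<close> does not depend on the set of scales, so
  it survives the limit over dyadic levels.\<close>

lemma (in restriction_measure) majorant_bound:
 assumes \<rho>: "1 < \<rho>" and f: "integrable lborel f" and m: "continuous_on UNIV m" "\<And>x. cmod (m x) \<le> Bm"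
  and test: "testable \<rho> m C0" and C0: "0 < C0"
  and P: "(LI+ x. ennreal (cmod (f x) powr (4/3))) = ennreal P" "0 \<le> P"
 shows "(TI+ \<omega>. majorant \<rho> m f \<omega>) \<le> ennreal ((2 * sqrt (A + 1) + 8 * sqrt C0) * P powr (3/2))"
proof -
 let ?V = "\<lambda>n \<omega>. (ennreal (dyadic_variation \<rho> (\<lambda>t. fourier (\<lambda>x. f x * m (t *\<^sub>R x)) \<omega>) n))^2"
 let ?F = "\<lambda>\<omega>. (ennreal (cmod (fourier f \<omega>)))^2"
 note dm [measurable] = measurable_dyadic_variation[OF \<rho> f m]
 note [measurable] = measurable_fourier[OF f]
 have Vm: "?V n \<in> borel_measurable borel" for n by measurable
 have Fm: "?F \<in> borel_measurable borel" by measurable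
 have Sm: "(\<lambda>\<omega>. SUP n. ?V n \<omega>) \<in> borel_measurable borel" by measurable
 have m\<tau>: "g \<in> borel_measurable \<tau>" if "g \<in> borel_measurable borel" for g :: "R3 \<Rightarrow> ennreal"
  using that by (simp cong: measurable_cong_sets)
 have V: "(TI+ \<omega>. (SUP n. ?V n \<omega>)) \<le> ennreal (sqrt C0 * P powr (3/2))"
 proof -
  have "incseq ?V"
   by (intro incseq_SucI le_funI power_mono ennreal_leI dyadic_variation_mono) simp_all
  then have "(TI+ \<omega>. (SUP n. ?V n \<omega>)) = (SUP n. TI+ \<omega>. ?V n \<omega>)"
   by (rule nn_integral_monotone_convergence_SUP) (rule m\<tau>[OF Vm])
  also have "\<dots> \<le> ennreal (sqrt C0 * P powr (3/2))"
  proof (rule SUP_least)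
   fix n
   show "(TI+ \<omega>. ?V n \<omega>) \<le> ennreal (sqrt C0 * P powr (3/2))"
    unfolding dyadic_variation_def by (rule variation_bound[OF \<rho> m test C0 f P dyadic_props(1-3)])
  qed
  finally show ?thesis .
 qed
 have "(TI+ \<omega>. majorant \<rho> m f \<omega>) = (TI+ \<omega>. 2 * ?F \<omega>) + (TI+ \<omega>. 8 * (SUP n. ?V n \<omega>))"
  unfolding majorant_def by (rule nn_integral_add) (intro m\<tau> borel_measurable_times_ennreal borel_measurable_const Fm Sm)+
 also have "\<dots> = 2 * (TI+ \<omega>. ?F \<omega>) + 8 * (TI+ \<omega>. (SUP n. ?V n \<omega>))"
  by (intro arg_cong2[where f="(+)"] nn_integral_cmult m\<tau> Fm Sm)
 also have "\<dots> \<le> 2 * ennreal (sqrt (A + 1) * P powr (3/2)) + 8 * ennreal (sqrt C0 * P powr (3/2))"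
  by (intro add_mono mult_left_mono restriction_bound[OF f P] V) simp_all
 also have "\<dots> = ennreal (2 * (sqrt (A + 1) * P powr (3/2))) + ennreal (8 * (sqrt C0 * P powr (3/2)))"
  using A_nonneg C0 by (subst (1 2) ennreal_mult) auto
 also have "\<dots> = ennreal (2 * (sqrt (A + 1) * P powr (3/2)) + 8 * (sqrt C0 * P powr (3/2)))"
  using A_nonneg C0 by (intro ennreal_plus[symmetric] mult_nonneg_nonneg) auto
 also have "\<dots> = ennreal ((2 * sqrt (A + 1) + 8 * sqrt C0) * P powr (3/2))" by (simp only: distrib_right mult.assoc)
 finally show ?thesis .
qed

lemma Lnorm_c_4_3:
 assumes P: "(LI+ x. ennreal (cmod (f x) powr (4/3))) = ennreal P" "0 \<le> P"
 shows "enn2real (Lnorm_c (4/3) lborel f) = P powr (3/4)"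
proof -
 have "(LI+ x. ennpow (4/3) (ennreal (cmod (f x)))) = ennreal P"
  unfolding P(1)[symmetric] by (simp add: ennpow_def)
 then have "Lnorm_c (4/3) lborel f = ennreal (P powr (3/4))"
  unfolding Lnorm_c_def Lnorm_def using P(2) by (simp add: ennpow_def)
 then show ?thesis by simp
qed

text \<open>The convolution with a dilate agrees with its Fourier expression at positive scales, and
  no others occur in a partition.\<close>

lemma var_cong:
 assumes "\<And>t. 0 < t \<Longrightarrow> a t = b t"
 shows "var \<rho> a = var \<rho> b"
 unfolding var_def
proof (rule SUP_cong[OF refl], clarify)
 fix m e assume "(m, e) \<in> partitions"
 then have e0: "0 < e 0" and inc: "\<And>j. j < m \<Longrightarrow> e j < e (Suc j)" by (auto simp: partitions_def)
 have pos: "0 < e j" if "j \<le> m" for j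
  using that
 proof (induction j)
  case (Suc j)
  then show ?case using inc[of j] by simp
 qed (simp add: e0)
 have "(\<Sum>j\<in>{1..m}. cmod (a (e j) - a (e (j - 1))) powr \<rho>) = (\<Sum>j\<in>{1..m}. cmod (b (e j) - b (e (j - 1))) powr \<rho>)"
 proof (rule sum.cong[OF refl])
  fix j assume "j \<in> {1..m}"
  then have "a (e j) = b (e j)" "a (e (j - 1)) = b (e (j - 1))" by (auto intro!: assms pos)
  then show "cmod (a (e j) - a (e (j - 1))) powr \<rho> = cmod (b (e j) - b (e (j - 1))) powr \<rho>" by (simp only:)
 qed
 then show "ennreal ((cmod (a (e 0)) powr \<rho> + (\<Sum>j\<in>{1..m}. cmod (a (e j) - a (e (j - 1))) powr \<rho>)) powr (1 / \<rho>))
  = ennreal ((cmod (b (e 0)) powr \<rho> + (\<Sum>j\<in>{1..m}. cmod (b (e j) - b (e (j - 1))) powr \<rho>)) powr (1 / \<rho>))"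
  using assms[OF e0] by (simp only:)
qed

theorem theorem1:
  fixes \<mu> :: cmeasure and \<rho> :: real
  assumes rho: "1 < \<rho>"
    and meas: "is_cmeasure \<mu>"
    and normalized: "cm_apply \<mu> UNIV = 1"
    and even: "\<forall>E\<in>sets borel. cm_apply \<mu> (uminus ` E) = cm_apply \<mu> E"
    and cond: "((\<exists>D. (\<forall>x. (cm_fourier \<mu> has_derivative blinfun_apply (D x)) (at x))
                   \<and> (\<forall>x. Im (- blinfun_apply (D x) x) = 0 \<and> Re (- blinfun_apply (D x) x) \<ge> 0))
                \<and> (\<exists>C::real. \<forall>h. schwartz h \<longrightarrow>
                     Lnorm 2 lborel (\<lambda>x. var_tilde \<rho> (\<lambda>\<epsilon>. cm_conv h (cm_dilate \<epsilon> \<mu>) x))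
                       \<le> ennreal (C * enn2real (Lnorm_c 2 lborel h))))
             \<or> (2 < \<rho> \<and>
                (\<exists>D D2. (\<forall>x. (cm_fourier \<mu> has_derivative blinfun_apply (D x)) (at x))
                   \<and> (\<forall>x. (D has_derivative blinfun_apply (D2 x)) (at x))
                   \<and> continuous_on UNIV D2
                   \<and> (\<exists>\<delta>>0. \<exists>C::real. \<forall>x. grad_norm (D x) \<le> C * (1 + norm x) powr (- 1 - \<delta>))))
             \<or> (\<exists>C::real. \<forall>h. schwartz h \<longrightarrow>
                   Lnorm 2 lborel (\<lambda>x. var2_tilde \<rho>
                      (\<lambda>\<epsilon> \<eta>. cm_conv (cm_conv h (cm_dilate \<epsilon> \<mu>)) (cm_dilate \<eta> (cm_cnj \<mu>)) x))
                     \<le> ennreal (C * enn2real (Lnorm_c 2 lborel h)))"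
  shows "\<exists>C'::real. \<forall>f. schwartz f \<longrightarrow>
           Lnorm 2 sphere_measure (\<lambda>\<omega>. var \<rho> (\<lambda>\<epsilon>. cm_conv (fourier f) (cm_dilate \<epsilon> \<mu>) \<omega>))
             \<le> ennreal (C' * enn2real (Lnorm_c (4/3) lborel f))"
proof -
 let ?m = "mhat \<mu>"
 have m: "continuous_on UNIV ?m" "\<And>x. cmod (?m x) \<le> (\<integral>y. cmod (snd \<mu> y) \<partial>fst \<mu>)"
  using continuous_on_mhat[OF meas] norm_mhat_le[OF meas] by blast+
 have m0: "?m 0 = 1" using mhat_0[OF meas] normalized by simp
 let ?\<tau> = "\<lambda>e. density sphere_measure (indicator (cap e))"
 \<comment> \<open>The only place where the three conditions are distinguished. Each cap may have
   its own constant; there are finitely many.\<close>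
 have test: "\<exists>C0. 0 < C0 \<and> restriction_measure.testable (?\<tau> e) \<rho> ?m C0" if e: "e \<in> cap_centres" for e
 proof -
  interpret restriction_measure "?\<tau> e" 144 by (rule restriction_measure_cap[OF norm_cap_centres[OF e]])
  from cond show ?thesis
  proof (elim disjE conjE exE, goal_cases)
   case prems: (1 D C)
   show ?case by (rule testable_monotone[OF rho meas normalized prems(1,2)[rule_format] prems(3)[rule_format]])
  next
   case prems: (2 D D2 \<delta> C)
   show ?case by (rule testable_smooth[OF prems(1) meas even prems(2,3)[rule_format] prems(4,5) prems(6)[rule_format]])
  next
   case prems: (3 C)
   show ?case by (rule testable_double[OF rho meas even prems(1)[rule_format]])
  qed
 qed
 then have "\<forall>e\<in>cap_centres. \<exists>C0. 0 < C0 \<and> restriction_measure.testable (?\<tau> e) \<rho> ?m C0" by (rule ballI)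
 from bchoice[OF this] obtain C0 where C0: "\<forall>e\<in>cap_centres. 0 < C0 e \<and> restriction_measure.testable (?\<tau> e) \<rho> ?m (C0 e)" ..
 define c where "c = (\<Sum>e\<in>cap_centres. 2 * sqrt (144 + 1) + 8 * sqrt (C0 e))"
 have C0p: "0 < C0 e" "restriction_measure.testable (?\<tau> e) \<rho> ?m (C0 e)" if "e \<in> cap_centres" for e
  by (rule conjunct1[OF bspec[OF C0 that]], rule conjunct2[OF bspec[OF C0 that]])
 have kn: "0 \<le> 2 * sqrt (144 + 1) + 8 * sqrt (C0 e)" if "e \<in> cap_centres" for e
  using C0p(1)[OF that] by (intro add_nonneg_nonneg mult_nonneg_nonneg) (auto simp: less_imp_le)
 have cnn: "0 \<le> c" unfolding c_def by (rule sum_nonneg) (rule kn)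
 show ?thesis
 \<comment> \<open>The squared norm is bounded by c P^(3/2), whose root is sqrt(c) P^(3/4), and
   P^(3/4) is the L^(4/3) norm of f.\<close>
 proof (intro exI[of _ "sqrt c"] allI impI)
  fix f assume f: "schwartz f"
  have fi: "integrable lborel f" by (rule schwartz_integrable[OF f])
  define P where "P = enn2real (LI+ x. ennreal (cmod (f x) powr (4/3)))"
  have P: "(LI+ x. ennreal (cmod (f x) powr (4/3))) = ennreal P" "0 \<le> P"
   using schwartz_L43_finite[OF f] by (auto simp: P_def)
  let ?v = "\<lambda>\<omega>. var \<rho> (\<lambda>\<epsilon>. cm_conv (fourier f) (cm_dilate \<epsilon> \<mu>) \<omega>)"
  have v: "(?v \<omega>)^2 \<le> majorant \<rho> ?m f \<omega>" for \<omega>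
  proof -
   have "?v \<omega> = var \<rho> (\<lambda>t. fourier (\<lambda>x. f x * ?m (t *\<^sub>R x)) \<omega>)"
    by (rule var_cong) (simp only: cm_conv_fourier[OF meas fi])
   then show ?thesis using var_power2_le_majorant[OF rho fi m m0, of \<omega>] by (simp only:)
  qed
  have "(\<integral>\<^sup>+\<omega>. (?v \<omega>)^2 \<partial>sphere_measure) \<le> (\<integral>\<^sup>+\<omega>. majorant \<rho> ?m f \<omega> \<partial>sphere_measure)"
   by (rule nn_integral_mono) (rule v)
  \<comment> \<open>Measurability of the majorant is what allows the sphere to be split
    here.\<close>
  also have "\<dots> \<le> (\<Sum>e\<in>cap_centres. \<integral>\<^sup>+\<omega>. majorant \<rho> ?m f \<omega> \<partial>?\<tau> e)"
   by (rule nn_integral_sphere_le_caps[OF measurable_majorant[OF rho fi m]])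
  also have "\<dots> \<le> (\<Sum>e\<in>cap_centres. ennreal ((2 * sqrt (144 + 1) + 8 * sqrt (C0 e)) * P powr (3/2)))"
  proof (rule sum_mono)
   fix e assume e: "e \<in> cap_centres"
   show "(\<integral>\<^sup>+\<omega>. majorant \<rho> ?m f \<omega> \<partial>?\<tau> e) \<le> ennreal ((2 * sqrt (144 + 1) + 8 * sqrt (C0 e)) * P powr (3/2))"
    by (rule restriction_measure.majorant_bound[OF restriction_measure_cap[OF norm_cap_centres[OF e]] rho fi m C0p(2)[OF e] C0p(1)[OF e] P])
  qed
  also have "\<dots> = ennreal (\<Sum>e\<in>cap_centres. (2 * sqrt (144 + 1) + 8 * sqrt (C0 e)) * P powr (3/2))"
   by (rule sum_ennreal) (intro mult_nonneg_nonneg kn powr_ge_zero)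
  also have "\<dots> = ennreal (c * P powr (3/2))" unfolding c_def sum_distrib_right ..
  also have "c * P powr (3/2) = (sqrt c * P powr (3/4))^2"
  proof -
   have "(P powr (3/4))^2 = P powr (3/4 + 3/4)" unfolding powr_add power2_eq_square ..
   then show ?thesis using cnn by (simp add: power_mult_distrib)
  qed
  finally have "Lnorm 2 sphere_measure ?v \<le> ennreal (sqrt c * P powr (3/4))"
   using cnn by (subst Lnorm_2_le_iff) auto
  then show "Lnorm 2 sphere_measure ?v \<le> ennreal (sqrt c * enn2real (Lnorm_c (4/3) lborel f))"
   unfolding Lnorm_c_4_3[OF P] .
 qed
qed

end
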